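(* Any Nash equilibrium in noise-state linear controls is a Nash equilibrium of the unrestricted game. That is, let $D^*=(D^{*,1},\dots,D^{*,n})$ be a profile of noise-state linear strategies such that for every player $i$ and every noise-state linear alternative $\widetilde D^i$ one has $J^i(D^{*,i};D^{*,-i})\le J^i(\widetilde D^i;D^{*,-i})$. Then for every player $i$ and every admissible (square-integrable, not necessarily linear) alternative strategy map $\widetilde D^i$, $$J^i(D^{*,i};D^{*,-i})\le J^i(\widetilde D^i;D^{*,-i}),$$ where in a unilateral deviation by $i$ the opponents' strategy maps, including their filters, are held fixed and applied to the deviated signal paths.
   Context: **Game.** There are $n$ players on $[0,T]$. $W=(W^0,\dots,W^n)$ consists of mutually independent $d$-dimensional Brownian motions. The state $X_t\in\mathbb{R}^d$ satisfies $dX_t=(A(t)X_t+\sum_{j=1}^nD^j_t)\,dt+\Sigma(t)\,dW^0_t$, $X_0=x_0$, with $A,\Sigma$ deterministic and bounded, and $D^j_t\in\mathbb{R}^d$ player $j$'s control. Player $j$ observes $dY^j_t=\Gamma^j(t)X_t\,dt+E^j\,dW_t$, $Y^j_0=0$, with $\Gamma^j(t)\in\mathbb{R}^{d\times d}$ deterministic and $E^j\in\mathbb{R}^{d\times(n+1)d}$ the selector $E^jW=W^j$; $\mathcal{F}^j_t=\sigma(Y^j_s:s\le t)$. Player $i$ minimizes $$J^i(D^i;D^{-i})=\mathbb{E}\Big[\int_0^T\big(X_t^\top G^{XX,i}(t)X_t+2(G^{X,i}_t)^\top X_t+G^i(t)+(D^i_t)^\top G^{DD,i}(t)D^i_t\big)dt+X_T^\top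 G^{XX,i}(T)X_T+2(G^{X,i}_T)^\top X_T\Big],$$ with $G^{XX,i}(t),G^{DD,i}(t)$ deterministic symmetric positive semidefinite, $G^{DD,i}(t)$ positive definite, and $G^{X,i}_t$ deterministic and bounded (more generally $G^{X,i}_t=\bar G^{X,i}_t+\int_0^tG^{X,i}_t(r)\,dW_r$ with deterministic mean and kernel). **Strategies.** A strategy map of player $i$ assigns to each $t$ an action $D^i_t=D^i_t[Y^i]$ that is a progressively measurable functional of the private history $Y^i_{\cdot\wedge t}$; it is admissible if $\mathbb{E}\int_0^T\|D^i_t\|^2dt<\infty$. A profile is a Nash equilibrium (of the unrestricted game) if no player can lower its cost by switching to another admissible strategy map, opponents' maps being held fixed. **Noise-state linear strategies and frozen filters.** On a profile, $\widehat W^k_t(u)=\mathbb{E}[W_u\mid\mathcal{F}^k_t]$, $0\le u\le t$. A noise-state linear strategy is an admissible map $D^k_t[Y^k]=\bar D^k_t+\int_0^tD^k_t(u)\,d_u\widehat W^k_t[Y^k](u)$ with deterministic $\bar D^k_t\in\mathbb{R}^d$, $D^k_t(u)\in\mathbb{R}^{d\times(n+1)d}$, $\int_0^t\|D^k_t(u)\|^2du<\infty$. The filters are those of the candidate profile $D^*$, on which $X_t=\bar X_t+\int_0^tX_t(s)\,dW_s$ with deterministic mean and kernel, and $\widetilde X^k_t(u)$ is the kernel of $X_t-\mathbb{E}[X_t\mid\mathcal{F}^k_t]=\int_0^t\widetilde X^k_t(u)\,dW_u$. For an arbitrary history of an opponent $k\neq i$, $\widehat W^k[Y^k]$ is given by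 $d_u\widehat W^k_t(u)=E^{k\top}dI^k_u+\big(\int_u^t\widetilde X^k_s(u)^\top\Gamma^k(s)^\top dI^k_s\big)du$, with $dI^k_t=dY^k_t-\Gamma^k(t)\widehat X^k_t\,dt$ and $\widehat X^k_t=\bar X_t+\int_0^tX_t(u)\,d_u\widehat W^k_t(u)$; opponents do not recompute their filters after a deviation. For the deviating player $i$, own actions enter $Y^i$ only through a known drift, so the innovation path $dI^i_t=dY^i_t-\Gamma^i(t)\mathbb{E}[X_t\mid\mathcal{F}^i_t]\,dt$ is invariant to $i$'s deviations, $i$'s information is identified across own controls through $I^i$, and $\widehat W^i$ is the same deterministic linear functional of $I^i$ as on the candidate profile. The deterministic coefficients $A$, $\Gamma^k$, $\widetilde X^k$, $D^k$, $X(\cdot,\cdot)$ entering the response of the state and filters to a deviation are bounded. *)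

theory Defs
  imports "HOL-Probability.Probability"
begin

section \<open>Brownian motion\<close>

definition history :: "'w measure \<Rightarrow> (real \<Rightarrow> 'w \<Rightarrow> 'a::topological_space) \<Rightarrow> real \<Rightarrow> 'w measure" where
  "history M Z t =
     vimage_algebra (space M) (\<lambda>\<omega>. \<lambda>s\<in>{0..t}. Z s \<omega>) (PiM {0..t} (\<lambda>_. borel))"

definition scalar_brownian :: "'w measure \<Rightarrow> real \<Rightarrow> (real \<Rightarrow> 'w \<Rightarrow> real) \<Rightarrow> bool" where
  "scalar_brownian M T B \<longleftrightarrow>
     (\<forall>t\<in>{0..T}. B t \<in> borel_measurable M) \<and>
     (AE \<omega> in M. B 0 \<omega> = 0) \<and>
     (AE \<omega> in M. continuous_on {0..T} (\<lambda>t. B t \<omega>)) \<and>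
     (\<forall>s t. 0 \<le> s \<and> s < t \<and> t \<le> T \<longrightarrow>
        distributed M lborel (\<lambda>\<omega>. B t \<omega> - B s \<omega>) (\<lambda>x. ennreal (normal_density 0 (sqrt (t - s)) x)) \<and>
        prob_space.indep_set M
          (sets (vimage_algebra (space M) (\<lambda>\<omega>. B t \<omega> - B s \<omega>) borel)) (sets (history M B s)))"

definition brownian :: "'w measure \<Rightarrow> real \<Rightarrow> (real \<Rightarrow> 'w \<Rightarrow> real^'m) \<Rightarrow> bool" where
  "brownian M T B \<longleftrightarrow>
     (\<forall>a. scalar_brownian M T (\<lambda>t \<omega>. B t \<omega> $ a)) \<and>
     prob_space.indep_vars M (\<lambda>_. PiM {0..T} (\<lambda>_. borel))
       (\<lambda>a \<omega>. \<lambda>t\<in>{0..T}. B t \<omega> $ a) UNIV"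

section \<open>Processes, information, integrals of deterministic integrands\<close>

definition sq_process :: "'w measure \<Rightarrow> real \<Rightarrow> (real \<Rightarrow> 'w \<Rightarrow> real^'m) \<Rightarrow> bool" where
  "sq_process M T Z \<longleftrightarrow>
     (\<lambda>(t, \<omega>). Z t \<omega>) \<in> borel_measurable (restrict_space borel {0..T} \<Otimes>\<^sub>M M) \<and>
     (\<integral>\<^sup>+\<omega>. (\<integral>\<^sup>+t\<in>{0..T}. ennreal ((norm (Z t \<omega>))\<^sup>2) \<partial>lborel) \<partial>M) < \<infinity>"

definition contained_mod_null :: "'w measure \<Rightarrow> 'w measure \<Rightarrow> 'w measure \<Rightarrow> bool" where
  "contained_mod_null M F H \<longleftrightarrow>
     (\<forall>A\<in>sets F. \<exists>B\<in>sets H. AE \<omega> in M. \<omega> \<in> A \<longleftrightarrow> \<omega> \<in> B)"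

definition cond_exp_vec :: "'w measure \<Rightarrow> 'w measure \<Rightarrow> ('w \<Rightarrow> real^'m) \<Rightarrow> 'w \<Rightarrow> real^'m" where
  "cond_exp_vec M F Z \<omega> = (\<chi> a. real_cond_exp M F (\<lambda>\<omega>'. Z \<omega>' $ a) \<omega>)"

text \<open>\<open>has_stoch_integral M Z F a b R\<close>: the random vector \<open>R\<close> is the integral
  of the deterministic square-integrable matrix function \<open>F\<close> against \<open>dZ\<close> over \<open>[a, b]\<close>, as the
  mean-square limit of the elementary sums of any step functions approaching \<open>F\<close> in mean square.
  For a Brownian \<open>Z\<close> this is the Wiener integral. The same definition serves for the innovations
  (Brownian motion plus a square-integrable drift) and, at a fixed \<open>t\<close>, for the smoothed
  noise \<open>u \<mapsto> E[W\<^sub>u | F\<^sub>t]\<close>.\<close>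

definition has_stoch_integral ::
  "'w measure \<Rightarrow> (real \<Rightarrow> 'w \<Rightarrow> real^'m) \<Rightarrow> (real \<Rightarrow> real^'m^'k) \<Rightarrow> real \<Rightarrow> real \<Rightarrow>
   ('w \<Rightarrow> real^'k) \<Rightarrow> bool" where
  "has_stoch_integral M Z F a b R \<longleftrightarrow>
     (\<forall>u\<in>{a..b}. Z u \<in> borel_measurable M) \<and> R \<in> borel_measurable M \<and>
     set_borel_measurable lborel {a..b} F \<and>
     (\<integral>\<^sup>+u\<in>{a..b}. ennreal ((norm (F u))\<^sup>2) \<partial>lborel) < \<infinity> \<and>
     (\<forall>\<epsilon>>0. \<exists>\<delta>>0. \<forall>(N::nat) (p::nat \<Rightarrow> real) (c::nat \<Rightarrow> real^'m^'k).
        p 0 = a \<and> p N = b \<and> mono_on {..N} p \<and>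
        (\<integral>\<^sup>+u\<in>{a..b}. ennreal ((norm (F u - (\<Sum>j<N. indicator {p j<..p (Suc j)} u *\<^sub>R c j)))\<^sup>2) \<partial>lborel)
           < ennreal \<delta> \<longrightarrow>
        (\<integral>\<^sup>+\<omega>. ennreal ((norm (R \<omega> - (\<Sum>j<N. c j *v (Z (p (Suc j)) \<omega> - Z (p j) \<omega>))))\<^sup>2) \<partial>M)
           < ennreal \<epsilon>)"

section \<open>The game\<close>

text \<open>Players are the elements of the finite type \<open>'n\<close>. The noise \<open>W\<close> takes values in a space
  of dimension \<open>(n + 1) d\<close>, with coordinates indexed by \<open>'n option \<times> 'd\<close>: block \<open>None\<close> is the
  state noise (\<open>W\<close> with upper index 0), block \<open>Some k\<close> the observation noise of player \<open>k\<close>.\<close>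

type_synonym ('d, 'n) noise_vec = "(real, 'n option \<times> 'd) vec"
type_synonym ('d, 'n) noise_mat = "((real, 'n option \<times> 'd) vec, 'd) vec"

definition block :: "'n option \<Rightarrow> ('d::finite, 'n::finite) noise_mat" where
  "block j = (\<chi> a p. if p = (j, a) then 1 else 0)"

abbreviation obs_block :: "'n \<Rightarrow> ('d::finite, 'n::finite) noise_mat" where
  "obs_block k \<equiv> block (Some k)"

text \<open>\<open>wX\<close> is the linear state weight process, with mean \<open>wX_mean\<close> and noise kernel \<open>wX_ker\<close>;
  a zero kernel is the case of a deterministic weight.\<close>

record ('w, 'd, 'n) lq_game =
  Pr :: "'w measure"
  noise :: "real \<Rightarrow> 'w \<Rightarrow> ('d, 'n) noise_vec"
  horizon :: real
  init :: "(real, 'd) vec"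
  drift :: "real \<Rightarrow> ((real, 'd) vec, 'd) vec"
  vol :: "real \<Rightarrow> ((real, 'd) vec, 'd) vec"
  sens :: "'n \<Rightarrow> real \<Rightarrow> ((real, 'd) vec, 'd) vec"
  wXX :: "'n \<Rightarrow> real \<Rightarrow> ((real, 'd) vec, 'd) vec"
  wDD :: "'n \<Rightarrow> real \<Rightarrow> ((real, 'd) vec, 'd) vec"
  w0 :: "'n \<Rightarrow> real \<Rightarrow> real"
  wX :: "'n \<Rightarrow> real \<Rightarrow> 'w \<Rightarrow> (real, 'd) vec"
  wX_mean :: "'n \<Rightarrow> real \<Rightarrow> (real, 'd) vec"
  wX_ker :: "'n \<Rightarrow> real \<Rightarrow> real \<Rightarrow> ('d, 'n) noise_mat"

definition psd :: "real^'d^'d \<Rightarrow> bool" where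
  "psd Q \<longleftrightarrow> transpose Q = Q \<and> (\<forall>v. 0 \<le> v \<bullet> (Q *v v))"

definition posdef :: "real^'d^'d \<Rightarrow> bool" where
  "posdef Q \<longleftrightarrow> transpose Q = Q \<and> (\<forall>v. v \<noteq> 0 \<longrightarrow> 0 < v \<bullet> (Q *v v))"

definition time_measurable :: "real \<Rightarrow> (real \<Rightarrow> 'a::topological_space) \<Rightarrow> bool" where
  "time_measurable T f \<longleftrightarrow> f \<in> borel_measurable (restrict_space borel {0..T})"

definition kernel_measurable :: "real \<Rightarrow> (real \<Rightarrow> real \<Rightarrow> 'a::topological_space) \<Rightarrow> bool" where
  "kernel_measurable T K \<longleftrightarrow>
     (\<lambda>(t, u). K t u) \<in> borel_measurable (restrict_space borel ({0..T} \<times> {0..T}))"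

definition kernel_bounded :: "real \<Rightarrow> (real \<Rightarrow> real \<Rightarrow> 'a::metric_space) \<Rightarrow> bool" where
  "kernel_bounded T K \<longleftrightarrow> bounded {K t u | t u. 0 \<le> u \<and> u \<le> t \<and> t \<le> T}"

definition lq_game :: "('w, 'd::finite, 'n::finite) lq_game \<Rightarrow> bool" where
  "lq_game G \<longleftrightarrow>
     (let M = Pr G; T = horizon G in
      prob_space M \<and> 0 < T \<and>
      (\<forall>j. brownian M T (\<lambda>t \<omega>. block j *v noise G t \<omega>)) \<and>
      prob_space.indep_vars M (\<lambda>_. PiM {0..T} (\<lambda>_. borel))
        (\<lambda>j \<omega>. \<lambda>t\<in>{0..T}. block j *v noise G t \<omega>) UNIV \<and>
      time_measurable T (drift G) \<and> bounded (drift G ` {0..T}) \<and>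
      time_measurable T (vol G) \<and> bounded (vol G ` {0..T}) \<and>
      (\<forall>k. time_measurable T (sens G k) \<and> bounded (sens G k ` {0..T})) \<and>
      (\<forall>k. time_measurable T (wXX G k) \<and> (\<forall>t\<in>{0..T}. psd (wXX G k t)) \<and>
           time_measurable T (wDD G k) \<and> (\<forall>t\<in>{0..T}. posdef (wDD G k t)) \<and>
           set_integrable lborel {0..T} (w0 G k)) \<and>
      (\<forall>k. time_measurable T (wX_mean G k) \<and> bounded (wX_mean G k ` {0..T}) \<and>
           kernel_measurable T (wX_ker G k) \<and> sq_process M T (wX G k) \<and>
           (\<forall>t\<in>{0..T}. has_stoch_integral M (noise G) (wX_ker G k t) 0 t
                          (\<lambda>\<omega>. wX G k t \<omega> - wX_mean G k t))))"

definition state_equation ::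
  "('w, 'd::finite, 'n::finite) lq_game \<Rightarrow> (real \<Rightarrow> 'w \<Rightarrow> real^'d) \<Rightarrow>
   ('n \<Rightarrow> real \<Rightarrow> 'w \<Rightarrow> real^'d) \<Rightarrow> bool" where
  "state_equation G X D \<longleftrightarrow>
     (\<forall>t\<in>{0..horizon G}.
        has_stoch_integral (Pr G) (\<lambda>s \<omega>. block None *v noise G s \<omega>) (vol G) 0 t
          (\<lambda>\<omega>. X t \<omega> - init G -
                (LINT s:{0..t}|lborel. drift G s *v X s \<omega> + (\<Sum>j\<in>UNIV. D j s \<omega>))))"

definition signal ::
  "('w, 'd::finite, 'n::finite) lq_game \<Rightarrow> (real \<Rightarrow> 'w \<Rightarrow> real^'d) \<Rightarrow> 'n \<Rightarrow> real \<Rightarrow> 'w \<Rightarrow> real^'d" where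
  "signal G X k t \<omega> =
     (LINT s:{0..t}|lborel. sens G k s *v X s \<omega>) + obs_block k *v noise G t \<omega>"

text \<open>The nonnegative quadratic terms and the integrable terms of the cost are collected separately,
  so that the cost is a well-defined extended real even if the quadratic weights are unbounded.\<close>

definition cost ::
  "('w, 'd::finite, 'n::finite) lq_game \<Rightarrow> 'n \<Rightarrow> (real \<Rightarrow> 'w \<Rightarrow> real^'d) \<Rightarrow>
   (real \<Rightarrow> 'w \<Rightarrow> real^'d) \<Rightarrow> ereal" where
  "cost G i X D =
     (let T = horizon G in
      enn2ereal (\<integral>\<^sup>+\<omega>.
         (\<integral>\<^sup>+t\<in>{0..T}. ennreal (X t \<omega> \<bullet> (wXX G i t *v X t \<omega>) + D t \<omega> \<bullet> (wDD G i t *v D t \<omega>)) \<partial>lborel)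
         + ennreal (X T \<omega> \<bullet> (wXX G i T *v X T \<omega>)) \<partial>Pr G)
      + ereal (LINT \<omega>|Pr G.
         (LINT t:{0..T}|lborel. 2 * (wX G i t \<omega> \<bullet> X t \<omega>) + w0 G i t)
         + 2 * (wX G i T \<omega> \<bullet> X T \<omega>)))"

section \<open>Frozen filters and noise-state linear strategies\<close>

text \<open>State coefficients of the candidate profile: mean and noise kernel of the state, and for
  each player the noise kernel of the state estimation error.\<close>

record ('d, 'n) filter_coeffs =
  X_mean :: "real \<Rightarrow> (real, 'd) vec"
  X_ker :: "real \<Rightarrow> real \<Rightarrow> ('d, 'n) noise_mat"
  err_ker :: "'n \<Rightarrow> real \<Rightarrow> real \<Rightarrow> ('d, 'n) noise_mat"

record ('d, 'n) lin_strategy =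
  D_mean :: "real \<Rightarrow> (real, 'd) vec"
  D_ker :: "real \<Rightarrow> real \<Rightarrow> ('d, 'n) noise_mat"

definition lin_strategy :: "real \<Rightarrow> ('d::finite, 'n::finite) lin_strategy \<Rightarrow> bool" where
  "lin_strategy T S \<longleftrightarrow>
     time_measurable T (D_mean S) \<and> kernel_measurable T (D_ker S) \<and>
     (\<forall>t\<in>{0..T}. (\<integral>\<^sup>+u\<in>{0..t}. ennreal ((norm (D_ker S t u))\<^sup>2) \<partial>lborel) < \<infinity>)"

definition innovation ::
  "('w, 'd::finite, 'n::finite) lq_game \<Rightarrow> 'n \<Rightarrow> (real \<Rightarrow> 'w \<Rightarrow> real^'d) \<Rightarrow>
   (real \<Rightarrow> 'w \<Rightarrow> real^'d) \<Rightarrow> real \<Rightarrow> 'w \<Rightarrow> real^'d" where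
  "innovation G k Y Xhat t \<omega> = Y t \<omega> - (LINT s:{0..t}|lborel. sens G k s *v Xhat s \<omega>)"

text \<open>The density part of the noise filter: \<open>R t u\<close> is the integral over \<open>[u, t]\<close>
  of the transposed error kernel times the transposed sensitivity against the innovation \<open>I\<close>.\<close>

definition smoothing_density ::
  "('w, 'd::finite, 'n::finite) lq_game \<Rightarrow> ('d, 'n) filter_coeffs \<Rightarrow> 'n \<Rightarrow>
   (real \<Rightarrow> 'w \<Rightarrow> real^'d) \<Rightarrow> (real \<Rightarrow> real \<Rightarrow> 'w \<Rightarrow> ('d, 'n) noise_vec) \<Rightarrow> bool" where
  "smoothing_density G F k I R \<longleftrightarrow>
     (\<forall>t\<in>{0..horizon G}. sq_process (Pr G) t (R t) \<and>
        (AE u in lborel. u \<in> {0..t} \<longrightarrow>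
           has_stoch_integral (Pr G) I
             (\<lambda>s. transpose (err_ker F k s u) ** transpose (sens G k s)) u t (R t u)))"

definition noise_filter ::
  "'n \<Rightarrow> (real \<Rightarrow> 'w \<Rightarrow> real^'d) \<Rightarrow> (real \<Rightarrow> real \<Rightarrow> 'w \<Rightarrow> ('d::finite, 'n::finite) noise_vec) \<Rightarrow>
   real \<Rightarrow> real \<Rightarrow> 'w \<Rightarrow> ('d, 'n) noise_vec" where
  "noise_filter k I R t u \<omega> =
     transpose (obs_block k) *v I u \<omega> + (LINT v:{0..u}|lborel. R t v \<omega>)"

text \<open>\<open>frozen_filter G F k Y R Xhat\<close>: the filter of player \<open>k\<close> with the coefficients \<open>F\<close>, applied to
  an arbitrary signal \<open>Y\<close>, has state estimate \<open>Xhat\<close> and density part \<open>R\<close>. State estimates and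
  actions are identified up to null sets of times.\<close>

definition frozen_filter ::
  "('w, 'd::finite, 'n::finite) lq_game \<Rightarrow> ('d, 'n) filter_coeffs \<Rightarrow> 'n \<Rightarrow>
   (real \<Rightarrow> 'w \<Rightarrow> real^'d) \<Rightarrow> (real \<Rightarrow> real \<Rightarrow> 'w \<Rightarrow> ('d, 'n) noise_vec) \<Rightarrow>
   (real \<Rightarrow> 'w \<Rightarrow> real^'d) \<Rightarrow> bool" where
  "frozen_filter G F k Y R Xhat \<longleftrightarrow>
     (let I = innovation G k Y Xhat in
      sq_process (Pr G) (horizon G) Xhat \<and> smoothing_density G F k I R \<and>
      (AE t in lborel. t \<in> {0..horizon G} \<longrightarrow>
         has_stoch_integral (Pr G) (noise_filter k I R t) (X_ker F t) 0 t
           (\<lambda>\<omega>. Xhat t \<omega> - X_mean F t)))"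

definition lin_action ::
  "('w, 'd::finite, 'n::finite) lq_game \<Rightarrow> ('d, 'n) lin_strategy \<Rightarrow>
   (real \<Rightarrow> real \<Rightarrow> 'w \<Rightarrow> ('d, 'n) noise_vec) \<Rightarrow> (real \<Rightarrow> 'w \<Rightarrow> real^'d) \<Rightarrow> bool" where
  "lin_action G S What D \<longleftrightarrow>
     (AE t in lborel. t \<in> {0..horizon G} \<longrightarrow>
        has_stoch_integral (Pr G) (What t) (D_ker S t) 0 t (\<lambda>\<omega>. D t \<omega> - D_mean S t))"

definition plays_linear ::
  "('w, 'd::finite, 'n::finite) lq_game \<Rightarrow> ('d, 'n) filter_coeffs \<Rightarrow> 'n \<Rightarrow> ('d, 'n) lin_strategy \<Rightarrow>
   (real \<Rightarrow> 'w \<Rightarrow> real^'d) \<Rightarrow> (real \<Rightarrow> real \<Rightarrow> 'w \<Rightarrow> ('d, 'n) noise_vec) \<Rightarrow>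
   (real \<Rightarrow> 'w \<Rightarrow> real^'d) \<Rightarrow> (real \<Rightarrow> 'w \<Rightarrow> real^'d) \<Rightarrow> bool" where
  "plays_linear G F k S Y R Xhat D \<longleftrightarrow>
     frozen_filter G F k Y R Xhat \<and>
     lin_action G S (noise_filter k (innovation G k Y Xhat) R) D"

section \<open>Candidate profile and unilateral deviations\<close>

text \<open>The play of the profile \<open>S\<close>. The last three conditions say that \<open>F\<close> consists of the
  coefficients of this very play, and that on it the filters are the conditional expectations.\<close>

definition candidate ::
  "('w, 'd::finite, 'n::finite) lq_game \<Rightarrow> ('d, 'n) filter_coeffs \<Rightarrow> ('n \<Rightarrow> ('d, 'n) lin_strategy) \<Rightarrow>
   (real \<Rightarrow> 'w \<Rightarrow> real^'d) \<Rightarrow> ('n \<Rightarrow> real \<Rightarrow> 'w \<Rightarrow> real^'d) \<Rightarrow>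
   ('n \<Rightarrow> real \<Rightarrow> real \<Rightarrow> 'w \<Rightarrow> ('d, 'n) noise_vec) \<Rightarrow> ('n \<Rightarrow> real \<Rightarrow> 'w \<Rightarrow> real^'d) \<Rightarrow> bool" where
  "candidate G F S X D R Xhat \<longleftrightarrow>
     (let M = Pr G; T = horizon G; Y = signal G X;
          What = (\<lambda>k. noise_filter k (innovation G k (Y k) (Xhat k)) (R k)) in
      time_measurable T (X_mean F) \<and>
      kernel_measurable T (X_ker F) \<and> kernel_bounded T (X_ker F) \<and>
      (\<forall>k. kernel_measurable T (err_ker F k) \<and> kernel_bounded T (err_ker F k)) \<and>
      (\<forall>k. lin_strategy T (S k) \<and> kernel_bounded T (D_ker (S k))) \<and>
      sq_process M T X \<and> (\<forall>k. sq_process M T (D k)) \<and>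
      state_equation G X D \<and>
      (\<forall>k. plays_linear G F k (S k) (Y k) (R k) (Xhat k) (D k)) \<and>
      (\<forall>t\<in>{0..T}. has_stoch_integral M (noise G) (X_ker F t) 0 t (\<lambda>\<omega>. X t \<omega> - X_mean F t)) \<and>
      (\<forall>k. \<forall>t\<in>{0..T}. has_stoch_integral M (noise G) (err_ker F k t) 0 t
          (\<lambda>\<omega>. X t \<omega> - cond_exp_vec M (history M (Y k) t) (X t) \<omega>)) \<and>
      (\<forall>k. \<forall>t\<in>{0..T}. \<forall>u\<in>{0..t}. AE \<omega> in M.
          What k t u \<omega> = cond_exp_vec M (history M (Y k) t) (noise G u) \<omega>))"

text \<open>The play \<open>(X, D)\<close> when player \<open>i\<close> takes the actions \<open>D i\<close> and the opponents keep their
  strategies \<open>S\<close> and their filter coefficients \<open>F\<close>, applied to the resulting signals.\<close>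

definition deviation_play ::
  "('w, 'd::finite, 'n::finite) lq_game \<Rightarrow> ('d, 'n) filter_coeffs \<Rightarrow> ('n \<Rightarrow> ('d, 'n) lin_strategy) \<Rightarrow>
   'n \<Rightarrow> (real \<Rightarrow> 'w \<Rightarrow> real^'d) \<Rightarrow> ('n \<Rightarrow> real \<Rightarrow> 'w \<Rightarrow> real^'d) \<Rightarrow> bool" where
  "deviation_play G F S i X D \<longleftrightarrow>
     sq_process (Pr G) (horizon G) X \<and> (\<forall>k. sq_process (Pr G) (horizon G) (D k)) \<and>
     state_equation G X D \<and>
     (\<forall>k. k \<noteq> i \<longrightarrow> (\<exists>R Xhat. plays_linear G F k (S k) (signal G X k) R Xhat (D k)))"

text \<open>Strategy maps are functionals on the space of continuous signal paths. On the space of all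
  paths even the map \<open>(s, y) \<mapsto> y s\<close> would not be progressively measurable.\<close>

definition path_history :: "real \<Rightarrow> real \<Rightarrow> (real \<Rightarrow> real^'d) measure" where
  "path_history T t =
     vimage_algebra {y. continuous_on {0..T} y} (\<lambda>y. restrict y {0..t}) (PiM {0..t} (\<lambda>_. borel))"

definition strategy_map :: "real \<Rightarrow> (real \<Rightarrow> (real \<Rightarrow> real^'d) \<Rightarrow> real^'d) \<Rightarrow> bool" where
  "strategy_map T \<phi> \<longleftrightarrow>
     (\<forall>t\<in>{0..T}. (\<lambda>(s, y). \<phi> s y) \<in>
        borel_measurable (restrict_space borel {0..t} \<Otimes>\<^sub>M path_history T t))"

text \<open>The innovation path of the deviating player, hence its noise filter, is invariant to its
  own deviations, so a linear alternative loads on the noise filter of the candidate play.\<close>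

definition linear_nash ::
  "('w, 'd::finite, 'n::finite) lq_game \<Rightarrow> ('d, 'n) filter_coeffs \<Rightarrow> ('n \<Rightarrow> ('d, 'n) lin_strategy) \<Rightarrow>
   (real \<Rightarrow> 'w \<Rightarrow> real^'d) \<Rightarrow> ('n \<Rightarrow> real \<Rightarrow> 'w \<Rightarrow> real^'d) \<Rightarrow>
   ('n \<Rightarrow> real \<Rightarrow> real \<Rightarrow> 'w \<Rightarrow> ('d, 'n) noise_vec) \<Rightarrow> ('n \<Rightarrow> real \<Rightarrow> 'w \<Rightarrow> real^'d) \<Rightarrow> bool" where
  "linear_nash G F S X D R Xhat \<longleftrightarrow>
     (\<forall>i S' X' D'.
        lin_strategy (horizon G) S' \<and> deviation_play G F S i X' D' \<and>
        lin_action G S' (noise_filter i (innovation G i (signal G X i) (Xhat i)) (R i)) (D' i)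
        \<longrightarrow> cost G i X (D i) \<le> cost G i X' (D' i))"

text \<open>An arbitrary alternative \<open>\<phi>\<close> acts on the signal path that it generates itself. The
  containment expresses that the information of player \<open>i\<close> is identified across own controls through
  the innovation: the closed loop does not reveal more to player \<open>i\<close> than the
  innovation path of the candidate play. Without such a condition, a solution of the closed loop
  that is not determined by the innovation path could anticipate the noise.\<close>

definition unrestricted_nash ::
  "('w, 'd::finite, 'n::finite) lq_game \<Rightarrow> ('d, 'n) filter_coeffs \<Rightarrow> ('n \<Rightarrow> ('d, 'n) lin_strategy) \<Rightarrow>
   (real \<Rightarrow> 'w \<Rightarrow> real^'d) \<Rightarrow> ('n \<Rightarrow> real \<Rightarrow> 'w \<Rightarrow> real^'d) \<Rightarrow> ('n \<Rightarrow> real \<Rightarrow> 'w \<Rightarrow> real^'d) \<Rightarrow> bool" where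
  "unrestricted_nash G F S X D Xhat \<longleftrightarrow>
     (\<forall>i \<phi> X' D'.
        strategy_map (horizon G) \<phi> \<and> deviation_play G F S i X' D' \<and>
        (AE \<omega> in Pr G. \<forall>t\<in>{0..horizon G}. D' i t \<omega> = \<phi> t (\<lambda>s. signal G X' i s \<omega>)) \<and>
        (\<forall>t\<in>{0..horizon G}.
           contained_mod_null (Pr G) (history (Pr G) (signal G X' i) t)
             (history (Pr G) (innovation G i (signal G X i) (Xhat i)) t))
        \<longrightarrow> cost G i X (D i) \<le> cost G i X' (D' i))"

end

(*
  Let H be the closed span in L2 of the constants and the noise coordinates W_u. Every relation that
  defines a unilateral deviation (state equation, signals, innovations, frozen filters, linear
  actions of the opponents) is linear with deterministic coefficients, hence is preserved when all
  random variables are projected orthogonally on H. So the projection of an arbitrary deviation is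
  again a deviation, without any Volterra equation being solved. It is not more expensive: the linear
  weight lies in H, so the linear cost does not change, and the quadratic cost loses the
  contribution of the orthogonal complement.

  The projected action of the deviating player is a noise-state linear one. On the candidate play,
  conditioning on F_t, the signal history up to t, maps H into H, so the projection on H commutes
  with this conditioning, and the projected action P is F_t-measurable. As P lies in H and is
  orthogonal to the future noise, P = m + (integral over [0,t] of K dW), and conditioning on F_t
  replaces W_u by the filtered noise E[W_u | F_t]: P loads on the filter with the same kernel K.
*)
theory Submission
  imports Defs
begin

section \<open>Annihilators and orthogonal projections in L2\<close>


text \<open>The delicate point is measurability in time. For each \<open>t\<close> the projection of
  \<open>Z t\<close> is determined only up to a null set, whereas a play needs processes measurable
  in \<open>(t, \<omega>)\<close> and a linear strategy needs a kernel measurable in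
  \<open>(t, u)\<close>. Projections are therefore constructed explicitly: finite sums over dyadic
  noise increments, with a level that depends measurably on \<open>t\<close>, converge to the
  projection, and the corresponding step functions converge to its kernel.

  That conditioning maps H into H is a feature of the candidate play: its filters are the
  conditional expectations of the noise, and they are linear in the innovation with deterministic
  kernels. Conditional expectation is treated as a second orthogonal projection, on the span of
  indicators, so the same lemmas on stochastic integrals serve for both.

  The actions of a deviating player are tied to the candidate information only through the
  innovation path and up to null sets, which is why completed sigma-algebras appear. Square
  integrability is available at almost every time for actions and filters, but at every time for the
  state, as the terminal cost demands.\<close>

definition L2 :: "'w measure \<Rightarrow> ('w \<Rightarrow> real) set" where
  "L2 M = {f \<in> borel_measurable M. integrable M (\<lambda>\<omega>. (f \<omega>)\<^sup>2)}"

text \<open>The choice \<open>B = {}\<close> gives all of \<open>L2 M\<close>, so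
  \<open>orthv M {} Z\<close> below just says that the random vector \<open>Z\<close> is square
  integrable. Elements are functions and not classes modulo null sets, since processes have to stay
  jointly measurable; \<open>orth_cong_AE\<close> moves between versions.\<close>

definition orth :: "'w measure \<Rightarrow> ('w \<Rightarrow> real) set \<Rightarrow> ('w \<Rightarrow> real) set" where
  "orth M B = {V \<in> L2 M. \<forall>h\<in>B. (LINT \<omega>|M. V \<omega> * h \<omega>) = 0}"

text \<open>\<open>Z'\<close> is the orthogonal projection of \<open>Z\<close> on the closed span of \<open>A\<close>. The closed span is encoded as
  the annihilator of the annihilator of \<open>A\<close>, so that no completion is needed.\<close>

definition is_proj :: "'w measure \<Rightarrow> ('w \<Rightarrow> real) set \<Rightarrow> ('w \<Rightarrow> real) \<Rightarrow> ('w \<Rightarrow> real) \<Rightarrow> bool" where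
  "is_proj M A Z Z' \<longleftrightarrow> (\<lambda>\<omega>. Z \<omega> - Z' \<omega>) \<in> orth M A \<and> Z' \<in> orth M (orth M A)"

lemma L2_meas[measurable_dest]: "f \<in> L2 M \<Longrightarrow> f \<in> borel_measurable M"
  and L2_sq_int: "f \<in> L2 M \<Longrightarrow> integrable M (\<lambda>\<omega>. (f \<omega>)\<^sup>2)"
  by (auto simp: L2_def)

lemma L2_I: "f \<in> borel_measurable M \<Longrightarrow> integrable M (\<lambda>\<omega>. (f \<omega>)\<^sup>2) \<Longrightarrow> f \<in> L2 M"
  by (auto simp: L2_def)

lemma L2_iff_nn:
  assumes "f \<in> borel_measurable M"
  shows "f \<in> L2 M \<longleftrightarrow> (\<integral>\<^sup>+\<omega>. ennreal ((f \<omega>)\<^sup>2) \<partial>M) < \<infinity>"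
  using assms by (auto simp: L2_def integrable_iff_bounded)

lemma nn_eq_LINT_sq:
  "f \<in> L2 M \<Longrightarrow> (\<integral>\<^sup>+\<omega>. ennreal ((f \<omega>)\<^sup>2) \<partial>M) = ennreal (LINT \<omega>|M. (f \<omega>)\<^sup>2)"
  by (intro nn_integral_eq_integral L2_sq_int) auto

lemma L2_prod_integrable:
  assumes "f \<in> L2 M" "g \<in> L2 M"
  shows "integrable M (\<lambda>\<omega>. f \<omega> * g \<omega>)"
proof (rule Bochner_Integration.integrable_bound[where f="\<lambda>\<omega>. (f \<omega>)\<^sup>2 + (g \<omega>)\<^sup>2"])
  have "\<bar>x * y\<bar> \<le> \<bar>x\<^sup>2 + y\<^sup>2\<bar>" for x y :: real
  proof -
    have "2 * (\<bar>x\<bar> * \<bar>y\<bar>) \<le> x\<^sup>2 + y\<^sup>2" using sum_squares_bound[of "\<bar>x\<bar>" "\<bar>y\<bar>"] by simp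
    moreover have "0 \<le> \<bar>x\<bar> * \<bar>y\<bar>" by simp
    ultimately show ?thesis unfolding abs_mult by linarith
  qed
  then show "AE \<omega> in M. norm (f \<omega> * g \<omega>) \<le> norm ((f \<omega>)\<^sup>2 + (g \<omega>)\<^sup>2)"
    by simp
qed (use assms in \<open>auto simp: L2_def\<close>)

lemma L2_add: assumes "f \<in> L2 M" "g \<in> L2 M" shows "(\<lambda>\<omega>. f \<omega> + g \<omega>) \<in> L2 M"
proof -
  have "integrable M (\<lambda>\<omega>. (f \<omega>)\<^sup>2 + (g \<omega>)\<^sup>2 + 2 * (f \<omega> * g \<omega>))"
    using L2_prod_integrable[OF assms] assms by (auto simp: L2_def)
  then show ?thesis using assms by (auto simp: L2_def power2_sum mult.assoc)
qed

lemma L2_cmult: "f \<in> L2 M \<Longrightarrow> (\<lambda>\<omega>. c * f \<omega>) \<in> L2 M"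
  by (auto simp: L2_def power_mult_distrib)

lemma L2_diff: assumes "f \<in> L2 M" "g \<in> L2 M" shows "(\<lambda>\<omega>. f \<omega> - g \<omega>) \<in> L2 M"
  using L2_add[OF assms(1) L2_cmult[OF assms(2), of "-1"]] by simp

lemma L2_zero: "(\<lambda>\<omega>. 0) \<in> L2 M"
  by (auto simp: L2_def)

lemma L2_sum: "(\<And>i. i \<in> I \<Longrightarrow> f i \<in> L2 M) \<Longrightarrow> (\<lambda>\<omega>. \<Sum>i\<in>I. f i \<omega>) \<in> L2 M"
  by (induction I rule: infinite_finite_induct) (auto intro!: L2_add L2_zero)

lemma L2_const: "finite_measure M \<Longrightarrow> (\<lambda>\<omega>. c) \<in> L2 M"
  by (auto simp: L2_def finite_measure.integrable_const)

lemma L2_integrable: "finite_measure M \<Longrightarrow> f \<in> L2 M \<Longrightarrow> integrable M f"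
  using L2_prod_integrable[OF L2_const, of M f 1] by simp

lemma L2_cong_AE:
  assumes "f \<in> L2 M" "g \<in> borel_measurable M" "AE \<omega> in M. f \<omega> = g \<omega>"
  shows "g \<in> L2 M"
proof -
  have "integrable M (\<lambda>\<omega>. (f \<omega>)\<^sup>2) \<longleftrightarrow> integrable M (\<lambda>\<omega>. (g \<omega>)\<^sup>2)"
    using assms by (intro Bochner_Integration.integrable_cong_AE) (auto simp: L2_def)
  then show ?thesis using assms by (auto simp: L2_def)
qed

lemma LINT_sq_add_le:
  assumes "f \<in> L2 M" "g \<in> L2 M"
  shows "(LINT \<omega>|M. (f \<omega> + g \<omega>)\<^sup>2) \<le> 2 * (LINT \<omega>|M. (f \<omega>)\<^sup>2) + 2 * (LINT \<omega>|M. (g \<omega>)\<^sup>2)"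
proof -
  have i: "integrable M (\<lambda>\<omega>. 2 * (f \<omega>)\<^sup>2)" "integrable M (\<lambda>\<omega>. 2 * (g \<omega>)\<^sup>2)"
    using assms by (auto simp: L2_def)
  have "(LINT \<omega>|M. (f \<omega> + g \<omega>)\<^sup>2) \<le> (LINT \<omega>|M. 2 * (f \<omega>)\<^sup>2 + 2 * (g \<omega>)\<^sup>2)"
  proof (rule integral_mono)
    show "(f \<omega> + g \<omega>)\<^sup>2 \<le> 2 * (f \<omega>)\<^sup>2 + 2 * (g \<omega>)\<^sup>2" for \<omega>
      using sum_squares_bound[of "f \<omega>" "g \<omega>"] by (simp add: power2_sum)
  qed (use i L2_add[OF assms] in \<open>auto dest: L2_sq_int\<close>)
  then show ?thesis using i by simp
qed

text \<open>Stands in for Minkowski's inequality: it stays with squared norms and costs a factor 2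
  at each use.\<close>

lemma LINT_sq_diff_le:
  assumes "f \<in> L2 M" "g \<in> L2 M" "h \<in> L2 M"
  shows "(LINT \<omega>|M. (f \<omega> - h \<omega>)\<^sup>2) \<le> 2 * (LINT \<omega>|M. (f \<omega> - g \<omega>)\<^sup>2) + 2 * (LINT \<omega>|M. (g \<omega> - h \<omega>)\<^sup>2)"
  using LINT_sq_add_le[OF L2_diff[OF assms(1,2)] L2_diff[OF assms(2,3)]] by simp

lemma LINT_sq_zero_AE:
  assumes "f \<in> L2 M" "(LINT \<omega>|M. (f \<omega>)\<^sup>2) = 0"
  shows "AE \<omega> in M. f \<omega> = 0"
  using integral_nonneg_eq_0_iff_AE[OF L2_sq_int[OF assms(1)]] assms(2) by auto

lemma Cauchy_Schwarz_sq:
  assumes "f \<in> L2 M" "g \<in> L2 M"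
  shows "(LINT \<omega>|M. f \<omega> * g \<omega>)\<^sup>2 \<le> (LINT \<omega>|M. (f \<omega>)\<^sup>2) * (LINT \<omega>|M. (g \<omega>)\<^sup>2)"
proof -
  let ?a = "LINT \<omega>|M. (f \<omega>)\<^sup>2" and ?b = "LINT \<omega>|M. f \<omega> * g \<omega>" and ?c = "LINT \<omega>|M. (g \<omega>)\<^sup>2"
  have i: "integrable M (\<lambda>\<omega>. (f \<omega>)\<^sup>2)" "integrable M (\<lambda>\<omega>. (g \<omega>)\<^sup>2)" "integrable M (\<lambda>\<omega>. f \<omega> * g \<omega>)"
    using assms L2_prod_integrable[OF assms] by (auto dest: L2_sq_int)
  \<comment> \<open>Homogeneous in \<open>(s, t)\<close>, so that the values \<open>s = ?c\<close>
    and \<open>t = ?b\<close> lead to the discriminant without a division.\<close>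
  have q: "0 \<le> s\<^sup>2 * ?a - 2 * s * t * ?b + t\<^sup>2 * ?c" for s t
  proof -
    have "0 \<le> (LINT \<omega>|M. (s * f \<omega> - t * g \<omega>)\<^sup>2)" by simp
    also have "\<dots> = (LINT \<omega>|M. s\<^sup>2 * (f \<omega>)\<^sup>2 - 2 * s * t * (f \<omega> * g \<omega>) + t\<^sup>2 * (g \<omega>)\<^sup>2)"
      by (intro Bochner_Integration.integral_cong) (auto simp: power2_eq_square algebra_simps)
    also have "\<dots> = s\<^sup>2 * ?a - 2 * s * t * ?b + t\<^sup>2 * ?c"
      using i by simp
    finally show ?thesis .
  qed
  have c0: "0 \<le> ?c" "0 \<le> ?a" by simp_all
  show ?thesis
  proof (cases "?c = 0")
    case True
    have "?b = 0"
    proof (rule ccontr)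
      assume "?b \<noteq> 0"
      \<comment> \<open>With \<open>?c = 0\<close> the form is affine in \<open>t\<close>, and this
        value of \<open>t\<close> makes it equal to \<open>-1\<close>.\<close>
      then show False using q[of 1 "(?a + 1) / (2 * ?b)"] True c0 by (simp add: field_simps)
    qed
    then show ?thesis by simp
  next
    case False
    then have cp: "0 < ?c" using c0(1) by linarith
    have "0 \<le> ?c * (?a * ?c - ?b\<^sup>2)"
      using q[of ?c ?b] by (simp add: power2_eq_square algebra_simps)
    then have "0 \<le> ?a * ?c - ?b\<^sup>2" using cp by (simp add: zero_le_mult_iff)
    then show ?thesis by simp
  qed
qed

section \<open>Annihilators\<close>

lemma orth_L2: "V \<in> orth M B \<Longrightarrow> V \<in> L2 M" by (simp add: orth_def)

lemma orthD: "V \<in> orth M B \<Longrightarrow> h \<in> B \<Longrightarrow> (LINT \<omega>|M. V \<omega> * h \<omega>) = 0" by (simp add: orth_def)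

lemma orth_empty: "orth M {} = L2 M" by (auto simp: orth_def)

lemma orth_add:
  assumes "B \<subseteq> L2 M" "f \<in> orth M B" "g \<in> orth M B" shows "(\<lambda>\<omega>. f \<omega> + g \<omega>) \<in> orth M B"
proof -
  have "(LINT \<omega>|M. (f \<omega> + g \<omega>) * h \<omega>) = 0" if "h \<in> B" for h
  proof -
    have "h \<in> L2 M" using that assms(1) by auto
    then show ?thesis using assms that
      by (simp add: distrib_right L2_prod_integrable orth_L2 orthD)
  qed
  then show ?thesis using assms by (auto simp: orth_def intro: L2_add)
qed

lemma orth_cmult: "f \<in> orth M B \<Longrightarrow> (\<lambda>\<omega>. c * f \<omega>) \<in> orth M B"
  by (auto simp: orth_def mult.assoc intro: L2_cmult)

lemma orth_diff:
  assumes "B \<subseteq> L2 M" "f \<in> orth M B" "g \<in> orth M B" shows "(\<lambda>\<omega>. f \<omega> - g \<omega>) \<in> orth M B"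
  using orth_add[OF assms(1,2) orth_cmult[OF assms(3), of "-1"]] by simp

lemma orth_zero: "(\<lambda>\<omega>. 0) \<in> orth M B"
  by (auto simp: orth_def L2_zero)

lemma orth_sum:
  "B \<subseteq> L2 M \<Longrightarrow> (\<And>i. i \<in> I \<Longrightarrow> f i \<in> orth M B) \<Longrightarrow> (\<lambda>\<omega>. \<Sum>i\<in>I. f i \<omega>) \<in> orth M B"
  by (induction I rule: infinite_finite_induct) (auto intro!: orth_add orth_zero)

lemma orth_cong_AE:
  assumes "f \<in> orth M B" "B \<subseteq> L2 M" "g \<in> borel_measurable M" "AE \<omega> in M. f \<omega> = g \<omega>"
  shows "g \<in> orth M B"
proof -
  have g: "g \<in> L2 M" using L2_cong_AE[OF orth_L2[OF assms(1)] assms(3,4)] .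
  have "(LINT \<omega>|M. g \<omega> * h \<omega>) = (LINT \<omega>|M. f \<omega> * h \<omega>)" if "h \<in> B" for h
  proof (rule integral_cong_AE)
    have "h \<in> L2 M" using that assms by auto
    then show "(\<lambda>\<omega>. g \<omega> * h \<omega>) \<in> borel_measurable M" "(\<lambda>\<omega>. f \<omega> * h \<omega>) \<in> borel_measurable M"
      using assms g orth_L2[OF assms(1)] by (auto dest: L2_meas)
  qed (use assms(4) in auto)
  then show ?thesis using g assms(1) by (auto simp: orth_def)
qed

text \<open>By Cauchy-Schwarz the pairing with a fixed \<open>h\<close> is continuous in mean
  square, so annihilators are closed. \<open>R\<close> is only assumed measurable; its square
  integrability follows from any one approximation. Stochastic integrals, dyadic limits and the
  passage from dyadic to arbitrary times all rest on this.\<close>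

lemma orth_limit:
  assumes "B \<subseteq> L2 M" "R \<in> borel_measurable M"
    and approx: "\<And>e. e > 0 \<Longrightarrow> \<exists>Q\<in>orth M B. (\<integral>\<^sup>+\<omega>. ennreal ((R \<omega> - Q \<omega>)\<^sup>2) \<partial>M) \<le> ennreal e"
  shows "R \<in> orth M B"
proof -
  have rq: "(\<lambda>\<omega>. R \<omega> - Q \<omega>) \<in> L2 M" if "Q \<in> orth M B" "(\<integral>\<^sup>+\<omega>. ennreal ((R \<omega> - Q \<omega>)\<^sup>2) \<partial>M) \<le> ennreal e" for Q e
  proof -
    have "Q \<in> borel_measurable M" using that orth_L2 L2_meas by blast
    then show ?thesis
      using assms(2) that(2) by (subst L2_iff_nn) (auto intro: le_less_trans)
  qed
  obtain Q where Q: "Q \<in> orth M B" "(\<integral>\<^sup>+\<omega>. ennreal ((R \<omega> - Q \<omega>)\<^sup>2) \<partial>M) \<le> ennreal 1"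
    using approx[of 1] by auto
  have RL: "R \<in> L2 M" using L2_add[OF rq[OF Q] orth_L2[OF Q(1)]] by simp
  have "(LINT \<omega>|M. R \<omega> * h \<omega>) = 0" if "h \<in> B" for h
  proof -
    have hL: "h \<in> L2 M" using that assms(1) by auto
    let ?H = "LINT \<omega>|M. (h \<omega>)\<^sup>2"
    have "(LINT \<omega>|M. R \<omega> * h \<omega>)\<^sup>2 \<le> 0 + e" if "e > 0" for e
    proof -
      \<comment> \<open>The added 1 keeps the divisor positive when \<open>h\<close>
        vanishes.\<close>
      have H: "?H + 1 > 0" by (simp add: add_nonneg_pos)
      obtain Q where Q: "Q \<in> orth M B" "(\<integral>\<^sup>+\<omega>. ennreal ((R \<omega> - Q \<omega>)\<^sup>2) \<partial>M) \<le> ennreal (e / (?H + 1))"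
        using approx[of "e / (?H + 1)"] \<open>e > 0\<close> H by auto
      have RQ: "(\<lambda>\<omega>. R \<omega> - Q \<omega>) \<in> L2 M" by (rule rq[OF Q])
      have le: "(LINT \<omega>|M. (R \<omega> - Q \<omega>)\<^sup>2) \<le> e / (?H + 1)"
        using Q(2) nn_eq_LINT_sq[OF RQ] \<open>e > 0\<close> H by (simp add: ennreal_le_iff)
      have "(LINT \<omega>|M. R \<omega> * h \<omega>) = (LINT \<omega>|M. (R \<omega> - Q \<omega>) * h \<omega> + Q \<omega> * h \<omega>)"
        by (simp add: algebra_simps)
      also have "\<dots> = (LINT \<omega>|M. (R \<omega> - Q \<omega>) * h \<omega>)"
        using L2_prod_integrable[OF RQ hL] L2_prod_integrable[OF orth_L2[OF Q(1)] hL] orthD[OF Q(1) \<open>h \<in> B\<close>]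
        by (subst Bochner_Integration.integral_add) auto
      finally have "(LINT \<omega>|M. R \<omega> * h \<omega>)\<^sup>2 \<le> (LINT \<omega>|M. (R \<omega> - Q \<omega>)\<^sup>2) * ?H"
        using Cauchy_Schwarz_sq[OF RQ hL] by simp
      also have "\<dots> \<le> e / (?H + 1) * (?H + 1)"
        using le H that by (intro mult_mono) auto
      finally show ?thesis using H by simp
    qed
    then have "(LINT \<omega>|M. R \<omega> * h \<omega>)\<^sup>2 \<le> 0" by (rule field_le_epsilon)
    then show ?thesis by simp
  qed
  then show ?thesis using RL by (auto simp: orth_def)
qed

lemma orth_anti: "B \<subseteq> C \<Longrightarrow> orth M C \<subseteq> orth M B" by (auto simp: orth_def)

lemma orth_orth_incl: "B \<subseteq> L2 M \<Longrightarrow> h \<in> B \<Longrightarrow> h \<in> orth M (orth M B)"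
  by (auto simp: orth_def mult.commute)

lemma orth_subset_L2: "orth M B \<subseteq> L2 M" by (auto simp: orth_def)

lemma orth_commute_zero: "V \<in> orth M B \<Longrightarrow> Z \<in> orth M (orth M B) \<Longrightarrow> (LINT \<omega>|M. V \<omega> * Z \<omega>) = 0"
  using orthD[of Z M "orth M B" V] by (simp add: mult.commute)

lemma orth_inter_zero:
  assumes "V \<in> orth M B" "V \<in> orth M (orth M B)" shows "AE \<omega> in M. V \<omega> = 0"
  using LINT_sq_zero_AE[OF orth_L2[OF assms(1)]] orth_commute_zero[OF assms] by (simp add: power2_eq_square)

section \<open>Orthogonal projections\<close>

lemma is_proj_L2: "is_proj M A Z Z' \<Longrightarrow> Z \<in> L2 M \<and> Z' \<in> L2 M"
  using L2_add[of "\<lambda>\<omega>. Z \<omega> - Z' \<omega>" M Z'] orth_L2 unfolding is_proj_def by fastforce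

lemma is_proj_self: "Z \<in> orth M (orth M A) \<Longrightarrow> is_proj M A Z Z"
  by (simp add: is_proj_def orth_zero)

lemma is_proj_add:
  assumes "A \<subseteq> L2 M" "is_proj M A Z Z'" "is_proj M A Y Y'"
  shows "is_proj M A (\<lambda>\<omega>. Z \<omega> + Y \<omega>) (\<lambda>\<omega>. Z' \<omega> + Y' \<omega>)"
  using orth_add[OF assms(1), of "\<lambda>\<omega>. Z \<omega> - Z' \<omega>" "\<lambda>\<omega>. Y \<omega> - Y' \<omega>"] assms
  by (auto simp: is_proj_def algebra_simps intro!: orth_add[OF orth_subset_L2])

lemma is_proj_cmult:
  assumes "is_proj M A Z Z'" shows "is_proj M A (\<lambda>\<omega>. c * Z \<omega>) (\<lambda>\<omega>. c * Z' \<omega>)"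
  using orth_cmult[of "\<lambda>\<omega>. Z \<omega> - Z' \<omega>" M A c] orth_cmult[of Z' M "orth M A" c] assms
  by (auto simp: is_proj_def algebra_simps)

lemma is_proj_diff:
  assumes "A \<subseteq> L2 M" "is_proj M A Z Z'" "is_proj M A Y Y'"
  shows "is_proj M A (\<lambda>\<omega>. Z \<omega> - Y \<omega>) (\<lambda>\<omega>. Z' \<omega> - Y' \<omega>)"
  using is_proj_add[OF assms(1,2) is_proj_cmult[OF assms(3), of "-1"]] by simp

lemma is_proj_zero: "is_proj M A (\<lambda>\<omega>. 0) (\<lambda>\<omega>. 0)"
  by (intro is_proj_self orth_zero)

lemma is_proj_sum:
  "A \<subseteq> L2 M \<Longrightarrow> (\<And>i. i \<in> I \<Longrightarrow> is_proj M A (f i) (g i)) \<Longrightarrow>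
    is_proj M A (\<lambda>\<omega>. \<Sum>i\<in>I. f i \<omega>) (\<lambda>\<omega>. \<Sum>i\<in>I. g i \<omega>)"
  by (induction I rule: infinite_finite_induct) (auto intro!: is_proj_add is_proj_zero)

lemma is_proj_cong_AE:
  assumes "A \<subseteq> L2 M" "is_proj M A Z Z'" "Y \<in> borel_measurable M" "Y' \<in> borel_measurable M"
    and "AE \<omega> in M. Z \<omega> = Y \<omega>" "AE \<omega> in M. Z' \<omega> = Y' \<omega>"
  shows "is_proj M A Y Y'"
proof -
  have "AE \<omega> in M. Z \<omega> - Z' \<omega> = Y \<omega> - Y' \<omega>" using assms(5,6) by auto
  then show ?thesis
    using assms by (auto simp: is_proj_def intro: orth_cong_AE[OF _ assms(1)] orth_cong_AE[OF _ orth_subset_L2])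
qed

lemma is_proj_contraction:
  assumes "is_proj M A Z Z'"
  shows "(LINT \<omega>|M. (Z' \<omega>)\<^sup>2) \<le> (LINT \<omega>|M. (Z \<omega>)\<^sup>2)"
proof -
  have L: "(\<lambda>\<omega>. Z \<omega> - Z' \<omega>) \<in> L2 M" "Z' \<in> L2 M" using assms by (auto simp: is_proj_def orth_L2)
  have z: "(LINT \<omega>|M. (Z \<omega> - Z' \<omega>) * Z' \<omega>) = 0"
    using assms by (auto simp: is_proj_def intro: orth_commute_zero)
  have "(LINT \<omega>|M. (Z \<omega>)\<^sup>2) = (LINT \<omega>|M. (Z \<omega> - Z' \<omega>)\<^sup>2 + (Z' \<omega>)\<^sup>2 + 2 * ((Z \<omega> - Z' \<omega>) * Z' \<omega>))"
    by (intro Bochner_Integration.integral_cong) (auto simp: power2_eq_square algebra_simps)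
  also have "\<dots> = (LINT \<omega>|M. (Z \<omega> - Z' \<omega>)\<^sup>2) + (LINT \<omega>|M. (Z' \<omega>)\<^sup>2)"
    using L L2_prod_integrable[OF L] z by (simp add: L2_sq_int)
  finally show ?thesis by simp
qed

lemma is_proj_contraction_nn:
  assumes "is_proj M A Z Z'"
  shows "(\<integral>\<^sup>+\<omega>. ennreal ((Z' \<omega>)\<^sup>2) \<partial>M) \<le> (\<integral>\<^sup>+\<omega>. ennreal ((Z \<omega>)\<^sup>2) \<partial>M)"
  using is_proj_contraction[OF assms] is_proj_L2[OF assms] by (simp add: nn_eq_LINT_sq ennreal_leI)

text \<open>The removed component \<open>Z - Z'\<close> is orthogonal to everything in the span. For
  a weight process in the span this keeps the linear cost unchanged; in
  \<open>proj_keeps_measurability\<close> it exchanges \<open>Z\<close> and \<open>Z'\<close> inside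
  inner products.\<close>

lemma is_proj_inner:
  assumes "is_proj M A Z Z'" "h \<in> orth M (orth M A)"
  shows "(LINT \<omega>|M. h \<omega> * Z \<omega>) = (LINT \<omega>|M. h \<omega> * Z' \<omega>)"
proof -
  have hL: "h \<in> L2 M" using assms(2) by (rule orth_L2)
  have "(LINT \<omega>|M. h \<omega> * (Z \<omega> - Z' \<omega>)) = 0"
    using assms by (auto simp: is_proj_def intro!: orthD[of h M "orth M A"])
  then show ?thesis
    using is_proj_L2[OF assms(1)] hL by (simp add: right_diff_distrib L2_prod_integrable)
qed

section \<open>Random vectors, coordinate by coordinate\<close>

abbreviation orthv :: "'w measure \<Rightarrow> ('w \<Rightarrow> real) set \<Rightarrow> ('w \<Rightarrow> real^'m) \<Rightarrow> bool" where
  "orthv M B Z \<equiv> \<forall>a. (\<lambda>\<omega>. Z \<omega> $ a) \<in> orth M B"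

abbreviation is_projv :: "'w measure \<Rightarrow> ('w \<Rightarrow> real) set \<Rightarrow> ('w \<Rightarrow> real^'m) \<Rightarrow> ('w \<Rightarrow> real^'m) \<Rightarrow> bool" where
  "is_projv M A Z Z' \<equiv> \<forall>a. is_proj M A (\<lambda>\<omega>. Z \<omega> $ a) (\<lambda>\<omega>. Z' \<omega> $ a)"

lemma norm_vec_sq: "(norm (x :: real^'m))\<^sup>2 = (\<Sum>a\<in>UNIV. (x $ a)\<^sup>2)"
  by (simp add: norm_vec_def L2_set_def sum_nonneg)

lemma norm_mat_sq: "(norm (x :: real^'m^'k))\<^sup>2 = (\<Sum>a\<in>UNIV. \<Sum>b\<in>UNIV. (x $ a $ b)\<^sup>2)"
  by (simp add: norm_vec_def[where 'b = 'k] L2_set_def sum_nonneg norm_vec_sq)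

lemma borel_measurable_vec:
  fixes f :: "'a \<Rightarrow> real^'m"
  shows "f \<in> borel_measurable M \<longleftrightarrow> (\<forall>a. (\<lambda>x. f x $ a) \<in> borel_measurable M)"
proof
  assume f: "f \<in> borel_measurable M"
  have "(\<lambda>x::real^'m. x $ a) \<in> borel_measurable borel" for a
    by (intro borel_measurable_continuous_onI continuous_intros)
  then show "\<forall>a. (\<lambda>x. f x $ a) \<in> borel_measurable M"
    using measurable_compose[OF f] by blast
next
  assume "\<forall>a. (\<lambda>x. f x $ a) \<in> borel_measurable M"
  then show "f \<in> borel_measurable M"
    by (subst borel_measurable_euclidean_space) (auto simp: Basis_vec_def inner_axis)
qed

\<comment> \<open>With the library rule the measurability prover does not terminate on coordinates of vectors.\<close>
declare borel_measurable_nth[measurable del]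

lemma borel_measurable_vec_nth[measurable]:
  "f \<in> borel_measurable M \<Longrightarrow> (\<lambda>x. (f x :: real^'m) $ a) \<in> borel_measurable M"
  by (simp add: borel_measurable_vec)

lemma borel_measurable_row[measurable]:
  "f \<in> borel_measurable M \<Longrightarrow> (\<lambda>x. (f x :: real^'k^'m) $ a) \<in> borel_measurable M"
  by (erule measurable_compose) (intro borel_measurable_continuous_onI continuous_intros)

lemma borel_measurable_mat:
  fixes f :: "'a \<Rightarrow> real^'k^'m"
  shows "f \<in> borel_measurable M \<longleftrightarrow> (\<forall>a b. (\<lambda>x. f x $ a $ b) \<in> borel_measurable M)"
proof
  assume "\<forall>a b. (\<lambda>x. f x $ a $ b) \<in> borel_measurable M"
  then show "f \<in> borel_measurable M"
    by (subst borel_measurable_euclidean_space) (auto simp: Basis_vec_def inner_axis)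
next
  assume f: "f \<in> borel_measurable M"
  show "\<forall>a b. (\<lambda>x. f x $ a $ b) \<in> borel_measurable M"
    using borel_measurable_vec_nth[OF borel_measurable_row[OF f]] by blast
qed

lemma orthv_meas: "orthv M B Z \<Longrightarrow> Z \<in> borel_measurable M"
  by (auto simp: borel_measurable_vec orth_def L2_def)

lemma is_projv_L2: "is_projv M A Z Z' \<Longrightarrow> orthv M {} Z" "is_projv M A Z Z' \<Longrightarrow> orthv M {} Z'"
  using is_proj_L2 by (fastforce simp: orth_empty)+

lemma is_projv_meas: "is_projv M A Z Z' \<Longrightarrow> Z \<in> borel_measurable M" "is_projv M A Z Z' \<Longrightarrow> Z' \<in> borel_measurable M"
  by (erule orthv_meas[OF is_projv_L2(1)], erule orthv_meas[OF is_projv_L2(2)])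

lemma nn_norm_vec_sq:
  fixes Z :: "'w \<Rightarrow> real^'m"
  assumes "Z \<in> borel_measurable M"
  shows "(\<integral>\<^sup>+\<omega>. ennreal ((norm (Z \<omega>))\<^sup>2) \<partial>M) = (\<Sum>a\<in>UNIV. \<integral>\<^sup>+\<omega>. ennreal ((Z \<omega> $ a)\<^sup>2) \<partial>M)"
proof -
  have m: "(\<lambda>\<omega>. ennreal ((Z \<omega> $ a)\<^sup>2)) \<in> borel_measurable M" for a
    using borel_measurable_vec_nth[OF assms, of a] by simp
  have "(\<integral>\<^sup>+\<omega>. ennreal ((norm (Z \<omega>))\<^sup>2) \<partial>M) = (\<integral>\<^sup>+\<omega>. (\<Sum>a\<in>UNIV. ennreal ((Z \<omega> $ a)\<^sup>2)) \<partial>M)"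
    by (intro nn_integral_cong) (simp add: norm_vec_sq sum_ennreal)
  also have "\<dots> = (\<Sum>a\<in>UNIV. \<integral>\<^sup>+\<omega>. ennreal ((Z \<omega> $ a)\<^sup>2) \<partial>M)"
    by (rule nn_integral_sum) (rule m)
  finally show ?thesis .
qed

lemma nn_norm_vec_component:
  fixes Z :: "'w \<Rightarrow> real^'m"
  shows "(\<integral>\<^sup>+\<omega>. ennreal ((Z \<omega> $ a)\<^sup>2) \<partial>M) \<le> (\<integral>\<^sup>+\<omega>. ennreal ((norm (Z \<omega>))\<^sup>2) \<partial>M)"
  by (intro nn_integral_mono ennreal_leI)
    (metis abs_le_square_iff abs_norm_cancel component_le_norm_cart)

lemma L2v_iff:
  fixes Z :: "'w \<Rightarrow> real^'m"
  assumes "Z \<in> borel_measurable M"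
  shows "orthv M {} Z \<longleftrightarrow> (\<integral>\<^sup>+\<omega>. ennreal ((norm (Z \<omega>))\<^sup>2) \<partial>M) < \<infinity>"
proof -
  have m: "(\<lambda>\<omega>. Z \<omega> $ a) \<in> borel_measurable M" for a using assms by (rule borel_measurable_vec_nth)
  have "(\<integral>\<^sup>+\<omega>. ennreal ((norm (Z \<omega>))\<^sup>2) \<partial>M) < \<infinity> \<longleftrightarrow> (\<forall>a. (\<integral>\<^sup>+\<omega>. ennreal ((Z \<omega> $ a)\<^sup>2) \<partial>M) < \<infinity>)"
    unfolding nn_norm_vec_sq[OF assms] infinity_ennreal_def less_top[symmetric]
    by (simp add: ennreal_sum_eq_top)
  then show ?thesis unfolding orth_empty L2_iff_nn[OF m] by blast
qed

lemma orthv_add: "B \<subseteq> L2 M \<Longrightarrow> orthv M B Z \<Longrightarrow> orthv M B Y \<Longrightarrow> orthv M B (\<lambda>\<omega>. Z \<omega> + Y \<omega>)"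
  by (auto intro: orth_add)
lemma orthv_diff: "B \<subseteq> L2 M \<Longrightarrow> orthv M B Z \<Longrightarrow> orthv M B Y \<Longrightarrow> orthv M B (\<lambda>\<omega>. Z \<omega> - Y \<omega>)"
  by (auto intro: orth_diff)
lemma orthv_matvec: "B \<subseteq> L2 M \<Longrightarrow> orthv M B Z \<Longrightarrow> orthv M B (\<lambda>\<omega>. c *v Z \<omega>)"
  unfolding matrix_vector_mult_def vec_lambda_beta by (intro allI orth_sum orth_cmult) blast+
lemma orthv_sum: "B \<subseteq> L2 M \<Longrightarrow> (\<And>i. i \<in> I \<Longrightarrow> orthv M B (Z i)) \<Longrightarrow> orthv M B (\<lambda>\<omega>. \<Sum>i\<in>I. Z i \<omega>)"
  unfolding sum_component by (intro allI orth_sum) blast+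
lemma orthv_cong_AE:
  assumes "orthv M B Z" "B \<subseteq> L2 M" "Y \<in> borel_measurable M" "AE \<omega> in M. Z \<omega> = Y \<omega>"
  shows "orthv M B Y"
proof
  fix a show "(\<lambda>\<omega>. Y \<omega> $ a) \<in> orth M B"
  proof (rule orth_cong_AE[OF assms(1)[rule_format, of a] assms(2)])
    show "AE \<omega> in M. Z \<omega> $ a = Y \<omega> $ a" using assms(4) by eventually_elim simp
  qed (rule borel_measurable_vec_nth[OF assms(3)])
qed

lemma is_projv_add: "A \<subseteq> L2 M \<Longrightarrow> is_projv M A Z Z' \<Longrightarrow> is_projv M A Y Y' \<Longrightarrow> is_projv M A (\<lambda>\<omega>. Z \<omega> + Y \<omega>) (\<lambda>\<omega>. Z' \<omega> + Y' \<omega>)"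
  by (auto intro: is_proj_add)
lemma is_projv_diff: "A \<subseteq> L2 M \<Longrightarrow> is_projv M A Z Z' \<Longrightarrow> is_projv M A Y Y' \<Longrightarrow> is_projv M A (\<lambda>\<omega>. Z \<omega> - Y \<omega>) (\<lambda>\<omega>. Z' \<omega> - Y' \<omega>)"
  by (auto intro: is_proj_diff)
lemma is_projv_matvec: "A \<subseteq> L2 M \<Longrightarrow> is_projv M A Z Z' \<Longrightarrow> is_projv M A (\<lambda>\<omega>. c *v Z \<omega>) (\<lambda>\<omega>. c *v Z' \<omega>)"
  unfolding matrix_vector_mult_def vec_lambda_beta by (intro allI is_proj_sum is_proj_cmult) blast+
lemma is_projv_sum: "A \<subseteq> L2 M \<Longrightarrow> (\<And>i. i \<in> I \<Longrightarrow> is_projv M A (Z i) (Z' i)) \<Longrightarrow> is_projv M A (\<lambda>\<omega>. \<Sum>i\<in>I. Z i \<omega>) (\<lambda>\<omega>. \<Sum>i\<in>I. Z' i \<omega>)"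
  unfolding sum_component by (intro allI is_proj_sum) blast+
lemma is_projv_self: "orthv M (orth M A) Z \<Longrightarrow> is_projv M A Z Z"
  by (auto intro: is_proj_self)
lemma is_projv_cong_AE:
  assumes "A \<subseteq> L2 M" "is_projv M A Z Z'" "Y \<in> borel_measurable M" "Y' \<in> borel_measurable M"
    and "AE \<omega> in M. Z \<omega> = Y \<omega>" "AE \<omega> in M. Z' \<omega> = Y' \<omega>"
  shows "is_projv M A Y Y'"
proof
  fix a show "is_proj M A (\<lambda>\<omega>. Y \<omega> $ a) (\<lambda>\<omega>. Y' \<omega> $ a)"
  proof (rule is_proj_cong_AE[OF assms(1) assms(2)[rule_format, of a]])
    show "AE \<omega> in M. Z \<omega> $ a = Y \<omega> $ a" using assms(5) by eventually_elim simp
    show "AE \<omega> in M. Z' \<omega> $ a = Y' \<omega> $ a" using assms(6) by eventually_elim simp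
  qed (rule borel_measurable_vec_nth[OF assms(3)] borel_measurable_vec_nth[OF assms(4)])+
qed

lemma is_projv_contraction:
  assumes "is_projv M A Z Z'"
  shows "(\<integral>\<^sup>+\<omega>. ennreal ((norm (Z' \<omega>))\<^sup>2) \<partial>M) \<le> (\<integral>\<^sup>+\<omega>. ennreal ((norm (Z \<omega>))\<^sup>2) \<partial>M)"
  unfolding nn_norm_vec_sq[OF is_projv_meas(1)[OF assms]] nn_norm_vec_sq[OF is_projv_meas(2)[OF assms]]
  by (intro sum_mono is_proj_contraction_nn[OF assms[rule_format]])

section \<open>Step functions and stochastic integrals\<close>


abbreviation step_fun :: "nat \<Rightarrow> (nat \<Rightarrow> real) \<Rightarrow> (nat \<Rightarrow> 'b::real_vector) \<Rightarrow> real \<Rightarrow> 'b" where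
  "step_fun N p c u \<equiv> (\<Sum>j<N. indicator {p j<..p (Suc j)} u *\<^sub>R c j)"

text \<open>The mean-square closure of the continuous functions on \<open>[a, b]\<close>. It is
  closed under sums and limits and contains the indicators, hence by way of simple functions
  everything square integrable.\<close>

definition cont_approx :: "real \<Rightarrow> real \<Rightarrow> (real \<Rightarrow> 'b::euclidean_space) \<Rightarrow> bool" where
  "cont_approx a b f \<longleftrightarrow> f \<in> borel_measurable borel \<and>
     (\<forall>e>0. \<exists>g. continuous_on UNIV g \<and>
        (\<integral>\<^sup>+u\<in>{a..b}. ennreal ((norm (f u - g u))\<^sup>2) \<partial>lborel) \<le> ennreal e)"

lemma norm_sq_diff_le: "(norm (x - z))\<^sup>2 \<le> 2 * (norm (x - y))\<^sup>2 + 2 * (norm (y - z :: 'b::real_normed_vector))\<^sup>2"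
proof -
  have "norm (x - z) \<le> norm (x - y) + norm (y - z)" using norm_triangle_ineq[of "x - y" "y - z"] by simp
  then have "(norm (x - z))\<^sup>2 \<le> (norm (x - y) + norm (y - z))\<^sup>2" by (simp add: power_mono)
  also have "\<dots> \<le> 2 * (norm (x - y))\<^sup>2 + 2 * (norm (y - z))\<^sup>2"
    using sum_squares_bound[of "norm (x - y)" "norm (y - z)"] by (simp add: power2_sum)
  finally show ?thesis .
qed

lemma nn_sq_diff_le:
  fixes f g h :: "'a \<Rightarrow> 'b::euclidean_space"
  assumes [measurable]: "f \<in> borel_measurable M" "g \<in> borel_measurable M" "h \<in> borel_measurable M"
    and [measurable]: "A \<in> sets M"
  shows "(\<integral>\<^sup>+u\<in>A. ennreal ((norm (f u - h u))\<^sup>2) \<partial>M) \<le>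
    2 * (\<integral>\<^sup>+u\<in>A. ennreal ((norm (f u - g u))\<^sup>2) \<partial>M) + 2 * (\<integral>\<^sup>+u\<in>A. ennreal ((norm (g u - h u))\<^sup>2) \<partial>M)"
proof -
  have "(\<integral>\<^sup>+u\<in>A. ennreal ((norm (f u - h u))\<^sup>2) \<partial>M) \<le>
     (\<integral>\<^sup>+u. 2 * (ennreal ((norm (f u - g u))\<^sup>2) * indicator A u) + 2 * (ennreal ((norm (g u - h u))\<^sup>2) * indicator A u) \<partial>M)"
  proof (rule nn_integral_mono)
    fix u
    have "ennreal ((norm (f u - h u))\<^sup>2) \<le> ennreal (2 * (norm (f u - g u))\<^sup>2 + 2 * (norm (g u - h u))\<^sup>2)"
      by (intro ennreal_leI norm_sq_diff_le)
    also have "\<dots> = 2 * ennreal ((norm (f u - g u))\<^sup>2) + 2 * ennreal ((norm (g u - h u))\<^sup>2)"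
      by (simp add: ennreal_plus ennreal_mult)
    finally show "ennreal ((norm (f u - h u))\<^sup>2) * indicator A u \<le>
      2 * (ennreal ((norm (f u - g u))\<^sup>2) * indicator A u) + 2 * (ennreal ((norm (g u - h u))\<^sup>2) * indicator A u)"
      by (simp add: indicator_def)
  qed
  also have "\<dots> = 2 * (\<integral>\<^sup>+u\<in>A. ennreal ((norm (f u - g u))\<^sup>2) \<partial>M) + 2 * (\<integral>\<^sup>+u\<in>A. ennreal ((norm (g u - h u))\<^sup>2) \<partial>M)"
    by (subst nn_integral_add) (auto simp: nn_integral_cmult)
  finally show ?thesis .
qed

text \<open>Closes the estimates made with \<open>nn_sq_diff_le\<close>: two errors of
  \<open>e / 4\<close>, each doubled.\<close>

lemma twice_quarters_le: "e > 0 \<Longrightarrow> x \<le> ennreal (e / 4) \<Longrightarrow> y \<le> ennreal (e / 4) \<Longrightarrow> 2 * x + 2 * y \<le> ennreal e"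
proof -
  assume e: "e > 0" "x \<le> ennreal (e / 4)" "y \<le> ennreal (e / 4)"
  have "2 * x + 2 * y \<le> 2 * ennreal (e / 4) + 2 * ennreal (e / 4)"
    using e by (intro add_mono mult_left_mono) auto
  also have "2 * ennreal (e / 4) = ennreal (2 * (e / 4))"
    using e(1) ennreal_mult[of 2 "e / 4"] by simp
  also have "ennreal (2 * (e / 4)) + ennreal (2 * (e / 4)) = ennreal (2 * (e / 4) + 2 * (e / 4))"
    using e(1) by (intro ennreal_plus[symmetric]) auto
  finally show ?thesis by simp
qed

lemma cont_approx_limit:
  assumes [measurable]: "f \<in> borel_measurable borel"
    and "\<And>e. e > 0 \<Longrightarrow> \<exists>s. cont_approx a b s \<and> (\<integral>\<^sup>+u\<in>{a..b}. ennreal ((norm (f u - s u))\<^sup>2) \<partial>lborel) \<le> ennreal e"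
  shows "cont_approx a b f"
  unfolding cont_approx_def
proof (intro conjI allI impI)
  fix e :: real assume e: "e > 0"
  obtain s where s: "cont_approx a b s" "(\<integral>\<^sup>+u\<in>{a..b}. ennreal ((norm (f u - s u))\<^sup>2) \<partial>lborel) \<le> ennreal (e / 4)"
    using assms(2)[of "e / 4"] e by auto
  obtain g where g: "continuous_on UNIV g" "(\<integral>\<^sup>+u\<in>{a..b}. ennreal ((norm (s u - g u))\<^sup>2) \<partial>lborel) \<le> ennreal (e / 4)"
    using s(1) e unfolding cont_approx_def by (meson divide_pos_pos zero_less_numeral)
  have [measurable]: "s \<in> borel_measurable borel" "g \<in> borel_measurable borel"
    using s(1) g(1) by (auto simp: cont_approx_def borel_measurable_continuous_onI)
  have "(\<integral>\<^sup>+u\<in>{a..b}. ennreal ((norm (f u - g u))\<^sup>2) \<partial>lborel) \<le> ennreal e"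
    by (rule order_trans[OF nn_sq_diff_le twice_quarters_le[OF e s(2) g(2)]]) auto
  then show "\<exists>g. continuous_on UNIV g \<and> (\<integral>\<^sup>+u\<in>{a..b}. ennreal ((norm (f u - g u))\<^sup>2) \<partial>lborel) \<le> ennreal e"
    using g(1) by auto
qed fact

lemma cont_approx_add:
  assumes "cont_approx a b f" "cont_approx a b h" shows "cont_approx a b (\<lambda>u. f u + h u)"
  unfolding cont_approx_def
proof (intro conjI allI impI)
  have [measurable]: "f \<in> borel_measurable borel" "h \<in> borel_measurable borel"
    using assms by (auto simp: cont_approx_def)
  show "(\<lambda>u. f u + h u) \<in> borel_measurable borel" by simp
  fix e :: real assume e: "e > 0"
  then have e4: "e / 4 > 0" by simp
  obtain g where g: "continuous_on UNIV g" "(\<integral>\<^sup>+u\<in>{a..b}. ennreal ((norm (f u - g u))\<^sup>2) \<partial>lborel) \<le> ennreal (e / 4)"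
    using assms(1) e4 unfolding cont_approx_def by meson
  obtain k where k: "continuous_on UNIV k" "(\<integral>\<^sup>+u\<in>{a..b}. ennreal ((norm (h u - k u))\<^sup>2) \<partial>lborel) \<le> ennreal (e / 4)"
    using assms(2) e4 unfolding cont_approx_def by meson
  have [measurable]: "g \<in> borel_measurable borel" "k \<in> borel_measurable borel"
    using k(1) g(1) by (auto simp: borel_measurable_continuous_onI)
  have "(\<integral>\<^sup>+u\<in>{a..b}. ennreal ((norm (f u + h u - (g u + k u)))\<^sup>2) \<partial>lborel) \<le>
     2 * (\<integral>\<^sup>+u\<in>{a..b}. ennreal ((norm (f u + h u - (g u + h u)))\<^sup>2) \<partial>lborel) + 2 * (\<integral>\<^sup>+u\<in>{a..b}. ennreal ((norm (g u + h u - (g u + k u)))\<^sup>2) \<partial>lborel)"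
    by (rule nn_sq_diff_le) auto
  also have "\<dots> \<le> ennreal e"
    using twice_quarters_le[OF e g(2) k(2)] by simp
  finally show "\<exists>g. continuous_on UNIV g \<and> (\<integral>\<^sup>+u\<in>{a..b}. ennreal ((norm (f u + h u - g u))\<^sup>2) \<partial>lborel) \<le> ennreal e"
    using g(1) k(1) by (intro exI[of _ "\<lambda>u. g u + k u"]) (auto intro: continuous_intros)
qed

lemma cont_approx_zero: "cont_approx a b (\<lambda>u. 0)"
  unfolding cont_approx_def by (auto intro!: exI[of _ "\<lambda>u. 0"])

lemma cont_approx_sum:
  "(\<And>i. i \<in> I \<Longrightarrow> cont_approx a b (f i)) \<Longrightarrow> cont_approx a b (\<lambda>u. \<Sum>i\<in>I. f i u)"
  by (induction I rule: infinite_finite_induct) (auto intro!: cont_approx_add cont_approx_zero)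

text \<open>Outer regularity, applied to \<open>A\<close> and to its complement, encloses
  \<open>A\<close> between the closed set \<open>- V\<close> and the open set \<open>U\<close>. A
  Urysohn function between them differs from the indicator only on \<open>U - A\<close> and
  \<open>V - (- A)\<close>, two sets of small measure.\<close>

lemma cont_approx_indicator:
  fixes v :: "'b::euclidean_space"
  assumes A[measurable]: "A \<in> sets borel"
  shows "cont_approx a b (\<lambda>u::real. indicator A u *\<^sub>R v)"
  unfolding cont_approx_def
proof (intro conjI allI impI)
  fix e :: real assume e: "e > 0"
  \<comment> \<open>The error is at most the squared norm of \<open>v\<close> times the measure of
    two sets, each below \<open>d\<close>; the added 1 allows \<open>v = 0\<close>.\<close>
  define d where "d = e / (2 * ((norm v)\<^sup>2 + 1))"
  have d: "d > 0" using e by (simp add: d_def add_nonneg_pos)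
  obtain U where U: "open U" "A \<subseteq> U" "emeasure lborel (U - A) < d"
    using outer_regular_lborel[OF A d] by auto
  obtain V where V: "open V" "- A \<subseteq> V" "emeasure lborel (V - (- A)) < d"
    using outer_regular_lborel[of "- A" d] d A by auto
  have disj: "- V \<inter> - U = {}" using U(2) V(2) by auto
  obtain h :: "real \<Rightarrow> real" where h: "continuous_on UNIV h" "\<And>x. h x \<in> closed_segment 1 0"
      "\<And>x. x \<in> - V \<Longrightarrow> h x = 1" "\<And>x. x \<in> - U \<Longrightarrow> h x = 0"
    using Urysohn[of "- V" "- U" "1::real" 0] U(1) V(1) disj by auto
  have h01: "0 \<le> h x" "h x \<le> 1" for x using h(2)[of x] by (auto simp: closed_segment_eq_real_ivl)
  have [measurable]: "h \<in> borel_measurable borel" using h(1) by (rule borel_measurable_continuous_onI)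
  have [measurable]: "U \<in> sets borel" "V \<in> sets borel" using U V by auto
  have pt: "(norm (indicator A u *\<^sub>R v - h u *\<^sub>R v))\<^sup>2 \<le> (norm v)\<^sup>2 * (indicator (U - A) u + indicator (V - (- A)) u)" for u
  proof -
    have "(norm (indicator A u *\<^sub>R v - h u *\<^sub>R v))\<^sup>2 = (indicator A u - h u)\<^sup>2 * (norm v)\<^sup>2"
      by (simp add: scaleR_diff_left[symmetric] power_mult_distrib)
    also have "\<dots> \<le> (indicator (U - A) u + indicator (V - (- A)) u) * (norm v)\<^sup>2"
    proof (rule mult_right_mono)
      show "(indicator A u - h u)\<^sup>2 \<le> indicator (U - A) u + indicator (V - (- A)) u"
        using h(3)[of u] h(4)[of u] h01[of u] U(2) V(2)
        by (auto simp: indicator_def power_le_one split: if_splits)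
    qed simp
    finally show ?thesis by (simp add: mult.commute)
  qed
  have "(\<integral>\<^sup>+u\<in>{a..b}. ennreal ((norm (indicator A u *\<^sub>R v - h u *\<^sub>R v))\<^sup>2) \<partial>lborel)
      \<le> (\<integral>\<^sup>+u. ennreal ((norm v)\<^sup>2) * (indicator (U - A) u + indicator (V - (- A)) u) \<partial>lborel)"
  proof (rule nn_integral_mono)
    fix u :: real
    have "ennreal ((norm (indicator A u *\<^sub>R v - h u *\<^sub>R v))\<^sup>2) * indicator {a..b} u
      \<le> ennreal ((norm (indicator A u *\<^sub>R v - h u *\<^sub>R v))\<^sup>2)" by (simp add: indicator_def)
    also have "\<dots> \<le> ennreal ((norm v)\<^sup>2 * (indicator (U - A) u + indicator (V - (- A)) u))"
      by (rule ennreal_leI[OF pt])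
    also have "\<dots> = ennreal ((norm v)\<^sup>2) * (indicator (U - A) u + indicator (V - (- A)) u)"
      by (auto simp: indicator_def ennreal_mult)
    finally show "ennreal ((norm (indicator A u *\<^sub>R v - h u *\<^sub>R v))\<^sup>2) * indicator {a..b} u \<le> \<dots>" .
  qed
  also have "\<dots> = ennreal ((norm v)\<^sup>2) * (emeasure lborel (U - A) + emeasure lborel (V - (- A)))"
    by (simp add: nn_integral_cmult nn_integral_add)
  also have "\<dots> \<le> ennreal ((norm v)\<^sup>2) * (ennreal d + ennreal d)"
    using U(3) V(3) by (intro mult_left_mono add_mono) auto
  also have "\<dots> = ennreal ((norm v)\<^sup>2 * (2 * d))"
    using d by (simp add: ennreal_mult ennreal_plus[symmetric] del: ennreal_plus)
  also have "\<dots> \<le> ennreal e"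
  proof (rule ennreal_leI)
    have "(norm v)\<^sup>2 * (2 * d) \<le> ((norm v)\<^sup>2 + 1) * (2 * d)" using d by (intro mult_right_mono) auto
    also have "\<dots> = e" unfolding d_def using add_nonneg_pos[of "(norm v)\<^sup>2" 1] by (simp add: field_simps)
    finally show "(norm v)\<^sup>2 * (2 * d) \<le> e" .
  qed
  finally show "\<exists>g. continuous_on UNIV g \<and>
      (\<integral>\<^sup>+u\<in>{a..b}. ennreal ((norm (indicator A u *\<^sub>R v - g u))\<^sup>2) \<partial>lborel) \<le> ennreal e"
    using h(1) by (intro exI[of _ "\<lambda>u. h u *\<^sub>R v"]) (auto intro!: continuous_intros)
qed simp

lemma cont_approx_simple:
  assumes "simple_function borel s"
  shows "cont_approx a b (s :: real \<Rightarrow> 'b::euclidean_space)"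
proof -
  have fin: "finite (s ` UNIV)" using assms by (simp add: simple_function_def)
  have "(\<Sum>y\<in>s ` UNIV. indicator (s -` {y}) u *\<^sub>R y) = s u" for u
  proof -
    have "(\<Sum>y\<in>s ` UNIV. indicator (s -` {y}) u *\<^sub>R y) = (\<Sum>y\<in>{s u}. indicator (s -` {y}) u *\<^sub>R y)"
      using fin by (intro sum.mono_neutral_right) (auto simp: indicator_def)
    then show ?thesis by simp
  qed
  then have eq: "(\<lambda>u. \<Sum>y\<in>s ` UNIV. indicator (s -` {y}) u *\<^sub>R y) = s" by (rule ext)
  have "cont_approx a b (\<lambda>u. \<Sum>y\<in>s ` UNIV. indicator (s -` {y}) u *\<^sub>R y)"
  proof (intro cont_approx_sum cont_approx_indicator)
    fix y assume "y \<in> s ` UNIV"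
    then show "s -` {y} \<in> sets borel" using simple_functionD(2)[OF assms, of "{y}"] by simp
  qed
  then show ?thesis by (subst (asm) eq)
qed

lemma cont_approx_L2:
  fixes f :: "real \<Rightarrow> 'b::euclidean_space"
  assumes f[measurable]: "f \<in> borel_measurable borel" and fin: "(\<integral>\<^sup>+u\<in>{a..b}. ennreal ((norm (f u))\<^sup>2) \<partial>lborel) < \<infinity>"
  shows "cont_approx a b f"
proof (rule cont_approx_limit[OF f])
  fix e :: real assume e: "e > 0"
  obtain s where s: "\<And>i. simple_function borel (s i)" "\<And>x. (\<lambda>i. s i x) \<longlonglongrightarrow> f x"
      "\<And>i x. dist (s i x) 0 \<le> 2 * dist (f x) 0"
    using borel_measurable_implies_sequence_metric[OF f, of 0] by auto
  have [measurable]: "s i \<in> borel_measurable borel" for i using s(1) by (rule borel_measurable_simple_function)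
  have "(\<lambda>i. \<integral>\<^sup>+u\<in>{a..b}. ennreal ((norm (f u - s i u))\<^sup>2) \<partial>lborel) \<longlonglongrightarrow> (\<integral>\<^sup>+(u::real). 0 \<partial>lborel)"
  proof (rule nn_integral_dominated_convergence[where w="\<lambda>u. 9 * (ennreal ((norm (f u))\<^sup>2) * indicator {a..b} u)" and u'="\<lambda>_. 0"])
    \<comment> \<open>The simple functions satisfy \<open>norm (s i u) \<le> 2 * norm (f u)\<close>,
      so the error is at most \<open>3 * norm (f u)\<close>; squaring gives the 9.\<close>
    show "AE u in lborel. ennreal ((norm (f u - s i u))\<^sup>2) * indicator {a..b} u \<le> 9 * (ennreal ((norm (f u))\<^sup>2) * indicator {a..b} u)" for i
    proof (rule AE_I2)
      fix u :: real
      have "norm (f u - s i u) \<le> 3 * norm (f u)"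
        using s(3)[of i u] norm_triangle_ineq4[of "f u" "s i u"] by simp
      then have "(norm (f u - s i u))\<^sup>2 \<le> (3 * norm (f u))\<^sup>2" by (intro power_mono) auto
      then have "ennreal ((norm (f u - s i u))\<^sup>2) \<le> ennreal (9 * (norm (f u))\<^sup>2)"
        by (intro ennreal_leI) (simp add: power_mult_distrib)
      then show "ennreal ((norm (f u - s i u))\<^sup>2) * indicator {a..b} u \<le> 9 * (ennreal ((norm (f u))\<^sup>2) * indicator {a..b} u)"
        by (simp add: indicator_def ennreal_mult)
    qed
    show "(\<integral>\<^sup>+u. 9 * (ennreal ((norm (f u))\<^sup>2) * indicator {a..b} u) \<partial>lborel) < \<infinity>"
      using fin by (subst nn_integral_cmult) (auto simp: ennreal_mult_less_top)
    show "AE u in lborel. (\<lambda>i. ennreal ((norm (f u - s i u))\<^sup>2) * indicator {a..b} u) \<longlonglongrightarrow> 0"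
    proof (rule AE_I2)
      fix u :: real
      have "(\<lambda>i. (norm (f u - s i u))\<^sup>2) \<longlonglongrightarrow> (norm (f u - f u))\<^sup>2"
        by (intro tendsto_intros s(2))
      then have "(\<lambda>i. ennreal ((norm (f u - s i u))\<^sup>2)) \<longlonglongrightarrow> ennreal 0"
        by (intro tendsto_ennrealI) simp
      then show "(\<lambda>i. ennreal ((norm (f u - s i u))\<^sup>2) * indicator {a..b} u) \<longlonglongrightarrow> 0"
        by (simp add: indicator_def)
    qed
  qed auto
  then have lim: "(\<lambda>i. \<integral>\<^sup>+u\<in>{a..b}. ennreal ((norm (f u - s i u))\<^sup>2) \<partial>lborel) \<longlonglongrightarrow> 0" by simp
  have "\<forall>\<^sub>F i in sequentially. (\<integral>\<^sup>+u\<in>{a..b}. ennreal ((norm (f u - s i u))\<^sup>2) \<partial>lborel) < ennreal e"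
    by (rule order_tendstoD(2)[OF lim]) (use e in simp)
  then obtain i where "(\<integral>\<^sup>+u\<in>{a..b}. ennreal ((norm (f u - s i u))\<^sup>2) \<partial>lborel) < ennreal e"
    using eventually_happens'[OF sequentially_bot] by blast
  then show "\<exists>s. cont_approx a b s \<and> (\<integral>\<^sup>+u\<in>{a..b}. ennreal ((norm (f u - s u))\<^sup>2) \<partial>lborel) \<le> ennreal e"
    using cont_approx_simple[OF s(1)] less_imp_le by blast
qed

text \<open>The nodes may coincide, so cells can be empty; being open on the left and closed on the
  right, different cells are disjoint all the same, and exactly one term survives.\<close>

lemma step_value:
  fixes p :: "nat \<Rightarrow> real" and c :: "nat \<Rightarrow> 'b::real_vector"
  assumes "mono_on {..N} p" "j < N" "p j < u" "u \<le> p (Suc j)"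
  shows "step_fun N p c u = c j"
proof -
  have "step_fun N p c u = (\<Sum>k\<in>{j}. indicator {p k<..p (Suc k)} u *\<^sub>R c k)"
  proof (rule sum.mono_neutral_right)
    show "\<forall>k\<in>{..<N} - {j}. indicator {p k<..p (Suc k)} u *\<^sub>R c k = 0"
    proof
      fix k assume k: "k \<in> {..<N} - {j}"
      then consider "Suc k \<le> j" | "Suc j \<le> k" by fastforce
      then have "u \<notin> {p k<..p (Suc k)}"
      proof cases
        case 1 then have "p (Suc k) \<le> p j" using assms k by (intro mono_onD[OF assms(1)]) auto
        then show ?thesis using assms by auto
      next
        case 2 then have "p (Suc j) \<le> p k" using assms k by (intro mono_onD[OF assms(1)]) auto
        then show ?thesis using assms by auto
      qed
      then show "indicator {p k<..p (Suc k)} u *\<^sub>R c k = 0" by simp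
    qed
  qed (use assms in auto)
  then show ?thesis using assms by simp
qed

lemma step_index: "(p :: nat \<Rightarrow> real) 0 < u \<Longrightarrow> u \<le> p N \<Longrightarrow> \<exists>j<N. p j < u \<and> u \<le> p (Suc j)"
proof (induction N)
  case (Suc N)
  then show ?case by (cases "u \<le> p N") (auto intro: less_SucI)
qed simp

text \<open>This gives content to \<open>has_stoch_integral\<close>, which constrains
  \<open>R\<close> only through step functions close to \<open>F\<close>: there always are some. A
  continuous approximant is sampled on a uniform partition fine enough for its uniform
  continuity.\<close>

lemma step_dense:
  fixes F :: "real \<Rightarrow> 'b::euclidean_space"
  assumes ab: "a \<le> b" and F: "set_borel_measurable lborel {a..b} F"
    and fin: "(\<integral>\<^sup>+u\<in>{a..b}. ennreal ((norm (F u))\<^sup>2) \<partial>lborel) < \<infinity>" and d: "\<delta> > 0"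
  shows "\<exists>(N::nat) p c. p 0 = a \<and> p N = b \<and> mono_on {..N} p \<and>
    (\<integral>\<^sup>+u\<in>{a..b}. ennreal ((norm (F u - step_fun N p c u))\<^sup>2) \<partial>lborel) < ennreal \<delta>"
proof -
  define f where "f u = indicator {a..b} u *\<^sub>R F u" for u
  have f[measurable]: "f \<in> borel_measurable borel"
    using F by (simp add: f_def[abs_def] set_borel_measurable_def)
  have "(\<integral>\<^sup>+u\<in>{a..b}. ennreal ((norm (f u))\<^sup>2) \<partial>lborel) = (\<integral>\<^sup>+u\<in>{a..b}. ennreal ((norm (F u))\<^sup>2) \<partial>lborel)"
    by (intro nn_integral_cong) (auto simp: f_def indicator_def)
  then have "cont_approx a b f" using fin by (intro cont_approx_L2[OF f]) simp
  then obtain g where g: "continuous_on UNIV g"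
      "(\<integral>\<^sup>+u\<in>{a..b}. ennreal ((norm (f u - g u))\<^sup>2) \<partial>lborel) \<le> ennreal ((\<delta>/2) / 4)"
    using d unfolding cont_approx_def by (meson divide_pos_pos zero_less_numeral)
  have [measurable]: "g \<in> borel_measurable borel" using g(1) by (rule borel_measurable_continuous_onI)
  \<comment> \<open>Makes \<open>\<eta>\<^sup>2 * (b - a + 1)\<close> equal to the second quarter;
    the added 1 covers \<open>a = b\<close>.\<close>
  define \<eta> where "\<eta> = sqrt ((\<delta>/2) / 4 / (b - a + 1))"
  have eta: "\<eta> > 0" using ab d by (simp add: \<eta>_def)
  have "uniformly_continuous_on {a..b} g"
    using g(1) by (intro compact_uniformly_continuous) (auto intro: continuous_on_subset)
  then obtain r where r: "r > 0" "\<And>x y. x \<in> {a..b} \<Longrightarrow> y \<in> {a..b} \<Longrightarrow> dist y x < r \<Longrightarrow> dist (g y) (g x) < \<eta>"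
    using eta unfolding uniformly_continuous_on_def by meson
  obtain N :: nat where N: "(b - a) / r < N" using reals_Archimedean2 by blast
  then have N0: "N > 0" using ab r(1) by (metis divide_nonneg_pos diff_ge_0_iff_ge gr0I of_nat_0 not_le)
  define p where "p j = a + (b - a) * real j / real N" for j :: nat
  have p0: "p 0 = a" "p N = b" using N0 by (auto simp: p_def)
  have pm: "mono_on {..N} p"
    using ab N0 by (intro mono_onI) (auto simp: p_def intro!: divide_right_mono mult_left_mono)
  have gap: "p (Suc j) - p j < r" for j
  proof -
    have "p (Suc j) - p j = (b - a) / real N"
      by (simp add: p_def ring_distribs add_divide_distrib)
    also have "\<dots> < r" using N N0 r(1) by (simp add: pos_divide_less_eq mult.commute)
    finally show ?thesis .
  qed
  define c where "c j = g (p (Suc j))" for j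
  define q where "q u = step_fun N p c u" for u
  have [measurable]: "q \<in> borel_measurable borel" unfolding q_def[abs_def] by measurable
  have close: "(norm (g u - q u))\<^sup>2 \<le> \<eta>\<^sup>2" if u: "u \<in> {a<..b}" for u
  proof -
    obtain j where j: "j < N" "p j < u" "u \<le> p (Suc j)" using step_index[of p u N] u p0 by auto
    have "q u = g (p (Suc j))" unfolding q_def using step_value[OF pm j] by (simp add: c_def)
    moreover have "p (Suc j) \<le> p N" using j(1) by (intro mono_onD[OF pm]) auto
    then have "dist (g (p (Suc j))) (g u) < \<eta>"
      using u j gap[of j] p0 by (intro r(2)) (auto simp: dist_real_def)
    ultimately have "norm (g u - q u) \<le> \<eta>" by (simp add: dist_norm norm_minus_commute)
    then show ?thesis by (intro power_mono) auto
  qed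
  have "(\<integral>\<^sup>+u\<in>{a..b}. ennreal ((norm (g u - q u))\<^sup>2) \<partial>lborel) \<le> (\<integral>\<^sup>+u. ennreal (\<eta>\<^sup>2) * indicator {a..b} u \<partial>lborel)"
  proof (rule nn_integral_mono_AE)
    \<comment> \<open>The left end point \<open>a\<close> belongs to no cell, so the step function
      need not be close to \<open>g\<close> there.\<close>
    show "AE u in lborel. ennreal ((norm (g u - q u))\<^sup>2) * indicator {a..b} u \<le> ennreal (\<eta>\<^sup>2) * indicator {a..b} u"
      using AE_lborel_singleton[of a]
      by eventually_elim (use close in \<open>auto simp: indicator_def intro!: ennreal_leI\<close>)
  qed
  also have "\<dots> = ennreal (\<eta>\<^sup>2 * (b - a))"
    using ab by (simp add: nn_integral_cmult_indicator ennreal_mult)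
  also have "\<dots> \<le> ennreal ((\<delta>/2) / 4)"
  proof (rule ennreal_leI)
    have "\<eta>\<^sup>2 * (b - a) \<le> \<eta>\<^sup>2 * (b - a + 1)" by (intro mult_left_mono) auto
    also have "\<dots> = (\<delta>/2) / 4" using ab d by (simp add: \<eta>_def field_simps)
    finally show "\<eta>\<^sup>2 * (b - a) \<le> (\<delta>/2) / 4" .
  qed
  finally have gq: "(\<integral>\<^sup>+u\<in>{a..b}. ennreal ((norm (g u - q u))\<^sup>2) \<partial>lborel) \<le> ennreal ((\<delta>/2) / 4)" .
  have "(\<integral>\<^sup>+u\<in>{a..b}. ennreal ((norm (F u - q u))\<^sup>2) \<partial>lborel) = (\<integral>\<^sup>+u\<in>{a..b}. ennreal ((norm (f u - q u))\<^sup>2) \<partial>lborel)"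
    by (intro nn_integral_cong) (auto simp: f_def indicator_def)
  also have "\<dots> \<le> 2 * (\<integral>\<^sup>+u\<in>{a..b}. ennreal ((norm (f u - g u))\<^sup>2) \<partial>lborel) + 2 * (\<integral>\<^sup>+u\<in>{a..b}. ennreal ((norm (g u - q u))\<^sup>2) \<partial>lborel)"
    by (rule nn_sq_diff_le) auto
  also have "\<dots> \<le> ennreal (\<delta>/2)" using d by (intro twice_quarters_le g(2) gq) auto
  also have "\<dots> < ennreal \<delta>" using d by (intro ennreal_lessI) auto
  finally show ?thesis using p0 pm unfolding q_def by blast
qed


section \<open>Stochastic integrals under mean-square limits and projections\<close>

abbreviation elem_sum :: "nat \<Rightarrow> (nat \<Rightarrow> real) \<Rightarrow> (nat \<Rightarrow> real^'m^'k) \<Rightarrow> (real \<Rightarrow> 'w \<Rightarrow> real^'m) \<Rightarrow> 'w \<Rightarrow> real^'k" where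
  "elem_sum N p c Z \<omega> \<equiv> (\<Sum>j<N. c j *v (Z (p (Suc j)) \<omega> - Z (p j) \<omega>))"

lemma node_in:
  fixes p :: "nat \<Rightarrow> real"
  assumes "p 0 = a" "p N = b" "mono_on {..N} p" "j \<le> N"
  shows "p j \<in> {a..b}"
  using mono_onD[OF assms(3), of 0 j] mono_onD[OF assms(3), of j N] assms by auto

lemma stoch_integral_approx:
  assumes h: "has_stoch_integral M Z F a b R" and ab: "a \<le> b" and e: "e > 0"
  shows "\<exists>(N::nat) p c. p 0 = a \<and> p N = b \<and> mono_on {..N} p \<and>
    (\<integral>\<^sup>+\<omega>. ennreal ((norm (R \<omega> - elem_sum N p c Z \<omega>))\<^sup>2) \<partial>M) < ennreal e"
proof -
  obtain d where d: "d > 0" and *: "\<And>(N::nat) p c. p 0 = a \<and> p N = b \<and> mono_on {..N} p \<and>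
        (\<integral>\<^sup>+u\<in>{a..b}. ennreal ((norm (F u - step_fun N p c u))\<^sup>2) \<partial>lborel)
           < ennreal d \<Longrightarrow>
        (\<integral>\<^sup>+\<omega>. ennreal ((norm (R \<omega> - elem_sum N p c Z \<omega>))\<^sup>2) \<partial>M) < ennreal e"
    using h e unfolding has_stoch_integral_def by meson
  show ?thesis
    using step_dense[OF ab _ _ d, of F] * h unfolding has_stoch_integral_def by meson
qed

lemma elem_sum_meas:
  fixes p :: "nat \<Rightarrow> real"
  assumes "p 0 = a" "p N = b" "mono_on {..N} p" "\<And>u. u \<in> {a..b} \<Longrightarrow> Z u \<in> borel_measurable M"
  shows "elem_sum N p c Z \<in> borel_measurable M"
proof (rule borel_measurable_sum)
  fix j assume "j \<in> {..<N}"
  then have [measurable]: "Z (p (Suc j)) \<in> borel_measurable M" "Z (p j) \<in> borel_measurable M"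
    using node_in[OF assms(1-3)] by (auto intro!: assms(4))
  have "(*v) (c j) \<in> borel_measurable borel"
    by (intro borel_measurable_continuous_onI matrix_vector_mult_linear_continuous_on)
  then show "(\<lambda>\<omega>. c j *v (Z (p (Suc j)) \<omega> - Z (p j) \<omega>)) \<in> borel_measurable M"
    by (rule measurable_compose[rotated]) simp
qed

text \<open>Elementary sums of integrators in an annihilator remain in it, and annihilators are
  closed. With \<open>B = orth M gens\<close> this puts integrals into the span of the noise, with
  \<open>B = orth M (indicators K)\<close> it makes them measurable up to null sets, and with
  \<open>B = {}\<close> it gives square integrability.\<close>

lemma stoch_integral_orth:
  assumes h: "has_stoch_integral M Z F a b R" and ab: "a \<le> b"
    and B: "B \<subseteq> L2 M" and Z: "\<And>u. u \<in> {a..b} \<Longrightarrow> orthv M B (Z u)"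
  shows "orthv M B R"
proof
  fix k
  have Rm: "R \<in> borel_measurable M" using h by (simp add: has_stoch_integral_def)
  show "(\<lambda>\<omega>. R \<omega> $ k) \<in> orth M B"
  proof (rule orth_limit[OF B borel_measurable_vec_nth[OF Rm]])
    fix e :: real assume "e > 0"
    then obtain N :: nat and p c where p: "p 0 = a" "p N = b" "mono_on {..N} p"
      and *: "(\<integral>\<^sup>+\<omega>. ennreal ((norm (R \<omega> - elem_sum N p c Z \<omega>))\<^sup>2) \<partial>M) < ennreal e"
      using stoch_integral_approx[OF h ab] by meson
    have "orthv M B (elem_sum N p c Z)"
      using node_in[OF p] by (intro orthv_sum orthv_matvec orthv_diff B Z) auto
    moreover have "(\<integral>\<^sup>+\<omega>. ennreal ((R \<omega> $ k - elem_sum N p c Z \<omega> $ k)\<^sup>2) \<partial>M) \<le> ennreal e"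
      using nn_norm_vec_component[where Z="\<lambda>\<omega>. R \<omega> - elem_sum N p c Z \<omega>" and a=k and M=M] * by simp
    ultimately show "\<exists>Q\<in>orth M B. (\<integral>\<^sup>+\<omega>. ennreal ((R \<omega> $ k - Q \<omega>)\<^sup>2) \<partial>M) \<le> ennreal e"
      by (intro bexI[of _ "\<lambda>\<omega>. elem_sum N p c Z \<omega> $ k"]) auto
  qed
qed

text \<open>The residual for \<open>Z'\<close> and \<open>R'\<close> is the projection of the
  residual for \<open>Z\<close> and \<open>R\<close> with the same nodes and coefficients.
  Projections contract, so each tolerance keeps its \<open>d\<close>. \<open>A\<close> will be the
  noise when a deviation is projected, and the indicators of an information sigma-algebra when an
  integral is conditioned.\<close>

lemma stoch_integral_proj:
  fixes Z Z' :: "real \<Rightarrow> 'w \<Rightarrow> real^'m" and R R' :: "'w \<Rightarrow> real^'k"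
  assumes h: "has_stoch_integral M Z F a b R" and A: "A \<subseteq> L2 M"
    and Z: "\<And>u. u \<in> {a..b} \<Longrightarrow> is_projv M A (Z u) (Z' u)" and R: "is_projv M A R R'"
  shows "has_stoch_integral M Z' F a b R'"
proof -
  have le: "(\<integral>\<^sup>+\<omega>. ennreal ((norm (R' \<omega> - elem_sum N p c Z' \<omega>))\<^sup>2) \<partial>M)
      \<le> (\<integral>\<^sup>+\<omega>. ennreal ((norm (R \<omega> - elem_sum N p c Z \<omega>))\<^sup>2) \<partial>M)"
    if p: "p 0 = a" "p N = b" "mono_on {..N} p" for N :: nat and p and c :: "nat \<Rightarrow> real^'m^'k"
    using node_in[OF p]
    by (intro is_projv_contraction[where A=A] is_projv_diff[OF A R] is_projv_sum[OF A] is_projv_matvec[OF A] is_projv_diff[OF A] Z) auto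
  have m: "Z' u \<in> borel_measurable M" if "u \<in> {a..b}" for u
    by (rule is_projv_meas(2)[OF Z[OF that]])
  show ?thesis
    unfolding has_stoch_integral_def
  proof (intro conjI allI impI ballI)
    fix e :: real assume "e > 0"
    then obtain d where d: "d > 0" and *: "\<And>(N::nat) p c. p 0 = a \<and> p N = b \<and> mono_on {..N} p \<and>
          (\<integral>\<^sup>+u\<in>{a..b}. ennreal ((norm (F u - step_fun N p c u))\<^sup>2) \<partial>lborel)
             < ennreal d \<Longrightarrow>
          (\<integral>\<^sup>+\<omega>. ennreal ((norm (R \<omega> - elem_sum N p c Z \<omega>))\<^sup>2) \<partial>M) < ennreal e"
      using h unfolding has_stoch_integral_def by meson
    show "\<exists>d>0. \<forall>(N::nat) p c. p 0 = a \<and> p N = b \<and> mono_on {..N} p \<and>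
          (\<integral>\<^sup>+u\<in>{a..b}. ennreal ((norm (F u - step_fun N p c u))\<^sup>2) \<partial>lborel)
             < ennreal d \<longrightarrow>
          (\<integral>\<^sup>+\<omega>. ennreal ((norm (R' \<omega> - elem_sum N p c Z' \<omega>))\<^sup>2) \<partial>M) < ennreal e"
      using d * le_less_trans[OF le] by blast
  qed (use h m is_projv_meas(2)[OF R] in \<open>auto simp: has_stoch_integral_def\<close>)
qed

lemma stoch_integral_modulus:
  assumes "has_stoch_integral M Z F a b R" "e > 0"
  obtains d where "d > 0" "\<And>(N::nat) p c. p 0 = a \<and> p N = b \<and> mono_on {..N} p \<and>
        (\<integral>\<^sup>+u\<in>{a..b}. ennreal ((norm (F u - step_fun N p c u))\<^sup>2) \<partial>lborel)
           < ennreal d \<Longrightarrow>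
        (\<integral>\<^sup>+\<omega>. ennreal ((norm (R \<omega> - elem_sum N p c Z \<omega>))\<^sup>2) \<partial>M) < ennreal e"
  using assms unfolding has_stoch_integral_def by meson

text \<open>A step function close enough to \<open>F\<close> for both moduli has an elementary sum
  close to \<open>R1\<close> and to \<open>R2\<close>.\<close>

lemma stoch_integral_unique:
  assumes h1: "has_stoch_integral M Z F a b R1" and h2: "has_stoch_integral M Z F a b R2" and ab: "a \<le> b"
  shows "AE \<omega> in M. R1 \<omega> = R2 \<omega>"
proof -
  have m[measurable]: "R1 \<in> borel_measurable M" "R2 \<in> borel_measurable M"
    using h1 h2 by (auto simp: has_stoch_integral_def)
  have "(\<integral>\<^sup>+\<omega>. ennreal ((norm (R1 \<omega> - R2 \<omega>))\<^sup>2) \<partial>M) \<le> 0 + ennreal e" if e: "e > 0" for e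
  proof -
    obtain d1 where d1: "d1 > 0" "\<And>(N::nat) p c. p 0 = a \<and> p N = b \<and> mono_on {..N} p \<and>
          (\<integral>\<^sup>+u\<in>{a..b}. ennreal ((norm (F u - step_fun N p c u))\<^sup>2) \<partial>lborel)
             < ennreal d1 \<Longrightarrow>
          (\<integral>\<^sup>+\<omega>. ennreal ((norm (R1 \<omega> - elem_sum N p c Z \<omega>))\<^sup>2) \<partial>M) < ennreal (e/4)"
      by (rule stoch_integral_modulus[OF h1, of "e / 4"]) (use e in auto)
    obtain d2 where d2: "d2 > 0" "\<And>(N::nat) p c. p 0 = a \<and> p N = b \<and> mono_on {..N} p \<and>
          (\<integral>\<^sup>+u\<in>{a..b}. ennreal ((norm (F u - step_fun N p c u))\<^sup>2) \<partial>lborel)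
             < ennreal d2 \<Longrightarrow>
          (\<integral>\<^sup>+\<omega>. ennreal ((norm (R2 \<omega> - elem_sum N p c Z \<omega>))\<^sup>2) \<partial>M) < ennreal (e/4)"
      by (rule stoch_integral_modulus[OF h2, of "e / 4"]) (use e in auto)
    have F: "set_borel_measurable lborel {a..b} F" "(\<integral>\<^sup>+u\<in>{a..b}. ennreal ((norm (F u))\<^sup>2) \<partial>lborel) < \<infinity>"
      using h1 by (auto simp: has_stoch_integral_def)
    obtain N :: nat and p c where p: "p 0 = a" "p N = b" "mono_on {..N} p"
      and s: "(\<integral>\<^sup>+u\<in>{a..b}. ennreal ((norm (F u - step_fun N p c u))\<^sup>2) \<partial>lborel)
             < ennreal (min d1 d2)"
      using step_dense[OF ab F, of "min d1 d2"] d1(1) d2(1) by (meson min_less_iff_conj)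
    have s12: "(\<integral>\<^sup>+u\<in>{a..b}. ennreal ((norm (F u - step_fun N p c u))\<^sup>2) \<partial>lborel) < ennreal d1"
        "(\<integral>\<^sup>+u\<in>{a..b}. ennreal ((norm (F u - step_fun N p c u))\<^sup>2) \<partial>lborel) < ennreal d2"
      by (rule less_le_trans[OF s], rule ennreal_leI, simp)+
    have Q: "elem_sum N p c Z \<in> borel_measurable M"
      using h1 by (intro elem_sum_meas[OF p]) (auto simp: has_stoch_integral_def)
    have r: "(\<integral>\<^sup>+\<omega>. ennreal ((norm (R1 \<omega> - elem_sum N p c Z \<omega>))\<^sup>2) \<partial>M) < ennreal (e/4)"
        "(\<integral>\<^sup>+\<omega>. ennreal ((norm (R2 \<omega> - elem_sum N p c Z \<omega>))\<^sup>2) \<partial>M) < ennreal (e/4)"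
      using d1(2)[of p N c] d2(2)[of p N c] p s12 by auto
    have r2: "(\<integral>\<^sup>+\<omega>. ennreal ((norm (elem_sum N p c Z \<omega> - R2 \<omega>))\<^sup>2) \<partial>M) < ennreal (e/4)"
      using r(2) by (simp add: norm_minus_commute)
    have "(\<integral>\<^sup>+\<omega>\<in>space M. ennreal ((norm (R1 \<omega> - R2 \<omega>))\<^sup>2) \<partial>M) \<le>
      2 * (\<integral>\<^sup>+\<omega>\<in>space M. ennreal ((norm (R1 \<omega> - elem_sum N p c Z \<omega>))\<^sup>2) \<partial>M) +
      2 * (\<integral>\<^sup>+\<omega>\<in>space M. ennreal ((norm (elem_sum N p c Z \<omega> - R2 \<omega>))\<^sup>2) \<partial>M)"
      using Q by (intro nn_sq_diff_le) auto
    also have "\<dots> \<le> ennreal e"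
      using r r2 by (intro twice_quarters_le e) (auto simp: nn_set_integral_space)
    finally show ?thesis by (simp add: nn_set_integral_space)
  qed
  then have "(\<integral>\<^sup>+\<omega>. ennreal ((norm (R1 \<omega> - R2 \<omega>))\<^sup>2) \<partial>M) \<le> 0"
    by (rule ennreal_le_epsilon)
  then have "(\<integral>\<^sup>+\<omega>. ennreal ((norm (R1 \<omega> - R2 \<omega>))\<^sup>2) \<partial>M) = 0" by (simp only: le_zero_eq)
  then have "AE \<omega> in M. ennreal ((norm (R1 \<omega> - R2 \<omega>))\<^sup>2) = 0"
    by (subst (asm) nn_integral_0_iff_AE) measurable
  then show ?thesis by eventually_elim (simp add: ennreal_eq_0_iff)
qed

section \<open>Projection on the span of a white noise\<close>


text \<open>The Riesz-Fischer theorem with a prescribed rate. The rate makes the whole sequence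
  converge almost everywhere, so the limit is the pointwise \<open>lim\<close> and no subsequence
  has to be selected. A family that depends measurably on a parameter then has a jointly measurable
  limit.\<close>

lemma L2_fast_limit:
  fixes f :: "nat \<Rightarrow> 'a \<Rightarrow> real"
  assumes L: "\<And>n. f n \<in> L2 M"
    and c: "\<And>n m. n \<le> m \<Longrightarrow> (LINT x|M. (f m x - f n x)\<^sup>2) \<le> (1/4)^n"
  shows "(\<lambda>x. lim (\<lambda>n. f n x)) \<in> L2 M"
    and "(LINT x|M. (lim (\<lambda>n. f n x) - f n x)\<^sup>2) \<le> (1/4)^n"
proof -
  note [measurable] = L2_meas[OF L]
  have c': "(\<integral>\<^sup>+x. ennreal ((f m x - f n x)\<^sup>2) \<partial>M) \<le> ennreal ((1/4)^n)" if "n \<le> m" for n m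
    unfolding nn_eq_LINT_sq[OF L2_diff[OF L L]] by (intro ennreal_leI c that)
  \<comment> \<open>The weight \<open>2^n\<close> leaves \<open>(1/2)^n\<close> of the bound
    \<open>(1/4)^n\<close>, which is still summable, and forces the increments to decay pointwise
    like \<open>(sqrt (1/2))^n\<close>.\<close>
  have "(\<integral>\<^sup>+x. (\<Sum>n. ennreal (2^n * (f (Suc n) x - f n x)\<^sup>2)) \<partial>M) = (\<Sum>n. \<integral>\<^sup>+x. ennreal (2^n * (f (Suc n) x - f n x)\<^sup>2) \<partial>M)"
    by (rule nn_integral_suminf) simp
  also have "\<dots> \<le> (\<Sum>n. ennreal ((1/2)^n))"
  proof (intro suminf_le)
    fix n
    have "(\<integral>\<^sup>+x. ennreal (2^n * (f (Suc n) x - f n x)\<^sup>2) \<partial>M) = ennreal (2^n) * (\<integral>\<^sup>+x. ennreal ((f (Suc n) x - f n x)\<^sup>2) \<partial>M)"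
      by (simp add: ennreal_mult nn_integral_cmult)
    also have "\<dots> \<le> ennreal (2^n) * ennreal ((1/4)^n)"
      by (intro mult_left_mono c') auto
    also have "\<dots> = ennreal ((1/2)^n)"
      by (simp add: ennreal_mult[symmetric] power_mult_distrib[symmetric])
    finally show "(\<integral>\<^sup>+x. ennreal (2^n * (f (Suc n) x - f n x)\<^sup>2) \<partial>M) \<le> ennreal ((1/2)^n)" .
  qed auto
  also have "\<dots> = ennreal (\<Sum>n. (1/2)^n)"
    by (intro suminf_ennreal2) (auto intro: summable_geometric)
  also have "\<dots> < \<infinity>" by simp
  finally have "AE x in M. (\<Sum>n. ennreal (2^n * (f (Suc n) x - f n x)\<^sup>2)) \<noteq> \<infinity>"
    by (intro nn_integral_PInf_AE) auto
  then have conv: "AE x in M. (\<lambda>n. f n x) \<longlonglongrightarrow> lim (\<lambda>n. f n x)"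
  proof eventually_elim
    case (elim x)
    define D where "D n = f (Suc n) x - f n x" for n
    have s: "summable (\<lambda>n. 2^n * (D n)\<^sup>2)"
      using elim by (intro summable_suminf_not_top) (auto simp: D_def)
    define S where "S = (\<Sum>n. 2^n * (D n)\<^sup>2)"
    have le: "norm (D n) \<le> sqrt S * (sqrt (1/2))^n" for n
    proof -
      have "2^n * (D n)\<^sup>2 \<le> S" unfolding S_def
        using sum_le_suminf[OF s, of "{n}"] by simp
      then have "(D n)\<^sup>2 \<le> S * (1/2)^n" by (simp add: power_one_over field_simps)
      then have "sqrt ((D n)\<^sup>2) \<le> sqrt (S * (1/2)^n)" by (rule real_sqrt_le_mono)
      then show ?thesis
        unfolding real_sqrt_abs real_sqrt_mult real_sqrt_power[of "1/2"] real_norm_def .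
    qed
    have "summable (\<lambda>n. sqrt S * (sqrt (1/2))^n)"
      by (intro summable_mult summable_geometric) (simp add: real_sqrt_divide)
    then have "summable D"
      by (rule summable_comparison_test'[where N=0]) (rule le)
    then have "convergent (\<lambda>n. \<Sum>k<n. D k)" by (simp add: summable_iff_convergent)
    moreover have "(\<Sum>k<n. D k) = f n x - f 0 x" for n
      unfolding D_def by (rule sum_lessThan_telescope)
    ultimately have "convergent (\<lambda>n. (f n x - f 0 x) + f 0 x)"
      by (intro convergent_add) (auto intro: convergent_const)
    then show ?case by (simp add: convergent_LIMSEQ_iff)
  qed
  have Fm[measurable]: "(\<lambda>x. lim (\<lambda>n. f n x)) \<in> borel_measurable M"
    by (rule borel_measurable_lim_metric) simp
  have bd: "(\<integral>\<^sup>+x. ennreal ((lim (\<lambda>n. f n x) - f n x)\<^sup>2) \<partial>M) \<le> ennreal ((1/4)^n)" for n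
  proof -
    have "(\<integral>\<^sup>+x. ennreal ((lim (\<lambda>n. f n x) - f n x)\<^sup>2) \<partial>M) = (\<integral>\<^sup>+x. liminf (\<lambda>m. ennreal ((f m x - f n x)\<^sup>2)) \<partial>M)"
    proof (rule nn_integral_cong_AE)
      show "AE x in M. ennreal ((lim (\<lambda>n. f n x) - f n x)\<^sup>2) = liminf (\<lambda>m. ennreal ((f m x - f n x)\<^sup>2))"
        using conv
      proof eventually_elim
        case (elim x)
        have "(\<lambda>m. ennreal ((f m x - f n x)\<^sup>2)) \<longlonglongrightarrow> ennreal ((lim (\<lambda>n. f n x) - f n x)\<^sup>2)"
          by (intro tendsto_ennrealI tendsto_intros elim)
        then show ?case by (rule lim_imp_Liminf[OF trivial_limit_sequentially, symmetric])
      qed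
    qed
    also have "\<dots> \<le> liminf (\<lambda>m. \<integral>\<^sup>+x. ennreal ((f m x - f n x)\<^sup>2) \<partial>M)"
      by (rule nn_integral_liminf) simp
    also have "\<dots> \<le> liminf (\<lambda>m. ennreal ((1/4)^n))"
      by (rule Liminf_mono) (auto simp: eventually_sequentially intro!: exI[of _ n] c')
    finally show ?thesis by (simp add: Liminf_const)
  qed
  have dL: "(\<lambda>x. lim (\<lambda>n. f n x) - f n x) \<in> L2 M" for n
    using bd[of n] by (subst L2_iff_nn) (auto intro: le_less_trans)
  show "(\<lambda>x. lim (\<lambda>n. f n x)) \<in> L2 M"
    using L2_add[OF dL[of 0] L[of 0]] by simp
  show "(LINT x|M. (lim (\<lambda>n. f n x) - f n x)\<^sup>2) \<le> (1/4)^n"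
    using bd[of n] unfolding nn_eq_LINT_sq[OF dL] by simp
qed

text \<open>For a process with covariance \<open>min\<close>, the covariance of two increments is
  the length of the overlap of their intervals.\<close>

lemma increment_overlap:
  "a \<le> b \<Longrightarrow> a' \<le> b' \<Longrightarrow> min b b' - min b a' - min a b' + min a a' = max 0 (min b b' - max a (a'::real))"
  by (simp add: min_def max_def)

text \<open>Means and covariances determine the projections and their kernels. Independence and
  normality serve to verify these assumptions for Brownian motion.\<close>

locale white_noise = prob_space M for M :: "'w measure" +
  fixes T :: real and B :: "'q::finite \<Rightarrow> real \<Rightarrow> 'w \<Rightarrow> real"
  assumes T: "0 < T"
    and B_L2: "\<And>q u. u \<in> {0..T} \<Longrightarrow> B q u \<in> L2 M"
    and B_mean: "\<And>q u. u \<in> {0..T} \<Longrightarrow> (LINT \<omega>|M. B q u \<omega>) = 0"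
    and B_cov: "\<And>q r u s. u \<in> {0..T} \<Longrightarrow> s \<in> {0..T} \<Longrightarrow>
      (LINT \<omega>|M. B q u \<omega> * B r s \<omega>) = (if q = r then min u s else 0)"
begin

text \<open>With the constant among the generators a projection keeps the mean, and deterministic
  terms such as the initial state are fixed by it.\<close>

definition gens :: "('w \<Rightarrow> real) set" where
  "gens = insert (\<lambda>_. 1) {B q u | q u. u \<in> {0..T}}"

definition inc :: "'q \<Rightarrow> real \<Rightarrow> real \<Rightarrow> 'w \<Rightarrow> real" where
  "inc q a b \<omega> = B q b \<omega> - B q a \<omega>"

text \<open>Component \<open>p\<close> of the step integrand whose integral is the sum of the
  \<open>c i * inc (q i) (a i) (b i)\<close>. The index type is free, so that a difference of two
  such sums is again of this form, over a disjoint union of index sets.\<close>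

definition stepf :: "('i \<Rightarrow> real) \<Rightarrow> 'i set \<Rightarrow> ('i \<Rightarrow> 'q) \<Rightarrow> ('i \<Rightarrow> real) \<Rightarrow> ('i \<Rightarrow> real) \<Rightarrow> 'q \<Rightarrow> real \<Rightarrow> real" where
  "stepf c I q a b p u = (\<Sum>i\<in>I. c i * (if q i = p then indicator {a i<..b i} u else 0))"

lemma L2_one: "(\<lambda>_. c) \<in> L2 M" by (rule L2_const) unfold_locales

lemma L2_int: "f \<in> L2 M \<Longrightarrow> integrable M f" by (rule L2_integrable) unfold_locales

lemma gens_L2: "gens \<subseteq> L2 M" by (auto simp: gens_def B_L2 L2_one)

lemma inc_L2: "a \<in> {0..T} \<Longrightarrow> b \<in> {0..T} \<Longrightarrow> inc q a b \<in> L2 M"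
  unfolding inc_def[abs_def] by (intro L2_diff B_L2)

lemma inc_mean: "a \<in> {0..T} \<Longrightarrow> b \<in> {0..T} \<Longrightarrow> (LINT \<omega>|M. inc q a b \<omega>) = 0"
  unfolding inc_def by (subst Bochner_Integration.integral_diff) (auto intro!: L2_int B_L2 simp: B_mean)

lemma inc_cov:
  assumes "a \<in> {0..T}" "b \<in> {0..T}" "a' \<in> {0..T}" "b' \<in> {0..T}" "a \<le> b" "a' \<le> b'"
  shows "(LINT \<omega>|M. inc q a b \<omega> * inc r a' b' \<omega>) = (if q = r then max 0 (min b b' - max a a') else 0)"
proof -
  note i = L2_prod_integrable[OF B_L2 B_L2]
  have "(LINT \<omega>|M. inc q a b \<omega> * inc r a' b' \<omega>) =
    (LINT \<omega>|M. B q b \<omega> * B r b' \<omega> - B q b \<omega> * B r a' \<omega> - B q a \<omega> * B r b' \<omega> + B q a \<omega> * B r a' \<omega>)"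
    by (simp add: inc_def algebra_simps)
  also have "\<dots> = (LINT \<omega>|M. B q b \<omega> * B r b' \<omega>) - (LINT \<omega>|M. B q b \<omega> * B r a' \<omega>) -
     (LINT \<omega>|M. B q a \<omega> * B r b' \<omega>) + (LINT \<omega>|M. B q a \<omega> * B r a' \<omega>)"
    using assms by (simp add: i)
  also have "\<dots> = (if q = r then min b b' - min b a' - min a b' + min a a' else 0)"
    using assms by (simp add: B_cov)
  finally show ?thesis using increment_overlap[OF assms(5,6)] by simp
qed

lemma indicator_prod_LINT:
  "(LINT u|lborel. indicator {a<..b} u * indicator {a'<..b'} (u::real)) = max 0 (min b b' - max a (a'::real))"
proof -
  have "(\<lambda>u. indicator {a<..b} u * indicator {a'<..b'} u :: real) = indicator {max a a'<..min b b'}"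
    by (auto simp: indicator_def fun_eq_iff)
  moreover have "(LINT u|lborel. indicator {l<..r} (u::real)) = max 0 (r - l)" for l r :: real
    by (cases "l \<le> r") auto
  ultimately show ?thesis by simp
qed

lemma interval_indicator_L2: "(indicator {a<..b::real} :: real \<Rightarrow> real) \<in> L2 lborel"
proof -
  have "(\<lambda>u. (indicator {a<..b} u :: real)\<^sup>2) = indicator {a<..b}"
    by (auto simp: indicator_def fun_eq_iff)
  moreover have "integrable lborel (indicator {a<..b} :: real \<Rightarrow> real)"
    by (intro integrable_real_indicator emeasure_bounded_finite) auto
  ultimately show ?thesis by (simp add: L2_def)
qed

lemma stepf_L2: "stepf c I q a b p \<in> L2 lborel"
proof -
  have "(\<lambda>u. if q i = p then indicator {a i<..b i} u else 0 :: real) \<in> L2 lborel" for i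
    using interval_indicator_L2[of "a i" "b i"] by (cases "q i = p") (simp_all add: L2_zero)
  then show ?thesis unfolding stepf_def[abs_def] by (intro L2_sum L2_cmult)
qed

text \<open>Ito's isometry for step integrands: increments and indicators have the same Gram matrix,
  the overlap lengths, with zero for different coordinates.\<close>

lemma isometry:
  assumes "finite I" and ab: "\<And>i. i \<in> I \<Longrightarrow> a i \<in> {0..T} \<and> b i \<in> {0..T} \<and> a i \<le> b i"
  shows "(LINT \<omega>|M. (\<Sum>i\<in>I. c i * inc (q i) (a i) (b i) \<omega>)\<^sup>2) =
    (\<Sum>p\<in>UNIV. LINT u|lborel. (stepf c I q a b p u)\<^sup>2)"
proof -
  let ?x = "\<lambda>i j. c i * c j * max 0 (min (b i) (b j) - max (a i) (a j))"
  have i: "integrable M (\<lambda>\<omega>. inc (q i) (a i) (b i) \<omega> * inc (q j) (a j) (b j) \<omega>)" if "i \<in> I" "j \<in> I" for i j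
    using ab that by (intro L2_prod_integrable inc_L2) auto
  have "(LINT \<omega>|M. (\<Sum>i\<in>I. c i * inc (q i) (a i) (b i) \<omega>)\<^sup>2) =
    (LINT \<omega>|M. (\<Sum>i\<in>I. \<Sum>j\<in>I. c i * c j * (inc (q i) (a i) (b i) \<omega> * inc (q j) (a j) (b j) \<omega>)))"
    by (simp add: power2_eq_square sum_product algebra_simps)
  also have "\<dots> = (\<Sum>i\<in>I. \<Sum>j\<in>I. LINT \<omega>|M. c i * c j * (inc (q i) (a i) (b i) \<omega> * inc (q j) (a j) (b j) \<omega>))"
    by (subst Bochner_Integration.integral_sum, (intro Bochner_Integration.integrable_sum integrable_mult_right i; assumption),
        intro sum.cong refl Bochner_Integration.integral_sum integrable_mult_right i)
  also have "\<dots> = (\<Sum>i\<in>I. \<Sum>j\<in>I. (if q i = q j then ?x i j else 0))"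
    using ab by (intro sum.cong refl) (simp add: inc_cov)
  finally have 1: "(LINT \<omega>|M. (\<Sum>i\<in>I. c i * inc (q i) (a i) (b i) \<omega>)\<^sup>2) = (\<Sum>i\<in>I. \<Sum>j\<in>I. (if q i = q j then ?x i j else 0))" .
  let ?e = "\<lambda>p i u. (if q i = p then indicator {a i<..b i} u else 0 :: real)"
  have ie: "integrable lborel (\<lambda>u. ?e p i u * ?e p j u)" for p i j
  proof -
    have "?e p i \<in> L2 lborel" for p i
      using interval_indicator_L2[of "a i" "b i"] by (cases "q i = p") (simp_all add: L2_zero)
    then show ?thesis by (intro L2_prod_integrable)
  qed
  have "(LINT u|lborel. (stepf c I q a b p u)\<^sup>2) = (\<Sum>i\<in>I. \<Sum>j\<in>I. (if q i = p \<and> q j = p then ?x i j else 0))" for p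
  proof -
    have "(LINT u|lborel. (stepf c I q a b p u)\<^sup>2) = (LINT u|lborel. (\<Sum>i\<in>I. \<Sum>j\<in>I. c i * c j * (?e p i u * ?e p j u)))"
      unfolding stepf_def power2_eq_square sum_product
      by (intro Bochner_Integration.integral_cong refl sum.cong) (simp add: algebra_simps)
    also have "\<dots> = (\<Sum>i\<in>I. \<Sum>j\<in>I. LINT u|lborel. c i * c j * (?e p i u * ?e p j u))"
      by (subst Bochner_Integration.integral_sum, (intro Bochner_Integration.integrable_sum integrable_mult_right ie),
        intro sum.cong refl Bochner_Integration.integral_sum integrable_mult_right ie)
    also have "\<dots> = (\<Sum>i\<in>I. \<Sum>j\<in>I. (if q i = p \<and> q j = p then ?x i j else 0))"
      by (intro sum.cong refl) (auto simp: indicator_prod_LINT)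
    finally show ?thesis .
  qed
  then have "(\<Sum>p\<in>UNIV. LINT u|lborel. (stepf c I q a b p u)\<^sup>2) =
    (\<Sum>p\<in>UNIV. \<Sum>i\<in>I. \<Sum>j\<in>I. (if q i = p \<and> q j = p then ?x i j else 0))" by simp
  also have "\<dots> = (\<Sum>i\<in>I. \<Sum>j\<in>I. \<Sum>p\<in>UNIV. (if q i = p \<and> q j = p then ?x i j else 0))"
    by (subst sum.swap, intro sum.cong refl, rule sum.swap)
  also have "\<dots> = (\<Sum>i\<in>I. \<Sum>j\<in>I. (if q i = q j then ?x i j else 0))"
  proof (intro sum.cong refl)
    fix i j
    have "(\<Sum>p\<in>UNIV. (if q i = p \<and> q j = p then ?x i j else 0)) = (\<Sum>p\<in>UNIV. (if q i = p then (if q j = q i then ?x i j else 0) else 0))"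
      by (intro sum.cong refl) auto
    also have "\<dots> = (if q i = q j then ?x i j else 0)" by (simp add: sum.delta')
    finally show "(\<Sum>p\<in>UNIV. (if q i = p \<and> q j = p then ?x i j else 0)) = (if q i = q j then ?x i j else 0)" .
  qed
  finally show ?thesis using 1 by simp
qed

section \<open>Dyadic approximation of the projection and of its kernel\<close>

definition grid :: "nat \<Rightarrow> nat \<Rightarrow> real" where "grid n j = T * real j / 2^n"

definition cells :: "nat \<Rightarrow> real \<Rightarrow> ('q \<times> nat) set" where
  "cells n \<tau> = {(q, j). j < 2^n \<and> grid n (Suc j) \<le> \<tau>}"

definition cinc :: "nat \<Rightarrow> 'q \<times> nat \<Rightarrow> 'w \<Rightarrow> real" where
  "cinc n i = inc (fst i) (grid n (snd i)) (grid n (Suc (snd i)))"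

text \<open>The Fourier coefficient with respect to the orthogonal increments, each of which has
  variance \<open>T / 2^n\<close>.\<close>

definition coef :: "nat \<Rightarrow> ('w \<Rightarrow> real) \<Rightarrow> 'q \<times> nat \<Rightarrow> real" where
  "coef n Z i = (LINT \<omega>|M. Z \<omega> * cinc n i \<omega>) * 2^n / T"

definition dproj :: "nat \<Rightarrow> real \<Rightarrow> ('w \<Rightarrow> real) \<Rightarrow> 'w \<Rightarrow> real" where
  "dproj n \<tau> Z \<omega> = (LINT \<omega>|M. Z \<omega>) + (\<Sum>i\<in>cells n \<tau>. coef n Z i * cinc n i \<omega>)"

definition dker :: "nat \<Rightarrow> real \<Rightarrow> ('w \<Rightarrow> real) \<Rightarrow> 'q \<Rightarrow> real \<Rightarrow> real" where
  "dker n \<tau> Z = stepf (coef n Z) (cells n \<tau>) fst (\<lambda>i. grid n (snd i)) (\<lambda>i. grid n (Suc (snd i)))"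

lemma finite_cells: "finite (cells n \<tau>)"
  by (rule finite_subset[of _ "UNIV \<times> {..<2^n}"]) (auto simp: cells_def)

lemma grid_mem: "j \<le> 2^n \<Longrightarrow> grid n j \<in> {0..T}"
proof -
  assume "j \<le> 2^n"
  then have "real j \<le> 2^n" by (metis of_nat_le_iff of_nat_numeral of_nat_power)
  then have "T * real j \<le> T * 2^n" using T by simp
  then show ?thesis using T by (simp add: grid_def field_simps)
qed

lemma grid_mono: "j \<le> k \<Longrightarrow> grid n j \<le> grid n k"
  using T by (simp add: grid_def divide_right_mono)

lemma grid_refine: "grid n j = grid (Suc n) (2 * j)"
  by (simp add: grid_def)

lemma cells_grid: "i \<in> cells n \<tau> \<Longrightarrow> grid n (snd i) \<in> {0..T} \<and> grid n (Suc (snd i)) \<in> {0..T} \<and> grid n (snd i) \<le> grid n (Suc (snd i))"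
  using grid_mem[of "snd i" n] grid_mem[of "Suc (snd i)" n] grid_mono[of "snd i" "Suc (snd i)" n]
  by (auto simp: cells_def)

lemma cinc_L2: "i \<in> cells n \<tau> \<Longrightarrow> cinc n i \<in> L2 M"
  unfolding cinc_def using cells_grid by (intro inc_L2) auto

lemma cinc_mean: "i \<in> cells n \<tau> \<Longrightarrow> (LINT \<omega>|M. cinc n i \<omega>) = 0"
  unfolding cinc_def using cells_grid by (intro inc_mean) auto

lemma cinc_cov:
  assumes "i \<in> cells n \<tau>" "i' \<in> cells n \<tau>"
  shows "(LINT \<omega>|M. cinc n i \<omega> * cinc n i' \<omega>) = (if i = i' then T / 2^n else 0)"
proof -
  obtain q j where i: "i = (q, j)" by (cases i)
  obtain r k where i': "i' = (r, k)" by (cases i')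
  have *: "(LINT \<omega>|M. cinc n i \<omega> * cinc n i' \<omega>) =
    (if q = r then max 0 (min (grid n (Suc j)) (grid n (Suc k)) - max (grid n j) (grid n k)) else 0)"
    unfolding cinc_def using cells_grid[OF assms(1)] cells_grid[OF assms(2)]
    by (subst inc_cov) (auto simp: i i')
  have step: "grid n (Suc j) - grid n j = T / 2^n" by (simp add: grid_def field_simps)
  consider "j = k" | "Suc j \<le> k" | "Suc k \<le> j" by linarith
  then have "max 0 (min (grid n (Suc j)) (grid n (Suc k)) - max (grid n j) (grid n k)) = (if j = k then T / 2^n else 0)"
  proof cases
    case 1 then show ?thesis using step T by simp
  next
    case 2 then show ?thesis
      using grid_mono[of "Suc j" k n] grid_mono[of j "Suc j" n] grid_mono[of k "Suc k" n] by auto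
  next
    case 3 then show ?thesis
      using grid_mono[of "Suc k" j n] grid_mono[of j "Suc j" n] grid_mono[of k "Suc k" n] by auto
  qed
  then show ?thesis using * by (auto simp: i i')
qed

lemma dproj_L2: "dproj n \<tau> Z \<in> L2 M"
  unfolding dproj_def[abs_def] by (intro L2_add L2_sum L2_cmult L2_one cinc_L2)

lemma dproj_mean: "(LINT \<omega>|M. dproj n \<tau> Z \<omega>) = (LINT \<omega>|M. Z \<omega>)"
proof -
  have i: "integrable M (cinc n i)" if "i \<in> cells n \<tau>" for i using cinc_L2[OF that] by (rule L2_int)
  have "(LINT \<omega>|M. dproj n \<tau> Z \<omega>) = (LINT \<omega>|M. Z \<omega>) + (\<Sum>i\<in>cells n \<tau>. coef n Z i * (LINT \<omega>|M. cinc n i \<omega>))"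
    unfolding dproj_def using i
    by (subst Bochner_Integration.integral_add)
      (auto simp: Bochner_Integration.integral_sum prob_space intro!: Bochner_Integration.integrable_sum)
  then show ?thesis by (simp add: cinc_mean)
qed

lemma dproj_cinc:
  assumes Z: "Z \<in> L2 M" and i: "i \<in> cells n \<tau>"
  shows "(LINT \<omega>|M. dproj n \<tau> Z \<omega> * cinc n i \<omega>) = (LINT \<omega>|M. Z \<omega> * cinc n i \<omega>)"
proof -
  have in1: "integrable M (\<lambda>\<omega>. cinc n k \<omega> * cinc n i \<omega>)" if "k \<in> cells n \<tau>" for k
    by (intro L2_prod_integrable cinc_L2[OF that] cinc_L2[OF i])
  have in2: "integrable M (cinc n i)" by (rule L2_int[OF cinc_L2[OF i]])
  have "(LINT \<omega>|M. dproj n \<tau> Z \<omega> * cinc n i \<omega>) =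
    (LINT \<omega>|M. (LINT \<omega>|M. Z \<omega>) * cinc n i \<omega> + (\<Sum>k\<in>cells n \<tau>. coef n Z k * (cinc n k \<omega> * cinc n i \<omega>)))"
    by (simp add: dproj_def distrib_right sum_distrib_right mult.assoc)
  also have "\<dots> = (LINT \<omega>|M. Z \<omega>) * (LINT \<omega>|M. cinc n i \<omega>) + (\<Sum>k\<in>cells n \<tau>. coef n Z k * (LINT \<omega>|M. cinc n k \<omega> * cinc n i \<omega>))"
    using in1 in2 by (subst Bochner_Integration.integral_add)
      (auto simp: Bochner_Integration.integral_sum intro!: Bochner_Integration.integrable_sum)
  also have "\<dots> = (\<Sum>k\<in>cells n \<tau>. coef n Z k * (if k = i then T / 2^n else 0))"
    using i by (simp add: cinc_mean cinc_cov cong: sum.cong)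
  also have "\<dots> = coef n Z i * (T / 2^n)"
    using i finite_cells by (simp add: if_distrib[of "\<lambda>x. _ * x"] sum.delta' cong: if_cong)
  also have "\<dots> = (LINT \<omega>|M. Z \<omega> * cinc n i \<omega>)" using T by (simp add: coef_def)
  finally show ?thesis .
qed

text \<open>Downward induction on the level: an increment of level \<open>n\<close> is the sum of
  its two halves of level \<open>n + 1\<close>, and both halves end by \<open>\<tau>\<close> if it
  does. The finer projection therefore refines the coarser one.\<close>

lemma resid_orth:
  assumes Z: "Z \<in> L2 M" and nm: "n \<le> m" and i: "i \<in> cells n \<tau>"
  shows "(\<lambda>\<omega>. Z \<omega> - dproj m \<tau> Z \<omega>) \<in> orth M {cinc n i}"
proof -
  have RL: "(\<lambda>\<omega>. Z \<omega> - dproj m \<tau> Z \<omega>) \<in> L2 M" by (intro L2_diff Z dproj_L2)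
  have "(LINT \<omega>|M. (Z \<omega> - dproj m \<tau> Z \<omega>) * cinc n i \<omega>) = 0" using nm i
  proof (induction n arbitrary: i rule: inc_induct)
    case base
    have "(LINT \<omega>|M. (Z \<omega> - dproj m \<tau> Z \<omega>) * cinc m i \<omega>) = (LINT \<omega>|M. Z \<omega> * cinc m i \<omega>) - (LINT \<omega>|M. dproj m \<tau> Z \<omega> * cinc m i \<omega>)"
      by (simp add: left_diff_distrib L2_prod_integrable Z cinc_L2[OF base] dproj_L2)
    then show ?case using dproj_cinc[OF Z base] by simp
  next
    case (step n)
    obtain q j where i: "i = (q, j)" by (cases i)
    have j: "j < 2^n" "grid n (Suc j) \<le> \<tau>" using step.prems by (auto simp: i cells_def)
    have g: "grid (Suc n) (Suc (Suc (2 * j))) = grid n (Suc j)" using grid_refine[of n "Suc j"] by simp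
    have "grid (Suc n) (Suc (2 * j)) \<le> grid n (Suc j)" unfolding g[symmetric] by (rule grid_mono) simp
    then have c: "(q, 2 * j) \<in> cells (Suc n) \<tau>" "(q, Suc (2 * j)) \<in> cells (Suc n) \<tau>"
      using j g by (auto simp: cells_def)
    have split: "cinc n i \<omega> = cinc (Suc n) (q, 2 * j) \<omega> + cinc (Suc n) (q, Suc (2 * j)) \<omega>" for \<omega>
      using g grid_refine[of n j] by (simp add: cinc_def inc_def i)
    show ?case
      using step.IH[OF c(1)] step.IH[OF c(2)]
      by (simp add: split distrib_left L2_prod_integrable RL cinc_L2[OF c(1)] cinc_L2[OF c(2)])
  qed
  then show ?thesis using RL by (simp add: orth_def)
qed

text \<open>The variance explained at level \<open>n\<close>. Its differences are the squared
  distances between levels, and it is bounded, so a single real sequence, measurable in a parameter,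
  controls the convergence.\<close>

definition energy :: "nat \<Rightarrow> real \<Rightarrow> ('w \<Rightarrow> real) \<Rightarrow> real" where
  "energy n \<tau> Z = (LINT \<omega>|M. (dproj n \<tau> Z \<omega> - (LINT \<omega>|M. Z \<omega>))\<^sup>2)"

lemma pythagoras:
  assumes "f \<in> L2 M" "g \<in> L2 M" "(LINT \<omega>|M. f \<omega> * g \<omega>) = 0"
  shows "(LINT \<omega>|M. (f \<omega> + g \<omega>)\<^sup>2) = (LINT \<omega>|M. (f \<omega>)\<^sup>2) + (LINT \<omega>|M. (g \<omega>)\<^sup>2)"
proof -
  have "(LINT \<omega>|M. (f \<omega> + g \<omega>)\<^sup>2) = (LINT \<omega>|M. (f \<omega>)\<^sup>2 + (g \<omega>)\<^sup>2 + 2 * (f \<omega> * g \<omega>))"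
    by (simp add: power2_sum mult.assoc)
  then show ?thesis using assms L2_prod_integrable[OF assms(1,2)] by (simp add: L2_sq_int)
qed

lemma orth_dproj:
  assumes V: "\<And>i. i \<in> cells n \<tau> \<Longrightarrow> V \<in> orth M {cinc n i}" and VL: "V \<in> L2 M"
  shows "(LINT \<omega>|M. V \<omega> * (dproj n \<tau> Z \<omega> - (LINT \<omega>|M. Z \<omega>))) = 0"
proof -
  have "(LINT \<omega>|M. V \<omega> * (dproj n \<tau> Z \<omega> - (LINT \<omega>|M. Z \<omega>))) = (LINT \<omega>|M. (\<Sum>i\<in>cells n \<tau>. coef n Z i * (V \<omega> * cinc n i \<omega>)))"
    by (simp add: dproj_def sum_distrib_left algebra_simps)
  also have "\<dots> = (\<Sum>i\<in>cells n \<tau>. coef n Z i * (LINT \<omega>|M. V \<omega> * cinc n i \<omega>))"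
    by (subst Bochner_Integration.integral_sum) (auto intro!: L2_prod_integrable VL cinc_L2)
  also have "\<dots> = 0" using V by (simp add: orth_def)
  finally show ?thesis .
qed

lemma energy_diff:
  assumes Z: "Z \<in> L2 M" and nm: "n \<le> m"
  shows "(LINT \<omega>|M. (dproj m \<tau> Z \<omega> - dproj n \<tau> Z \<omega>)\<^sup>2) = energy m \<tau> Z - energy n \<tau> Z"
proof -
  have V: "(\<lambda>\<omega>. dproj m \<tau> Z \<omega> - dproj n \<tau> Z \<omega>) \<in> orth M {cinc n i}" if "i \<in> cells n \<tau>" for i
    using orth_diff[OF _ resid_orth[OF Z order_refl that] resid_orth[OF Z nm that]] cinc_L2[OF that] by simp
  have "(LINT \<omega>|M. (dproj m \<tau> Z \<omega> - dproj n \<tau> Z \<omega>) * (dproj n \<tau> Z \<omega> - (LINT \<omega>|M. Z \<omega>))) = 0"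
    by (intro orth_dproj V L2_diff dproj_L2)
  from pythagoras[OF L2_diff[OF dproj_L2 dproj_L2] L2_diff[OF dproj_L2 L2_one] this]
  show ?thesis by (simp add: energy_def)
qed

lemma energy_bound:
  assumes Z: "Z \<in> L2 M"
  shows "energy n \<tau> Z \<le> (LINT \<omega>|M. (Z \<omega> - (LINT \<omega>|M. Z \<omega>))\<^sup>2)"
proof -
  have "(LINT \<omega>|M. (Z \<omega> - dproj n \<tau> Z \<omega>) * (dproj n \<tau> Z \<omega> - (LINT \<omega>|M. Z \<omega>))) = 0"
    by (intro orth_dproj resid_orth Z L2_diff dproj_L2 order_refl)
  from pythagoras[OF L2_diff[OF Z dproj_L2] L2_diff[OF dproj_L2 L2_one] this]
  show ?thesis by (simp add: energy_def)
qed

lemma dker_diff_isometry: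
  "(\<Sum>p\<in>UNIV. LINT u|lborel. (dker m \<tau> Z p u - dker n \<tau> Z p u)\<^sup>2) = (LINT \<omega>|M. (dproj m \<tau> Z \<omega> - dproj n \<tau> Z \<omega>)\<^sup>2)"
proof -
  \<comment> \<open>The disjoint sum of the index sets, with the second family of coefficients
    negated, turns the difference into a single elementary sum.\<close>
  let ?I = "cells m \<tau> <+> cells n \<tau>"
  let ?c = "case_sum (coef m Z) (\<lambda>i. - coef n Z i)"
  let ?q = "case_sum fst fst"
  let ?a = "case_sum (\<lambda>i. grid m (snd i)) (\<lambda>i. grid n (snd i))"
  let ?b = "case_sum (\<lambda>i. grid m (Suc (snd i))) (\<lambda>i. grid n (Suc (snd i)))"
  have 1: "(\<Sum>i\<in>?I. ?c i * inc (?q i) (?a i) (?b i) \<omega>) = dproj m \<tau> Z \<omega> - dproj n \<tau> Z \<omega>" for \<omega>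
    by (subst sum.Plus) (auto simp: finite_cells dproj_def cinc_def sum_negf o_def)
  have 2: "stepf ?c ?I ?q ?a ?b p u = dker m \<tau> Z p u - dker n \<tau> Z p u" for p u
    unfolding stepf_def dker_def by (subst sum.Plus) (auto simp: finite_cells sum_negf o_def cong: if_cong)
  have fin: "finite ?I" by (simp add: finite_cells)
  have ab: "?a i \<in> {0..T} \<and> ?b i \<in> {0..T} \<and> ?a i \<le> ?b i" if "i \<in> ?I" for i
    using that cells_grid by fastforce
  from isometry[where I="?I" and c="?c" and q="?q" and a="?a" and b="?b", OF fin ab] show ?thesis unfolding 1 2 by simp
qed

text \<open>\<open>B q 0\<close> has second moment \<open>min 0 0 = 0\<close>, so it is zero in mean
  square, which is all that the locale provides.\<close>

lemma B_zero_orth: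
  assumes "V \<in> L2 M" shows "(LINT \<omega>|M. B q 0 \<omega> * V \<omega>) = 0"
proof -
  have 0: "0 \<in> {0..T}" using T by simp
  have "(LINT \<omega>|M. B q 0 \<omega> * V \<omega>)\<^sup>2 \<le> (LINT \<omega>|M. (B q 0 \<omega>)\<^sup>2) * (LINT \<omega>|M. (V \<omega>)\<^sup>2)"
    by (intro Cauchy_Schwarz_sq B_L2 0 assms)
  also have "(LINT \<omega>|M. (B q 0 \<omega>)\<^sup>2) = 0"
    using B_cov[OF 0 0, of q q] by (simp add: power2_eq_square)
  finally show ?thesis by simp
qed

text \<open>Telescoping from \<open>B q 0\<close> gives orthogonality at the grid points up to
  \<open>\<tau>\<close>, and mean-square continuity of the noise extends it to every
  \<open>u\<close>. The approximation is from below, since grid points after \<open>u\<close> may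
  lie beyond \<open>\<tau>\<close>.\<close>

lemma dyadic_orth:
  assumes V: "V \<in> L2 M" and u: "0 \<le> u" "u \<le> \<tau>" "\<tau> \<le> T"
    and c: "\<And>n i. i \<in> cells n \<tau> \<Longrightarrow> (LINT \<omega>|M. V \<omega> * cinc n i \<omega>) = 0"
  shows "(LINT \<omega>|M. V \<omega> * B q u \<omega>) = 0"
proof -
  have uT: "u \<in> {0..T}" using u by simp
  have node: "B q (grid n j) \<in> orth M {V}" if "grid n j \<le> \<tau>" for n j
    using that
  proof (induction j)
    case 0
    then show ?case using B_zero_orth[OF V] T by (simp add: grid_def orth_def B_L2)
  next
    case (Suc j)
    have "grid n (Suc j) \<le> T" using Suc.prems u(3) by simp
    then have "T * real (Suc j) \<le> T * 2^n" unfolding grid_def by (simp add: pos_divide_le_eq)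
    then have "real (Suc j) \<le> 2^n" using T by simp
    then have j: "Suc j \<le> 2^n" by (metis of_nat_le_iff of_nat_numeral of_nat_power)
    have i: "(q, j) \<in> cells n \<tau>" using j Suc.prems by (simp add: cells_def)
    have "B q (grid n j) \<in> orth M {V}" using Suc.prems grid_mono[of j "Suc j" n] by (intro Suc.IH) simp
    moreover have "cinc n (q, j) \<in> orth M {V}"
      using c[OF i] cinc_L2[OF i] by (simp add: orth_def mult.commute)
    ultimately have "(\<lambda>\<omega>. B q (grid n j) \<omega> + cinc n (q, j) \<omega>) \<in> orth M {V}" using V by (intro orth_add) auto
    then show ?case by (simp add: cinc_def inc_def)
  qed
  have "B q u \<in> orth M {V}"
  proof (rule orth_limit)
    fix e :: real assume e: "e > 0"
    obtain n where n: "(1/2)^n < e / T" using real_arch_pow_inv[of "e / T" "1/2"] e T by auto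
    \<comment> \<open>The last grid point not after \<open>u\<close>, at distance at most
      \<open>T / 2^n\<close>.\<close>
    define j where "j = nat \<lfloor>u * 2^n / T\<rfloor>"
    have rj: "real j = of_int \<lfloor>u * 2^n / T\<rfloor>" using u T by (simp add: j_def)
    have j: "real j \<le> u * 2^n / T" "u * 2^n / T < real j + 1" unfolding rj by linarith+
    have "u * 2^n < T * real j + T" "T * real j \<le> u * 2^n" using j T by (simp_all add: field_simps)
    then have "u < (T * real j + T) / 2^n" "T * real j / 2^n \<le> u"
      by (simp_all add: pos_less_divide_eq pos_divide_le_eq)
    then have g: "grid n j \<le> u" "u - grid n j \<le> T / 2^n"
      by (simp_all add: grid_def add_divide_distrib)
    have gm: "grid n j \<in> {0..T}" using g(1) uT T by (simp add: grid_def)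
    have "(LINT \<omega>|M. (B q u \<omega> - B q (grid n j) \<omega>)\<^sup>2) = u - grid n j"
      using inc_cov[OF gm uT gm uT g(1) g(1), of q q] g(1) by (simp add: inc_def power2_eq_square)
    also have "\<dots> \<le> T / 2^n" by (rule g(2))
    also have "\<dots> \<le> e" using n T by (simp add: power_one_over field_simps)
    finally have "(\<integral>\<^sup>+\<omega>. ennreal ((B q u \<omega> - B q (grid n j) \<omega>)\<^sup>2) \<partial>M) \<le> ennreal e"
      by (simp add: nn_eq_LINT_sq[OF L2_diff[OF B_L2[OF uT] B_L2[OF gm]]] ennreal_leI)
    then show "\<exists>Q\<in>orth M {V}. (\<integral>\<^sup>+\<omega>. ennreal ((B q u \<omega> - Q \<omega>)\<^sup>2) \<partial>M) \<le> ennreal e"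
      using node[of n j] g(1) u by (intro bexI[of _ "B q (grid n j)"]) auto
  qed (use V L2_meas[OF B_L2[OF uT]] in auto)
  then show ?thesis by (simp add: orth_def mult.commute)
qed

text \<open>\<open>Z'\<close> is the projection of \<open>Z\<close> on the constants and the noise up to time \<open>\<tau>\<close>, and \<open>k\<close> is its
  kernel. The last conjunct is the isometry between \<open>Z' - E Z\<close> and \<open>k\<close>, tested against step
  functions; the factor 4 comes from using \<open>(x + y)\<^sup>2 \<le> 2x\<^sup>2 + 2y\<^sup>2\<close> twice instead of Minkowski's
  inequality.\<close>

definition proj_upto :: "real \<Rightarrow> ('w \<Rightarrow> real) \<Rightarrow> ('w \<Rightarrow> real) \<Rightarrow> ('q \<Rightarrow> real \<Rightarrow> real) \<Rightarrow> bool" where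
  "proj_upto \<tau> Z Z' k \<longleftrightarrow> Z' \<in> orth M (orth M gens) \<and> (LINT \<omega>|M. Z' \<omega>) = (LINT \<omega>|M. Z \<omega>) \<and>
    (\<forall>q. \<forall>u\<in>{0..\<tau>}. (LINT \<omega>|M. (Z \<omega> - Z' \<omega>) * B q u \<omega>) = 0) \<and>
    (\<forall>q. \<forall>u\<in>{\<tau>..T}. (LINT \<omega>|M. Z' \<omega> * inc q \<tau> u \<omega>) = 0) \<and>
    (\<forall>q. k q \<in> L2 lborel) \<and> (\<forall>q u. u \<notin> {0<..\<tau>} \<longrightarrow> k q u = 0) \<and>
    (\<forall>I c (q :: nat \<times> 'q \<Rightarrow> 'q) a b. finite I \<longrightarrow> (\<forall>i\<in>I. a i \<in> {0..T} \<and> b i \<in> {0..T} \<and> a i \<le> b i) \<longrightarrow>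
       ennreal (LINT \<omega>|M. (Z' \<omega> - (LINT \<omega>|M. Z \<omega>) - (\<Sum>i\<in>I. c i * inc (q i) (a i) (b i) \<omega>))\<^sup>2)
         \<le> 4 * ennreal (\<Sum>p\<in>UNIV. LINT u|lborel. (k p u - stepf c I q a b p u)\<^sup>2))"

lemma dproj_gens: "dproj n \<tau> Z \<in> orth M (orth M gens)"
proof -
  have B: "B q u \<in> orth M (orth M gens)" if "u \<in> {0..T}" for q u
    using that by (intro orth_orth_incl gens_L2) (auto simp: gens_def)
  have 1: "(\<lambda>_. 1) \<in> orth M (orth M gens)" by (intro orth_orth_incl gens_L2) (auto simp: gens_def)
  have c: "(\<lambda>_. c) \<in> orth M (orth M gens)" for c using orth_cmult[OF 1, of c] by simp
  have "cinc n i \<in> orth M (orth M gens)" if "i \<in> cells n \<tau>" for i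
    unfolding cinc_def inc_def[abs_def] using cells_grid[OF that] by (intro orth_diff[OF orth_subset_L2] B) auto
  then show ?thesis unfolding dproj_def[abs_def]
    by (intro orth_add[OF orth_subset_L2] orth_sum[OF orth_subset_L2] orth_cmult c)
qed

text \<open>The levels \<open>\<kappa> k\<close> may be sparse: \<open>k \<le> \<kappa> k\<close>
  ensures that each fixed dyadic increment is eventually resolved, and the energy bound is the rate
  required by \<open>L2_fast_limit\<close>. Orthogonality passes to the limit because annihilators
  are closed, the isometry because the approximation errors vanish.\<close>

lemma proj_limit:
  assumes Z: "Z \<in> L2 M" and tau: "\<tau> \<in> {0..T}" and K: "\<And>k. k \<le> \<kappa> k" "mono \<kappa>"
    and e: "\<And>k m. \<kappa> k \<le> m \<Longrightarrow> energy m \<tau> Z - energy (\<kappa> k) \<tau> Z \<le> (1/4)^k"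
  shows "proj_upto \<tau> Z (\<lambda>\<omega>. lim (\<lambda>k. dproj (\<kappa> k) \<tau> Z \<omega>)) (\<lambda>q u. lim (\<lambda>k. dker (\<kappa> k) \<tau> Z q u))"
    (is "proj_upto \<tau> Z ?Z ?k")
proof -
  let ?f = "\<lambda>k. dproj (\<kappa> k) \<tau> Z"
  have fd: "(LINT \<omega>|M. (?f m \<omega> - ?f n \<omega>)\<^sup>2) \<le> (1/4)^n" if "n \<le> m" for n m
    using energy_diff[OF Z monoD[OF K(2) that]] e[OF monoD[OF K(2) that]] by simp
  have ZL: "?Z \<in> L2 M" by (rule L2_fast_limit(1)[OF dproj_L2 fd])
  have lim: "(LINT \<omega>|M. (?Z \<omega> - ?f k \<omega>)\<^sup>2) \<le> (1/4)^k" for k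
    by (rule L2_fast_limit(2)[OF dproj_L2 fd])
  have kd: "(LINT u|lborel. (dker (\<kappa> m) \<tau> Z q u - dker (\<kappa> n) \<tau> Z q u)\<^sup>2) \<le> (1/4)^n" if "n \<le> m" for n m q
  proof -
    have "(LINT u|lborel. (dker (\<kappa> m) \<tau> Z q u - dker (\<kappa> n) \<tau> Z q u)\<^sup>2) \<le>
      (\<Sum>q\<in>UNIV. LINT u|lborel. (dker (\<kappa> m) \<tau> Z q u - dker (\<kappa> n) \<tau> Z q u)\<^sup>2)"
      by (rule member_le_sum) auto
    then show ?thesis unfolding dker_diff_isometry using fd[OF that] by simp
  qed
  have dkL: "dker n \<tau> Z q \<in> L2 lborel" for n q unfolding dker_def by (rule stepf_L2)
  have kL: "?k q \<in> L2 lborel" for q by (rule L2_fast_limit(1)[OF dkL kd])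
  have klim: "(LINT u|lborel. (?k q u - dker (\<kappa> k) \<tau> Z q u)\<^sup>2) \<le> (1/4)^k" for q k
    by (rule L2_fast_limit(2)[OF dkL kd])
  have small: "\<exists>k\<ge>k0. (1/4)^k \<le> e" if "e > 0" for e :: real and k0 :: nat
  proof -
    obtain k where "(1/4)^k < e" using real_arch_pow_inv[of e "1/4"] \<open>e > 0\<close> by auto
    moreover have "(1/4::real)^(max k k0) \<le> (1/4)^k" by (rule power_decreasing) auto
    ultimately have "(1/4)^(max k k0) \<le> e" by linarith
    then show ?thesis using max.cobounded2 by blast
  qed
  \<comment> \<open>Stated for \<open>Y - ?Z\<close>, with orthogonality from some \<open>k0\<close>
    on: this covers the residual \<open>Z - ?Z\<close> tested on a fixed dyadic increment and, with
    \<open>Y = 0\<close>, the limit itself.\<close>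
  have lo: "(\<lambda>\<omega>. Y \<omega> - ?Z \<omega>) \<in> orth M S"
    if "S \<subseteq> L2 M" "Y \<in> L2 M" "\<And>k. k \<ge> k0 \<Longrightarrow> (\<lambda>\<omega>. Y \<omega> - ?f k \<omega>) \<in> orth M S" for S Y k0
  proof (rule orth_limit[OF that(1)])
    show "(\<lambda>\<omega>. Y \<omega> - ?Z \<omega>) \<in> borel_measurable M" using L2_meas[OF L2_diff[OF that(2) ZL]] .
    fix e :: real assume "e > 0"
    then obtain k where k: "k \<ge> k0" "(1/4)^k \<le> e" using small by blast
    have "(\<integral>\<^sup>+\<omega>. ennreal ((Y \<omega> - ?Z \<omega> - (Y \<omega> - ?f k \<omega>))\<^sup>2) \<partial>M) = (\<integral>\<^sup>+\<omega>. ennreal ((?Z \<omega> - ?f k \<omega>)\<^sup>2) \<partial>M)"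
      by (simp add: power2_commute)
    also have "\<dots> \<le> ennreal e"
      unfolding nn_eq_LINT_sq[OF L2_diff[OF ZL dproj_L2]] using lim[of k] k(2) by (intro ennreal_leI) simp
    finally show "\<exists>Q\<in>orth M S. (\<integral>\<^sup>+\<omega>. ennreal ((Y \<omega> - ?Z \<omega> - Q \<omega>)\<^sup>2) \<partial>M) \<le> ennreal e"
      using that(3)[OF k(1)] by (intro bexI)
  qed
  have lo0: "?Z \<in> orth M S" if "S \<subseteq> L2 M" "\<And>k. ?f k \<in> orth M S" for S
  proof -
    have "(\<lambda>\<omega>. 0 - ?Z \<omega>) \<in> orth M S"
      using orth_cmult[OF that(2), of "-1"] by (intro lo[of S "\<lambda>_. 0" 0] that(1) L2_zero) simp
    from orth_cmult[OF this, of "-1"] show ?thesis by simp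
  qed
  have p1: "?Z \<in> orth M (orth M gens)" by (intro lo0 orth_subset_L2 dproj_gens)
  have m: "(\<lambda>\<omega>. Z \<omega> - ?Z \<omega>) \<in> orth M {\<lambda>_. 1}"
  proof (rule lo[of _ _ 0])
    show "(\<lambda>\<omega>. Z \<omega> - ?f k \<omega>) \<in> orth M {\<lambda>_. 1}" for k
      using Z dproj_L2 by (simp add: orth_def L2_diff L2_int dproj_mean)
  qed (use L2_one Z in auto)
  then have p2: "(LINT \<omega>|M. ?Z \<omega>) = (LINT \<omega>|M. Z \<omega>)"
    using Z ZL by (simp add: orth_def L2_int)
  have "(LINT \<omega>|M. (Z \<omega> - ?Z \<omega>) * cinc n i \<omega>) = 0" if i: "i \<in> cells n \<tau>" for n i
  proof -
    have "(\<lambda>\<omega>. Z \<omega> - ?Z \<omega>) \<in> orth M {cinc n i}"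
    proof (rule lo[of _ _ n])
      show "(\<lambda>\<omega>. Z \<omega> - ?f k \<omega>) \<in> orth M {cinc n i}" if "k \<ge> n" for k
        using K(1)[of k] that by (intro resid_orth Z i) simp
    qed (use cinc_L2[OF i] Z in auto)
    then show ?thesis by (simp add: orth_def)
  qed
  then have p3: "(LINT \<omega>|M. (Z \<omega> - ?Z \<omega>) * B q u \<omega>) = 0" if "u \<in> {0..\<tau>}" for q u
    using that tau by (intro dyadic_orth[where \<tau>=\<tau>] L2_diff Z ZL) auto
  have p4: "(LINT \<omega>|M. ?Z \<omega> * inc q \<tau> u \<omega>) = 0" if u: "u \<in> {\<tau>..T}" for q u
  proof -
    have uT: "u \<in> {0..T}" using u tau by auto
    have iL: "inc q \<tau> u \<in> L2 M" using tau uT by (intro inc_L2)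
    have c: "cinc n i \<in> orth M {inc q \<tau> u}" if i: "i \<in> cells n \<tau>" for n i
    proof -
      have "grid n (Suc (snd i)) \<le> \<tau>" using i by (auto simp: cells_def)
      then have "(LINT \<omega>|M. cinc n i \<omega> * inc q \<tau> u \<omega>) = 0"
        unfolding cinc_def using cells_grid[OF i] u uT tau by (subst inc_cov) auto
      then show ?thesis using cinc_L2[OF i] by (simp add: orth_def)
    qed
    have "(\<lambda>_. d) \<in> orth M {inc q \<tau> u}" for d
      using inc_mean[OF tau uT] by (simp add: orth_def L2_one)
    then have "?f k \<in> orth M {inc q \<tau> u}" for k
      unfolding dproj_def[abs_def] using iL by (intro orth_add orth_sum orth_cmult c) auto
    then have "?Z \<in> orth M {inc q \<tau> u}" using iL by (intro lo0) auto
    then show ?thesis by (simp add: orth_def)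
  qed
  \<comment> \<open>This holds at every such \<open>u\<close> and not just almost everywhere: each
    \<open>dker\<close> vanishes there, and \<open>lim\<close> of the zero sequence is 0.\<close>
  have p6: "?k q u = 0" if "u \<notin> {0<..\<tau>}" for q u
  proof -
    have "dker n \<tau> Z q u = 0" for n
      unfolding dker_def stepf_def
    proof (intro sum.neutral ballI)
      fix i assume i: "i \<in> cells n \<tau>"
      have "{grid n (snd i)<..grid n (Suc (snd i))} \<subseteq> {0<..\<tau>}"
        using cells_grid[OF i] i by (auto simp: cells_def)
      then show "coef n Z i * (if fst i = q then indicator {grid n (snd i)<..grid n (Suc (snd i))} u else 0) = 0"
        using that by (auto simp: indicator_def)
    qed
    then show ?thesis by simp
  qed
  have p7: "ennreal (LINT \<omega>|M. (?Z \<omega> - (LINT \<omega>|M. Z \<omega>) - (\<Sum>i\<in>I. c i * inc (q i) (a i) (b i) \<omega>))\<^sup>2)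
         \<le> 4 * ennreal (\<Sum>p\<in>UNIV. LINT u|lborel. (?k p u - stepf c I q a b p u)\<^sup>2)"
    if I: "finite I" and ab: "\<And>i. i \<in> I \<Longrightarrow> a i \<in> {0..T} \<and> b i \<in> {0..T} \<and> a i \<le> b i"
    for I c and q :: "nat \<times> 'q \<Rightarrow> 'q" and a b
  proof -
    let ?S = "\<lambda>\<omega>. (LINT \<omega>|M. Z \<omega>) + (\<Sum>i\<in>I. c i * inc (q i) (a i) (b i) \<omega>)"
    let ?E = "LINT \<omega>|M. (?Z \<omega> - ?S \<omega>)\<^sup>2"
    let ?F = "\<Sum>p\<in>UNIV. LINT u|lborel. (?k p u - stepf c I q a b p u)\<^sup>2"
    have SL: "?S \<in> L2 M" using ab by (intro L2_add L2_one L2_sum L2_cmult inc_L2) auto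
    \<comment> \<open>Going from \<open>?Z\<close> to its approximation and from the approximating
      kernel to \<open>?k\<close> doubles \<open>?F\<close> twice. The errors of \<open>?Z\<close>
      and of the \<open>CARD('q')\<close> kernel components make up the term that vanishes with
      \<open>k\<close>.\<close>
    have main: "?E \<le> (2 + 4 * CARD('q)) * (1/4)^k + 4 * ?F" for k
    proof -
      let ?J = "cells (\<kappa> k) \<tau> <+> I"
      let ?c = "case_sum (coef (\<kappa> k) Z) (\<lambda>i. - c i)"
      let ?q = "case_sum fst q"
      let ?a = "case_sum (\<lambda>i. grid (\<kappa> k) (snd i)) a"
      let ?b = "case_sum (\<lambda>i. grid (\<kappa> k) (Suc (snd i))) b"
      have 1: "(\<Sum>i\<in>?J. ?c i * inc (?q i) (?a i) (?b i) \<omega>) = ?f k \<omega> - ?S \<omega>" for \<omega>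
        using I by (subst sum.Plus) (auto simp: finite_cells dproj_def cinc_def sum_negf o_def)
      have 2: "stepf ?c ?J ?q ?a ?b p u = dker (\<kappa> k) \<tau> Z p u - stepf c I q a b p u" for p u
        using I unfolding stepf_def dker_def by (subst sum.Plus) (auto simp: finite_cells sum_negf o_def cong: if_cong)
      have fin: "finite ?J" using I by (simp add: finite_cells)
      have ab': "?a i \<in> {0..T} \<and> ?b i \<in> {0..T} \<and> ?a i \<le> ?b i" if "i \<in> ?J" for i
      proof (cases i)
        case (Inl x)
        then have "x \<in> cells (\<kappa> k) \<tau>" using that by auto
        then show ?thesis using cells_grid[of x] Inl by simp
      next
        case (Inr x)
        then have "x \<in> I" using that by auto
        then show ?thesis using ab[of x] Inr by simp
      qed
      have iso: "(LINT \<omega>|M. (?f k \<omega> - ?S \<omega>)\<^sup>2) = (\<Sum>p\<in>UNIV. LINT u|lborel. (dker (\<kappa> k) \<tau> Z p u - stepf c I q a b p u)\<^sup>2)"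
        using isometry[where I="?J" and c="?c" and q="?q" and a="?a" and b="?b", OF fin ab'] unfolding 1 2 .
      have "(LINT u|lborel. (dker (\<kappa> k) \<tau> Z p u - stepf c I q a b p u)\<^sup>2)
         \<le> 2 * (1/4)^k + 2 * (LINT u|lborel. (?k p u - stepf c I q a b p u)\<^sup>2)" for p
      proof -
        have "(LINT u|lborel. (dker (\<kappa> k) \<tau> Z p u - ?k p u)\<^sup>2) \<le> (1/4)^k"
          unfolding power2_commute[of "dker (\<kappa> k) \<tau> Z p u" for u] by (rule klim)
        then show ?thesis
          using LINT_sq_diff_le[OF dkL[of "\<kappa> k" p] kL[of p] stepf_L2[of c I q a b p]] by linarith
      qed
      then have "(LINT \<omega>|M. (?f k \<omega> - ?S \<omega>)\<^sup>2) \<le> (\<Sum>p\<in>UNIV. 2 * (1/4)^k + 2 * (LINT u|lborel. (?k p u - stepf c I q a b p u)\<^sup>2))"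
        unfolding iso by (intro sum_mono)
      also have "\<dots> = CARD('q) * (2 * (1/4)^k) + 2 * ?F"
        by (simp add: sum.distrib sum_distrib_left)
      finally have 3: "(LINT \<omega>|M. (?f k \<omega> - ?S \<omega>)\<^sup>2) \<le> CARD('q) * (2 * (1/4)^k) + 2 * ?F" .
      have "?E \<le> 2 * (LINT \<omega>|M. (?Z \<omega> - ?f k \<omega>)\<^sup>2) + 2 * (LINT \<omega>|M. (?f k \<omega> - ?S \<omega>)\<^sup>2)"
        by (rule LINT_sq_diff_le[OF ZL dproj_L2 SL])
      also have "\<dots> \<le> 2 * (1/4)^k + 2 * (CARD('q) * (2 * (1/4)^k) + 2 * ?F)"
        by (intro add_mono mult_left_mono lim 3) simp_all
      also have "\<dots> = (2 + 4 * CARD('q)) * (1/4)^k + 4 * ?F" by (simp add: algebra_simps)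
      finally show ?thesis .
    qed
    have z: "(\<lambda>k. (1/4::real)^k) \<longlonglongrightarrow> 0" by (rule LIMSEQ_power_zero) simp
    have "(\<lambda>k. (2 + 4 * CARD('q)) * (1/4)^k + 4 * ?F) \<longlonglongrightarrow> real (2 + 4 * CARD('q)) * 0 + 4 * ?F"
      by (intro tendsto_add tendsto_mult tendsto_const z)
    then have "?E \<le> 4 * ?F" using main by (intro LIMSEQ_le_const) auto
    then have "ennreal ?E \<le> 4 * ennreal ?F"
      by (simp add: ennreal_leI ennreal_mult'[symmetric] sum_nonneg flip: ennreal_numeral)
    then show ?thesis by (simp add: diff_diff_eq)
  qed
  show ?thesis
    unfolding proj_upto_def using p1 p2 p3 p4 kL p6 p7 by blast
qed


text \<open>The dyadic level is chosen measurably in \<open>t\<close> and so large that the approximations converge at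
  a geometric rate. The limit then exists for every \<open>t\<close>, not only for almost every \<open>t\<close>.\<close>

lemma exists_measurable_projection:
  fixes Z :: "'a \<Rightarrow> 'w \<Rightarrow> real"
  assumes Zm: "(\<lambda>(t, \<omega>). Z t \<omega>) \<in> borel_measurable (\<A> \<Otimes>\<^sub>M M)"
    and taum[measurable]: "\<tau> \<in> borel_measurable \<A>" and tau: "\<And>t. t \<in> space \<A> \<Longrightarrow> \<tau> t \<in> {0..T}"
  obtains Z' k where "(\<lambda>(t, \<omega>). Z' t \<omega>) \<in> borel_measurable (\<A> \<Otimes>\<^sub>M M)"
    "\<And>q. (\<lambda>(t, u). k t q u) \<in> borel_measurable (\<A> \<Otimes>\<^sub>M borel)"
    "\<And>t. t \<in> space \<A> \<Longrightarrow> Z t \<in> L2 M \<Longrightarrow> proj_upto (\<tau> t) (Z t) (Z' t) (k t)"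
proof -
  note [measurable] = Zm
  let ?C = "\<lambda>n. (UNIV :: 'q set) \<times> {..<2^n :: nat}"
  have cm: "cinc n i \<in> borel_measurable M" if "i \<in> ?C n" for n i
  proof -
    have "i \<in> cells n T" using that grid_mem[of "Suc (snd i)" n] by (auto simp: cells_def)
    then show ?thesis by (intro L2_meas cinc_L2)
  qed
  \<comment> \<open>The sum now runs over a fixed index set, with the dependence on time moved into
    a condition, so it is measurable in \<open>t\<close> term by term.\<close>
  have cellsum: "(\<Sum>i\<in>cells n t. g i) = (\<Sum>i\<in>?C n. if grid n (Suc (snd i)) \<le> t then g i else 0)" for n t and g :: "'q \<times> nat \<Rightarrow> real"
    by (subst sum.inter_filter[symmetric]) (auto simp: cells_def intro!: sum.cong)
  have coefm: "(\<lambda>t. coef n (Z t) i) \<in> borel_measurable \<A>" if "i \<in> ?C n" for n i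
  proof -
    note [measurable] = cm[OF that]
    show ?thesis unfolding coef_def by measurable
  qed
  have meanm[measurable]: "(\<lambda>t. LINT \<omega>|M. Z t \<omega>) \<in> borel_measurable \<A>" by measurable
  have dpm[measurable]: "(\<lambda>(t, \<omega>). dproj n (\<tau> t) (Z t) \<omega>) \<in> borel_measurable (\<A> \<Otimes>\<^sub>M M)" for n
  proof -
    have "(\<lambda>(t, \<omega>). if grid n (Suc (snd i)) \<le> \<tau> t then coef n (Z t) i * cinc n i \<omega> else 0) \<in> borel_measurable (\<A> \<Otimes>\<^sub>M M)"
      if i: "i \<in> ?C n" for i
    proof -
      note [measurable] = cm[OF i] coefm[OF i]
      show ?thesis by measurable
    qed
    then show ?thesis
      unfolding dproj_def cellsum case_prod_beta by (intro borel_measurable_add borel_measurable_sum) auto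
  qed
  have dkm[measurable]: "(\<lambda>(t, u). dker n (\<tau> t) (Z t) q u) \<in> borel_measurable (\<A> \<Otimes>\<^sub>M borel)" for n q
  proof -
    have "(\<lambda>(t, u). if grid n (Suc (snd i)) \<le> \<tau> t then coef n (Z t) i *
        (if fst i = q then indicator {grid n (snd i)<..grid n (Suc (snd i))} u else 0) else 0) \<in> borel_measurable (\<A> \<Otimes>\<^sub>M borel)"
      if i: "i \<in> ?C n" for i
    proof -
      note [measurable] = coefm[OF i]
      show ?thesis by measurable
    qed
    then show ?thesis
      unfolding dker_def stepf_def cellsum case_prod_beta by (intro borel_measurable_sum) auto
  qed
  have em[measurable]: "(\<lambda>t. energy n (\<tau> t) (Z t)) \<in> borel_measurable \<A>" for n
    unfolding energy_def by measurable
  \<comment> \<open>From such a level on, the energy grows by no more than the required rate. This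
    is a countable conjunction of measurable conditions, so the \<open>LEAST\<close> level is
    measurable in \<open>t\<close>.\<close>
  define P where "P k t N \<longleftrightarrow> k \<le> N \<and> (\<forall>m\<ge>N. energy m (\<tau> t) (Z t) - energy N (\<tau> t) (Z t) \<le> (1/4)^k)" for k t N
  define \<kappa> where "\<kappa> k t = (LEAST N. P k t N)" for k t
  have km[measurable]: "\<kappa> k \<in> measurable \<A> (count_space UNIV)" for k
    unfolding \<kappa>_def P_def by measurable
  define Z' where "Z' t \<omega> = lim (\<lambda>k. dproj (\<kappa> k t) (\<tau> t) (Z t) \<omega>)" for t \<omega>
  define K where "K t q u = lim (\<lambda>k. dker (\<kappa> k t) (\<tau> t) (Z t) q u)" for t q u
  have "(\<lambda>(t, \<omega>). Z' t \<omega>) \<in> borel_measurable (\<A> \<Otimes>\<^sub>M M)"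
  proof -
    have "(\<lambda>x. (\<lambda>(t, \<omega>). dproj (\<kappa> k (fst x)) (\<tau> t) (Z t) \<omega>) x) \<in> borel_measurable (\<A> \<Otimes>\<^sub>M M)" for k
      by (rule measurable_compose_countable[where f="\<lambda>n x. (\<lambda>(t, \<omega>). dproj n (\<tau> t) (Z t) \<omega>) x" and g="\<lambda>x. \<kappa> k (fst x)"]) measurable
    then show ?thesis unfolding Z'_def case_prod_beta by (rule borel_measurable_lim_metric)
  qed
  moreover have "(\<lambda>(t, u). K t q u) \<in> borel_measurable (\<A> \<Otimes>\<^sub>M borel)" for q
  proof -
    have "(\<lambda>x. (\<lambda>(t, u). dker (\<kappa> k (fst x)) (\<tau> t) (Z t) q u) x) \<in> borel_measurable (\<A> \<Otimes>\<^sub>M borel)" for k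
      by (rule measurable_compose_countable[where f="\<lambda>n x. (\<lambda>(t, u). dker n (\<tau> t) (Z t) q u) x" and g="\<lambda>x. \<kappa> k (fst x)"]) measurable
    then show ?thesis unfolding K_def case_prod_beta by (rule borel_measurable_lim_metric)
  qed
  moreover have "proj_upto (\<tau> t) (Z t) (Z' t) (K t)" if t: "t \<in> space \<A>" and ZL: "Z t \<in> L2 M" for t
  proof -
    let ?e = "\<lambda>n. energy n (\<tau> t) (Z t)"
    have inc: "incseq ?e"
    proof (rule incseq_SucI)
      fix n
      have "0 \<le> (LINT \<omega>|M. (dproj (Suc n) (\<tau> t) (Z t) \<omega> - dproj n (\<tau> t) (Z t) \<omega>)\<^sup>2)" by simp
      then show "?e n \<le> ?e (Suc n)" using energy_diff[OF ZL, of n "Suc n" "\<tau> t"] by simp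
    qed
    obtain L where L: "?e \<longlonglongrightarrow> L" "\<And>n. ?e n \<le> L"
      using incseq_convergent[OF inc] energy_bound[OF ZL] by blast
    have ex: "\<exists>N. P k t N" for k
    proof -
      have "\<forall>\<^sub>F n in sequentially. L - (1/4)^k < ?e n" using L(1) by (rule order_tendstoD) simp
      then obtain N0 where N0: "\<And>n. n \<ge> N0 \<Longrightarrow> L - (1/4)^k < ?e n" by (auto simp: eventually_sequentially)
      have "?e m - ?e (max N0 k) \<le> (1/4)^k" for m
        using N0[of "max N0 k"] L(2)[of m] by simp
      then have "P k t (max N0 k)" by (simp add: P_def)
      then show ?thesis ..
    qed
    then have PK: "P k t (\<kappa> k t)" for k unfolding \<kappa>_def by (rule LeastI_ex)
    \<comment> \<open>A level good enough for \<open>l\<close> is good enough for every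
      \<open>k \<le> l\<close>, hence the least ones are ordered.\<close>
    have "mono (\<lambda>k. \<kappa> k t)"
    proof (rule monoI)
      fix k l :: nat assume kl: "k \<le> l"
      have "(1/4::real)^l \<le> (1/4)^k" using kl by (intro power_decreasing) auto
      then have "P k t (\<kappa> l t)" using PK[of l] kl unfolding P_def by (meson order_trans)
      then show "\<kappa> k t \<le> \<kappa> l t" unfolding \<kappa>_def[of k] by (rule Least_le)
    qed
    then show ?thesis
      unfolding Z'_def K_def using PK by (intro proj_limit ZL tau t) (auto simp: P_def)
  qed
  ultimately show ?thesis by (rule that)
qed

end

section \<open>Brownian motions with independent blocks\<close>


lemma space_history[simp]: "space (history M Z t) = space M"
  by (simp add: history_def)

lemma history_coord:
  assumes "s \<in> {0..t}"
  shows "Z s \<in> borel_measurable (history M Z t)"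
proof -
  have "(\<lambda>\<omega>. (\<lambda>s\<in>{0..t}. Z s \<omega>) s) \<in> borel_measurable (history M Z t)"
    unfolding history_def
    by (rule measurable_compose[OF measurable_vimage_algebra1 measurable_component_singleton[OF assms]])
      (auto simp: space_PiM)
  then show ?thesis using assms by simp
qed

lemma history_least:
  assumes "\<And>s. s \<in> {0..t} \<Longrightarrow> Z s \<in> borel_measurable K" "space K = space M"
  shows "sets (history M Z t) \<subseteq> sets K"
proof -
  have m: "(\<lambda>\<omega>. \<lambda>s\<in>{0..t}. Z s \<omega>) \<in> measurable K (PiM {0..t} (\<lambda>_. borel))"
    by (intro measurable_restrict assms)
  have "(\<lambda>\<omega>. \<lambda>s\<in>{0..t}. Z s \<omega>) \<in> space M \<rightarrow> space (PiM {0..t} (\<lambda>_. borel))"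
    by (auto simp: space_PiM)
  then show ?thesis
    unfolding history_def using measurable_sets[OF m] assms(2) by (auto simp: sets_vimage_algebra2)
qed

lemma history_subalgebra:
  assumes "\<And>s. s \<in> {0..t} \<Longrightarrow> Z s \<in> borel_measurable M"
  shows "subalgebra M (history M Z t)"
  using history_least[of t Z M M] assms by (auto simp: subalgebra_def)

context prob_space
begin

text \<open>Independence is a property of the generated sigma-algebras, so it passes to functions
  measurable with respect to them, also when these are not written as compositions.\<close>

lemma indep_vars_of_vimage:
  assumes X: "indep_vars N X I"
    and f: "\<And>i. i \<in> I \<Longrightarrow> f i \<in> borel_measurable (vimage_algebra (space M) (X i) (N i))"
  shows "indep_vars (\<lambda>_. borel) f I"
  unfolding indep_vars_def2
proof (intro conjI ballI)
  have Xm: "X i \<in> measurable M (N i)" if "i \<in> I" for i using X that by (auto simp: indep_vars_def2)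
  have s: "sets (vimage_algebra (space M) (X i) (N i)) = {X i -` A \<inter> space M |A. A \<in> sets (N i)}" if "i \<in> I" for i
    using Xm[OF that] by (intro sets_vimage_algebra2) (auto dest: measurable_space)
  have "sets (vimage_algebra (space M) (X i) (N i)) \<subseteq> sets M" if "i \<in> I" for i
    unfolding s[OF that] using measurable_sets[OF Xm[OF that]] by auto
  then have sub: "subalgebra M (vimage_algebra (space M) (X i) (N i))" if "i \<in> I" for i
    using that by (auto simp: subalgebra_def)
  show "f i \<in> borel_measurable M" if "i \<in> I" for i
    by (rule measurable_from_subalg[OF sub[OF that] f[OF that]])
  have "indep_sets (\<lambda>i. {X i -` A \<inter> space M |A. A \<in> sets (N i)}) I" using X by (simp add: indep_vars_def2)
  then show "indep_sets (\<lambda>i. {f i -` A \<inter> space M |A. A \<in> sets borel}) I"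
  proof (rule indep_sets_mono_sets)
    fix i assume i: "i \<in> I"
    show "{f i -` A \<inter> space M |A. A \<in> sets borel} \<subseteq> {X i -` A \<inter> space M |A. A \<in> sets (N i)}"
      unfolding s[OF i, symmetric] using measurable_sets[OF f[OF i]] by auto
  qed
qed

lemma indep_var_of_indep_set:
  assumes X: "X \<in> borel_measurable M" and f: "f \<in> borel_measurable K" and K: "subalgebra M K"
    and ind: "indep_set (sets (vimage_algebra (space M) X borel)) (sets K)"
  shows "indep_var borel X borel f"
  unfolding indep_var_eq indep_set_def
proof (intro conjI X measurable_from_subalg[OF K f])
  show "indep_sets (case_bool (sigma_sets (space M) {X -` A \<inter> space M |A. A \<in> sets borel})
     (sigma_sets (space M) {f -` A \<inter> space M |A. A \<in> sets borel})) UNIV"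
  proof (rule indep_sets_mono_sets[OF ind[unfolded indep_set_def]])
    have "sigma_sets (space M) {X -` A \<inter> space M |A. A \<in> sets borel} \<subseteq> sets (vimage_algebra (space M) X borel)"
      by (simp add: sets_vimage_algebra)
    moreover have "sigma_sets (space M) {f -` A \<inter> space M |A. A \<in> sets borel} \<subseteq> sets K"
      using K measurable_sets[OF f] sets.sigma_sets_subset[of "{f -` A \<inter> space M |A. A \<in> sets borel}" K]
      by (auto simp: subalgebra_def)
    ultimately show "case_bool (sigma_sets (space M) {X -` A \<inter> space M |A. A \<in> sets borel})
      (sigma_sets (space M) {f -` A \<inter> space M |A. A \<in> sets borel}) i
      \<subseteq> case_bool (sets (vimage_algebra (space M) X borel)) (sets K) i" for i
      by (cases i) auto
  qed
qed

lemma normal_increment_moments: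
  assumes r: "0 < r" and D: "distributed M lborel X (\<lambda>x. ennreal (normal_density 0 (sqrt r) x))"
  shows "X \<in> L2 M" "expectation X = 0" "expectation (\<lambda>\<omega>. (X \<omega>)\<^sup>2) = r"
proof -
  have m: "X \<in> borel_measurable M" using distributed_measurable[OF D] by simp
  have s: "sqrt r > 0" using r by simp
  show E: "expectation X = 0" using normal_distributed_expectation[OF s D] .
  show "expectation (\<lambda>\<omega>. (X \<omega>)\<^sup>2) = r" using normal_distributed_variance[OF s D] E r by simp
  have "integrable lborel (\<lambda>x. normal_density 0 (sqrt r) x * x^2)"
    using integrable_normal_moment[OF s, of 0 2] by simp
  then have "integrable M (\<lambda>\<omega>. (X \<omega>)^2)"
    using distributed_integrable[OF D, of "\<lambda>x. x^2"] by simp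
  then show "X \<in> L2 M" using m by (rule L2_I[rotated])
qed

lemma scalar_brownian_history:
  assumes B: "scalar_brownian M T B" and t: "0 \<le> t" "t \<le> T"
  shows "subalgebra M (history M B t)"
  using B t by (intro history_subalgebra) (auto simp: scalar_brownian_def)

lemma scalar_brownian_increment:
  assumes B: "scalar_brownian M T B" and st: "0 \<le> s" "s \<le> t" "t \<le> T"
  shows "(\<lambda>\<omega>. B t \<omega> - B s \<omega>) \<in> L2 M" "expectation (\<lambda>\<omega>. B t \<omega> - B s \<omega>) = 0"
    "expectation (\<lambda>\<omega>. (B t \<omega> - B s \<omega>)\<^sup>2) = t - s"
    "f \<in> L2 M \<Longrightarrow> f \<in> borel_measurable (history M B s) \<Longrightarrow> expectation (\<lambda>\<omega>. (B t \<omega> - B s \<omega>) * f \<omega>) = 0"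
proof -
  have *: "(\<lambda>\<omega>. B t \<omega> - B s \<omega>) \<in> L2 M \<and> expectation (\<lambda>\<omega>. B t \<omega> - B s \<omega>) = 0 \<and>
    expectation (\<lambda>\<omega>. (B t \<omega> - B s \<omega>)\<^sup>2) = t - s \<and>
    (f \<in> L2 M \<longrightarrow> f \<in> borel_measurable (history M B s) \<longrightarrow> expectation (\<lambda>\<omega>. (B t \<omega> - B s \<omega>) * f \<omega>) = 0)"
  \<comment> \<open>\<open>scalar_brownian\<close> speaks of \<open>s < t\<close> only; for
    \<open>s = t\<close> the increment is zero.\<close>
  proof (cases "s = t")
    case True then show ?thesis by (simp add: L2_zero)
  next
    case False
    then have lt: "s < t" using st by simp
    then have D: "distributed M lborel (\<lambda>\<omega>. B t \<omega> - B s \<omega>) (\<lambda>x. ennreal (normal_density 0 (sqrt (t - s)) x))"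
      and ind: "indep_set (sets (vimage_algebra (space M) (\<lambda>\<omega>. B t \<omega> - B s \<omega>) borel)) (sets (history M B s))"
      using B st unfolding scalar_brownian_def by auto
    have mom: "(\<lambda>\<omega>. B t \<omega> - B s \<omega>) \<in> L2 M" "expectation (\<lambda>\<omega>. B t \<omega> - B s \<omega>) = 0"
      "expectation (\<lambda>\<omega>. (B t \<omega> - B s \<omega>)\<^sup>2) = t - s"
      using normal_increment_moments[OF _ D] lt by auto
    have "expectation (\<lambda>\<omega>. (B t \<omega> - B s \<omega>) * f \<omega>) = 0" if f: "f \<in> L2 M" "f \<in> borel_measurable (history M B s)"
    proof -
      have "indep_var borel (\<lambda>\<omega>. B t \<omega> - B s \<omega>) borel f"
        using st by (intro indep_var_of_indep_set[OF L2_meas[OF mom(1)] f(2) _ ind] scalar_brownian_history[OF B]) auto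
      then show ?thesis
        using mom f by (subst indep_var_lebesgue_integral) (auto intro: L2_integrable finite_measure_axioms)
    qed
    then show ?thesis using mom by blast
  qed
  show "(\<lambda>\<omega>. B t \<omega> - B s \<omega>) \<in> L2 M" "expectation (\<lambda>\<omega>. B t \<omega> - B s \<omega>) = 0"
    "expectation (\<lambda>\<omega>. (B t \<omega> - B s \<omega>)\<^sup>2) = t - s"
    "f \<in> L2 M \<Longrightarrow> f \<in> borel_measurable (history M B s) \<Longrightarrow> expectation (\<lambda>\<omega>. (B t \<omega> - B s \<omega>) * f \<omega>) = 0"
    using * by auto
qed

lemma scalar_brownian_moments:
  assumes B: "scalar_brownian M T B" and st: "0 \<le> s" "s \<le> t" "t \<le> T"
  shows "B t \<in> L2 M" "expectation (B t) = 0" "expectation (\<lambda>\<omega>. B s \<omega> * B t \<omega>) = s"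
proof -
  have zero: "AE \<omega> in M. B 0 \<omega> = 0" and m[measurable]: "\<And>u. u \<in> {0..T} \<Longrightarrow> B u \<in> borel_measurable M"
    using B by (auto simp: scalar_brownian_def)
  \<comment> \<open>\<open>B 0\<close> vanishes only almost everywhere, so \<open>B u\<close> is a
    version of the increment from time 0 and inherits its moments.\<close>
  have L: "B u \<in> L2 M" if u: "0 \<le> u" "u \<le> T" for u
    by (rule L2_cong_AE[OF scalar_brownian_increment(1)[OF B order_refl u]]) (use zero m u in auto)
  show "B t \<in> L2 M" using L st by simp
  have tm: "B t \<in> borel_measurable M" "B 0 \<in> borel_measurable M" "B s \<in> borel_measurable M" using m st by auto
  have "expectation (B t) = expectation (\<lambda>\<omega>. B t \<omega> - B 0 \<omega>)"
    using zero tm by (intro integral_cong_AE) auto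
  then show "expectation (B t) = 0" using scalar_brownian_increment(2)[OF B order_refl] st by simp
  have "expectation (\<lambda>\<omega>. (B s \<omega>)\<^sup>2) = expectation (\<lambda>\<omega>. (B s \<omega> - B 0 \<omega>)\<^sup>2)"
    using zero tm by (intro integral_cong_AE) auto
  then have ss: "expectation (\<lambda>\<omega>. (B s \<omega>)\<^sup>2) = s"
    using scalar_brownian_increment(3)[OF B order_refl, of s] st by simp
  have sL: "B s \<in> L2 M" using L st by simp
  have "expectation (\<lambda>\<omega>. B s \<omega> * B t \<omega>) = expectation (\<lambda>\<omega>. (B s \<omega>)\<^sup>2 + (B t \<omega> - B s \<omega>) * B s \<omega>)"
    by (simp add: power2_eq_square algebra_simps)
  also have "\<dots> = expectation (\<lambda>\<omega>. (B s \<omega>)\<^sup>2) + expectation (\<lambda>\<omega>. (B t \<omega> - B s \<omega>) * B s \<omega>)"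
    by (intro Bochner_Integration.integral_add L2_sq_int sL L2_prod_integrable scalar_brownian_increment(1)[OF B st])
  also have "expectation (\<lambda>\<omega>. (B t \<omega> - B s \<omega>) * B s \<omega>) = 0"
    using st by (intro scalar_brownian_increment(4)[OF B st] sL history_coord) auto
  finally show "expectation (\<lambda>\<omega>. B s \<omega> * B t \<omega>) = s" using ss by simp
qed

end

section \<open>The whole noise vector as a white noise\<close>

lemma block_nth: "(block j *v v) $ a = v $ (j, a)"
  by (simp add: block_def matrix_vector_mult_def if_distrib[of "\<lambda>x. x * _"] cong: if_cong)

locale brownian_blocks = prob_space M for M :: "'w measure" +
  fixes T :: real and W :: "real \<Rightarrow> 'w \<Rightarrow> ('d::finite, 'n::finite) noise_vec"
  assumes T0: "0 < T"
    and W_block: "\<And>j. brownian M T (\<lambda>t \<omega>. block j *v W t \<omega>)"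
    and W_indep: "indep_vars (\<lambda>_. PiM {0..T} (\<lambda>_. borel)) (\<lambda>j \<omega>. \<lambda>t\<in>{0..T}. block j *v W t \<omega>) UNIV"
begin

abbreviation Wc :: "'n option \<times> 'd \<Rightarrow> real \<Rightarrow> 'w \<Rightarrow> real" where
  "Wc p t \<omega> \<equiv> W t \<omega> $ p"

lemma W_scalar: "scalar_brownian M T (Wc p)"
  using W_block[of "fst p"] by (simp add: brownian_def block_nth) (metis prod.collapse)

text \<open>Independence comes in two layers, between the blocks and between the coordinates of one
  block. The layers are combined on expectations of products, which is the form in which
  independence is used below.\<close>

lemma product_expectation:
  fixes f :: "'n option \<times> 'd \<Rightarrow> 'w \<Rightarrow> real"
  assumes f: "\<And>p. f p \<in> borel_measurable (history M (Wc p) T)" and i: "\<And>p. integrable M (f p)"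
  shows "expectation (\<lambda>\<omega>. \<Prod>p\<in>UNIV. f p \<omega>) = (\<Prod>p\<in>UNIV. expectation (f p))"
    "integrable M (\<lambda>\<omega>. \<Prod>p\<in>UNIV. f p \<omega>)"
proof -
  have flat: "(\<Prod>p\<in>UNIV. g p) = (\<Prod>j\<in>UNIV. \<Prod>a\<in>UNIV. g (j, a))" for g :: "'n option \<times> 'd \<Rightarrow> real"
    using prod.cartesian_product'[of g UNIV UNIV] by simp
  have inner: "indep_vars (\<lambda>_. borel) (\<lambda>a. f (j, a)) UNIV" for j
  proof (rule indep_vars_of_vimage)
    show "indep_vars (\<lambda>_. PiM {0..T} (\<lambda>_. borel)) (\<lambda>a \<omega>. \<lambda>t\<in>{0..T}. W t \<omega> $ (j, a)) UNIV"
      using W_block[of j] by (simp add: brownian_def block_nth)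
    show "f (j, a) \<in> borel_measurable (vimage_algebra (space M) (\<lambda>\<omega>. \<lambda>t\<in>{0..T}. W t \<omega> $ (j, a)) (PiM {0..T} (\<lambda>_. borel)))" for a
      using f[of "(j, a)"] by (simp add: history_def)
  qed
  have E: "expectation (\<lambda>\<omega>. \<Prod>a\<in>UNIV. f (j, a) \<omega>) = (\<Prod>a\<in>UNIV. expectation (f (j, a)))"
    and I: "integrable M (\<lambda>\<omega>. \<Prod>a\<in>UNIV. f (j, a) \<omega>)" for j
    by (rule indep_vars_lebesgue_integral[OF finite inner], rule i)
      (rule indep_vars_integrable[OF finite inner], rule i)
  \<comment> \<open>The product over the coordinates of block \<open>j\<close> is measurable with
    respect to the history of that block.\<close>
  have outer: "indep_vars (\<lambda>_. borel) (\<lambda>j \<omega>. \<Prod>a\<in>UNIV. f (j, a) \<omega>) UNIV"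
  proof (rule indep_vars_of_vimage[OF W_indep], fold history_def)
    fix j
    let ?H = "history M (\<lambda>t \<omega>. block j *v W t \<omega>) T"
    have sub: "sets (history M (Wc (j, a)) T) \<subseteq> sets ?H" for a
    proof (rule history_least)
      fix s assume "s \<in> {0..T}"
      then have "(\<lambda>\<omega>. (block j *v W s \<omega>) $ a) \<in> borel_measurable ?H"
        by (intro borel_measurable_vec_nth) (rule history_coord[of s T "\<lambda>t \<omega>. block j *v W t \<omega>"])
      then show "Wc (j, a) s \<in> borel_measurable ?H" by (simp add: block_nth)
    qed simp
    show "(\<lambda>\<omega>. \<Prod>a\<in>UNIV. f (j, a) \<omega>) \<in> borel_measurable ?H"
    proof (rule borel_measurable_prod)
      show "f (j, a) \<in> borel_measurable ?H" for a
      proof (rule measurable_from_subalg[OF _ f[of "(j, a)"]])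
        show "subalgebra ?H (history M (Wc (j, a)) T)" using sub by (simp add: subalgebra_def)
      qed
    qed
  qed
  show "expectation (\<lambda>\<omega>. \<Prod>p\<in>UNIV. f p \<omega>) = (\<Prod>p\<in>UNIV. expectation (f p))"
    unfolding flat using indep_vars_lebesgue_integral[OF finite outer I] E by simp
  show "integrable M (\<lambda>\<omega>. \<Prod>p\<in>UNIV. f p \<omega>)"
    unfolding flat by (rule indep_vars_integrable[OF finite outer I])
qed

lemma Wc_cov:
  assumes "u \<in> {0..T}" "s \<in> {0..T}"
  shows "expectation (\<lambda>\<omega>. Wc p u \<omega> * Wc q s \<omega>) = (if p = q then min u s else 0)"
proof (cases "p = q")
  case True
  then show ?thesis
    using assms scalar_brownian_moments(3)[OF W_scalar[of q], of u s] scalar_brownian_moments(3)[OF W_scalar[of q], of s u]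
    by (cases "u \<le> s") (auto simp: mult.commute min_def)
next
  case False
  \<comment> \<open>Constant factors 1 at the other coordinates extend the pair to a product over
    all coordinates.\<close>
  define f where "f r = (if r = p then Wc p u else if r = q then Wc q s else (\<lambda>_. 1))" for r
  have m: "f r \<in> borel_measurable (history M (Wc r) T)" for r
    using assms by (auto simp: f_def intro: history_coord)
  have L: "Wc r v \<in> L2 M" if "v \<in> {0..T}" for r v
    using scalar_brownian_moments(1)[OF W_scalar[of r], of v v] that by simp
  have "integrable M (Wc p u)" "integrable M (Wc q s)"
    by (rule L2_integrable[OF finite_measure_axioms L], fact)+
  then have i: "integrable M (f r)" for r
    by (simp add: f_def)
  have "(\<Prod>r\<in>UNIV. f r \<omega>) = f p \<omega> * (f q \<omega> * (\<Prod>r\<in>UNIV - {p} - {q}. f r \<omega>))" for \<omega>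
    using False by (subst prod.remove[of _ p], simp, simp, subst prod.remove[of _ q]) auto
  moreover have "(\<Prod>r\<in>UNIV - {p} - {q}. f r \<omega>) = 1" for \<omega>
    by (rule prod.neutral) (auto simp: f_def)
  ultimately have "(\<Prod>r\<in>UNIV. f r \<omega>) = Wc p u \<omega> * Wc q s \<omega>" for \<omega>
    using False by (simp add: f_def)
  then have "expectation (\<lambda>\<omega>. Wc p u \<omega> * Wc q s \<omega>) = (\<Prod>r\<in>UNIV. expectation (f r))"
    using product_expectation(1)[OF m i] by simp
  moreover have "expectation (f p) = 0"
    using scalar_brownian_moments(2)[OF W_scalar[of p], of u u] assms by (simp add: f_def)
  then have "(\<Prod>r\<in>UNIV. expectation (f r)) = 0" by (intro prod_zero bexI[of _ p]) simp_all
  ultimately show ?thesis using False by simp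
qed

sublocale white_noise M T Wc
proof
  show "0 < T" by (rule T0)
  show "Wc q u \<in> L2 M" "expectation (Wc q u) = 0" if "u \<in> {0..T}" for q u
    using scalar_brownian_moments(1,2)[OF W_scalar[of q], of u u] that by simp_all
qed (rule Wc_cov)

lemma W_meas: "u \<in> {0..T} \<Longrightarrow> W u \<in> borel_measurable M"
  by (simp add: borel_measurable_vec L2_meas[OF B_L2])

text \<open>\<open>scalar_brownian\<close> makes an increment independent of the past of its own
  coordinate only. Intersections of events, one from the past of each coordinate, form an
  \<open>Int_stable\<close> generator of the full history; on them the expectation factorizes, and
  the factor of coordinate \<open>p\<close> is zero. Dynkin's argument extends this to all
  events.\<close>

lemma future_orth:
  assumes tu: "0 \<le> t" "t \<le> u" "u \<le> T" and A: "A \<in> sets (history M W t)"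
  shows "expectation (\<lambda>\<omega>. indicator A \<omega> * inc p t u \<omega>) = 0"
proof -
  define G where "G = {\<Inter>p. A p | A. \<forall>p. A p \<in> sets (history M (Wc p) t)}"
  have subH: "sets (history M (Wc p) t) \<subseteq> sets M" for p
    using scalar_brownian_history[OF W_scalar] tu by (auto simp: subalgebra_def)
  have spH: "space M \<in> sets (history M (Wc p) t)" for p using sets.top[of "history M (Wc p) t"] by simp
  have GM: "G \<subseteq> sets M"
  proof
    fix A assume "A \<in> G"
    then obtain B where B: "A = (\<Inter>p. B p)" "\<forall>p. B p \<in> sets (history M (Wc p) t)" unfolding G_def by blast
    show "A \<in> sets M" unfolding B(1)
    proof (rule sets.finite_INT)
      show "B p \<in> sets M" for p using B(2) subH[of p] by blast
    qed auto
  qed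
  have GP: "G \<subseteq> Pow (space M)" using GM sets.sets_into_space by auto
  have "sets (history M W t) \<subseteq> sets (sigma (space M) G)"
  proof (rule history_least)
    fix s assume s: "s \<in> {0..t}"
    have "Wc p s \<in> borel_measurable (sigma (space M) G)" for p
    proof -
      have "sets (history M (Wc p) t) \<subseteq> G"
      proof
        fix A assume A: "A \<in> sets (history M (Wc p) t)"
        have "A \<subseteq> space M" using sets.sets_into_space[OF A] by simp
        \<comment> \<open>An event of one coordinate is padded with the sure event in all
          others.\<close>
        then have "A = (\<Inter>q. if q = p then A else space M)" by auto
        moreover have "\<forall>q. (if q = p then A else space M) \<in> sets (history M (Wc q) t)"
          using A spH by auto
        ultimately show "A \<in> G" unfolding G_def by blast
      qed
      then have "subalgebra (sigma (space M) G) (history M (Wc p) t)"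
        using GP by (auto simp: subalgebra_def intro: sigma_sets.Basic)
      then show ?thesis by (rule measurable_from_subalg) (rule history_coord[OF s])
    qed
    then show "W s \<in> borel_measurable (sigma (space M) G)" by (simp add: borel_measurable_vec)
  qed (use GP in simp)
  then have AA: "A \<in> sigma_sets (space M) G" using A GP by auto
  have IS: "Int_stable G"
  proof (rule Int_stableI)
    fix a b assume "a \<in> G" "b \<in> G"
    then obtain A B where A: "a = (\<Inter>p. A p)" "\<forall>p. A p \<in> sets (history M (Wc p) t)"
      and B: "b = (\<Inter>p. B p)" "\<forall>p. B p \<in> sets (history M (Wc p) t)" unfolding G_def by blast
    have "a \<inter> b = (\<Inter>p. A p \<inter> B p)" using A B by auto
    then show "a \<inter> b \<in> G" unfolding G_def using A(2) B(2) by (auto intro!: exI[of _ "\<lambda>p. A p \<inter> B p"])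
  qed
  have tT: "t \<in> {0..T}" "u \<in> {0..T}" using tu by auto
  note iL = inc_L2[OF tT]
  have ind_int: "integrable M (\<lambda>\<omega>. indicator A \<omega> * inc p t u \<omega>)" if "A \<in> sets M" for A
    using integrable_mult_indicator[OF that L2_int[OF iL]] by simp
  show ?thesis using IS GP AA
  proof (induction rule: sigma_sets_induct_disjoint)
    case (basic A)
    then obtain As where As: "A = (\<Inter>p. As p)" "\<And>p. As p \<in> sets (history M (Wc p) t)" unfolding G_def by blast
    \<comment> \<open>The increment is attached to its own coordinate \<open>p\<close>, where it
      meets an event of its own past.\<close>
    define f where "f q \<omega> = (indicator (As q) \<omega> * (if q = p then inc p t u \<omega> else 1) :: real)" for q \<omega>
    have sub: "subalgebra (history M (Wc q) T) (history M (Wc q) t)" for q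
    proof -
      have "sets (history M (Wc q) t) \<subseteq> sets (history M (Wc q) T)"
      proof (rule history_least)
        show "Wc q s \<in> borel_measurable (history M (Wc q) T)" if "s \<in> {0..t}" for s
          using that tu by (intro history_coord) simp
      qed simp
      then show ?thesis by (simp add: subalgebra_def)
    qed
    have AT: "As q \<in> sets (history M (Wc q) T)" for q
      using sub[of q] As(2)[of q] by (auto simp: subalgebra_def)
    have Am: "As q \<in> sets M" for q using subH[of q] As(2)[of q] by auto
    have fm: "f q \<in> borel_measurable (history M (Wc q) T)" for q
    proof -
      have "inc q t u \<in> borel_measurable (history M (Wc q) T)"
        unfolding inc_def[abs_def] using tT by (intro borel_measurable_diff history_coord)
      then show ?thesis using AT[of q] by (cases "q = p") (simp_all add: f_def[abs_def])
    qed
    have fi: "integrable M (f q)" for q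
      using ind_int[OF Am[of q]] Am[of q] emeasure_finite[of "As q"]
      by (cases "q = p") (simp_all add: f_def[abs_def] less_top[symmetric])
    have "expectation (f p) = expectation (\<lambda>\<omega>. inc p t u \<omega> * indicator (As p) \<omega>)"
      by (simp add: f_def[abs_def] mult.commute)
    also have "\<dots> = 0"
      unfolding inc_def
    proof (rule scalar_brownian_increment(4)[OF W_scalar tu])
      show "(indicator (As p) :: 'w \<Rightarrow> real) \<in> borel_measurable (history M (Wc p) t)" using As(2)[of p] by simp
      have "(\<lambda>\<omega>. (indicator (As p) \<omega>)\<^sup>2) = (indicator (As p) :: 'w \<Rightarrow> real)"
        by (auto simp: indicator_def fun_eq_iff)
      then show "(indicator (As p) :: 'w \<Rightarrow> real) \<in> L2 M"
        using Am[of p] emeasure_finite[of "As p"] by (simp add: L2_def less_top[symmetric])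
    qed
    finally have "(\<Prod>q\<in>UNIV. expectation (f q)) = 0" by (intro prod_zero bexI[of _ p]) simp_all
    moreover have "(\<Prod>q\<in>UNIV. f q \<omega>) = indicator A \<omega> * inc p t u \<omega>" for \<omega>
    proof -
      have "(\<Prod>q\<in>UNIV. f q \<omega>) = (\<Prod>q\<in>UNIV. indicator (As q) \<omega>) * (\<Prod>q\<in>UNIV. if q = p then inc p t u \<omega> else 1)"
        unfolding f_def by (rule prod.distrib)
      also have "(\<Prod>q\<in>UNIV. indicator (As q) \<omega> :: real) = indicator A \<omega>"
      proof (cases "\<omega> \<in> A")
        case True
        then have "\<omega> \<in> As q" for q unfolding As(1) by blast
        then show ?thesis using True by simp
      next
        case False
        then obtain q where "\<omega> \<notin> As q" unfolding As(1) by blast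
        then have "(\<Prod>q\<in>UNIV. indicator (As q) \<omega> :: real) = 0" by (intro prod_zero bexI[of _ q]) simp_all
        then show ?thesis using False by simp
      qed
      also have "(\<Prod>q\<in>UNIV. if q = p then inc p t u \<omega> else 1) = inc p t u \<omega>" by simp
      finally show ?thesis .
    qed
    ultimately show ?case using product_expectation(1)[OF fm fi] by simp
  next
    case empty show ?case by simp
  next
    case (compl A)
    have Am: "A \<in> sets M" using compl(1) GM by (metis sets.sigma_sets_subset subsetD)
    have "expectation (\<lambda>\<omega>. indicator (space M - A) \<omega> * inc p t u \<omega>) = expectation (\<lambda>\<omega>. inc p t u \<omega> - indicator A \<omega> * inc p t u \<omega>)"
      by (intro Bochner_Integration.integral_cong) (auto simp: indicator_def)
    also have "\<dots> = 0" using ind_int[OF Am] compl(2) inc_mean[OF tT] L2_int[OF iL] by simp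
    finally show ?case .
  next
    case (union A)
    have Am: "A i \<in> sets M" for i using union(2) GM by (metis rangeI sets.sigma_sets_subset subsetD)
    have "set_integrable M (\<Union>i. A i) (inc p t u)"
      unfolding set_integrable_def using ind_int[of "\<Union>i. A i"] Am by simp
    then have "(LINT \<omega>:(\<Union>i. A i)|M. inc p t u \<omega>) = (\<Sum>i. LINT \<omega>:A i|M. inc p t u \<omega>)"
      using union(1) Am by (intro lebesgue_integral_countable_add) (auto simp: disjoint_family_on_def)
    then show ?case using union(3) by (simp add: set_lebesgue_integral_def)
  qed
qed

end

section \<open>Completed sub-sigma-algebras and conditional expectation\<close>


text \<open>Only sets of \<open>M\<close> are added, so for a subalgebra \<open>H\<close> the result
  is again a subalgebra, to which \<open>real_cond_exp\<close> applies. Information in the game is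
  given up to null sets, both by \<open>contained_mod_null\<close> and by the almost sure identities
  for the filters.\<close>

definition completed :: "'w measure \<Rightarrow> 'w measure \<Rightarrow> 'w measure" where
  "completed M H = sigma (space M) {A \<in> sets M. \<exists>C\<in>sets H. AE \<omega> in M. \<omega> \<in> A \<longleftrightarrow> \<omega> \<in> C}"

text \<open>Up to null sets, their closed span is the space of square-integrable
  \<open>K\<close>-measurable functions. Conditioning thus becomes an instance of
  \<open>is_proj\<close>.\<close>

definition indicators :: "'w measure \<Rightarrow> ('w \<Rightarrow> real) set" where
  "indicators K = {indicator A | A. A \<in> sets K}"

lemma space_completed[simp]: "space (completed M H) = space M"
  by (simp add: completed_def space_measure_of_conv)

lemma sets_completed:
  assumes H: "subalgebra M H"
  shows "sets (completed M H) = {A \<in> sets M. \<exists>C\<in>sets H. AE \<omega> in M. \<omega> \<in> A \<longleftrightarrow> \<omega> \<in> C}" (is "_ = ?S")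
proof -
  have sp: "space H = space M" and HM: "sets H \<subseteq> sets M" using H by (auto simp: subalgebra_def)
  have "sigma_algebra (space M) ?S"
  proof (rule sigma_algebra.intro)
    show "algebra (space M) ?S"
      unfolding algebra_iff_Un
    proof (intro conjI ballI)
      show "?S \<subseteq> Pow (space M)" using sets.sets_into_space by auto
      show "{} \<in> ?S" by (auto intro!: bexI[of _ "{}"])
      show "space M - A \<in> ?S" if A: "A \<in> ?S" for A
      proof -
        obtain C where C: "C \<in> sets H" "AE \<omega> in M. \<omega> \<in> A \<longleftrightarrow> \<omega> \<in> C" using A by auto
        have "AE \<omega> in M. \<omega> \<in> space M - A \<longleftrightarrow> \<omega> \<in> space M - C" using C(2) by eventually_elim auto
        moreover have "space M - C \<in> sets H" using sets.compl_sets[OF C(1)] sp by simp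
        moreover have "space M - A \<in> sets M" using A by auto
        ultimately show ?thesis by blast
      qed
      show "A \<union> B \<in> ?S" if A: "A \<in> ?S" and B: "B \<in> ?S" for A B
      proof -
        obtain C where C: "C \<in> sets H" "AE \<omega> in M. \<omega> \<in> A \<longleftrightarrow> \<omega> \<in> C" using A by auto
        obtain D where D: "D \<in> sets H" "AE \<omega> in M. \<omega> \<in> B \<longleftrightarrow> \<omega> \<in> D" using B by auto
        have "AE \<omega> in M. \<omega> \<in> A \<union> B \<longleftrightarrow> \<omega> \<in> C \<union> D" using C(2) D(2) by eventually_elim auto
        moreover have "C \<union> D \<in> sets H" "A \<union> B \<in> sets M" using A B C(1) D(1) by auto
        ultimately show ?thesis by blast
      qed
    qed
    show "sigma_algebra_axioms ?S"
    proof (rule sigma_algebra_axioms.intro)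
      fix A :: "nat \<Rightarrow> 'a set" assume A: "range A \<subseteq> ?S"
      then have "\<forall>i. \<exists>C\<in>sets H. AE \<omega> in M. \<omega> \<in> A i \<longleftrightarrow> \<omega> \<in> C" by auto
      then obtain C where C: "\<And>i. C i \<in> sets H" "\<And>i. AE \<omega> in M. \<omega> \<in> A i \<longleftrightarrow> \<omega> \<in> C i" by metis
      have "AE \<omega> in M. \<forall>i. \<omega> \<in> A i \<longleftrightarrow> \<omega> \<in> C i" using C(2) by (simp add: AE_all_countable)
      then have "AE \<omega> in M. \<omega> \<in> (\<Union>i. A i) \<longleftrightarrow> \<omega> \<in> (\<Union>i. C i)" by eventually_elim auto
      moreover have "(\<Union>i. C i) \<in> sets H" using C(1) by auto
      moreover have "(\<Union>i. A i) \<in> sets M" using A by auto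
      ultimately show "(\<Union>i. A i) \<in> ?S" by blast
    qed
  qed
  then show ?thesis unfolding completed_def by (rule sigma_algebra.sets_measure_of_eq)
qed

lemma completed_subalgebra: "subalgebra M H \<Longrightarrow> subalgebra M (completed M H)"
  by (auto simp: subalgebra_def sets_completed[unfolded subalgebra_def])

lemma completed_incl: "subalgebra M H \<Longrightarrow> sets H \<subseteq> sets (completed M H)"
  by (subst sets_completed) (auto simp: subalgebra_def)

text \<open>The reason for completing: measurability now survives a change on a null set.\<close>

lemma completed_cong:
  assumes H: "subalgebra M H" and f: "f \<in> borel_measurable (completed M H)"
    and g: "g \<in> borel_measurable M" and eq: "AE \<omega> in M. f \<omega> = g \<omega>"
  shows "g \<in> borel_measurable (completed M H)"
proof (rule measurableI)
  fix A :: "'b set" assume A: "A \<in> sets borel"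
  have "f -` A \<inter> space M \<in> sets (completed M H)" using measurable_sets[OF f A] by simp
  then obtain C where C: "C \<in> sets H" "AE \<omega> in M. \<omega> \<in> f -` A \<inter> space M \<longleftrightarrow> \<omega> \<in> C"
    unfolding sets_completed[OF H] by blast
  have "AE \<omega> in M. \<omega> \<in> g -` A \<inter> space M \<longleftrightarrow> \<omega> \<in> C" using C(2) eq by eventually_elim auto
  then show "g -` A \<inter> space (completed M H) \<in> sets (completed M H)"
    unfolding sets_completed[OF H] space_completed using C(1) measurable_sets[OF g A] by blast
qed simp

lemma completed_mono:
  assumes H: "subalgebra M H" and K: "subalgebra M K" "sets H \<subseteq> sets K"
  shows "sets (completed M H) \<subseteq> sets (completed M K)"
  using K(2) by (auto simp: sets_completed[OF H] sets_completed[OF K(1)])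

text \<open>Two almost sure equalities of events compose, so it is enough to compare generators up
  to null sets.\<close>

lemma completed_least:
  assumes H: "subalgebra M H" and K: "subalgebra M K" "sets H \<subseteq> sets (completed M K)"
  shows "sets (completed M H) \<subseteq> sets (completed M K)"
proof
  fix A assume A: "A \<in> sets (completed M H)"
  then obtain C where C: "C \<in> sets H" "AE \<omega> in M. \<omega> \<in> A \<longleftrightarrow> \<omega> \<in> C" by (auto simp: sets_completed[OF H])
  then have "C \<in> sets (completed M K)" using K by auto
  then obtain C' where C': "C' \<in> sets K" "AE \<omega> in M. \<omega> \<in> C \<longleftrightarrow> \<omega> \<in> C'" by (auto simp: sets_completed[OF K(1)])
  have "AE \<omega> in M. \<omega> \<in> A \<longleftrightarrow> \<omega> \<in> C'" using C(2) C'(2) by eventually_elim auto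
  then show "A \<in> sets (completed M K)"
    using A C'(1) unfolding sets_completed[OF H] sets_completed[OF K(1)] by blast
qed

context prob_space
begin

lemma L2_imp_integrable: "f \<in> L2 M \<Longrightarrow> integrable M f"
  by (rule L2_integrable[OF finite_measure_axioms])

lemma sigma_finite_subalg: "subalgebra M K \<Longrightarrow> sigma_finite_subalgebra M K"
  by (intro finite_measure_subalgebra_is_sigma_finite) (simp add: finite_measure_subalgebra_def finite_measure_subalgebra_axioms_def finite_measure_axioms)

lemma indicator_L2: "A \<in> sets M \<Longrightarrow> (indicator A :: 'a \<Rightarrow> real) \<in> L2 M"
proof -
  assume A: "A \<in> sets M"
  have "(\<lambda>\<omega>. (indicator A \<omega>)\<^sup>2) = (indicator A :: 'a \<Rightarrow> real)" by (auto simp: indicator_def fun_eq_iff)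
  then show ?thesis using A emeasure_finite[of A] by (simp add: L2_def less_top[symmetric])
qed

lemma indicators_L2: "subalgebra M K \<Longrightarrow> indicators K \<subseteq> L2 M"
  by (auto simp: indicators_def subalgebra_def intro!: indicator_L2)

text \<open>Jensen's inequality for the square.\<close>

lemma cond_exp_L2:
  assumes K: "subalgebra M K" and f: "f \<in> L2 M"
  shows "real_cond_exp M K f \<in> L2 M"
proof -
  interpret sigma_finite_subalgebra M K by (rule sigma_finite_subalg[OF K])
  have sq: "convex_on UNIV (\<lambda>x::real. x\<^sup>2)" by (rule convex_power_even) simp
  have i: "integrable M f" "integrable M (\<lambda>x. (f x)\<^sup>2)" using f by (auto intro: L2_imp_integrable L2_sq_int)
  have "AE x in M. (real_cond_exp M K f x)\<^sup>2 \<le> real_cond_exp M K (\<lambda>x. (f x)\<^sup>2) x"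
    by (rule real_cond_exp_jensens_inequality(2)[where I=UNIV and q="\<lambda>x. x\<^sup>2"]) (use i sq in auto)
  then have le: "AE x in M. norm ((real_cond_exp M K f x)\<^sup>2) \<le> norm (real_cond_exp M K (\<lambda>x. (f x)\<^sup>2) x)"
    by eventually_elim auto
  have "integrable M (\<lambda>x. (real_cond_exp M K f x)\<^sup>2)"
    by (rule Bochner_Integration.integrable_bound[OF real_cond_exp_int(1)[OF i(2)] _ le]) measurable
  then show ?thesis by (intro L2_I) auto
qed

lemma cond_exp_self_adjoint:
  assumes K: "subalgebra M K" and f: "f \<in> L2 M" and g: "g \<in> L2 M"
  shows "expectation (\<lambda>\<omega>. real_cond_exp M K f \<omega> * g \<omega>) = expectation (\<lambda>\<omega>. real_cond_exp M K f \<omega> * real_cond_exp M K g \<omega>)"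
proof -
  interpret sigma_finite_subalgebra M K by (rule sigma_finite_subalg[OF K])
  show ?thesis
    using real_cond_exp_intg(2)[of "real_cond_exp M K f" g] L2_prod_integrable[OF cond_exp_L2[OF K f] g] L2_meas[OF g] by simp
qed

lemma cond_exp_adjoint:
  assumes K: "subalgebra M K" and f: "f \<in> L2 M" and g: "g \<in> L2 M"
  shows "expectation (\<lambda>\<omega>. real_cond_exp M K f \<omega> * g \<omega>) = expectation (\<lambda>\<omega>. f \<omega> * real_cond_exp M K g \<omega>)"
  using cond_exp_self_adjoint[OF K f g] cond_exp_self_adjoint[OF K g f] by (simp add: mult.commute)

lemma cond_exp_is_proj:
  assumes K: "subalgebra M K" and f: "f \<in> L2 M"
  shows "is_proj M (indicators K) f (real_cond_exp M K f)"
proof -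
  interpret sigma_finite_subalgebra M K by (rule sigma_finite_subalg[OF K])
  note L = cond_exp_L2[OF K f]
  have "expectation (\<lambda>\<omega>. (f \<omega> - real_cond_exp M K f \<omega>) * h \<omega>) = 0" if h: "h \<in> indicators K" for h
  proof -
    obtain A where A: "A \<in> sets K" "h = indicator A" using h by (auto simp: indicators_def)
    have "h \<in> L2 M" using indicators_L2[OF K] h by auto
    moreover have "expectation (\<lambda>\<omega>. f \<omega> * h \<omega>) = expectation (\<lambda>\<omega>. real_cond_exp M K f \<omega> * h \<omega>)"
      using real_cond_exp_intA[OF L2_imp_integrable[OF f] A(1)]
      by (simp add: A(2) set_lebesgue_integral_def mult.commute)
    ultimately show ?thesis using L f by (simp add: left_diff_distrib L2_prod_integrable)
  qed
  then have 1: "(\<lambda>\<omega>. f \<omega> - real_cond_exp M K f \<omega>) \<in> orth M (indicators K)"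
    using L2_diff[OF f L] by (simp add: orth_def)
  have "expectation (\<lambda>\<omega>. real_cond_exp M K f \<omega> * V \<omega>) = 0" if V: "V \<in> orth M (indicators K)" for V
  proof -
    have VL: "V \<in> L2 M" using V by (rule orth_L2)
    \<comment> \<open>\<open>V\<close> integrates to zero over every set of \<open>K\<close>, so its
      conditional expectation is zero; self-adjointness then moves the conditioning from
      \<open>f\<close> onto \<open>V\<close>.\<close>
    have "AE \<omega> in M. real_cond_exp M K V \<omega> = 0"
    proof (rule real_cond_exp_charact)
      fix A assume "A \<in> sets K"
      then have "indicator A \<in> indicators K" by (auto simp: indicators_def)
      then show "(LINT \<omega>:A|M. V \<omega>) = (LINT \<omega>:A|M. 0)"
        using orthD[OF V, of "indicator A"] by (simp add: set_lebesgue_integral_def mult.commute)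
    qed (use L2_imp_integrable[OF VL] in auto)
    then have "expectation (\<lambda>\<omega>. real_cond_exp M K f \<omega> * real_cond_exp M K V \<omega>) = expectation (\<lambda>\<omega>. 0)"
      by (intro integral_cong_AE) auto
    then show ?thesis using cond_exp_self_adjoint[OF K f VL] by simp
  qed
  then have "real_cond_exp M K f \<in> orth M (orth M (indicators K))" using L by (auto simp: orth_def)
  then show ?thesis using 1 by (simp add: is_proj_def)
qed

lemma meas_in_span:
  assumes K: "subalgebra M K" and f: "f \<in> L2 M" "f \<in> borel_measurable K"
  shows "f \<in> orth M (orth M (indicators K))"
proof -
  interpret sigma_finite_subalgebra M K by (rule sigma_finite_subalg[OF K])
  have "AE \<omega> in M. real_cond_exp M K f \<omega> = f \<omega>" by (rule real_cond_exp_F_meas[OF L2_imp_integrable[OF f(1)] f(2)])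
  then show ?thesis
    by (rule orth_cong_AE[OF conjunct2[OF cond_exp_is_proj[OF K f(1), unfolded is_proj_def]] orth_subset_L2 L2_meas[OF f(1)]])
qed

lemma span_eq_cond_exp:
  assumes K: "subalgebra M K" and f: "f \<in> orth M (orth M (indicators K))"
  shows "AE \<omega> in M. f \<omega> = real_cond_exp M K f \<omega>"
proof -
  have p: "is_proj M (indicators K) f (real_cond_exp M K f)" by (rule cond_exp_is_proj[OF K orth_L2[OF f]])
  have "AE \<omega> in M. f \<omega> - real_cond_exp M K f \<omega> = 0"
  proof (rule orth_inter_zero)
    show "(\<lambda>\<omega>. f \<omega> - real_cond_exp M K f \<omega>) \<in> orth M (indicators K)"
      by (rule conjunct1[OF p[unfolded is_proj_def]])
    show "(\<lambda>\<omega>. f \<omega> - real_cond_exp M K f \<omega>) \<in> orth M (orth M (indicators K))"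
      by (rule orth_diff[OF orth_subset_L2 f conjunct2[OF p[unfolded is_proj_def]]])
  qed
  then show ?thesis by eventually_elim simp
qed

text \<open>An element of the span equals its conditional expectation almost everywhere, and
  completeness up to null sets turns this into measurability of the element itself.\<close>

lemma span_meas:
  assumes H: "subalgebra M H" and f: "f \<in> orth M (orth M (indicators (completed M H)))"
  shows "f \<in> borel_measurable (completed M H)"
proof -
  have "real_cond_exp M (completed M H) f \<in> borel_measurable (completed M H)" by simp
  moreover have "AE \<omega> in M. real_cond_exp M (completed M H) f \<omega> = f \<omega>"
    using span_eq_cond_exp[OF completed_subalgebra[OF H] f] by eventually_elim simp
  ultimately show ?thesis
    using completed_cong[OF H _ L2_meas[OF orth_L2[OF f]]] by blast
qed

lemma cond_exp_completed:
  assumes H: "subalgebra M H" and f: "integrable M f"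
  shows "AE \<omega> in M. real_cond_exp M (completed M H) f \<omega> = real_cond_exp M H f \<omega>"
proof -
  interpret H: sigma_finite_subalgebra M H by (rule sigma_finite_subalg[OF H])
  interpret C: sigma_finite_subalgebra M "completed M H" by (rule sigma_finite_subalg[OF completed_subalgebra[OF H]])
  have m: "real_cond_exp M H f \<in> borel_measurable (completed M H)"
    using completed_incl[OF H] H
    by (intro measurable_from_subalg[of "completed M H" H]) (auto simp: subalgebra_def)
  show ?thesis
  proof (rule C.real_cond_exp_charact[OF _ f H.real_cond_exp_int(1)[OF f] m])
    fix A assume A: "A \<in> sets (completed M H)"
    then obtain C where C: "C \<in> sets H" "AE \<omega> in M. \<omega> \<in> A \<longleftrightarrow> \<omega> \<in> C" and AM: "A \<in> sets M"
      by (auto simp: sets_completed[OF H])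
    have CM: "C \<in> sets M" using C(1) H by (auto simp: subalgebra_def)
    have eq: "(LINT \<omega>:A|M. g \<omega>) = (LINT \<omega>:C|M. g \<omega>)" if "g \<in> borel_measurable M" for g :: "'a \<Rightarrow> real"
      unfolding set_lebesgue_integral_def
    proof (rule integral_cong_AE)
      show "AE x in M. indicat_real A x *\<^sub>R g x = indicat_real C x *\<^sub>R g x"
        using C(2) by eventually_elim (auto simp: indicator_def)
    qed (use that AM CM in auto)
    show "(LINT \<omega>:A|M. f \<omega>) = (LINT \<omega>:A|M. real_cond_exp M H f \<omega>)"
      using eq[of f] eq[of "real_cond_exp M H f"] H.real_cond_exp_intA[OF f C(1)] f by auto
  qed
qed

text \<open>Two orthogonal projections commute if one of them leaves the range of the other invariant.\<close>

lemma proj_keeps_measurability: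
  assumes A: "A \<subseteq> L2 M" and K: "subalgebra M K"
    and inv: "\<And>h. h \<in> A \<Longrightarrow> real_cond_exp M K h \<in> orth M (orth M A)"
    and Z: "Z \<in> orth M (orth M (indicators K))" and p: "is_proj M A Z Z'"
  shows "Z' \<in> orth M (orth M (indicators K))"
proof -
  let ?E = "real_cond_exp M K"
  have L: "Z \<in> L2 M" "Z' \<in> L2 M" using is_proj_L2[OF p] by auto
  have ZE: "AE \<omega> in M. Z \<omega> = ?E Z \<omega>" by (rule span_eq_cond_exp[OF K Z])
  \<comment> \<open>Self-adjointness moves the conditioning onto \<open>h\<close>. As
    \<open>?E h\<close> lies in the span of \<open>A\<close>, it cannot tell \<open>Z'\<close> from
    \<open>Z\<close>, and \<open>?E Z = Z\<close> almost everywhere. Once \<open>?E Z'\<close> is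
    known to lie in the span as well, the difference is orthogonal to itself.\<close>
  have 1: "(\<lambda>\<omega>. Z' \<omega> - ?E Z' \<omega>) \<in> orth M A"
  proof -
    have "expectation (\<lambda>\<omega>. (Z' \<omega> - ?E Z' \<omega>) * h \<omega>) = 0" if h: "h \<in> A" for h
    proof -
      have hL: "h \<in> L2 M" using h A by auto
      have "expectation (\<lambda>\<omega>. ?E Z' \<omega> * h \<omega>) = expectation (\<lambda>\<omega>. ?E h \<omega> * Z' \<omega>)"
        using cond_exp_adjoint[OF K L(2) hL] by (simp add: mult.commute)
      also have "\<dots> = expectation (\<lambda>\<omega>. ?E h \<omega> * Z \<omega>)"
        using is_proj_inner[OF p inv[OF h]] by simp
      also have "\<dots> = expectation (\<lambda>\<omega>. ?E Z \<omega> * h \<omega>)"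
        using cond_exp_adjoint[OF K hL L(1)] by (simp add: mult.commute)
      also have "\<dots> = expectation (\<lambda>\<omega>. Z \<omega> * h \<omega>)"
        using ZE L(1) hL by (intro integral_cong_AE) (auto dest: L2_meas)
      also have "\<dots> = expectation (\<lambda>\<omega>. Z' \<omega> * h \<omega>)"
        using is_proj_inner[OF p orth_orth_incl[OF A h]] by (simp add: mult.commute)
      finally show ?thesis using L hL cond_exp_L2[OF K L(2)] by (simp add: left_diff_distrib L2_prod_integrable)
    qed
    then show ?thesis using L2_diff[OF L(2) cond_exp_L2[OF K L(2)]] by (simp add: orth_def)
  qed
  have EV: "?E V \<in> orth M A" if V: "V \<in> orth M A" for V
  proof -
    have "expectation (\<lambda>\<omega>. ?E V \<omega> * h \<omega>) = 0" if h: "h \<in> A" for h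
      using cond_exp_adjoint[OF K orth_L2[OF V], of h] h A orth_commute_zero[OF V inv[OF h]] by auto
    then show ?thesis using cond_exp_L2[OF K orth_L2[OF V]] by (simp add: orth_def)
  qed
  have "?E Z' \<in> orth M (orth M A)"
  proof -
    have "expectation (\<lambda>\<omega>. ?E Z' \<omega> * V \<omega>) = 0" if V: "V \<in> orth M A" for V
      using cond_exp_adjoint[OF K L(2) orth_L2[OF V]] orthD[of Z' M "orth M A", OF _ EV[OF V]] p
      by (simp add: is_proj_def)
    then show ?thesis using cond_exp_L2[OF K L(2)] by (simp add: orth_def)
  qed
  then have "(\<lambda>\<omega>. Z' \<omega> - ?E Z' \<omega>) \<in> orth M (orth M A)"
    by (rule orth_diff[OF orth_subset_L2 conjunct2[OF p[unfolded is_proj_def]]])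
  from orth_inter_zero[OF 1 this] have "AE \<omega> in M. ?E Z' \<omega> = Z' \<omega>" by eventually_elim simp
  then show ?thesis
    by (rule orth_cong_AE[OF conjunct2[OF cond_exp_is_proj[OF K L(2), unfolded is_proj_def]] orth_subset_L2 L2_meas[OF L(2)]])
qed

end

section \<open>Time integrals of square-integrable processes\<close>


text \<open>Confines a time to \<open>[0, T]\<close>. Joint measurability is given over
  \<open>{0..T}\<close> only; composed with this map, a process is measurable on the whole line and
  unchanged on the interval, which is the setting for Fubini's theorem with
  \<open>lborel\<close>.\<close>

abbreviation clamp01 :: "real \<Rightarrow> real \<Rightarrow> real" where "clamp01 T s \<equiv> max 0 (min T s)"

lemma clamp_id: "0 \<le> s \<Longrightarrow> s \<le> T \<Longrightarrow> clamp01 T s = s"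
  by simp

lemma clamp_measurable:
  assumes T: "0 \<le> T"
  shows "clamp01 T \<in> measurable borel (restrict_space borel {0..T})"
  using T by (intro measurable_restrict_space2) auto

lemma joint_clamp:
  assumes T: "0 \<le> T" and Z: "(\<lambda>(t, \<omega>). Z t \<omega>) \<in> borel_measurable (restrict_space borel {0..T} \<Otimes>\<^sub>M M)"
  shows "(\<lambda>(s, \<omega>). Z (clamp01 T s) \<omega>) \<in> borel_measurable (lborel \<Otimes>\<^sub>M M)"
proof -
  have "(\<lambda>x. (clamp01 T (fst x), snd x)) \<in> measurable (lborel \<Otimes>\<^sub>M M) (restrict_space borel {0..T} \<Otimes>\<^sub>M M)"
    by (intro measurable_Pair measurable_compose[OF measurable_fst]) (use clamp_measurable[OF T] in simp_all)
  from measurable_compose[OF this Z] show ?thesis by (simp add: case_prod_beta)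
qed

lemma joint_section:
  fixes t T :: real
  assumes Z: "(\<lambda>(t, \<omega>). Z t \<omega>) \<in> borel_measurable (restrict_space borel {0..T} \<Otimes>\<^sub>M M)" and t: "t \<in> {0..T}"
  shows "Z t \<in> borel_measurable M"
proof -
  have "(\<lambda>\<omega>. (t, \<omega>)) \<in> measurable M (restrict_space borel {0..T} \<Otimes>\<^sub>M M)"
    using t by (intro measurable_Pair1') (simp add: space_restrict_space)
  from measurable_compose[OF this Z] show ?thesis by simp
qed

lemma joint_component:
  fixes Z :: "real \<Rightarrow> 'w \<Rightarrow> real^'m"
  shows "(\<lambda>(t, \<omega>). Z t \<omega>) \<in> borel_measurable N \<longleftrightarrow> (\<forall>a. (\<lambda>(t, \<omega>). Z t \<omega> $ a) \<in> borel_measurable N)"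
proof -
  have "(\<lambda>(t, \<omega>). Z t \<omega> $ a) = (\<lambda>x. (\<lambda>(t, \<omega>). Z t \<omega>) x $ a)" for a by (auto simp: fun_eq_iff)
  then show ?thesis using borel_measurable_vec[of "\<lambda>(t, \<omega>). Z t \<omega>" N] by simp
qed

context prob_space
begin

lemma lborel_pair_sigma_finite: "pair_sigma_finite lborel M"
  by (simp add: pair_sigma_finite_def sigma_finite_lborel sigma_finite_measure_axioms)

lemma nn_snd_meas:
  assumes "f \<in> borel_measurable (lborel \<Otimes>\<^sub>M M)"
  shows "(\<lambda>\<omega>. \<integral>\<^sup>+s. f (s :: real, \<omega>) \<partial>lborel) \<in> borel_measurable M"
proof (rule sigma_finite_measure.borel_measurable_nn_integral[OF sigma_finite_lborel])
  show "(\<lambda>(\<omega>, s). f (s, \<omega>)) \<in> borel_measurable (M \<Otimes>\<^sub>M lborel)"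
    using measurable_compose[OF measurable_pair_swap' assms] by (simp add: case_prod_beta)
qed

lemma nn_swap:
  fixes f :: "real \<Rightarrow> 'a \<Rightarrow> ennreal"
  assumes T: "0 \<le> T" and f: "(\<lambda>(t, \<omega>). f t \<omega>) \<in> borel_measurable (restrict_space borel {0..T} \<Otimes>\<^sub>M M)"
  shows "(\<integral>\<^sup>+\<omega>. (\<integral>\<^sup>+t\<in>{0..T}. f t \<omega> \<partial>lborel) \<partial>M) = (\<integral>\<^sup>+t\<in>{0..T}. (\<integral>\<^sup>+\<omega>. f t \<omega> \<partial>M) \<partial>lborel)"
    "(\<lambda>\<omega>. \<integral>\<^sup>+t\<in>{0..T}. f t \<omega> \<partial>lborel) \<in> borel_measurable M"
    "(\<lambda>t. (\<integral>\<^sup>+\<omega>. f t \<omega> \<partial>M) * indicator {0..T} t) \<in> borel_measurable borel"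
proof -
  interpret P: pair_sigma_finite lborel M by (rule lborel_pair_sigma_finite)
  have m: "(\<lambda>x. f (clamp01 T (fst x)) (snd x) * indicator {0..T} (fst x)) \<in> borel_measurable (lborel \<Otimes>\<^sub>M M)"
    using joint_clamp[OF T f] by (simp add: case_prod_beta)
  have eq: "f (clamp01 T t) \<omega> * indicator {0..T} t = f t \<omega> * indicator {0..T} t" for t \<omega>
    by (auto simp: indicator_def clamp_id)
  show 1: "(\<integral>\<^sup>+\<omega>. (\<integral>\<^sup>+t\<in>{0..T}. f t \<omega> \<partial>lborel) \<partial>M) = (\<integral>\<^sup>+t\<in>{0..T}. (\<integral>\<^sup>+\<omega>. f t \<omega> \<partial>M) \<partial>lborel)"
  proof -
    have "(\<integral>\<^sup>+\<omega>. (\<integral>\<^sup>+t\<in>{0..T}. f t \<omega> \<partial>lborel) \<partial>M) = (\<integral>\<^sup>+\<omega>. (\<integral>\<^sup>+t. f (clamp01 T t) \<omega> * indicator {0..T} t \<partial>lborel) \<partial>M)"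
      by (simp add: eq)
    also have "\<dots> = (\<integral>\<^sup>+t. (\<integral>\<^sup>+\<omega>. f (clamp01 T t) \<omega> * indicator {0..T} t \<partial>M) \<partial>lborel)"
      using P.Fubini[OF m] by simp
    also have "\<dots> = (\<integral>\<^sup>+t. (\<integral>\<^sup>+\<omega>. f t \<omega> * indicator {0..T} t \<partial>M) \<partial>lborel)" by (simp add: eq)
    also have "\<dots> = (\<integral>\<^sup>+t\<in>{0..T}. (\<integral>\<^sup>+\<omega>. f t \<omega> \<partial>M) \<partial>lborel)"
      by (intro nn_integral_cong) (simp add: indicator_def)
    finally show ?thesis .
  qed
  show "(\<lambda>\<omega>. \<integral>\<^sup>+t\<in>{0..T}. f t \<omega> \<partial>lborel) \<in> borel_measurable M"
    using nn_snd_meas[OF m] by (simp add: eq)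
  have "(\<lambda>t. \<integral>\<^sup>+\<omega>. f (clamp01 T t) \<omega> * indicator {0..T} t \<partial>M) \<in> borel_measurable lborel"
    using borel_measurable_nn_integral_fst[OF m] by simp
  moreover have "(\<integral>\<^sup>+\<omega>. f (clamp01 T t) \<omega> * indicator {0..T} t \<partial>M) = (\<integral>\<^sup>+\<omega>. f t \<omega> \<partial>M) * indicator {0..T} t" for t
    unfolding eq by (simp add: indicator_def)
  ultimately show "(\<lambda>t. (\<integral>\<^sup>+\<omega>. f t \<omega> \<partial>M) * indicator {0..T} t) \<in> borel_measurable borel" by simp
qed

lemma joint_norm_sq:
  fixes Z :: "real \<Rightarrow> 'a \<Rightarrow> 'b::euclidean_space"
  assumes Z: "(\<lambda>(t, \<omega>). Z t \<omega>) \<in> borel_measurable N"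
  shows "(\<lambda>(t, \<omega>). ennreal ((norm (Z t \<omega>))\<^sup>2)) \<in> borel_measurable N"
proof -
  have "(\<lambda>x. ennreal ((norm ((\<lambda>(t, \<omega>). Z t \<omega>) x))\<^sup>2)) \<in> borel_measurable N" using Z by measurable
  then show ?thesis by (simp add: case_prod_beta)
qed

text \<open>Projections act at fixed times and need second moments there, whereas the definition
  integrates over time first.\<close>

lemma sq_process_swap:
  assumes T: "0 \<le> T"
  shows "sq_process M T Z \<longleftrightarrow> (\<lambda>(t, \<omega>). Z t \<omega>) \<in> borel_measurable (restrict_space borel {0..T} \<Otimes>\<^sub>M M) \<and>
     (\<integral>\<^sup>+t\<in>{0..T}. (\<integral>\<^sup>+\<omega>. ennreal ((norm (Z t \<omega>))\<^sup>2) \<partial>M) \<partial>lborel) < \<infinity>"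
proof (cases "(\<lambda>(t, \<omega>). Z t \<omega>) \<in> borel_measurable (restrict_space borel {0..T} \<Otimes>\<^sub>M M)")
  case True
  show ?thesis unfolding sq_process_def nn_swap(1)[OF T joint_norm_sq[OF True]] ..
next
  case False
  then show ?thesis unfolding sq_process_def by blast
qed

lemma sq_process_component:
  assumes Z: "sq_process M T Z"
  shows "(\<integral>\<^sup>+\<omega>. (\<integral>\<^sup>+t\<in>{0..T}. ennreal ((Z t \<omega> $ a)\<^sup>2) \<partial>lborel) \<partial>M) < \<infinity>"
proof -
  have "(\<integral>\<^sup>+\<omega>. (\<integral>\<^sup>+t\<in>{0..T}. ennreal ((Z t \<omega> $ a)\<^sup>2) \<partial>lborel) \<partial>M) \<le>
     (\<integral>\<^sup>+\<omega>. (\<integral>\<^sup>+t\<in>{0..T}. ennreal ((norm (Z t \<omega>))\<^sup>2) \<partial>lborel) \<partial>M)"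
  proof (intro nn_integral_mono mult_right_mono ennreal_leI)
    show "(Z t \<omega> $ a)\<^sup>2 \<le> (norm (Z t \<omega>))\<^sup>2" for t \<omega>
      using component_le_norm_cart[of "Z t \<omega>" a] by (metis abs_le_square_iff abs_norm_cancel)
  qed simp
  also have "\<dots> < \<infinity>" using Z by (simp add: sq_process_def)
  finally show ?thesis .
qed

lemma sq_process_AE_L2:
  assumes T: "0 \<le> T" and Z: "sq_process M T Z"
  shows "AE t in lborel. t \<in> {0..T} \<longrightarrow> orthv M {} (Z t)"
proof -
  have jm: "(\<lambda>(t, \<omega>). Z t \<omega>) \<in> borel_measurable (restrict_space borel {0..T} \<Otimes>\<^sub>M M)"
    and fin: "(\<integral>\<^sup>+t\<in>{0..T}. (\<integral>\<^sup>+\<omega>. ennreal ((norm (Z t \<omega>))\<^sup>2) \<partial>M) \<partial>lborel) < \<infinity>"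
    using Z sq_process_swap[OF T] by auto
  have "AE t in lborel. (\<integral>\<^sup>+\<omega>. ennreal ((norm (Z t \<omega>))\<^sup>2) \<partial>M) * indicator {0..T} t \<noteq> \<infinity>"
    using fin nn_swap(3)[OF T joint_norm_sq[OF jm]] by (intro nn_integral_PInf_AE) auto
  then show ?thesis
  proof eventually_elim
    case (elim t)
    show ?case
    proof
      assume t: "t \<in> {0..T}"
      then have "(\<integral>\<^sup>+\<omega>. ennreal ((norm (Z t \<omega>))\<^sup>2) \<partial>M) < \<infinity>" using elim by (simp add: less_top)
      then show "orthv M {} (Z t)" by (subst L2v_iff[OF joint_section[OF jm t]])
    qed
  qed
qed

lemma path_integrable:
  fixes Z :: "real \<Rightarrow> 'a \<Rightarrow> 'b::euclidean_space"
  assumes T: "0 \<le> T" and jm: "(\<lambda>(t, \<omega>). Z t \<omega>) \<in> borel_measurable (restrict_space borel {0..T} \<Otimes>\<^sub>M M)"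
    and fin: "(\<integral>\<^sup>+\<omega>. (\<integral>\<^sup>+t\<in>{0..T}. ennreal ((norm (Z t \<omega>))\<^sup>2) \<partial>lborel) \<partial>M) < \<infinity>" and t: "t \<in> {0..T}"
  shows "AE \<omega> in M. set_integrable lborel {0..t} (\<lambda>s. Z s \<omega>)"
proof -
  have "AE \<omega> in M. (\<integral>\<^sup>+t\<in>{0..T}. ennreal ((norm (Z t \<omega>))\<^sup>2) \<partial>lborel) \<noteq> \<infinity>"
    using fin nn_swap(2)[OF T joint_norm_sq[OF jm]] by (intro nn_integral_PInf_AE) auto
  then show ?thesis using AE_space
  proof eventually_elim
    case (elim \<omega>)
    have m: "(\<lambda>s. Z (clamp01 T s) \<omega>) \<in> borel_measurable lborel"
      using measurable_compose[OF measurable_Pair2'[OF elim(2)] joint_clamp[OF T jm]] by simp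
    have "set_integrable lborel {0..T} (\<lambda>s. Z s \<omega>)"
      unfolding set_integrable_def
    proof (rule integrableI_bounded)
      have "(\<lambda>s. indicator {0..T} s *\<^sub>R Z (clamp01 T s) \<omega>) = (\<lambda>s. indicator {0..T} s *\<^sub>R Z s \<omega>)"
        by (auto simp: indicator_def fun_eq_iff clamp_id)
      moreover have "(\<lambda>s. indicator {0..T} s *\<^sub>R Z (clamp01 T s) \<omega>) \<in> borel_measurable lborel" using m by measurable
      ultimately show "(\<lambda>s. indicator {0..T} s *\<^sub>R Z s \<omega>) \<in> borel_measurable lborel" by simp
      have "(\<integral>\<^sup>+s. ennreal (norm (indicator {0..T} s *\<^sub>R Z s \<omega>)) \<partial>lborel) \<le>
        (\<integral>\<^sup>+s. indicator {0..T} s + ennreal ((norm (Z s \<omega>))\<^sup>2) * indicator {0..T} s \<partial>lborel)"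
      proof (rule nn_integral_mono)
        fix s :: real
        have "norm (Z s \<omega>) \<le> 1 + (norm (Z s \<omega>))\<^sup>2"
          using sum_squares_bound[of "norm (Z s \<omega>)" 1] by (simp add: power2_eq_square) (smt (verit) mult_left_le_one_le mult_nonneg_nonneg norm_ge_zero)
        then have "ennreal (norm (Z s \<omega>)) \<le> ennreal (1 + (norm (Z s \<omega>))\<^sup>2)" by (rule ennreal_leI)
        then show "ennreal (norm (indicator {0..T} s *\<^sub>R Z s \<omega>)) \<le> indicator {0..T} s + ennreal ((norm (Z s \<omega>))\<^sup>2) * indicator {0..T} s"
          by (auto simp: indicator_def ennreal_plus)
      qed
      also have "\<dots> = ennreal T + (\<integral>\<^sup>+s\<in>{0..T}. ennreal ((norm (Z s \<omega>))\<^sup>2) \<partial>lborel)"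
      proof (subst nn_integral_add)
        have "(\<lambda>s. ennreal ((norm (Z (clamp01 T s) \<omega>))\<^sup>2) * indicator {0..T} s) \<in> borel_measurable lborel" using m by measurable
        moreover have "(\<lambda>s. ennreal ((norm (Z (clamp01 T s) \<omega>))\<^sup>2) * indicator {0..T} s) = (\<lambda>s. ennreal ((norm (Z s \<omega>))\<^sup>2) * indicator {0..T} s)"
          by (auto simp: indicator_def fun_eq_iff clamp_id)
        ultimately show "(\<lambda>s. ennreal ((norm (Z s \<omega>))\<^sup>2) * indicator {0..T} s) \<in> borel_measurable lborel" by simp
      qed (use T in auto)
      also have "\<dots> < \<infinity>" using elim(1) by (simp add: less_top[symmetric])
      finally show "(\<integral>\<^sup>+s. ennreal (norm (indicator {0..T} s *\<^sub>R Z s \<omega>)) \<partial>lborel) < \<infinity>" .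
    qed
    then show ?case by (rule set_integrable_subset) (use t in auto)
  qed
qed

lemma time_integral_measurable:
  fixes Z :: "real \<Rightarrow> 'a \<Rightarrow> 'b::euclidean_space"
  assumes T: "0 \<le> T" and jm: "(\<lambda>(t, \<omega>). Z t \<omega>) \<in> borel_measurable (restrict_space borel {0..T} \<Otimes>\<^sub>M M)" and t: "t \<in> {0..T}"
  shows "(\<lambda>\<omega>. LINT s:{0..t}|lborel. Z s \<omega>) \<in> borel_measurable M"
proof -
  have 1: "(\<lambda>x. Z (clamp01 T (fst x)) (snd x)) \<in> borel_measurable (lborel \<Otimes>\<^sub>M M)"
    using joint_clamp[OF T jm] by (simp add: case_prod_beta)
  have "(\<lambda>x. Z (clamp01 T (snd x)) (fst x)) \<in> borel_measurable (M \<Otimes>\<^sub>M lborel)"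
    using measurable_compose[OF measurable_pair_swap' 1] by (simp add: case_prod_beta)
  then have "(\<lambda>(\<omega>, s). indicator {0..t} s *\<^sub>R Z (clamp01 T s) \<omega>) \<in> borel_measurable (M \<Otimes>\<^sub>M lborel)"
    unfolding case_prod_beta by measurable
  then have "(\<lambda>\<omega>. LINT s|lborel. indicator {0..t} s *\<^sub>R Z (clamp01 T s) \<omega>) \<in> borel_measurable M"
    by (rule sigma_finite_measure.borel_measurable_lebesgue_integral[OF sigma_finite_lborel])
  moreover have "(LINT s|lborel. indicator {0..t} s *\<^sub>R Z (clamp01 T s) \<omega>) = (LINT s:{0..t}|lborel. Z s \<omega>)" for \<omega>
    unfolding set_lebesgue_integral_def using t
    by (intro Bochner_Integration.integral_cong) (auto simp: indicator_def clamp_id)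
  ultimately show ?thesis by simp
qed

text \<open>Fubini moves the pairing with \<open>h\<close> inside the time integral, where it
  vanishes for almost every \<open>s\<close>; Cauchy-Schwarz in time bounds the second moment. An
  assumption at almost every time has to suffice, because state estimates and actions are identified
  only up to null sets of times.\<close>

lemma scalar_time_integral_orth:
  fixes z :: "real \<Rightarrow> 'a \<Rightarrow> real"
  assumes T: "0 \<le> T" and B: "B \<subseteq> L2 M"
    and jm: "(\<lambda>(t, \<omega>). z t \<omega>) \<in> borel_measurable (restrict_space borel {0..T} \<Otimes>\<^sub>M M)"
    and fin: "(\<integral>\<^sup>+\<omega>. (\<integral>\<^sup>+t\<in>{0..T}. ennreal ((z t \<omega>)\<^sup>2) \<partial>lborel) \<partial>M) < \<infinity>"
    and o: "AE s in lborel. s \<in> {0..t} \<longrightarrow> z s \<in> orth M B" and t: "t \<in> {0..T}"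
  shows "(\<lambda>\<omega>. LINT s:{0..t}|lborel. z s \<omega>) \<in> orth M B"
proof -
  interpret P: pair_sigma_finite lborel M by (rule lborel_pair_sigma_finite)
  define y where "y s \<omega> = indicator {0..t} s * z (clamp01 T s) \<omega>" for s \<omega>
  have yz: "y s \<omega> = indicator {0..t} s * z s \<omega>" for s \<omega>
    using t by (auto simp: y_def indicator_def clamp_id)
  have TI: "(LINT s:{0..t}|lborel. z s \<omega>) = (LINT s|lborel. y s \<omega>)" for \<omega>
    by (simp add: set_lebesgue_integral_def yz)
  have c: "(\<lambda>x. z (clamp01 T (fst x)) (snd x)) \<in> borel_measurable (lborel \<Otimes>\<^sub>M M)"
    using joint_clamp[OF T jm] by (simp add: case_prod_beta)
  then have ym[measurable]: "(\<lambda>(s, \<omega>). y s \<omega>) \<in> borel_measurable (lborel \<Otimes>\<^sub>M M)"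
    unfolding y_def case_prod_beta by measurable
  have y2: "(\<integral>\<^sup>+\<omega>. (\<integral>\<^sup>+s. ennreal ((y s \<omega>)\<^sup>2) \<partial>lborel) \<partial>M) < \<infinity>"
  proof -
    have "(\<integral>\<^sup>+\<omega>. (\<integral>\<^sup>+s. ennreal ((y s \<omega>)\<^sup>2) \<partial>lborel) \<partial>M) \<le> (\<integral>\<^sup>+\<omega>. (\<integral>\<^sup>+t\<in>{0..T}. ennreal ((z t \<omega>)\<^sup>2) \<partial>lborel) \<partial>M)"
      using t by (intro nn_integral_mono) (auto simp: yz indicator_def)
    then show ?thesis using fin by (rule le_less_trans)
  qed
  have Fm: "(\<lambda>\<omega>. LINT s|lborel. y s \<omega>) \<in> borel_measurable M"
    using time_integral_measurable[OF T jm t] by (simp add: TI)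
  have cs: "ennreal ((LINT s|lborel. y s \<omega>)\<^sup>2) \<le> ennreal t * (\<integral>\<^sup>+s. ennreal ((y s \<omega>)\<^sup>2) \<partial>lborel)" if w: "\<omega> \<in> space M" for \<omega>
  proof (cases "(\<integral>\<^sup>+s. ennreal ((y s \<omega>)\<^sup>2) \<partial>lborel) = \<infinity>")
    case True
    show ?thesis
    \<comment> \<open>The right-hand side is \<open>t * \<infinity>\<close>, which is 0 for
      \<open>t = 0\<close>; then the integral over the null set \<open>{0}\<close> vanishes whatever
      the path.\<close>
    proof (cases "t = 0")
      case True
      have "AE s in lborel. y s \<omega> = 0"
        using AE_lborel_singleton[of "0::real"] by eventually_elim (auto simp: yz True indicator_def)
      then have "(LINT s|lborel. y s \<omega>) = 0" by (rule integral_eq_zero_AE)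
      then show ?thesis by simp
    next
      case False
      then have "0 < t" using t by simp
      then show ?thesis using True by (simp add: ennreal_mult_top)
    qed
  next
    case False
    have yb: "(\<lambda>s. y s \<omega>) \<in> borel_measurable lborel"
      using measurable_compose[OF measurable_Pair2'[OF w] ym] by simp
    then have yL: "(\<lambda>s. y s \<omega>) \<in> L2 lborel" using False by (simp add: L2_iff_nn less_top)
    have iL: "(indicator {0..t} :: real \<Rightarrow> real) \<in> L2 lborel"
    proof -
      have "(\<lambda>u. (indicator {0..t} u :: real)\<^sup>2) = indicator {0..t}" by (auto simp: indicator_def fun_eq_iff)
      moreover have "integrable lborel (indicator {0..t} :: real \<Rightarrow> real)"
        by (intro integrable_real_indicator emeasure_bounded_finite) auto
      ultimately show ?thesis by (simp add: L2_def)
    qed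
    have "(LINT s|lborel. y s \<omega>)\<^sup>2 = (LINT s|lborel. indicator {0..t} s * y s \<omega>)\<^sup>2"
      by (simp add: yz mult.assoc[symmetric] indicator_inter_arith[symmetric])
    also have "\<dots> \<le> (LINT s|lborel. (indicator {0..t} s)\<^sup>2) * (LINT s|lborel. (y s \<omega>)\<^sup>2)"
      by (rule Cauchy_Schwarz_sq[OF iL yL])
    also have "(LINT s|lborel. (indicator {0..t} s)\<^sup>2) = t"
    proof -
      have "(\<lambda>u. (indicator {0..t} u :: real)\<^sup>2) = indicator {0..t}" by (auto simp: indicator_def fun_eq_iff)
      then show ?thesis using t by simp
    qed
    finally have "ennreal ((LINT s|lborel. y s \<omega>)\<^sup>2) \<le> ennreal (t * (LINT s|lborel. (y s \<omega>)\<^sup>2))" by (rule ennreal_leI)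
    then show ?thesis using t by (simp add: ennreal_mult nn_eq_LINT_sq[OF yL])
  qed
  have "(\<integral>\<^sup>+\<omega>. ennreal ((LINT s|lborel. y s \<omega>)\<^sup>2) \<partial>M) \<le> (\<integral>\<^sup>+\<omega>. ennreal t * (\<integral>\<^sup>+s. ennreal ((y s \<omega>)\<^sup>2) \<partial>lborel) \<partial>M)"
    by (rule nn_integral_mono) (rule cs)
  also have "\<dots> = ennreal t * (\<integral>\<^sup>+\<omega>. (\<integral>\<^sup>+s. ennreal ((y s \<omega>)\<^sup>2) \<partial>lborel) \<partial>M)"
  proof (rule nn_integral_cmult)
    have "(\<lambda>x. ennreal ((y (fst x) (snd x))\<^sup>2)) \<in> borel_measurable (lborel \<Otimes>\<^sub>M M)" using ym by (simp add: case_prod_beta)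
    from nn_snd_meas[OF this] show "(\<lambda>\<omega>. \<integral>\<^sup>+s. ennreal ((y s \<omega>)\<^sup>2) \<partial>lborel) \<in> borel_measurable M" by simp
  qed
  also have "\<dots> < \<infinity>" using y2 by (simp add: ennreal_mult_less_top)
  finally have L: "(\<lambda>\<omega>. LINT s|lborel. y s \<omega>) \<in> L2 M" using Fm by (simp add: L2_iff_nn)
  have "expectation (\<lambda>\<omega>. (LINT s|lborel. y s \<omega>) * h \<omega>) = 0" if h: "h \<in> B" for h
  proof -
    have hL: "h \<in> L2 M" using h B by auto
    note [measurable] = L2_meas[OF hL]
    have int: "integrable (lborel \<Otimes>\<^sub>M M) (\<lambda>(s, \<omega>). y s \<omega> * h \<omega>)"
    proof (rule integrableI_bounded)
      have "(\<integral>\<^sup>+x. ennreal (norm (case x of (s, \<omega>) \<Rightarrow> y s \<omega> * h \<omega>)) \<partial>(lborel \<Otimes>\<^sub>M M)) =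
        (\<integral>\<^sup>+\<omega>. \<integral>\<^sup>+s. ennreal \<bar>y s \<omega> * h \<omega>\<bar> \<partial>lborel \<partial>M)"
        by (subst P.nn_integral_snd[symmetric]) (auto simp: case_prod_beta)
      also have "\<dots> \<le> (\<integral>\<^sup>+\<omega>. (\<integral>\<^sup>+s. ennreal ((y s \<omega>)\<^sup>2) + ennreal ((h \<omega>)\<^sup>2) * indicator {0..t} s \<partial>lborel) \<partial>M)"
      proof (intro nn_integral_mono)
        fix s \<omega>
        \<comment> \<open>The indicator confines the term with \<open>h\<close>, which is constant
          in \<open>s\<close>, to a set of finite measure.\<close>
        have "\<bar>y s \<omega> * h \<omega>\<bar> \<le> (y s \<omega>)\<^sup>2 + (h \<omega>)\<^sup>2 * indicator {0..t} s"
        proof (cases "s \<in> {0..t}")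
          case True
          have "2 * (\<bar>y s \<omega>\<bar> * \<bar>h \<omega>\<bar>) \<le> (y s \<omega>)\<^sup>2 + (h \<omega>)\<^sup>2"
            using sum_squares_bound[of "\<bar>y s \<omega>\<bar>" "\<bar>h \<omega>\<bar>"] by simp
          moreover have "0 \<le> \<bar>y s \<omega>\<bar> * \<bar>h \<omega>\<bar>" by simp
          ultimately have "\<bar>y s \<omega>\<bar> * \<bar>h \<omega>\<bar> \<le> (y s \<omega>)\<^sup>2 + (h \<omega>)\<^sup>2" by linarith
          then show ?thesis using True unfolding abs_mult by simp
        qed (simp add: yz)
        then have "ennreal \<bar>y s \<omega> * h \<omega>\<bar> \<le> ennreal ((y s \<omega>)\<^sup>2 + (h \<omega>)\<^sup>2 * indicator {0..t} s)" by (rule ennreal_leI)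
        then show "ennreal \<bar>y s \<omega> * h \<omega>\<bar> \<le> ennreal ((y s \<omega>)\<^sup>2) + ennreal ((h \<omega>)\<^sup>2) * indicator {0..t} s"
          by (auto simp: indicator_def)
      qed
      also have "\<dots> = (\<integral>\<^sup>+\<omega>. (\<integral>\<^sup>+s. ennreal ((y s \<omega>)\<^sup>2) \<partial>lborel) + ennreal ((h \<omega>)\<^sup>2) * ennreal t \<partial>M)"
      proof (rule nn_integral_cong)
        fix \<omega> assume w: "\<omega> \<in> space M"
        have "(\<lambda>s. y s \<omega>) \<in> borel_measurable lborel"
          using measurable_compose[OF measurable_Pair2'[OF w] ym] by simp
        then show "(\<integral>\<^sup>+s. ennreal ((y s \<omega>)\<^sup>2) + ennreal ((h \<omega>)\<^sup>2) * indicator {0..t} s \<partial>lborel) =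
          (\<integral>\<^sup>+s. ennreal ((y s \<omega>)\<^sup>2) \<partial>lborel) + ennreal ((h \<omega>)\<^sup>2) * ennreal t"
          using t by (subst nn_integral_add) (auto simp: nn_integral_cmult_indicator)
      qed
      also have "\<dots> = (\<integral>\<^sup>+\<omega>. (\<integral>\<^sup>+s. ennreal ((y s \<omega>)\<^sup>2) \<partial>lborel) \<partial>M) + (\<integral>\<^sup>+\<omega>. ennreal ((h \<omega>)\<^sup>2) \<partial>M) * ennreal t"
      proof (subst nn_integral_add)
        have "(\<lambda>x. ennreal ((y (fst x) (snd x))\<^sup>2)) \<in> borel_measurable (lborel \<Otimes>\<^sub>M M)" using ym by (simp add: case_prod_beta)
        from nn_snd_meas[OF this] show "(\<lambda>\<omega>. \<integral>\<^sup>+s. ennreal ((y s \<omega>)\<^sup>2) \<partial>lborel) \<in> borel_measurable M" by simp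
      qed (auto simp: nn_integral_multc)
      also have "\<dots> < \<infinity>" using y2 nn_eq_LINT_sq[OF hL] by (simp add: ennreal_mult_less_top)
      finally show "(\<integral>\<^sup>+x. ennreal (norm (case x of (s, \<omega>) \<Rightarrow> y s \<omega> * h \<omega>)) \<partial>(lborel \<Otimes>\<^sub>M M)) < \<infinity>" .
    qed measurable
    have "expectation (\<lambda>\<omega>. (LINT s|lborel. y s \<omega>) * h \<omega>) = expectation (\<lambda>\<omega>. LINT s|lborel. y s \<omega> * h \<omega>)" by simp
    also have "\<dots> = (LINT s|lborel. expectation (\<lambda>\<omega>. y s \<omega> * h \<omega>))"
      using P.Fubini_integral[OF int] by simp
    also have "\<dots> = 0"
    proof (rule integral_eq_zero_AE)
      show "AE s in lborel. expectation (\<lambda>\<omega>. y s \<omega> * h \<omega>) = 0"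
        using o by eventually_elim (auto simp: yz indicator_def orthD[OF _ h])
    qed
    finally show ?thesis .
  qed
  then show ?thesis using L by (simp add: TI orth_def)
qed

lemma time_integral_orth:
  fixes Z :: "real \<Rightarrow> 'a \<Rightarrow> real^'m"
  assumes T: "0 \<le> T" and B: "B \<subseteq> L2 M" and Z: "sq_process M T Z"
    and o: "AE s in lborel. s \<in> {0..t} \<longrightarrow> orthv M B (Z s)" and t: "t \<in> {0..T}"
  shows "orthv M B (\<lambda>\<omega>. LINT s:{0..t}|lborel. Z s \<omega>)"
proof
  fix a
  have jm: "(\<lambda>(t, \<omega>). Z t \<omega>) \<in> borel_measurable (restrict_space borel {0..T} \<Otimes>\<^sub>M M)"
    and fin: "(\<integral>\<^sup>+\<omega>. (\<integral>\<^sup>+t\<in>{0..T}. ennreal ((norm (Z t \<omega>))\<^sup>2) \<partial>lborel) \<partial>M) < \<infinity>"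
    using Z by (auto simp: sq_process_def)
  have "(\<lambda>\<omega>. LINT s:{0..t}|lborel. Z s \<omega> $ a) \<in> orth M B"
  proof (rule scalar_time_integral_orth[OF T B _ sq_process_component[OF Z] _ t])
    show "(\<lambda>(t, \<omega>). Z t \<omega> $ a) \<in> borel_measurable (restrict_space borel {0..T} \<Otimes>\<^sub>M M)"
      using jm joint_component by blast
    show "AE s in lborel. s \<in> {0..t} \<longrightarrow> (\<lambda>\<omega>. Z s \<omega> $ a) \<in> orth M B" using o by eventually_elim blast
  qed
  then show "(\<lambda>\<omega>. (LINT s:{0..t}|lborel. Z s \<omega>) $ a) \<in> orth M B"
  proof (rule orth_cong_AE[OF _ B borel_measurable_vec_nth[OF time_integral_measurable[OF T jm t]]])
    \<comment> \<open>A component of the integral is identified with the integral of the component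
      on integrable paths; the other paths form a null set.\<close>
    show "AE \<omega> in M. (LINT s:{0..t}|lborel. Z s \<omega> $ a) = (LINT s:{0..t}|lborel. Z s \<omega>) $ a"
      using path_integrable[OF T jm fin t]
    proof eventually_elim
      case (elim \<omega>)
      have "(LINT s|lborel. (indicator {0..t} s *\<^sub>R Z s \<omega>) $ a) = (LINT s|lborel. indicator {0..t} s *\<^sub>R Z s \<omega>) $ a"
        using elim unfolding set_integrable_def by (rule integral_bounded_linear[OF bounded_linear_vec_nth])
      then show ?case by (simp add: set_lebesgue_integral_def)
    qed
  qed
qed

end

section \<open>Measurable projections of processes\<close>


lemma norm_matvec_sq_le: "(norm (A *v x))\<^sup>2 \<le> (norm (A :: real^'m^'k))\<^sup>2 * (norm x)\<^sup>2"
proof -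
  have "(norm (A *v x))\<^sup>2 = (\<Sum>a\<in>UNIV. (A $ a \<bullet> x)\<^sup>2)"
    by (simp add: norm_vec_sq matrix_vector_mul_component)
  also have "\<dots> \<le> (\<Sum>a\<in>UNIV. (norm (A $ a))\<^sup>2 * (norm x)\<^sup>2)"
    by (intro sum_mono) (metis Cauchy_Schwarz_ineq power2_norm_eq_inner)
  also have "\<dots> = (norm A)\<^sup>2 * (norm x)\<^sup>2"
    by (simp add: norm_mat_sq norm_vec_sq sum_distrib_right)
  finally show ?thesis .
qed

lemma nn_double_sum:
  fixes g :: "'a::finite \<Rightarrow> 'b::finite \<Rightarrow> 'c \<Rightarrow> ennreal"
  assumes m: "\<And>a q. g a q \<in> borel_measurable M"
  shows "(\<integral>\<^sup>+u. (\<Sum>a\<in>UNIV. \<Sum>q\<in>UNIV. g a q u) \<partial>M) = (\<Sum>a\<in>UNIV. \<Sum>q\<in>UNIV. \<integral>\<^sup>+u. g a q u \<partial>M)"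
proof -
  have "(\<integral>\<^sup>+u. (\<Sum>a\<in>UNIV. \<Sum>q\<in>UNIV. g a q u) \<partial>M) = (\<Sum>a\<in>UNIV. \<integral>\<^sup>+u. (\<Sum>q\<in>UNIV. g a q u) \<partial>M)"
    by (rule nn_integral_sum) (intro borel_measurable_sum m)
  also have "\<dots> = (\<Sum>a\<in>UNIV. \<Sum>q\<in>UNIV. \<integral>\<^sup>+u. g a q u \<partial>M)"
    by (intro sum.cong refl nn_integral_sum m)
  finally show ?thesis .
qed

lemma norm_sq_add_le: "(norm (x + y :: 'b::real_normed_vector))\<^sup>2 \<le> 2 * (norm x)\<^sup>2 + 2 * (norm y)\<^sup>2"
  using norm_sq_diff_le[of x "- y" 0] by simp

abbreviation jmeas :: "'w measure \<Rightarrow> real \<Rightarrow> (real \<Rightarrow> 'w \<Rightarrow> real^'m) \<Rightarrow> bool" where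
  "jmeas M T Z \<equiv> (\<lambda>(t, \<omega>). Z t \<omega>) \<in> borel_measurable (restrict_space borel {0..T} \<Otimes>\<^sub>M M)"

lemma sq_process_jmeas: "sq_process M T Z \<Longrightarrow> jmeas M T Z"
  by (simp add: sq_process_def)

lemma jmeas_matvec:
  fixes g :: "real \<Rightarrow> real^'m^'k"
  assumes g: "time_measurable T g" and Z: "jmeas M T Z"
  shows "jmeas M T (\<lambda>t \<omega>. g t *v Z t \<omega>)"
  unfolding joint_component
proof
  fix a
  have g': "(\<lambda>t. g t $ a $ b) \<in> borel_measurable (restrict_space borel {0..T})" for b
    using g by (simp add: time_measurable_def borel_measurable_mat)
  have "(\<lambda>x. g (fst x) $ a $ b * (\<lambda>(t, \<omega>). Z t \<omega> $ b) x) \<in> borel_measurable (restrict_space borel {0..T} \<Otimes>\<^sub>M M)" for b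
    using Z measurable_compose[OF measurable_fst g'] unfolding joint_component by (intro borel_measurable_times) blast+
  then have "(\<lambda>x. \<Sum>b\<in>UNIV. g (fst x) $ a $ b * (\<lambda>(t, \<omega>). Z t \<omega> $ b) x) \<in> borel_measurable (restrict_space borel {0..T} \<Otimes>\<^sub>M M)"
    by (rule borel_measurable_sum)
  then show "(\<lambda>(t, \<omega>). (g t *v Z t \<omega>) $ a) \<in> borel_measurable (restrict_space borel {0..T} \<Otimes>\<^sub>M M)"
    by (simp add: matrix_vector_mult_def case_prod_beta)
qed

context prob_space
begin

lemma sq_process_dom:
  assumes Y: "jmeas M T Y" and Z: "sq_process M T Z" and X: "sq_process M T X" and C: "0 \<le> C"
    and le: "\<And>t \<omega>. t \<in> {0..T} \<Longrightarrow> (norm (Y t \<omega>))\<^sup>2 \<le> C * (norm (Z t \<omega>))\<^sup>2 + C * (norm (X t \<omega>))\<^sup>2" and T: "0 \<le> T"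
  shows "sq_process M T Y"
proof -
  let ?n = "\<lambda>Z \<omega>. \<integral>\<^sup>+t\<in>{0..T}. ennreal ((norm (Z t \<omega>))\<^sup>2) \<partial>lborel"
  have ZX: "jmeas M T Z" "jmeas M T X" "(\<integral>\<^sup>+\<omega>. ?n Z \<omega> \<partial>M) < \<infinity>" "(\<integral>\<^sup>+\<omega>. ?n X \<omega> \<partial>M) < \<infinity>"
    using Z X by (auto simp: sq_process_def)
  have mZ: "(\<lambda>t. ennreal ((norm (Z t \<omega>))\<^sup>2) * indicator {0..T} t) \<in> borel_measurable lborel" 
    if w: "\<omega> \<in> space M" and jm: "jmeas M T Z" for \<omega> and Z :: "real \<Rightarrow> 'a \<Rightarrow> real^'z"
  proof -
    have "(\<lambda>s. Z (clamp01 T s) \<omega>) \<in> borel_measurable lborel"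
      using measurable_compose[OF measurable_Pair2'[OF w] joint_clamp[OF T jm]] by simp
    then have "(\<lambda>s. ennreal ((norm (Z (clamp01 T s) \<omega>))\<^sup>2) * indicator {0..T} s) \<in> borel_measurable lborel" by measurable
    moreover have "(\<lambda>s. ennreal ((norm (Z (clamp01 T s) \<omega>))\<^sup>2) * indicator {0..T} s) = (\<lambda>s. ennreal ((norm (Z s \<omega>))\<^sup>2) * indicator {0..T} s)"
      by (auto simp: indicator_def fun_eq_iff clamp_id)
    ultimately show ?thesis by simp
  qed
  have "(\<integral>\<^sup>+\<omega>. ?n Y \<omega> \<partial>M) \<le> (\<integral>\<^sup>+\<omega>. ennreal C * ?n Z \<omega> + ennreal C * ?n X \<omega> \<partial>M)"
  proof (rule nn_integral_mono)
    fix \<omega> assume w: "\<omega> \<in> space M"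
    have "?n Y \<omega> \<le> (\<integral>\<^sup>+t. ennreal C * (ennreal ((norm (Z t \<omega>))\<^sup>2) * indicator {0..T} t) + ennreal C * (ennreal ((norm (X t \<omega>))\<^sup>2) * indicator {0..T} t) \<partial>lborel)"
    proof (rule nn_integral_mono)
      fix t :: real
      show "ennreal ((norm (Y t \<omega>))\<^sup>2) * indicator {0..T} t \<le> ennreal C * (ennreal ((norm (Z t \<omega>))\<^sup>2) * indicator {0..T} t) + ennreal C * (ennreal ((norm (X t \<omega>))\<^sup>2) * indicator {0..T} t)"
        using ennreal_leI[OF le[of t \<omega>]] C by (auto simp: indicator_def ennreal_plus ennreal_mult)
    qed
    also have "\<dots> = ennreal C * ?n Z \<omega> + ennreal C * ?n X \<omega>"
      using mZ[OF w ZX(1)] mZ[OF w ZX(2)] by (subst nn_integral_add) (simp_all add: nn_integral_cmult)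
    finally show "?n Y \<omega> \<le> \<dots>" .
  qed
  also have "\<dots> = ennreal C * (\<integral>\<^sup>+\<omega>. ?n Z \<omega> \<partial>M) + ennreal C * (\<integral>\<^sup>+\<omega>. ?n X \<omega> \<partial>M)"
    using nn_swap(2)[OF T joint_norm_sq[OF ZX(1)]] nn_swap(2)[OF T joint_norm_sq[OF ZX(2)]]
    by (subst nn_integral_add) (simp_all add: nn_integral_cmult)
  also have "\<dots> < \<infinity>" using ZX by (simp add: ennreal_mult_less_top)
  finally show ?thesis using Y by (simp add: sq_process_def)
qed

lemma sq_process_add:
  assumes T: "0 \<le> T" and Z: "sq_process M T Z" "sq_process M T X"
  shows "sq_process M T (\<lambda>t \<omega>. Z t \<omega> + X t \<omega>)"
proof (rule sq_process_dom[OF _ Z, of _ 2])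
  show "jmeas M T (\<lambda>t \<omega>. Z t \<omega> + X t \<omega>)"
    using sq_process_jmeas[OF Z(1)] sq_process_jmeas[OF Z(2)] unfolding case_prod_beta by (rule borel_measurable_add)
qed (use T norm_sq_add_le in auto)

lemma sq_process_matvec:
  fixes g :: "real \<Rightarrow> real^'m^'k"
  assumes T: "0 \<le> T" and g: "time_measurable T g" "bounded (g ` {0..T})" and Z: "sq_process M T Z"
  shows "sq_process M T (\<lambda>t \<omega>. g t *v Z t \<omega>)"
proof -
  obtain b where b: "\<And>t. t \<in> {0..T} \<Longrightarrow> norm (g t) \<le> b" using g(2) unfolding bounded_iff by blast
  show ?thesis
  proof (rule sq_process_dom[OF jmeas_matvec[OF g(1) sq_process_jmeas[OF Z]] Z Z _ _ T])
    fix t \<omega> assume t: "t \<in> {0..T}"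
    have "(norm (g t *v Z t \<omega>))\<^sup>2 \<le> (norm (g t))\<^sup>2 * (norm (Z t \<omega>))\<^sup>2" by (rule norm_matvec_sq_le)
    also have "\<dots> \<le> b\<^sup>2 * (norm (Z t \<omega>))\<^sup>2" using b[OF t] by (intro mult_right_mono power_mono) auto
    also have "\<dots> \<le> b\<^sup>2 * (norm (Z t \<omega>))\<^sup>2 + b\<^sup>2 * (norm (Z t \<omega>))\<^sup>2" by simp
    finally show "(norm (g t *v Z t \<omega>))\<^sup>2 \<le> b\<^sup>2 * (norm (Z t \<omega>))\<^sup>2 + b\<^sup>2 * (norm (Z t \<omega>))\<^sup>2" .
  qed simp
qed

lemma sq_process_zero: "sq_process M T (\<lambda>t \<omega>. 0)"
  by (simp add: sq_process_def case_prod_beta)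

lemma sq_process_sum:
  assumes T: "0 \<le> T" and "\<And>i. i \<in> I \<Longrightarrow> sq_process M T (Z i)"
  shows "sq_process M T (\<lambda>t \<omega>. \<Sum>i\<in>I. Z i t \<omega>)"
  using assms(2) by (induction I rule: infinite_finite_induct) (simp_all add: sq_process_zero sq_process_add[OF T])

lemma sq_process_neg:
  assumes T: "0 \<le> T" and Z: "sq_process M T Z"
  shows "sq_process M T (\<lambda>t \<omega>. - Z t \<omega>)"
proof (rule sq_process_dom[OF _ Z Z, of _ 1])
  show "jmeas M T (\<lambda>t \<omega>. - Z t \<omega>)"
    using sq_process_jmeas[OF Z] unfolding case_prod_beta by (rule borel_measurable_uminus)
qed (use T in auto)

lemma sq_process_diff:
  assumes T: "0 \<le> T" and Z: "sq_process M T Z" "sq_process M T X"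
  shows "sq_process M T (\<lambda>t \<omega>. Z t \<omega> - X t \<omega>)"
  using sq_process_add[OF T Z(1) sq_process_neg[OF T Z(2)]] by simp

text \<open>Both conditions in \<open>is_proj\<close> are memberships in annihilators, and
  \<open>time_integral_orth\<close> applies to each of them.\<close>

lemma time_integral_proj:
  fixes Z Z' :: "real \<Rightarrow> 'a \<Rightarrow> real^'m"
  assumes T: "0 \<le> T" and A: "A \<subseteq> L2 M" and Z: "sq_process M T Z" "sq_process M T Z'"
    and p: "AE s in lborel. s \<in> {0..T} \<longrightarrow> is_projv M A (Z s) (Z' s)" and t: "t \<in> {0..T}"
  shows "is_projv M A (\<lambda>\<omega>. LINT s:{0..t}|lborel. Z s \<omega>) (\<lambda>\<omega>. LINT s:{0..t}|lborel. Z' s \<omega>)"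
proof -
  have 1: "orthv M (orth M A) (\<lambda>\<omega>. LINT s:{0..t}|lborel. Z' s \<omega>)"
  proof (rule time_integral_orth[OF T orth_subset_L2 Z(2) _ t])
    show "AE s in lborel. s \<in> {0..t} \<longrightarrow> orthv M (orth M A) (Z' s)"
      using p by eventually_elim (use t in \<open>simp add: is_proj_def\<close>)
  qed
  have "orthv M A (\<lambda>\<omega>. LINT s:{0..t}|lborel. Z s \<omega> - Z' s \<omega>)"
  proof (rule time_integral_orth[OF T A sq_process_diff[OF T Z] _ t])
    show "AE s in lborel. s \<in> {0..t} \<longrightarrow> orthv M A (\<lambda>\<omega>. Z s \<omega> - Z' s \<omega>)"
      using p by eventually_elim (use t in \<open>simp add: is_proj_def\<close>)
  qed
  then have 2: "orthv M A (\<lambda>\<omega>. (LINT s:{0..t}|lborel. Z s \<omega>) - (LINT s:{0..t}|lborel. Z' s \<omega>))"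
  proof (rule orthv_cong_AE[OF _ A])
    show "(\<lambda>\<omega>. (LINT s:{0..t}|lborel. Z s \<omega>) - (LINT s:{0..t}|lborel. Z' s \<omega>)) \<in> borel_measurable M"
      by (intro borel_measurable_diff time_integral_measurable[OF T _ t] sq_process_jmeas Z)
    have fZ: "(\<integral>\<^sup>+\<omega>. (\<integral>\<^sup>+t\<in>{0..T}. ennreal ((norm (Z t \<omega>))\<^sup>2) \<partial>lborel) \<partial>M) < \<infinity>"
      "(\<integral>\<^sup>+\<omega>. (\<integral>\<^sup>+t\<in>{0..T}. ennreal ((norm (Z' t \<omega>))\<^sup>2) \<partial>lborel) \<partial>M) < \<infinity>"
      using Z by (auto simp: sq_process_def)
    show "AE \<omega> in M. (LINT s:{0..t}|lborel. Z s \<omega> - Z' s \<omega>) = (LINT s:{0..t}|lborel. Z s \<omega>) - (LINT s:{0..t}|lborel. Z' s \<omega>)"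
      using path_integrable[OF T sq_process_jmeas[OF Z(1)] fZ(1) t] path_integrable[OF T sq_process_jmeas[OF Z(2)] fZ(2) t]
      by eventually_elim (rule set_integral_diff(2))
  qed
  show ?thesis using 1 2 by (simp add: is_proj_def)
qed

lemma sq_process_proj:
  assumes T: "0 \<le> T" and Z: "sq_process M T Z" and jm: "jmeas M T Z'"
    and p: "AE s in lborel. s \<in> {0..T} \<longrightarrow> is_projv M A (Z s) (Z' s)"
  shows "sq_process M T Z'"
proof -
  have "(\<integral>\<^sup>+t\<in>{0..T}. (\<integral>\<^sup>+\<omega>. ennreal ((norm (Z' t \<omega>))\<^sup>2) \<partial>M) \<partial>lborel) \<le> (\<integral>\<^sup>+t\<in>{0..T}. (\<integral>\<^sup>+\<omega>. ennreal ((norm (Z t \<omega>))\<^sup>2) \<partial>M) \<partial>lborel)"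
  proof (rule nn_integral_mono_AE)
    show "AE t in lborel. (\<integral>\<^sup>+\<omega>. ennreal ((norm (Z' t \<omega>))\<^sup>2) \<partial>M) * indicator {0..T} t \<le> (\<integral>\<^sup>+\<omega>. ennreal ((norm (Z t \<omega>))\<^sup>2) \<partial>M) * indicator {0..T} t"
      using p
    proof eventually_elim
      case (elim t)
      then show ?case using is_projv_contraction[of M A "Z t" "Z' t"] by (cases "t \<in> {0..T}") simp_all
    qed
  qed
  then show ?thesis using Z jm unfolding sq_process_swap[OF T] by (blast intro: le_less_trans)
qed

end

section \<open>Projections of processes as Wiener integrals with measurable kernels\<close>

context white_noise
begin

lemma proj_uptoD:
  assumes p: "proj_upto \<tau> Z Z' k"
  shows "Z' \<in> orth M (orth M gens)" "(LINT \<omega>|M. Z' \<omega>) = (LINT \<omega>|M. Z \<omega>)"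
    "\<And>q u. u \<in> {0..\<tau>} \<Longrightarrow> (LINT \<omega>|M. (Z \<omega> - Z' \<omega>) * B q u \<omega>) = 0"
    "\<And>q u. u \<in> {\<tau>..T} \<Longrightarrow> (LINT \<omega>|M. Z' \<omega> * inc q \<tau> u \<omega>) = 0"
    "\<And>q. k q \<in> L2 lborel" "\<And>q u. u \<notin> {0<..\<tau>} \<Longrightarrow> k q u = 0"
    "\<And>I c (q :: nat \<times> 'q \<Rightarrow> 'q) a b. finite I \<Longrightarrow> (\<forall>i\<in>I. a i \<in> {0..T} \<and> b i \<in> {0..T} \<and> a i \<le> b i) \<Longrightarrow>
       ennreal (LINT \<omega>|M. (Z' \<omega> - (LINT \<omega>|M. Z \<omega>) - (\<Sum>i\<in>I. c i * inc (q i) (a i) (b i) \<omega>))\<^sup>2)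
         \<le> 4 * ennreal (\<Sum>p\<in>UNIV. LINT u|lborel. (k p u - stepf c I q a b p u)\<^sup>2)"
proof -
  note P = p[unfolded proj_upto_def]
  note P2 = conjunct2[OF P] note P3 = conjunct2[OF P2] note P4 = conjunct2[OF P3]
  note P5 = conjunct2[OF P4] note P6 = conjunct2[OF P5] note P7 = conjunct2[OF P6]
  show "Z' \<in> orth M (orth M gens)" by (rule conjunct1[OF P])
  show "(LINT \<omega>|M. Z' \<omega>) = (LINT \<omega>|M. Z \<omega>)" by (rule conjunct1[OF P2])
  show "(LINT \<omega>|M. (Z \<omega> - Z' \<omega>) * B q u \<omega>) = 0" if "u \<in> {0..\<tau>}" for q u
    by (rule conjunct1[OF P3, rule_format, OF that])
  show "(LINT \<omega>|M. Z' \<omega> * inc q \<tau> u \<omega>) = 0" if "u \<in> {\<tau>..T}" for q u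
    by (rule conjunct1[OF P4, rule_format, OF that])
  show "k q \<in> L2 lborel" for q by (rule conjunct1[OF P5, rule_format])
  show "k q u = 0" if "u \<notin> {0<..\<tau>}" for q u by (rule conjunct1[OF P6, THEN spec, THEN spec, THEN mp, OF that])
  show "ennreal (LINT \<omega>|M. (Z' \<omega> - (LINT \<omega>|M. Z \<omega>) - (\<Sum>i\<in>I. c i * inc (q i) (a i) (b i) \<omega>))\<^sup>2)
         \<le> 4 * ennreal (\<Sum>p\<in>UNIV. LINT u|lborel. (k p u - stepf c I q a b p u)\<^sup>2)"
    if "finite I" "\<forall>i\<in>I. a i \<in> {0..T} \<and> b i \<in> {0..T} \<and> a i \<le> b i" for I c and q :: "nat \<times> 'q \<Rightarrow> 'q" and a b
    by (rule P7[THEN spec, THEN spec, THEN spec, THEN spec, THEN spec, THEN mp, OF that(1), THEN mp, OF that(2)])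
qed

text \<open>A variable orthogonal to the increments after \<open>\<tau>\<close> gains nothing from
  the later noise: splitting \<open>B q u\<close> at \<open>\<tau>\<close> reduces the case
  \<open>u > \<tau>\<close> to \<open>u = \<tau>\<close>.\<close>

lemma proj_upto_is_proj:
  assumes Z: "Z \<in> L2 M" and tau: "\<tau> \<in> {0..T}" and p: "proj_upto \<tau> Z Z' k"
    and ad: "\<And>q u. u \<in> {\<tau>..T} \<Longrightarrow> (LINT \<omega>|M. Z \<omega> * inc q \<tau> u \<omega>) = 0"
  shows "is_proj M gens Z Z'"
proof -
  note p1 = proj_uptoD(1)[OF p] and p2 = proj_uptoD(2)[OF p] and p3 = proj_uptoD(3)[OF p] and p4 = proj_uptoD(4)[OF p]
  have ZL: "Z' \<in> L2 M" by (rule orth_L2[OF p1])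
  note dL = L2_diff[OF Z ZL]
  have "(LINT \<omega>|M. (Z \<omega> - Z' \<omega>) * B q u \<omega>) = 0" if u: "u \<in> {0..T}" for q u
  proof (cases "u \<le> \<tau>")
    case True then show ?thesis using p3 u by simp
  next
    case False
    then have ut: "u \<in> {\<tau>..T}" using u by simp
    have iL: "inc q \<tau> u \<in> L2 M" by (intro inc_L2 tau u)
    have BL: "B q \<tau> \<in> L2 M" by (intro B_L2 tau)
    have "(LINT \<omega>|M. (Z \<omega> - Z' \<omega>) * B q u \<omega>) = (LINT \<omega>|M. (Z \<omega> - Z' \<omega>) * B q \<tau> \<omega> + (Z \<omega> * inc q \<tau> u \<omega> - Z' \<omega> * inc q \<tau> u \<omega>))"
      by (simp add: inc_def algebra_simps)
    also have "\<dots> = (LINT \<omega>|M. (Z \<omega> - Z' \<omega>) * B q \<tau> \<omega>) + ((LINT \<omega>|M. Z \<omega> * inc q \<tau> u \<omega>) - (LINT \<omega>|M. Z' \<omega> * inc q \<tau> u \<omega>))"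
      using L2_prod_integrable[OF dL BL] L2_prod_integrable[OF Z iL] L2_prod_integrable[OF ZL iL] by simp
    also have "\<dots> = 0" using p3[of \<tau> q] tau ad[OF ut] p4[OF ut] by simp
    finally show ?thesis .
  qed
  then have "(\<lambda>\<omega>. Z \<omega> - Z' \<omega>) \<in> orth M gens"
    using dL p2 L2_int[OF Z] L2_int[OF ZL] by (auto simp: orth_def gens_def)
  then show ?thesis using p1 by (simp add: is_proj_def)
qed

definition noisev :: "real \<Rightarrow> 'w \<Rightarrow> real^'q" where
  "noisev u \<omega> = (\<chi> q. B q u \<omega>)"

lemma sum_pairs_delta:
  "(\<Sum>i\<in>{..<N} \<times> UNIV. g (fst i) (snd i) * (if snd i = (p::'q) then h (fst i) else 0)) = (\<Sum>j<N. g j p * (h j :: real))"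
proof -
  have "(\<Sum>i\<in>{..<N} \<times> UNIV. g (fst i) (snd i) * (if snd i = p then h (fst i) else 0)) = (\<Sum>j<N. \<Sum>q\<in>UNIV. g j q * (if q = p then h j else 0))"
    by (simp add: sum.cartesian_product case_prod_beta)
  also have "\<dots> = (\<Sum>j<N. g j p * h j)"
    by (intro sum.cong refl) (simp add: if_distrib[of "\<lambda>x. _ * x"] cong: if_cong)
  finally show ?thesis .
qed

text \<open>Elementary sums with matrix coefficients are flattened into scalar ones indexed by a
  cell and a noise coordinate, whence the index type \<open>nat \<times> 'q\<close> in
  \<open>proj_upto\<close>. Its isometry bound then is the modulus demanded by
  \<open>has_stoch_integral\<close>.\<close>

lemma stoch_integral_of_proj:
  fixes Z Z' :: "'w \<Rightarrow> real^'k"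
  assumes t: "t \<in> {0..T}" and p: "\<And>a. proj_upto t (\<lambda>\<omega>. Z \<omega> $ a) (\<lambda>\<omega>. Z' \<omega> $ a) (k a)"
  shows "has_stoch_integral M noisev (\<lambda>u. \<chi> a q. k a q u) 0 t (\<lambda>\<omega>. Z' \<omega> - (\<chi> a. LINT \<omega>|M. Z \<omega> $ a))"
    "(\<integral>\<^sup>+u\<in>{0..t}. ennreal ((norm (\<chi> a q. k a q u))\<^sup>2) \<partial>lborel) < \<infinity>"
proof -
  let ?F = "\<lambda>u. (\<chi> a q. k a q u) :: real^'q^'k"
  let ?m = "(\<chi> a. LINT \<omega>|M. Z \<omega> $ a) :: real^'k"
  note kL = proj_uptoD(5)[OF p] and ZL = orth_L2[OF proj_uptoD(1)[OF p]]
  have k0: "k a q u = 0" if "u \<notin> {0<..t}" for a q u by (rule proj_uptoD(6)[OF p that])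
  have Fm: "?F \<in> borel_measurable lborel"
    using L2_meas[OF kL] by (simp add: borel_measurable_mat)
  have Zm: "Z' \<in> borel_measurable M" using L2_meas[OF ZL] by (simp add: borel_measurable_vec)
  have Nm: "noisev u \<in> borel_measurable M" if "u \<in> {0..T}" for u
    using L2_meas[OF B_L2[OF that]] by (simp add: borel_measurable_vec noisev_def)
  show fin: "(\<integral>\<^sup>+u\<in>{0..t}. ennreal ((norm (?F u))\<^sup>2) \<partial>lborel) < \<infinity>"
  proof -
    have "(\<integral>\<^sup>+u\<in>{0..t}. ennreal ((norm (?F u))\<^sup>2) \<partial>lborel) \<le> (\<integral>\<^sup>+u. (\<Sum>a\<in>UNIV. \<Sum>q\<in>UNIV. ennreal ((k a q u)\<^sup>2)) \<partial>lborel)"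
      by (intro nn_integral_mono) (auto simp: indicator_def norm_mat_sq sum_ennreal sum_nonneg)
    also have "\<dots> = (\<Sum>a\<in>UNIV. \<Sum>q\<in>UNIV. \<integral>\<^sup>+u. ennreal ((k a q u)\<^sup>2) \<partial>lborel)"
      using L2_meas[OF kL] by (intro nn_double_sum) simp
    also have "\<dots> < \<infinity>" by (simp add: nn_eq_LINT_sq[OF kL])
    finally show ?thesis .
  qed
  show "has_stoch_integral M noisev ?F 0 t (\<lambda>\<omega>. Z' \<omega> - ?m)"
    unfolding has_stoch_integral_def
  proof (intro conjI ballI allI impI)
    show "noisev u \<in> borel_measurable M" if "u \<in> {0..t}" for u using that t by (intro Nm) simp
    show "(\<lambda>\<omega>. Z' \<omega> - ?m) \<in> borel_measurable M" using Zm by simp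
    show "set_borel_measurable lborel {0..t} ?F"
      unfolding set_borel_measurable_def by (intro borel_measurable_scaleR Fm) simp
    fix \<epsilon> :: real assume e: "\<epsilon> > 0"
    show "\<exists>\<delta>>0. \<forall>(N::nat) (s::nat \<Rightarrow> real) c. s 0 = 0 \<and> s N = t \<and> mono_on {..N} s \<and>
        (\<integral>\<^sup>+u\<in>{0..t}. ennreal ((norm (?F u - step_fun N s c u))\<^sup>2) \<partial>lborel) < ennreal \<delta> \<longrightarrow>
        (\<integral>\<^sup>+\<omega>. ennreal ((norm (Z' \<omega> - ?m - elem_sum N s c noisev \<omega>))\<^sup>2) \<partial>M) < ennreal \<epsilon>"
    \<comment> \<open>Compensates the factor 4 of \<open>proj_upto\<close>.\<close>
    proof (intro exI[of _ "\<epsilon> / 4"] conjI allI impI)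
      show "\<epsilon> / 4 > 0" using e by simp
      fix N :: nat and s :: "nat \<Rightarrow> real" and c :: "nat \<Rightarrow> real^'q^'k"
      assume h: "s 0 = 0 \<and> s N = t \<and> mono_on {..N} s \<and>
        (\<integral>\<^sup>+u\<in>{0..t}. ennreal ((norm (?F u - step_fun N s c u))\<^sup>2) \<partial>lborel) < ennreal (\<epsilon> / 4)"
      then have s: "s 0 = 0" "s N = t" "mono_on {..N} s" by auto
      let ?I = "{..<N} \<times> (UNIV :: 'q set)"
      let ?a = "\<lambda>i. s (fst i)" and ?b = "\<lambda>i. s (Suc (fst i))"
      let ?c = "\<lambda>a i. c (fst i) $ a $ snd i"
      have ab: "\<forall>i\<in>?I. ?a i \<in> {0..T} \<and> ?b i \<in> {0..T} \<and> ?a i \<le> ?b i"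
      proof
        fix i assume "i \<in> ?I"
        then have j: "fst i < N" by auto
        show "?a i \<in> {0..T} \<and> ?b i \<in> {0..T} \<and> ?a i \<le> ?b i"
          using node_in[OF s, of "fst i"] node_in[OF s, of "Suc (fst i)"] mono_onD[OF s(3), of "fst i" "Suc (fst i)"] j t by auto
      qed
      have comp: "(Z' \<omega> - ?m - elem_sum N s c noisev \<omega>) $ a =
          Z' \<omega> $ a - (LINT \<omega>|M. Z \<omega> $ a) - (\<Sum>i\<in>?I. ?c a i * inc (snd i) (?a i) (?b i) \<omega>)" for a \<omega>
        by (simp add: matrix_vector_mult_def sum.cartesian_product[symmetric] noisev_def inc_def case_prod_beta
            sum.cartesian_product'[symmetric])
          (simp add: sum.cartesian_product case_prod_beta)
      have stp: "(?F u - step_fun N s c u) $ a $ p = k a p u - stepf (?c a) ?I snd ?a ?b p u" for u a p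
        unfolding stepf_def using sum_pairs_delta[of "\<lambda>j q. c j $ a $ q" p "\<lambda>j. indicator {s j<..s (Suc j)} u" N]
        by (simp add: mult.commute)
      \<comment> \<open>Kernel and step function both live on \<open>(0, t]\<close>, so the integral
        over \<open>[0, t]\<close> equals the integral over the line that occurs in
        \<open>proj_upto\<close>.\<close>
      have off: "k a p u - stepf (?c a) ?I snd ?a ?b p u = 0" if "u \<notin> {0..t}" for u a p
      proof -
        have "stepf (?c a) ?I snd ?a ?b p u = 0"
          unfolding stepf_def
        proof (intro sum.neutral ballI)
          fix i assume "i \<in> ?I"
          then have j: "fst i < N" by auto
          have "u \<notin> {?a i<..?b i}"
            using node_in[OF s, of "fst i"] node_in[OF s, of "Suc (fst i)"] j that by auto
          then show "?c a i * (if snd i = p then indicator {?a i<..?b i} u else 0) = 0" by simp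
        qed
        then show ?thesis using k0[of u a p] that by simp
      qed
      have dL: "(\<lambda>u. k a p u - stepf (?c a) ?I snd ?a ?b p u) \<in> L2 lborel" for a p
        by (intro L2_diff kL stepf_L2)
      have "(\<integral>\<^sup>+u\<in>{0..t}. ennreal ((norm (?F u - step_fun N s c u))\<^sup>2) \<partial>lborel) =
         (\<integral>\<^sup>+u. (\<Sum>a\<in>UNIV. \<Sum>p\<in>UNIV. ennreal ((k a p u - stepf (?c a) ?I snd ?a ?b p u)\<^sup>2)) \<partial>lborel)"
      proof (rule nn_integral_cong)
        fix u :: real
        show "ennreal ((norm (?F u - step_fun N s c u))\<^sup>2) * indicator {0..t} u =
          (\<Sum>a\<in>UNIV. \<Sum>p\<in>UNIV. ennreal ((k a p u - stepf (?c a) ?I snd ?a ?b p u)\<^sup>2))"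
        proof (cases "u \<in> {0..t}")
          case True
          then show ?thesis unfolding norm_mat_sq stp by (simp add: sum_ennreal sum_nonneg)
        next
          case False
          then show ?thesis unfolding off[OF False] by simp
        qed
      qed
      also have "\<dots> = (\<Sum>a\<in>UNIV. \<Sum>p\<in>UNIV. \<integral>\<^sup>+u. ennreal ((k a p u - stepf (?c a) ?I snd ?a ?b p u)\<^sup>2) \<partial>lborel)"
        using L2_meas[OF dL] by (intro nn_double_sum) simp
      also have "\<dots> = (\<Sum>a\<in>UNIV. ennreal (\<Sum>p\<in>UNIV. LINT u|lborel. (k a p u - stepf (?c a) ?I snd ?a ?b p u)\<^sup>2))"
        by (simp add: nn_eq_LINT_sq[OF dL] sum_ennreal)
      finally have small: "(\<Sum>a\<in>UNIV. ennreal (\<Sum>p\<in>UNIV. LINT u|lborel. (k a p u - stepf (?c a) ?I snd ?a ?b p u)\<^sup>2)) < ennreal (\<epsilon> / 4)"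
        using h by simp
      have rL: "(\<lambda>\<omega>. Z' \<omega> $ a - (LINT \<omega>|M. Z \<omega> $ a) - (\<Sum>i\<in>?I. ?c a i * inc (snd i) (?a i) (?b i) \<omega>)) \<in> L2 M" for a
        using ab by (intro L2_diff ZL L2_one L2_sum L2_cmult inc_L2) blast+
      have bound: "ennreal (LINT \<omega>|M. (Z' \<omega> $ a - (LINT \<omega>|M. Z \<omega> $ a) - (\<Sum>i\<in>?I. ?c a i * inc (snd i) (?a i) (?b i) \<omega>))\<^sup>2)
         \<le> 4 * ennreal (\<Sum>p\<in>UNIV. LINT u|lborel. (k a p u - stepf (?c a) ?I snd ?a ?b p u)\<^sup>2)" for a
        by (rule proj_uptoD(7)[OF p _ ab]) simp
      have "(\<integral>\<^sup>+\<omega>. ennreal ((norm (Z' \<omega> - ?m - elem_sum N s c noisev \<omega>))\<^sup>2) \<partial>M) =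
        (\<Sum>a\<in>UNIV. \<integral>\<^sup>+\<omega>. ennreal ((Z' \<omega> $ a - (LINT \<omega>|M. Z \<omega> $ a) - (\<Sum>i\<in>?I. ?c a i * inc (snd i) (?a i) (?b i) \<omega>))\<^sup>2) \<partial>M)"
      proof (subst nn_norm_vec_sq)
        have "elem_sum N s c noisev \<in> borel_measurable M"
          using t by (intro elem_sum_meas[OF s] Nm) simp
        then show "(\<lambda>\<omega>. Z' \<omega> - ?m - elem_sum N s c noisev \<omega>) \<in> borel_measurable M" using Zm by simp
      qed (simp only: comp)
      also have "\<dots> \<le> (\<Sum>a\<in>UNIV. 4 * ennreal (\<Sum>p\<in>UNIV. LINT u|lborel. (k a p u - stepf (?c a) ?I snd ?a ?b p u)\<^sup>2))"
        unfolding nn_eq_LINT_sq[OF rL] by (intro sum_mono bound)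
      also have "\<dots> = 4 * (\<Sum>a\<in>UNIV. ennreal (\<Sum>p\<in>UNIV. LINT u|lborel. (k a p u - stepf (?c a) ?I snd ?a ?b p u)\<^sup>2))"
        by (simp add: sum_distrib_left)
      also have "\<dots> < 4 * ennreal (\<epsilon> / 4)" by (rule ennreal_mult_strict_left_mono[OF small]) simp_all
      also have "\<dots> = ennreal \<epsilon>" using e ennreal_mult[of 4 "\<epsilon> / 4"] by simp
      finally show "(\<integral>\<^sup>+\<omega>. ennreal ((norm (Z' \<omega> - ?m - elem_sum N s c noisev \<omega>))\<^sup>2) \<partial>M) < ennreal \<epsilon>" .
    qed
  qed (rule fin)
qed

text \<open>The horizon of the projection may vary with time: \<open>\<tau> t = t\<close> gives the
  action of the deviating player a kernel on \<open>[0, t]\<close>, and the constant horizon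
  \<open>T\<close> serves for arbitrary processes. Square integrability of the kernel holds at every
  \<open>t\<close>, as \<open>lin_strategy\<close> requires, while the projection property holds
  where \<open>Z t\<close> is square integrable and orthogonal to the later noise.\<close>

lemma exists_process_projection_kernel:
  fixes Z :: "real \<Rightarrow> 'w \<Rightarrow> real^'k"
  assumes S: "0 \<le> S" and Z: "sq_process M S Z"
    and tm: "\<tau> \<in> borel_measurable (restrict_space borel {0..S})" and tau: "\<And>t. t \<in> {0..S} \<Longrightarrow> \<tau> t \<in> {0..T}"
    and ad: "AE t in lborel. t \<in> {0..S} \<longrightarrow> (\<forall>a q. \<forall>u\<in>{\<tau> t..T}. (LINT \<omega>|M. Z t \<omega> $ a * inc q (\<tau> t) u \<omega>) = 0)"
  obtains Z' K m where "sq_process M S Z'"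
    "(\<lambda>(t, u). K t u) \<in> borel_measurable (restrict_space borel {0..S} \<Otimes>\<^sub>M borel)"
    "time_measurable S m"
    "\<And>t. t \<in> {0..S} \<Longrightarrow> (\<integral>\<^sup>+u\<in>{0..\<tau> t}. ennreal ((norm (K t u :: real^'q^'k))\<^sup>2) \<partial>lborel) < \<infinity>"
    "\<And>t. t \<in> {0..S} \<Longrightarrow> orthv M {} (Z t) \<Longrightarrow> has_stoch_integral M noisev (K t) 0 (\<tau> t) (\<lambda>\<omega>. Z' t \<omega> - m t)"
    "\<And>t. t \<in> {0..S} \<Longrightarrow> orthv M {} (Z t) \<Longrightarrow> (\<forall>a q. \<forall>u\<in>{\<tau> t..T}. (LINT \<omega>|M. Z t \<omega> $ a * inc q (\<tau> t) u \<omega>) = 0) \<Longrightarrow>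
      is_projv M gens (Z t) (Z' t)"
proof -
  let ?A = "restrict_space borel {0..S}"
  have spA: "space ?A = {0..S}" by (simp add: space_restrict_space)
  \<comment> \<open>Times with an infinite second moment form a null set; there \<open>Z t\<close>
    is replaced by 0, so that a square-integrable kernel exists at every \<open>t\<close>.\<close>
  define good where "good t \<longleftrightarrow> (\<integral>\<^sup>+\<omega>. ennreal ((norm (Z t \<omega>))\<^sup>2) \<partial>M) < \<infinity>" for t
  define Y where "Y t \<omega> = (if good t then Z t \<omega> else 0)" for t \<omega>
  have jm: "jmeas M S Z" by (rule sq_process_jmeas[OF Z])
  have nm: "(\<lambda>t. \<integral>\<^sup>+\<omega>. ennreal ((norm (Z t \<omega>))\<^sup>2) \<partial>M) \<in> borel_measurable ?A"
    using joint_norm_sq[OF jm] by (rule borel_measurable_nn_integral)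
  have Ym: "(\<lambda>(t, \<omega>). Y t \<omega> $ a) \<in> borel_measurable (?A \<Otimes>\<^sub>M M)" for a
  proof -
    have 1: "(\<lambda>x. \<integral>\<^sup>+\<omega>. ennreal ((norm (Z (fst x) \<omega>))\<^sup>2) \<partial>M) \<in> borel_measurable (?A \<Otimes>\<^sub>M M)"
      using measurable_compose[OF measurable_fst nm] .
    have 2: "(\<lambda>x. Z (fst x) (snd x) $ a) \<in> borel_measurable (?A \<Otimes>\<^sub>M M)"
      using jm[unfolded joint_component, rule_format, of a] unfolding case_prod_beta' .
    have "(\<lambda>x. if (\<integral>\<^sup>+\<omega>. ennreal ((norm (Z (fst x) \<omega>))\<^sup>2) \<partial>M) < \<infinity> then Z (fst x) (snd x) $ a else 0) \<in> borel_measurable (?A \<Otimes>\<^sub>M M)"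
      using 1 2 by measurable
    then show ?thesis by (simp add: Y_def good_def case_prod_beta if_distrib[of "\<lambda>v. v $ a"] cong: if_cong)
  qed
  have YL: "(\<lambda>\<omega>. Y t \<omega> $ a) \<in> L2 M" if t: "t \<in> {0..S}" for t a
  proof (cases "good t")
    case True
    then have "orthv M {} (Z t)" unfolding L2v_iff[OF joint_section[OF jm t]] good_def .
    then show ?thesis using True by (simp add: Y_def orth_empty)
  next
    case False then show ?thesis by (simp add: Y_def L2_zero)
  qed
  have Yeq: "Y t = Z t" if t: "t \<in> {0..S}" and L: "orthv M {} (Z t)" for t
    using L unfolding L2v_iff[OF joint_section[OF jm t]] by (simp add: Y_def good_def fun_eq_iff)
  have "\<exists>Z' k. (\<lambda>(t, \<omega>). Z' t \<omega>) \<in> borel_measurable (?A \<Otimes>\<^sub>M M) \<and>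
    (\<forall>q. (\<lambda>(t, u). k t q u) \<in> borel_measurable (?A \<Otimes>\<^sub>M borel)) \<and>
    (\<forall>t\<in>{0..S}. proj_upto (\<tau> t) (\<lambda>\<omega>. Y t \<omega> $ a) (Z' t) (k t))" for a
  proof -
    obtain Z' k where *: "(\<lambda>(t, \<omega>). Z' t \<omega>) \<in> borel_measurable (?A \<Otimes>\<^sub>M M)"
      "\<And>q. (\<lambda>(t, u). k t q u) \<in> borel_measurable (?A \<Otimes>\<^sub>M borel)"
      "\<And>t. t \<in> space ?A \<Longrightarrow> (\<lambda>\<omega>. Y t \<omega> $ a) \<in> L2 M \<Longrightarrow> proj_upto (\<tau> t) (\<lambda>\<omega>. Y t \<omega> $ a) (Z' t) (k t)"
      by (rule exists_measurable_projection[OF Ym tm, of a]) (use tau spA in auto)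
    show ?thesis using * YL spA by blast
  qed
  then obtain Z1 k where Z1: "\<And>a. (\<lambda>(t, \<omega>). Z1 a t \<omega>) \<in> borel_measurable (?A \<Otimes>\<^sub>M M)"
    and k: "\<And>a q. (\<lambda>(t, u). k a t q u) \<in> borel_measurable (?A \<Otimes>\<^sub>M borel)"
    and pr: "\<And>a t. t \<in> {0..S} \<Longrightarrow> proj_upto (\<tau> t) (\<lambda>\<omega>. Y t \<omega> $ a) (Z1 a t) (k a t)"
    by metis
  define Z' where "Z' t \<omega> = (\<chi> a. Z1 a t \<omega>)" for t \<omega>
  define K where "K t u = (\<chi> a q. k a t q u)" for t u
  define m where "m t = (\<chi> a. LINT \<omega>|M. Y t \<omega> $ a)" for t
  have pr': "proj_upto (\<tau> t) (\<lambda>\<omega>. Y t \<omega> $ a) (\<lambda>\<omega>. Z' t \<omega> $ a) (k a t)" if "t \<in> {0..S}" for t a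
    using pr[OF that, of a] by (simp add: Z'_def)
  have jm': "jmeas M S Z'" unfolding joint_component using Z1 by (simp add: Z'_def)
  have Km: "(\<lambda>(t, u). K t u) \<in> borel_measurable (?A \<Otimes>\<^sub>M borel)"
    using k by (simp add: borel_measurable_mat K_def case_prod_beta)
  have mm: "time_measurable S m"
  proof -
    have "(\<lambda>t. LINT \<omega>|M. Y t \<omega> $ a) \<in> borel_measurable ?A" for a
      using Ym[of a] by (rule borel_measurable_lebesgue_integral)
    then show ?thesis by (simp add: time_measurable_def borel_measurable_vec m_def)
  qed
  have isp: "is_projv M gens (Z t) (Z' t)"
    if t: "t \<in> {0..S}" and L: "orthv M {} (Z t)"
      and ad: "\<forall>a q. \<forall>u\<in>{\<tau> t..T}. (LINT \<omega>|M. Z t \<omega> $ a * inc q (\<tau> t) u \<omega>) = 0" for t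
  proof
    fix a
    show "is_proj M gens (\<lambda>\<omega>. Z t \<omega> $ a) (\<lambda>\<omega>. Z' t \<omega> $ a)"
      using proj_upto_is_proj[OF YL[OF t] tau[OF t] pr'[OF t], of a] ad Yeq[OF t L] by simp
  qed
  have "AE t in lborel. t \<in> {0..S} \<longrightarrow> is_projv M gens (Z t) (Z' t)"
    using ad sq_process_AE_L2[OF S Z] by eventually_elim (use isp in blast)
  then have sq: "sq_process M S Z'" by (rule sq_process_proj[OF S Z jm'])
  have fin: "(\<integral>\<^sup>+u\<in>{0..\<tau> t}. ennreal ((norm (K t u))\<^sup>2) \<partial>lborel) < \<infinity>" if t: "t \<in> {0..S}" for t
    using stoch_integral_of_proj(2)[OF tau[OF t] pr'[OF t]] by (simp add: K_def)
  have h: "has_stoch_integral M noisev (K t) 0 (\<tau> t) (\<lambda>\<omega>. Z' t \<omega> - m t)" if t: "t \<in> {0..S}" for t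
    using stoch_integral_of_proj(1)[OF tau[OF t] pr'[OF t]] unfolding K_def[abs_def] m_def .
  show ?thesis by (rule that[OF sq Km mm fin h isp])
qed

lemma exists_process_projection:
  fixes Z :: "real \<Rightarrow> 'w \<Rightarrow> real^'k"
  assumes S: "0 \<le> S" and Z: "sq_process M S Z"
  obtains Z' where "sq_process M S Z'"
    "\<And>t. t \<in> {0..S} \<Longrightarrow> orthv M {} (Z t) \<Longrightarrow> is_projv M gens (Z t) (Z' t)"
proof -
  have T0: "T \<in> {0..T}" using T by simp
  \<comment> \<open>At the full horizon there is no later noise: \<open>inc q T T\<close> is
    zero.\<close>
  have triv: "\<forall>a q. \<forall>u\<in>{T..T}. (LINT \<omega>|M. Z t \<omega> $ a * inc q T u \<omega>) = 0" for t
    by (simp add: inc_def)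
  show ?thesis
    by (rule exists_process_projection_kernel[OF S Z, of "\<lambda>_. T"]) (use T0 triv that in auto)
qed

end

section \<open>The candidate play\<close>


lemma is_proj_unique:
  assumes "A \<subseteq> L2 M" "is_proj M A Z Z'" "is_proj M A Z Z''"
  shows "AE \<omega> in M. Z' \<omega> = Z'' \<omega>"
proof -
  have "(\<lambda>\<omega>. (Z \<omega> - Z'' \<omega>) - (Z \<omega> - Z' \<omega>)) \<in> orth M A"
    using assms(2,3) unfolding is_proj_def by (elim conjE) (rule orth_diff[OF assms(1)])
  then have 1: "(\<lambda>\<omega>. Z' \<omega> - Z'' \<omega>) \<in> orth M A" by simp
  have 2: "(\<lambda>\<omega>. Z' \<omega> - Z'' \<omega>) \<in> orth M (orth M A)"
    using assms(2,3) unfolding is_proj_def by (elim conjE) (rule orth_diff[OF orth_subset_L2])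
  from orth_inter_zero[OF 1 2] show ?thesis by eventually_elim simp
qed

lemma AE_vec_eqI:
  fixes f g :: "'w \<Rightarrow> real^'m"
  assumes "\<And>a. AE \<omega> in M. f \<omega> $ a = g \<omega> $ a"
  shows "AE \<omega> in M. f \<omega> = g \<omega>"
proof -
  have "AE \<omega> in M. \<forall>a. f \<omega> $ a = g \<omega> $ a" using assms by (simp add: AE_all_countable)
  then show ?thesis by eventually_elim (simp add: vec_eq_iff)
qed

context white_noise
begin

abbreviation in_span :: "('w \<Rightarrow> real^'m) \<Rightarrow> bool" where
  "in_span Z \<equiv> orthv M (orth M gens) Z"

lemma span_const: "in_span (\<lambda>_. v)"
proof
  fix a
  have "(\<lambda>_. 1) \<in> orth M (orth M gens)" by (intro orth_orth_incl gens_L2) (auto simp: gens_def)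
  from orth_cmult[OF this, of "v $ a"] show "(\<lambda>_. v $ a) \<in> orth M (orth M gens)" by simp
qed

lemma span_noise: "u \<in> {0..T} \<Longrightarrow> B q u \<in> orth M (orth M gens)"
  by (intro orth_orth_incl gens_L2) (auto simp: gens_def)

end

context prob_space
begin

lemma meas_const_span: "subalgebra M K \<Longrightarrow> orthv M (orth M (indicators K)) (\<lambda>_. v)"
  by (intro allI meas_in_span L2_const[OF finite_measure_axioms]) auto

lemma cond_exp_eq_proj:
  assumes K: "subalgebra M K" and p: "is_proj M (indicators K) f g"
  shows "AE \<omega> in M. real_cond_exp M K f \<omega> = g \<omega>"
  using is_proj_unique[OF indicators_L2[OF K] cond_exp_is_proj[OF K] p] is_proj_L2[OF p] by blast

end

lemma lq_blocks:
  assumes "lq_game G"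
  shows "brownian_blocks (Pr G) (horizon G) (noise G)"
  using assms unfolding lq_game_def Let_def brownian_blocks_def brownian_blocks_axioms_def by blast

locale lq_candidate =
  fixes G :: "('w, 'd::finite, 'n::finite) lq_game" and F :: "('d, 'n) filter_coeffs"
    and S :: "'n \<Rightarrow> ('d, 'n) lin_strategy" and X :: "real \<Rightarrow> 'w \<Rightarrow> real^'d"
    and D Xhat :: "'n \<Rightarrow> real \<Rightarrow> 'w \<Rightarrow> real^'d"
    and R :: "'n \<Rightarrow> real \<Rightarrow> real \<Rightarrow> 'w \<Rightarrow> ('d, 'n) noise_vec"
  assumes game: "lq_game G" and cand: "candidate G F S X D R Xhat"
begin

abbreviation "MM \<equiv> Pr G"
abbreviation "TT \<equiv> horizon G"

sublocale brownian_blocks "Pr G" "horizon G" "noise G"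
  by (rule lq_blocks[OF game])

abbreviation "YY k \<equiv> signal G X k"
abbreviation "II k \<equiv> innovation G k (YY k) (Xhat k)"
abbreviation "WW k \<equiv> noise_filter k (II k) (R k)"

text \<open>Completed because innovations and deviated actions are shown to be measurable only up to
  null sets of the signal history.\<close>

definition FY :: "'n \<Rightarrow> real \<Rightarrow> 'w measure" where
  "FY k t = completed MM (history MM (YY k) t)"

lemma horizon_nonneg: "0 \<le> TT" using T0 by simp

lemma sens_tb: "time_measurable TT (sens G k)" "bounded (sens G k ` {0..TT})"
  and drift_tb: "time_measurable TT (drift G)" "bounded (drift G ` {0..TT})"
  using game unfolding lq_game_def Let_def by blast+

lemma
  shows X_sq: "sq_process MM TT X"
    and X_plays: "\<And>k. plays_linear G F k (S k) (YY k) (R k) (Xhat k) (D k)"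
    and X_int: "\<And>t. t \<in> {0..TT} \<Longrightarrow> has_stoch_integral MM (noise G) (X_ker F t) 0 t (\<lambda>\<omega>. X t \<omega> - X_mean F t)"
    and err_int: "\<And>k t. t \<in> {0..TT} \<Longrightarrow> has_stoch_integral MM (noise G) (err_ker F k t) 0 t
          (\<lambda>\<omega>. X t \<omega> - cond_exp_vec MM (history MM (YY k) t) (X t) \<omega>)"
    and What_eq: "\<And>k t u. t \<in> {0..TT} \<Longrightarrow> u \<in> {0..t} \<Longrightarrow> AE \<omega> in MM.
          WW k t u \<omega> = cond_exp_vec MM (history MM (YY k) t) (noise G u) \<omega>"
  using cand unfolding candidate_def Let_def by simp_all

lemma
  shows Xhat_sq: "sq_process MM TT (Xhat k)" and smooth: "smoothing_density G F k (II k) (R k)"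
    and Xhat_int: "AE t in lborel. t \<in> {0..TT} \<longrightarrow>
         has_stoch_integral MM (WW k t) (X_ker F t) 0 t (\<lambda>\<omega>. Xhat k t \<omega> - X_mean F t)"
  using X_plays[of k] unfolding plays_linear_def frozen_filter_def Let_def by simp_all

lemma noise_span: "u \<in> {0..TT} \<Longrightarrow> in_span (noise G u)"
  by (intro allI span_noise)

lemma X_span: assumes t: "t \<in> {0..TT}" shows "in_span (X t)"
proof -
  have "in_span (\<lambda>\<omega>. X t \<omega> - X_mean F t)"
    using t by (intro stoch_integral_orth[OF X_int[OF t] _ orth_subset_L2 noise_span]) auto
  from orthv_add[OF orth_subset_L2 this span_const[of "X_mean F t"]] show ?thesis by simp
qed

lemma sens_X_sq: "sq_process MM TT Z \<Longrightarrow> sq_process MM TT (\<lambda>s \<omega>. sens G k s *v Z s \<omega>)"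
  by (rule sq_process_matvec[OF horizon_nonneg sens_tb])

text \<open>Stated for an arbitrary annihilator: one choice of \<open>B\<close> shows that the
  signal is linear in the noise, another that it is measurable with respect to the completed noise
  history.\<close>

lemma signal_orth:
  assumes B: "B \<subseteq> L2 MM" and Z: "sq_process MM TT Z" and t: "t \<in> {0..TT}"
    and o: "AE s in lborel. s \<in> {0..t} \<longrightarrow> orthv MM B (Z s)" and n: "orthv MM B (noise G t)"
  shows "orthv MM B (signal G Z k t)"
proof -
  have "orthv MM B (\<lambda>\<omega>. LINT s:{0..t}|lborel. sens G k s *v Z s \<omega>)"
  proof (rule time_integral_orth[OF horizon_nonneg B sens_X_sq[OF Z] _ t])
    show "AE s in lborel. s \<in> {0..t} \<longrightarrow> orthv MM B (\<lambda>\<omega>. sens G k s *v Z s \<omega>)"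
      using o by eventually_elim (use orthv_matvec[OF B] in blast)
  qed
  from orthv_add[OF B this orthv_matvec[OF B n]] show ?thesis
    unfolding signal_def[abs_def] .
qed

lemma Y_span: assumes t: "t \<in> {0..TT}" shows "in_span (YY k t)"
proof (rule signal_orth[OF orth_subset_L2 X_sq t _ noise_span[OF t]])
  show "AE s in lborel. s \<in> {0..t} \<longrightarrow> in_span (X s)"
    by (rule AE_I2, rule impI, rule X_span) (use t in simp)
qed

lemma noise_subalgebra: "t \<in> {0..TT} \<Longrightarrow> subalgebra MM (history MM (noise G) t)"
  by (intro history_subalgebra W_meas) simp

lemma signal_meas: "sq_process MM TT Z \<Longrightarrow> t \<in> {0..TT} \<Longrightarrow> signal G Z k t \<in> borel_measurable MM"
  unfolding signal_def[abs_def]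
  by (intro borel_measurable_add time_integral_measurable[OF horizon_nonneg] sq_process_jmeas sens_X_sq
      orthv_meas[OF orthv_matvec[OF orth_subset_L2 noise_span]])

lemma Y_subalgebra: "t \<in> {0..TT} \<Longrightarrow> subalgebra MM (history MM (YY k) t)"
  by (intro history_subalgebra signal_meas X_sq) simp

lemma FY_subalgebra: "t \<in> {0..TT} \<Longrightarrow> subalgebra MM (FY k t)"
  unfolding FY_def by (intro completed_subalgebra Y_subalgebra)

text \<open>The state is a mean-square limit of sums of noise increments up to the same time, hence
  measurable up to null sets with respect to the noise history, and the completion absorbs the null
  sets. So the signal does not anticipate future noise.\<close>

lemma Y_noise_meas:
  assumes t: "t \<in> {0..TT}"
  shows "sets (FY k t) \<subseteq> sets (completed MM (history MM (noise G) t))"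
  unfolding FY_def
proof (rule completed_least[OF Y_subalgebra[OF t] noise_subalgebra[OF t]])
  let ?K = "completed MM (history MM (noise G) t)"
  have K: "subalgebra MM ?K" by (intro completed_subalgebra noise_subalgebra t)
  have n: "orthv MM (orth MM (indicators ?K)) (noise G u)" if u: "u \<in> {0..t}" for u
  proof
    fix q
    have uT: "u \<in> {0..TT}" using u t by simp
    have "(\<lambda>\<omega>. noise G u \<omega> $ q) \<in> borel_measurable (history MM (noise G) t)"
      by (rule borel_measurable_vec_nth[OF history_coord[OF u]])
    then have "(\<lambda>\<omega>. noise G u \<omega> $ q) \<in> borel_measurable ?K"
      using completed_incl[OF noise_subalgebra[OF t]]
      by (intro measurable_from_subalg[of ?K "history MM (noise G) t"]) (auto simp: subalgebra_def)
    then show "(\<lambda>\<omega>. noise G u \<omega> $ q) \<in> orth MM (orth MM (indicators ?K))"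
      by (intro meas_in_span[OF K] B_L2 uT)
  qed
  have x: "orthv MM (orth MM (indicators ?K)) (X s)" if s: "s \<in> {0..t}" for s
  proof -
    have sT: "s \<in> {0..TT}" using s t by simp
    have "orthv MM (orth MM (indicators ?K)) (\<lambda>\<omega>. X s \<omega> - X_mean F s)"
      using s by (intro stoch_integral_orth[OF X_int[OF sT] _ orth_subset_L2 n]) auto
    from orthv_add[OF orth_subset_L2 this meas_const_span[OF K, of "X_mean F s"]] show ?thesis by simp
  qed
  show "sets (history MM (YY k) t) \<subseteq> sets ?K"
  proof (rule history_least)
    fix s assume s: "s \<in> {0..t}"
    have "orthv MM (orth MM (indicators ?K)) (YY k s)"
    proof (rule signal_orth[OF orth_subset_L2 X_sq _ _ n[OF s]])
      show "s \<in> {0..TT}" using s t by simp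
      show "AE r in lborel. r \<in> {0..s} \<longrightarrow> orthv MM (orth MM (indicators ?K)) (X r)"
        by (rule AE_I2, rule impI, rule x) (use s in auto)
    qed
    then have "(\<lambda>\<omega>. YY k s \<omega> $ a) \<in> borel_measurable ?K" for a by (intro span_meas[OF noise_subalgebra[OF t]]) blast
    then show "YY k s \<in> borel_measurable ?K" by (simp add: borel_measurable_vec)
  qed simp
qed

lemma inc_orth_FY:
  assumes tu: "t \<in> {0..TT}" "u \<in> {t..TT}"
  shows "inc q t u \<in> orth MM (indicators (FY k t))"
proof -
  have uT: "u \<in> {0..TT}" using tu by simp
  have "expectation (\<lambda>\<omega>. inc q t u \<omega> * h \<omega>) = 0" if h: "h \<in> indicators (FY k t)" for h
  proof -
    obtain A where A: "A \<in> sets (FY k t)" "h = indicator A" using h by (auto simp: indicators_def)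
    then have "A \<in> sets (completed MM (history MM (noise G) t))" using Y_noise_meas[OF tu(1)] by blast
    then obtain C where C: "C \<in> sets (history MM (noise G) t)" "AE \<omega> in MM. \<omega> \<in> A \<longleftrightarrow> \<omega> \<in> C" and AM: "A \<in> sets MM"
      by (auto simp: sets_completed[OF noise_subalgebra[OF tu(1)]])
    have CM: "C \<in> sets MM" using C(1) noise_subalgebra[OF tu(1)] by (auto simp: subalgebra_def)
    have "expectation (\<lambda>\<omega>. inc q t u \<omega> * h \<omega>) = expectation (\<lambda>\<omega>. indicator C \<omega> * inc q t u \<omega>)"
    proof (rule integral_cong_AE)
      show "AE \<omega> in MM. inc q t u \<omega> * h \<omega> = indicator C \<omega> * inc q t u \<omega>"
        using C(2) by eventually_elim (auto simp: A(2) indicator_def)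
    qed (use L2_meas[OF inc_L2[OF tu(1) uT]] AM CM in \<open>simp_all add: A(2)\<close>)
    then show ?thesis using future_orth[OF _ _ _ C(1)] tu by simp
  qed
  then show ?thesis using inc_L2[OF tu(1) uT] by (simp add: orth_def)
qed

lemma FY_mono: assumes "s \<in> {0..t}" "t \<in> {0..TT}" shows "sets (FY k s) \<subseteq> sets (FY k t)"
  unfolding FY_def
proof (rule completed_mono)
  show "subalgebra MM (history MM (YY k) s)" "subalgebra MM (history MM (YY k) t)"
    using assms by (auto intro!: Y_subalgebra)
  show "sets (history MM (YY k) s) \<subseteq> sets (history MM (YY k) t)"
  proof (rule history_least)
    show "YY k r \<in> borel_measurable (history MM (YY k) t)" if "r \<in> {0..s}" for r
      using that assms by (intro history_coord) simp
  qed simp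
qed

lemma FY_span_mono:
  assumes "s \<in> {0..t}" "t \<in> {0..TT}"
  shows "orth MM (orth MM (indicators (FY k s))) \<subseteq> orth MM (orth MM (indicators (FY k t)))"
  by (intro orth_anti) (use FY_mono[OF assms] in \<open>auto simp: indicators_def\<close>)

lemma II_meas:
  assumes u: "u \<in> {0..TT}" shows "II k u \<in> borel_measurable MM"
  unfolding innovation_def[abs_def]
  by (intro borel_measurable_diff signal_meas X_sq u time_integral_measurable[OF horizon_nonneg _ u] sq_process_jmeas sens_X_sq Xhat_sq)

lemma R_sq: "t \<in> {0..TT} \<Longrightarrow> sq_process MM t (R k t)"
  using smooth[of k] by (simp add: smoothing_density_def)

lemma WW_meas:
  assumes t: "t \<in> {0..TT}" and u: "u \<in> {0..t}" shows "WW k t u \<in> borel_measurable MM"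
proof -
  have uT: "u \<in> {0..TT}" and t0: "0 \<le> t" using t u by auto
  have "(*v) (transpose (obs_block k)) \<in> borel_measurable (borel :: (real^'d) measure)"
    by (intro borel_measurable_continuous_onI matrix_vector_mult_linear_continuous_on)
  from measurable_compose[OF II_meas[OF uT, of k] this] time_integral_measurable[OF t0 sq_process_jmeas[OF R_sq[OF t]] u]
  show ?thesis unfolding noise_filter_def[abs_def] by (rule borel_measurable_add)
qed

text \<open>Recasts the hypothesis that filters are conditional expectations as an orthogonal
  projection at fixed \<open>t\<close>, so that \<open>stoch_integral_proj\<close> can condition
  whole integrals against the noise.\<close>

lemma WW_proj:
  assumes t: "t \<in> {0..TT}" and u: "u \<in> {0..t}"
  shows "is_projv MM (indicators (FY k t)) (noise G u) (WW k t u)"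
proof
  fix q
  have uT: "u \<in> {0..TT}" using t u by simp
  have L: "Wc q u \<in> L2 MM" by (rule B_L2[OF uT])
  have p: "is_proj MM (indicators (FY k t)) (Wc q u) (real_cond_exp MM (FY k t) (Wc q u))"
    by (rule cond_exp_is_proj[OF FY_subalgebra[OF t] L])
  have "AE \<omega> in MM. real_cond_exp MM (FY k t) (Wc q u) \<omega> = WW k t u \<omega> $ q"
    using cond_exp_completed[OF Y_subalgebra[OF t] L2_imp_integrable[OF L], of k, folded FY_def] What_eq[OF t u, of k]
    by eventually_elim (simp add: cond_exp_vec_def)
  then show "is_proj MM (indicators (FY k t)) (\<lambda>\<omega>. noise G u \<omega> $ q) (\<lambda>\<omega>. WW k t u \<omega> $ q)"
    by (intro is_proj_cong_AE[OF indicators_L2[OF FY_subalgebra[OF t]] p L2_meas[OF L] borel_measurable_vec_nth[OF WW_meas[OF t u]]]) simp_all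
qed

text \<open>Conditioning the noise representation of \<open>X t\<close> gives the integral of the
  same kernel against the filter, so by uniqueness \<open>Xhat k t\<close> is the conditional
  expectation. That it lies in the span of the noise is read off the error kernel; an argument
  through the filter would be circular, as \<open>WW_span\<close> depends on this fact through the
  innovation.\<close>

lemma Xhat_proj:
  "AE t in lborel. t \<in> {0..TT} \<longrightarrow> is_projv MM (indicators (FY k t)) (X t) (Xhat k t) \<and> in_span (Xhat k t)"
  using Xhat_int[of k]
proof eventually_elim
  case (elim t)
  show ?case
  proof
    assume t: "t \<in> {0..TT}"
    let ?A = "indicators (FY k t)"
    let ?E = "\<lambda>\<omega>. (\<chi> a. real_cond_exp MM (FY k t) (\<lambda>\<omega>. X t \<omega> $ a) \<omega>) :: real^'d"
    note A = indicators_L2[OF FY_subalgebra[OF t, of k]]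
    note xL = orth_L2[OF X_span[OF t, rule_format]]
    have pE: "is_projv MM ?A (X t) ?E"
      using cond_exp_is_proj[OF FY_subalgebra[OF t] xL] by simp
    note pm = is_projv_self[OF meas_const_span[OF FY_subalgebra[OF t, of k], of "X_mean F t"]]
    have h1: "has_stoch_integral MM (WW k t) (X_ker F t) 0 t (\<lambda>\<omega>. ?E \<omega> - X_mean F t)"
      by (rule stoch_integral_proj[OF X_int[OF t] A WW_proj[OF t] is_projv_diff[OF A pE pm]])
    have eq: "AE \<omega> in MM. ?E \<omega> - X_mean F t = Xhat k t \<omega> - X_mean F t"
      using t by (intro stoch_integral_unique[OF h1 elim[rule_format, OF t]]) simp
    then have eq': "AE \<omega> in MM. ?E \<omega> = Xhat k t \<omega>" by eventually_elim simp
    have hm: "Xhat k t \<in> borel_measurable MM" by (rule joint_section[OF sq_process_jmeas[OF Xhat_sq] t])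
    have p: "is_projv MM ?A (X t) (Xhat k t)"
      by (rule is_projv_cong_AE[OF A pE is_projv_meas(1)[OF pE] hm _ eq']) simp
    have e: "in_span (\<lambda>\<omega>. X t \<omega> - cond_exp_vec MM (history MM (YY k) t) (X t) \<omega>)"
      using t by (intro stoch_integral_orth[OF err_int[OF t] _ orth_subset_L2 noise_span]) auto
    have "AE \<omega> in MM. X t \<omega> - cond_exp_vec MM (history MM (YY k) t) (X t) \<omega> = X t \<omega> - Xhat k t \<omega>"
    proof -
      have "AE \<omega> in MM. ?E \<omega> = cond_exp_vec MM (history MM (YY k) t) (X t) \<omega>"
      proof (rule AE_vec_eqI)
        show "AE \<omega> in MM. ?E \<omega> $ a = cond_exp_vec MM (history MM (YY k) t) (X t) \<omega> $ a" for a
          using cond_exp_completed[OF Y_subalgebra[OF t] L2_imp_integrable[OF xL], of k a, folded FY_def]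
          by eventually_elim (simp add: cond_exp_vec_def)
      qed
      then show ?thesis using eq' by eventually_elim simp
    qed
    from orthv_cong_AE[OF e orth_subset_L2 _ this]
    have "in_span (\<lambda>\<omega>. X t \<omega> - Xhat k t \<omega>)" using is_projv_meas(1)[OF pE] hm by simp
    from orthv_diff[OF orth_subset_L2 X_span[OF t] this] have "in_span (Xhat k t)" by simp
    then show "is_projv MM ?A (X t) (Xhat k t) \<and> in_span (Xhat k t)" using p by blast
  qed
qed

lemma innovation_orth:
  assumes B: "B \<subseteq> L2 MM" and u: "u \<in> {0..TT}" and Y: "orthv MM B (Y u)" and Z: "sq_process MM TT Z"
    and o: "AE s in lborel. s \<in> {0..u} \<longrightarrow> orthv MM B (Z s)"
  shows "orthv MM B (innovation G k Y Z u)"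
proof -
  have "orthv MM B (\<lambda>\<omega>. LINT s:{0..u}|lborel. sens G k s *v Z s \<omega>)"
  proof (rule time_integral_orth[OF horizon_nonneg B sens_X_sq[OF Z] _ u])
    show "AE s in lborel. s \<in> {0..u} \<longrightarrow> orthv MM B (\<lambda>\<omega>. sens G k s *v Z s \<omega>)"
      using o by eventually_elim (use orthv_matvec[OF B] in blast)
  qed
  from orthv_diff[OF B Y this] show ?thesis unfolding innovation_def[abs_def] .
qed

lemma II_span: assumes u: "u \<in> {0..TT}" shows "in_span (II k u)"
proof (rule innovation_orth[where Y="YY k" and Z="Xhat k", OF orth_subset_L2 u Y_span[OF u] Xhat_sq])
  show "AE s in lborel. s \<in> {0..u} \<longrightarrow> in_span (Xhat k s)"
    using Xhat_proj[of k] by eventually_elim (use u in simp)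
qed

text \<open>For almost every \<open>s\<close> up to \<open>t\<close> the estimate
  \<open>Xhat k s\<close> lies in the closed span of the signal information, which is enough for the
  time integral in the innovation. For a deviation this leads from innovation events to the
  filtration of the candidate signal.\<close>

lemma II_FY_meas:
  assumes t: "t \<in> {0..TT}" shows "sets (history MM (II k) t) \<subseteq> sets (FY k t)"
proof (rule history_least)
  fix u assume u: "u \<in> {0..t}"
  let ?B = "orth MM (indicators (FY k t))"
  have uT: "u \<in> {0..TT}" using u t by simp
  have "orthv MM ?B (II k u)"
  proof (rule innovation_orth[where Y="YY k" and Z="Xhat k", OF orth_subset_L2 uT _ Xhat_sq])
    show "orthv MM ?B (YY k u)"
    proof
      fix a
      have sub: "subalgebra (FY k t) (history MM (YY k) t)"
        using completed_incl[OF Y_subalgebra[OF t, of k]] by (simp add: subalgebra_def FY_def)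
      have "(\<lambda>\<omega>. YY k u \<omega> $ a) \<in> borel_measurable (FY k t)"
        by (rule measurable_from_subalg[OF sub borel_measurable_vec_nth[OF history_coord[OF u]]])
      then show "(\<lambda>\<omega>. YY k u \<omega> $ a) \<in> orth MM ?B"
        by (intro meas_in_span[OF FY_subalgebra[OF t]] orth_L2[OF Y_span[OF uT, rule_format]])
    qed
    show "AE s in lborel. s \<in> {0..u} \<longrightarrow> orthv MM ?B (Xhat k s)"
      using Xhat_proj[of k]
    proof eventually_elim
      case (elim s)
      show ?case
      proof (intro impI allI)
        fix a assume s: "s \<in> {0..u}"
        then have s': "s \<in> {0..TT}" "s \<in> {0..t}" using u t by auto
        show "(\<lambda>\<omega>. Xhat k s \<omega> $ a) \<in> orth MM ?B"
          by (rule subsetD[OF FY_span_mono[OF s'(2) t]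
            conjunct2[OF conjunct1[OF elim[THEN mp, OF s'(1)], THEN spec, of a, unfolded is_proj_def]]])
      qed
    qed
  qed
  then have "(\<lambda>\<omega>. II k u \<omega> $ a) \<in> borel_measurable (FY k t)" for a
    unfolding FY_def by (intro span_meas[OF Y_subalgebra[OF t]]) blast
  then show "II k u \<in> borel_measurable (FY k t)" by (simp add: borel_measurable_vec)
qed (simp add: FY_def)

lemma WW_span:
  assumes t: "t \<in> {0..TT}" and u: "u \<in> {0..t}" shows "in_span (WW k t u)"
proof -
  have uT: "u \<in> {0..TT}" and t0: "0 \<le> t" using t u by auto
  have "in_span (\<lambda>\<omega>. LINT v:{0..u}|lborel. R k t v \<omega>)"
  proof (rule time_integral_orth[OF t0 orth_subset_L2 R_sq[OF t] _ u])
    have "AE v in lborel. v \<in> {0..t} \<longrightarrow> has_stoch_integral MM (II k)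
             (\<lambda>s. transpose (err_ker F k s v) ** transpose (sens G k s)) v t (R k t v)"
      using smooth[of k] t by (simp add: smoothing_density_def)
    then show "AE v in lborel. v \<in> {0..u} \<longrightarrow> in_span (R k t v)"
    proof eventually_elim
      case (elim v)
      show ?case
      proof (rule impI)
        assume v: "v \<in> {0..u}"
        then have h: "has_stoch_integral MM (II k) (\<lambda>s. transpose (err_ker F k s v) ** transpose (sens G k s)) v t (R k t v)"
          using elim u by simp
        show "in_span (R k t v)"
          using v u t by (intro stoch_integral_orth[OF h _ orth_subset_L2 II_span]) auto
      qed
    qed
  qed
  from orthv_add[OF orth_subset_L2 orthv_matvec[OF orth_subset_L2 II_span[OF uT]] this]
  show ?thesis unfolding noise_filter_def[abs_def] .
qed

text \<open>Up to time \<open>t\<close>, the conditional expectations of the noise are the filters \<open>WW k t\<close>, which are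
  linear in the noise. Future increments are orthogonal to \<open>FY k t\<close>.\<close>

lemma cond_exp_gens:
  assumes t: "t \<in> {0..TT}" and h: "h \<in> gens"
  shows "real_cond_exp MM (FY k t) h \<in> orth MM (orth MM gens)"
proof -
  note A = indicators_L2[OF FY_subalgebra[OF t, of k]]
  have fin: "real_cond_exp MM (FY k t) h \<in> orth MM (orth MM gens)"
    if p: "is_proj MM (indicators (FY k t)) h g" and g: "g \<in> orth MM (orth MM gens)" for g
  proof (rule orth_cong_AE[OF g orth_subset_L2])
    show "AE \<omega> in MM. g \<omega> = real_cond_exp MM (FY k t) h \<omega>"
      using cond_exp_eq_proj[OF FY_subalgebra[OF t] p] by eventually_elim simp
  qed simp
  consider "h = (\<lambda>_. 1)" | q u where "h = Wc q u" "u \<in> {0..TT}" using h unfolding gens_def by blast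
  then show ?thesis
  proof cases
    case 1
    have c: "(\<lambda>_. 1) \<in> orth MM (orth MM (indicators (FY k t)))"
      by (intro meas_in_span FY_subalgebra t L2_one) simp
    show ?thesis unfolding 1
      by (rule fin[unfolded 1, OF is_proj_self[OF c]]) (intro orth_orth_incl gens_L2, simp add: gens_def)
  next
    case 2
    show ?thesis
    proof (cases "u \<le> t")
      case True
      then have u: "u \<in> {0..t}" using 2(2) by simp
      show ?thesis using WW_proj[OF t u, rule_format, of k q] WW_span[OF t u, rule_format, of k q]
        unfolding 2(1) by (rule fin[unfolded 2(1)])
    next
      case False
      then have u: "u \<in> {t..TT}" using 2(2) by simp
      have tt: "t \<in> {0..t}" using t by simp
      note p = WW_proj[OF t tt, rule_format, of k q]
      have "(\<lambda>\<omega>. (Wc q t \<omega> - WW k t t \<omega> $ q) + inc q t u \<omega>) \<in> orth MM (indicators (FY k t))"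
        using p inc_orth_FY[OF t u] unfolding is_proj_def by (intro orth_add A) blast+
      then have "is_proj MM (indicators (FY k t)) (Wc q u) (\<lambda>\<omega>. WW k t t \<omega> $ q)"
        using p by (simp add: is_proj_def inc_def)
      then show ?thesis using WW_span[OF t tt, rule_format, of k q]
        unfolding 2(1) by (rule fin[unfolded 2(1)])
    qed
  qed
qed

text \<open>Conditioning on \<open>FY k t\<close> does not change \<open>Z\<close>, and turns the integral of \<open>K\<close> against the noise
  into the integral of the same kernel against the filtered noise.\<close>

lemma linear_of_measurable:
  assumes t: "t \<in> {0..TT}" and h: "has_stoch_integral MM (noise G) K 0 t (\<lambda>\<omega>. Z \<omega> - m)"
    and Z: "orthv MM (orth MM (indicators (FY k t))) Z"
  shows "has_stoch_integral MM (WW k t) K 0 t (\<lambda>\<omega>. Z \<omega> - m)"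
proof (rule stoch_integral_proj[OF h indicators_L2[OF FY_subalgebra[OF t, of k]] WW_proj[OF t]])
  show "is_projv MM (indicators (FY k t)) (\<lambda>\<omega>. Z \<omega> - m) (\<lambda>\<omega>. Z \<omega> - m)"
    by (rule is_projv_self[OF orthv_diff[OF orth_subset_L2 Z meas_const_span[OF FY_subalgebra[OF t]]]])
qed

end

section \<open>Projection of costs and linear play\<close>


lemma completed_set_cong:
  assumes H: "subalgebra M H" and A: "A \<in> sets M" and B: "B \<in> sets (completed M H)" and eq: "AE \<omega> in M. \<omega> \<in> A \<longleftrightarrow> \<omega> \<in> B"
  shows "A \<in> sets (completed M H)"
proof -
  obtain C where C: "C \<in> sets H" "AE \<omega> in M. \<omega> \<in> B \<longleftrightarrow> \<omega> \<in> C" using B unfolding sets_completed[OF H] by blast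
  have "AE \<omega> in M. \<omega> \<in> A \<longleftrightarrow> \<omega> \<in> C" using eq C(2) by eventually_elim simp
  then show ?thesis using A C(1) unfolding sets_completed[OF H] by blast
qed

lemma LINT_continuous:
  fixes f :: "real \<Rightarrow> 'b::euclidean_space"
  assumes f: "set_integrable lborel {0..T} f"
  shows "continuous_on {0..T} (\<lambda>t. LINT s:{0..t}|lborel. f s)"
proof -
  have c: "continuous_on {0..T} (\<lambda>t. integral {0..t} f)"
    by (rule indefinite_integral_continuous_1[OF set_borel_integral_eq_integral(1)[OF f]])
  have e: "(LINT s:{0..t}|lborel. f s) = integral {0..t} f" if "t \<in> {0..T}" for t
  proof (rule set_borel_integral_eq_integral(2))
    show "set_integrable lborel {0..t} f" using that by (intro set_integrable_subset[OF f]) auto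
  qed
  show ?thesis by (rule continuous_on_eq[OF c e[symmetric]])
qed

lemma inner_matvec: "x \<bullet> (Q *v y) = (\<Sum>a\<in>UNIV. \<Sum>b\<in>UNIV. Q $ a $ b * (x $ a * y $ b))" for x y :: "real^'m"
  by (simp add: inner_vec_def matrix_vector_mult_def sum_distrib_left algebra_simps)

section \<open>Quadratic and linear costs under projection\<close>

context prob_space
begin

lemma bil_integral:
  fixes Z Y :: "'a \<Rightarrow> real^'m"
  assumes Z: "\<And>a. (\<lambda>\<omega>. Z \<omega> $ a) \<in> L2 M" and Y: "\<And>a. (\<lambda>\<omega>. Y \<omega> $ a) \<in> L2 M"
  shows "integrable M (\<lambda>\<omega>. Z \<omega> \<bullet> (Q *v Y \<omega>))"
    "expectation (\<lambda>\<omega>. Z \<omega> \<bullet> (Q *v Y \<omega>)) = (\<Sum>a\<in>UNIV. \<Sum>b\<in>UNIV. Q $ a $ b * expectation (\<lambda>\<omega>. Z \<omega> $ a * Y \<omega> $ b))"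
proof -
  have i: "integrable M (\<lambda>\<omega>. Q $ a $ b * (Z \<omega> $ a * Y \<omega> $ b))" for a b
    by (intro integrable_mult_right L2_prod_integrable Z Y)
  show "integrable M (\<lambda>\<omega>. Z \<omega> \<bullet> (Q *v Y \<omega>))"
    unfolding inner_matvec by (intro Bochner_Integration.integrable_sum i)
  have "expectation (\<lambda>\<omega>. Z \<omega> \<bullet> (Q *v Y \<omega>)) = (\<Sum>a\<in>UNIV. expectation (\<lambda>\<omega>. \<Sum>b\<in>UNIV. Q $ a $ b * (Z \<omega> $ a * Y \<omega> $ b)))"
    unfolding inner_matvec by (rule Bochner_Integration.integral_sum) (intro Bochner_Integration.integrable_sum i)
  also have "\<dots> = (\<Sum>a\<in>UNIV. \<Sum>b\<in>UNIV. expectation (\<lambda>\<omega>. Q $ a $ b * (Z \<omega> $ a * Y \<omega> $ b)))"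
    by (intro sum.cong refl Bochner_Integration.integral_sum i)
  finally show "expectation (\<lambda>\<omega>. Z \<omega> \<bullet> (Q *v Y \<omega>)) = (\<Sum>a\<in>UNIV. \<Sum>b\<in>UNIV. Q $ a $ b * expectation (\<lambda>\<omega>. Z \<omega> $ a * Y \<omega> $ b))"
    by simp
qed

text \<open>The form splits into those of \<open>Z'\<close> and of \<open>Z - Z'\<close> and two
  cross terms. Every component of \<open>Z - Z'\<close> is orthogonal to every component of
  \<open>Z'\<close>, so the cross terms have expectation zero, and the form of \<open>Z - Z'\<close>
  is nonnegative.\<close>

lemma quadratic_proj_le:
  fixes Z Z' :: "'a \<Rightarrow> real^'m"
  assumes p: "is_projv M A Z Z'" and Q: "\<And>v. 0 \<le> v \<bullet> (Q *v v)"
  shows "(\<integral>\<^sup>+\<omega>. ennreal (Z' \<omega> \<bullet> (Q *v Z' \<omega>)) \<partial>M) \<le> (\<integral>\<^sup>+\<omega>. ennreal (Z \<omega> \<bullet> (Q *v Z \<omega>)) \<partial>M)"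
proof -
  let ?U = "\<lambda>\<omega>. Z \<omega> - Z' \<omega>"
  have L: "(\<lambda>\<omega>. Z \<omega> $ a) \<in> L2 M" "(\<lambda>\<omega>. Z' \<omega> $ a) \<in> L2 M" for a
    using is_proj_L2[OF p[rule_format, of a]] by auto
  have UL: "(\<lambda>\<omega>. ?U \<omega> $ a) \<in> L2 M" for a using L2_diff[OF L] by simp
  have z: "expectation (\<lambda>\<omega>. ?U \<omega> $ a * Z' \<omega> $ b) = 0" for a b
    using p[rule_format, of a] p[rule_format, of b] unfolding is_proj_def
    by (intro orth_commute_zero[where B=A]) simp_all
  have z': "expectation (\<lambda>\<omega>. Z' \<omega> $ a * ?U \<omega> $ b) = 0" for a b using z[of b a] by (simp add: mult.commute)
  have "expectation (\<lambda>\<omega>. Z \<omega> \<bullet> (Q *v Z \<omega>)) = expectation (\<lambda>\<omega>. Z' \<omega> \<bullet> (Q *v Z' \<omega>) + ?U \<omega> \<bullet> (Q *v ?U \<omega>) + ?U \<omega> \<bullet> (Q *v Z' \<omega>) + Z' \<omega> \<bullet> (Q *v ?U \<omega>))"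
    by (intro Bochner_Integration.integral_cong refl) (simp add: matrix_vector_mult_diff_distrib inner_diff_left inner_diff_right)
  also have "\<dots> = expectation (\<lambda>\<omega>. Z' \<omega> \<bullet> (Q *v Z' \<omega>)) + expectation (\<lambda>\<omega>. ?U \<omega> \<bullet> (Q *v ?U \<omega>)) + expectation (\<lambda>\<omega>. ?U \<omega> \<bullet> (Q *v Z' \<omega>)) + expectation (\<lambda>\<omega>. Z' \<omega> \<bullet> (Q *v ?U \<omega>))"
    by (simp only: Bochner_Integration.integral_add Bochner_Integration.integrable_add bil_integral(1)[OF L(2) L(2)] bil_integral(1)[OF UL UL]
        bil_integral(1)[OF UL L(2)] bil_integral(1)[OF L(2) UL])
  also have "expectation (\<lambda>\<omega>. ?U \<omega> \<bullet> (Q *v Z' \<omega>)) = 0"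
    unfolding bil_integral(2)[OF UL L(2)] z by simp
  also have "expectation (\<lambda>\<omega>. Z' \<omega> \<bullet> (Q *v ?U \<omega>)) = 0"
    unfolding bil_integral(2)[OF L(2) UL] z' by simp
  finally have "expectation (\<lambda>\<omega>. Z' \<omega> \<bullet> (Q *v Z' \<omega>)) \<le> expectation (\<lambda>\<omega>. Z \<omega> \<bullet> (Q *v Z \<omega>))"
    using Bochner_Integration.integral_nonneg[of M "\<lambda>\<omega>. ?U \<omega> \<bullet> (Q *v ?U \<omega>)"] Q by simp
  moreover have "(\<integral>\<^sup>+\<omega>. ennreal (Y \<omega> \<bullet> (Q *v Y \<omega>)) \<partial>M) = ennreal (expectation (\<lambda>\<omega>. Y \<omega> \<bullet> (Q *v Y \<omega>)))"
    if "\<And>a. (\<lambda>\<omega>. Y \<omega> $ a) \<in> L2 M" for Y :: "'a \<Rightarrow> real^'m"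
    by (rule nn_integral_eq_integral[OF bil_integral(1)[OF that that]]) (simp add: Q)
  ultimately show ?thesis using L by (simp add: ennreal_leI)
qed

lemma inner_proj_eq:
  fixes Z Z' w :: "'a \<Rightarrow> real^'m"
  assumes p: "is_projv M A Z Z'" and w: "orthv M (orth M A) w"
  shows "expectation (\<lambda>\<omega>. w \<omega> \<bullet> Z \<omega>) = expectation (\<lambda>\<omega>. w \<omega> \<bullet> Z' \<omega>)"
    "integrable M (\<lambda>\<omega>. w \<omega> \<bullet> Z \<omega>)" "integrable M (\<lambda>\<omega>. w \<omega> \<bullet> Z' \<omega>)"
proof -
  have L: "(\<lambda>\<omega>. Z \<omega> $ a) \<in> L2 M" "(\<lambda>\<omega>. Z' \<omega> $ a) \<in> L2 M" "(\<lambda>\<omega>. w \<omega> $ a) \<in> L2 M" for a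
    using is_proj_L2[OF p[rule_format, of a]] orth_L2[OF w[rule_format, of a]] by auto
  note i1 = L2_prod_integrable[OF L(3) L(1)] and i2 = L2_prod_integrable[OF L(3) L(2)]
  show "integrable M (\<lambda>\<omega>. w \<omega> \<bullet> Z \<omega>)" "integrable M (\<lambda>\<omega>. w \<omega> \<bullet> Z' \<omega>)"
    unfolding inner_vec_def inner_real_def by (intro Bochner_Integration.integrable_sum i1, intro Bochner_Integration.integrable_sum i2)
  have "expectation (\<lambda>\<omega>. w \<omega> \<bullet> Z \<omega>) = (\<Sum>a\<in>UNIV. expectation (\<lambda>\<omega>. w \<omega> $ a * Z \<omega> $ a))"
    unfolding inner_vec_def inner_real_def by (intro Bochner_Integration.integral_sum i1)
  also have "\<dots> = (\<Sum>a\<in>UNIV. expectation (\<lambda>\<omega>. w \<omega> $ a * Z' \<omega> $ a))"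
    by (intro sum.cong refl is_proj_inner[OF p[rule_format] w[rule_format]])
  also have "\<dots> = expectation (\<lambda>\<omega>. w \<omega> \<bullet> Z' \<omega>)"
    unfolding inner_vec_def inner_real_def by (intro Bochner_Integration.integral_sum[symmetric] i2)
  finally show "expectation (\<lambda>\<omega>. w \<omega> \<bullet> Z \<omega>) = expectation (\<lambda>\<omega>. w \<omega> \<bullet> Z' \<omega>)" .
qed

lemma jmeas_inner:
  assumes "jmeas M T Z" "jmeas M T Y"
  shows "(\<lambda>(t, \<omega>). Z t \<omega> \<bullet> Y t \<omega>) \<in> borel_measurable (restrict_space borel {0..T} \<Otimes>\<^sub>M M)"
  using assms unfolding case_prod_beta' by (rule borel_measurable_inner)

text \<open>Reduces the running linear cost to expectations at fixed times, where the projection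
  property of the state is available.\<close>

lemma linear_cost_Fubini:
  fixes w Z :: "real \<Rightarrow> 'a \<Rightarrow> real^'m"
  assumes T: "0 \<le> T" and w: "sq_process M T w" and Z: "sq_process M T Z" and v: "set_integrable lborel {0..T} v"
  shows "integrable M (\<lambda>\<omega>. LINT t:{0..T}|lborel. 2 * (w t \<omega> \<bullet> Z t \<omega>) + v t)"
    "expectation (\<lambda>\<omega>. LINT t:{0..T}|lborel. 2 * (w t \<omega> \<bullet> Z t \<omega>) + v t)
      = (LINT t|lborel. indicator {0..T} t * expectation (\<lambda>\<omega>. 2 * (w t \<omega> \<bullet> Z t \<omega>) + v t))"
proof -
  interpret P: pair_sigma_finite lborel M by (rule lborel_pair_sigma_finite)
  define g where "g = (\<lambda>(t, \<omega>). indicator {0..T} t * (2 * (w (clamp01 T t) \<omega> \<bullet> Z (clamp01 T t) \<omega>)) + indicator {0..T} t * v t)"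
  have g: "g (t, \<omega>) = indicator {0..T} t * (2 * (w t \<omega> \<bullet> Z t \<omega>) + v t)" for t \<omega>
    by (auto simp: g_def indicator_def clamp_id algebra_simps)
  have vi: "integrable lborel (\<lambda>t. indicator {0..T} t * v t)" using v by (simp add: set_integrable_def)
  note vm = borel_measurable_integrable[OF vi]
  have c: "(\<lambda>x. w (clamp01 T (fst x)) (snd x) \<bullet> Z (clamp01 T (fst x)) (snd x)) \<in> borel_measurable (lborel \<Otimes>\<^sub>M M)"
    using joint_clamp[OF T jmeas_inner[OF sq_process_jmeas[OF w] sq_process_jmeas[OF Z]]] by (simp add: case_prod_beta')
  have gm: "g \<in> borel_measurable (lborel \<Otimes>\<^sub>M M)"
  proof -
    have "(\<lambda>x. indicator {0..T} (fst x) * (2 * (w (clamp01 T (fst x)) (snd x) \<bullet> Z (clamp01 T (fst x)) (snd x)))) \<in> borel_measurable (lborel \<Otimes>\<^sub>M M)"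
      using c by measurable
    from borel_measurable_add[OF this measurable_compose[OF measurable_fst vm]]
    show ?thesis unfolding g_def case_prod_beta' .
  qed
  let ?n = "\<lambda>Z t \<omega>. ennreal ((norm (Z t \<omega>))\<^sup>2)"
  have fin: "(\<integral>\<^sup>+t\<in>{0..T}. (\<integral>\<^sup>+\<omega>. ?n w t \<omega> \<partial>M) \<partial>lborel) < \<infinity>" "(\<integral>\<^sup>+t\<in>{0..T}. (\<integral>\<^sup>+\<omega>. ?n Z t \<omega> \<partial>M) \<partial>lborel) < \<infinity>"
    using w Z unfolding sq_process_swap[OF T] by auto
  have gi: "integrable (lborel \<Otimes>\<^sub>M M) g"
  proof (rule integrableI_bounded[OF gm])
    have "(\<integral>\<^sup>+x. ennreal (norm (g x)) \<partial>(lborel \<Otimes>\<^sub>M M)) = (\<integral>\<^sup>+t. \<integral>\<^sup>+\<omega>. ennreal (norm (g (t, \<omega>))) \<partial>M \<partial>lborel)"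
      using gm by (subst nn_integral_fst[symmetric]) simp_all
    also have "\<dots> \<le> (\<integral>\<^sup>+t. (\<integral>\<^sup>+\<omega>. ?n w t \<omega> \<partial>M) * indicator {0..T} t + (\<integral>\<^sup>+\<omega>. ?n Z t \<omega> \<partial>M) * indicator {0..T} t + ennreal (norm (indicator {0..T} t * v t)) \<partial>lborel)"
    proof (rule nn_integral_mono)
      fix t :: real
      show "(\<integral>\<^sup>+\<omega>. ennreal (norm (g (t, \<omega>))) \<partial>M) \<le> (\<integral>\<^sup>+\<omega>. ?n w t \<omega> \<partial>M) * indicator {0..T} t + (\<integral>\<^sup>+\<omega>. ?n Z t \<omega> \<partial>M) * indicator {0..T} t + ennreal (norm (indicator {0..T} t * v t))"
      proof (cases "t \<in> {0..T}")
        case False then show ?thesis by (simp add: g)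
      next
        case True
        have "(\<integral>\<^sup>+\<omega>. ennreal (norm (g (t, \<omega>))) \<partial>M) \<le> (\<integral>\<^sup>+\<omega>. ?n w t \<omega> + ?n Z t \<omega> + ennreal \<bar>v t\<bar> \<partial>M)"
        proof (rule nn_integral_mono)
          fix \<omega>
          have "\<bar>2 * (w t \<omega> \<bullet> Z t \<omega>) + v t\<bar> \<le> 2 * \<bar>w t \<omega> \<bullet> Z t \<omega>\<bar> + \<bar>v t\<bar>" by linarith
          moreover have "\<bar>w t \<omega> \<bullet> Z t \<omega>\<bar> \<le> norm (w t \<omega>) * norm (Z t \<omega>)" by (rule Cauchy_Schwarz_ineq2)
          moreover have "2 * (norm (w t \<omega>) * norm (Z t \<omega>)) \<le> (norm (w t \<omega>))\<^sup>2 + (norm (Z t \<omega>))\<^sup>2"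
            using sum_squares_bound[of "norm (w t \<omega>)" "norm (Z t \<omega>)"] by simp
          ultimately have "\<bar>2 * (w t \<omega> \<bullet> Z t \<omega>) + v t\<bar> \<le> (norm (w t \<omega>))\<^sup>2 + (norm (Z t \<omega>))\<^sup>2 + \<bar>v t\<bar>" by linarith
          then have "ennreal \<bar>2 * (w t \<omega> \<bullet> Z t \<omega>) + v t\<bar> \<le> ennreal ((norm (w t \<omega>))\<^sup>2 + (norm (Z t \<omega>))\<^sup>2 + \<bar>v t\<bar>)" by (rule ennreal_leI)
          then show "ennreal (norm (g (t, \<omega>))) \<le> ?n w t \<omega> + ?n Z t \<omega> + ennreal \<bar>v t\<bar>"
            using True by (simp add: g ennreal_plus)
        qed
        also have "\<dots> = (\<integral>\<^sup>+\<omega>. ?n w t \<omega> \<partial>M) + (\<integral>\<^sup>+\<omega>. ?n Z t \<omega> \<partial>M) + ennreal \<bar>v t\<bar>"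
        proof -
          have [measurable]: "w t \<in> borel_measurable M" "Z t \<in> borel_measurable M"
            by (rule joint_section[OF sq_process_jmeas[OF w] True], rule joint_section[OF sq_process_jmeas[OF Z] True])
          show ?thesis by (simp add: nn_integral_add emeasure_space_1)
        qed
        finally show ?thesis using True by simp
      qed
    qed
    also have "\<dots> = (\<integral>\<^sup>+t\<in>{0..T}. (\<integral>\<^sup>+\<omega>. ?n w t \<omega> \<partial>M) \<partial>lborel) + (\<integral>\<^sup>+t\<in>{0..T}. (\<integral>\<^sup>+\<omega>. ?n Z t \<omega> \<partial>M) \<partial>lborel) + (\<integral>\<^sup>+t. ennreal (norm (indicator {0..T} t * v t)) \<partial>lborel)"
      using nn_swap(3)[OF T joint_norm_sq[OF sq_process_jmeas[OF w]]] nn_swap(3)[OF T joint_norm_sq[OF sq_process_jmeas[OF Z]]] vm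
      by (subst nn_integral_add, simp, simp, subst nn_integral_add) simp_all
    also have "\<dots> < \<infinity>"
      using fin vi unfolding integrable_iff_bounded by simp
    finally show "(\<integral>\<^sup>+x. ennreal (norm (g x)) \<partial>(lborel \<Otimes>\<^sub>M M)) < \<infinity>" .
  qed
  have LI: "(LINT t:{0..T}|lborel. 2 * (w t \<omega> \<bullet> Z t \<omega>) + v t) = (LINT t|lborel. g (t, \<omega>))" for \<omega>
    by (simp add: set_lebesgue_integral_def g)
  show "integrable M (\<lambda>\<omega>. LINT t:{0..T}|lborel. 2 * (w t \<omega> \<bullet> Z t \<omega>) + v t)"
    unfolding LI using P.integrable_snd[of "\<lambda>t \<omega>. g (t, \<omega>)"] gi by simp
  have "expectation (\<lambda>\<omega>. LINT t|lborel. g (t, \<omega>)) = (LINT t|lborel. expectation (\<lambda>\<omega>. g (t, \<omega>)))"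
    using P.Fubini_integral[of "\<lambda>t \<omega>. g (t, \<omega>)"] gi by simp
  then show "expectation (\<lambda>\<omega>. LINT t:{0..T}|lborel. 2 * (w t \<omega> \<bullet> Z t \<omega>) + v t)
      = (LINT t|lborel. indicator {0..T} t * expectation (\<lambda>\<omega>. 2 * (w t \<omega> \<bullet> Z t \<omega>) + v t))"
    unfolding LI g by simp
qed

end

text \<open>The existential form lets \<open>choice\<close> and \<open>bchoice\<close> select
  projections for all players, or for all outer times of a filter density, at once.\<close>

lemma (in white_noise) process_projection_ex:
  fixes Z :: "real \<Rightarrow> 'w \<Rightarrow> real^'k"
  assumes S: "0 \<le> S" and Z: "sq_process M S Z"
  shows "\<exists>Z'. sq_process M S Z' \<and> (\<forall>t\<in>{0..S}. orthv M {} (Z t) \<longrightarrow> is_projv M gens (Z t) (Z' t))"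
proof (rule exists_process_projection[OF S Z])
  fix Z' assume a: "sq_process M S Z'"
    and b: "\<And>t. t \<in> {0..S} \<Longrightarrow> orthv M {} (Z t) \<Longrightarrow> is_projv M gens (Z t) (Z' t)"
  show ?thesis
  proof (intro exI[of _ Z'] conjI ballI impI)
    show "sq_process M S Z'" by (rule a)
    show "is_projv M gens (Z t) (Z' t)" if "t \<in> {0..S}" "orthv M {} (Z t)" for t by (rule b[OF that])
  qed
qed

lemma (in white_noise) AE_projv:
  assumes S: "0 \<le> S" and Z: "sq_process M S Z"
    and p: "\<forall>t\<in>{0..S}. orthv M {} (Z t) \<longrightarrow> is_projv M gens (Z t) (Z' t)"
  shows "AE t in lborel. t \<in> {0..S} \<longrightarrow> is_projv M gens (Z t) (Z' t)"
  using sq_process_AE_L2[OF S Z]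
proof eventually_elim
  case (elim t)
  show ?case
  proof (rule impI)
    assume t: "t \<in> {0..S}"
    show "is_projv M gens (Z t) (Z' t)" by (rule p[THEN bspec, OF t, THEN mp, OF elim[THEN mp, OF t]])
  qed
qed

context lq_candidate
begin

lemma
  shows wXX_m: "time_measurable TT (wXX G k)" and wXX_psd: "\<And>t. t \<in> {0..TT} \<Longrightarrow> psd (wXX G k t)"
    and wDD_m: "time_measurable TT (wDD G k)" and wDD_pos: "\<And>t. t \<in> {0..TT} \<Longrightarrow> posdef (wDD G k t)"
    and w0_int: "set_integrable lborel {0..TT} (w0 G k)" and wX_sq: "sq_process MM TT (wX G k)"
    and wX_int: "\<And>t. t \<in> {0..TT} \<Longrightarrow> has_stoch_integral MM (noise G) (wX_ker G k t) 0 t (\<lambda>\<omega>. wX G k t \<omega> - wX_mean G k t)"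
  using game unfolding lq_game_def Let_def by simp_all

lemma wX_span: assumes t: "t \<in> {0..TT}" shows "in_span (wX G k t)"
proof -
  have "in_span (\<lambda>\<omega>. wX G k t \<omega> - wX_mean G k t)"
    using t by (intro stoch_integral_orth[OF wX_int[OF t] _ orth_subset_L2 noise_span]) auto
  from orthv_add[OF orth_subset_L2 this span_const[of "wX_mean G k t"]] show ?thesis by simp
qed

text \<open>The state is projected at every time because the terminal cost looks at the single time
  \<open>TT\<close>; for the action almost every time is enough. The comparison takes place at fixed
  times, after the integrals are exchanged.\<close>

lemma cost_proj_le:
  assumes Z: "sq_process MM TT Z" "sq_process MM TT Z'" and U: "sq_process MM TT U" "sq_process MM TT U'"
    and pZ: "\<And>t. t \<in> {0..TT} \<Longrightarrow> is_projv MM gens (Z t) (Z' t)"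
    and pU: "AE t in lborel. t \<in> {0..TT} \<longrightarrow> is_projv MM gens (U t) (U' t)"
  shows "cost G k Z' U' \<le> cost G k Z U"
proof -
  have TT: "TT \<in> {0..TT}" using T0 by simp
  have psdX: "0 \<le> v \<bullet> (wXX G k t *v v)" if "t \<in> {0..TT}" for t v
    using wXX_psd[OF that] by (simp add: psd_def)
  have psdD: "0 \<le> v \<bullet> (wDD G k t *v v)" if "t \<in> {0..TT}" for t v
    using wDD_pos[OF that, of k] by (cases "v = 0") (auto simp: posdef_def less_imp_le)
  let ?q = "\<lambda>Z U t \<omega>. Z t \<omega> \<bullet> (wXX G k t *v Z t \<omega>) + U t \<omega> \<bullet> (wDD G k t *v U t \<omega>)"
  let ?N = "\<lambda>Z U. \<integral>\<^sup>+\<omega>. (\<integral>\<^sup>+t\<in>{0..TT}. ennreal (?q Z U t \<omega>) \<partial>lborel) + ennreal (Z TT \<omega> \<bullet> (wXX G k TT *v Z TT \<omega>)) \<partial>MM"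
  let ?L = "\<lambda>Z. expectation (\<lambda>\<omega>. (LINT t:{0..TT}|lborel. 2 * (wX G k t \<omega> \<bullet> Z t \<omega>) + w0 G k t) + 2 * (wX G k TT \<omega> \<bullet> Z TT \<omega>))"
  have jq: "(\<lambda>(t, \<omega>). Z t \<omega> \<bullet> (wXX G k t *v Z t \<omega>)) \<in> borel_measurable (restrict_space borel {0..TT} \<Otimes>\<^sub>M MM)"
    "(\<lambda>(t, \<omega>). Z t \<omega> \<bullet> (wDD G k t *v Z t \<omega>)) \<in> borel_measurable (restrict_space borel {0..TT} \<Otimes>\<^sub>M MM)"
    if "sq_process MM TT Z" for Z
    by (intro jmeas_inner jmeas_matvec wXX_m wDD_m sq_process_jmeas that)+
  have qm: "(\<lambda>(t, \<omega>). ennreal (?q Z U t \<omega>)) \<in> borel_measurable (restrict_space borel {0..TT} \<Otimes>\<^sub>M MM)"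
    if "sq_process MM TT Z" "sq_process MM TT U" for Z U
    using jq(1)[OF that(1)] jq(2)[OF that(2)] unfolding case_prod_beta' by measurable
  have N: "?N Z U = (\<integral>\<^sup>+t\<in>{0..TT}. (\<integral>\<^sup>+\<omega>. ennreal (?q Z U t \<omega>) \<partial>MM) \<partial>lborel) + (\<integral>\<^sup>+\<omega>. ennreal (Z TT \<omega> \<bullet> (wXX G k TT *v Z TT \<omega>)) \<partial>MM)"
    if ZU: "sq_process MM TT Z" "sq_process MM TT U" for Z U
  proof -
    have "(\<lambda>\<omega>. Z TT \<omega> \<bullet> (wXX G k TT *v Z TT \<omega>)) \<in> borel_measurable MM"
      by (rule joint_section[OF jq(1)[OF ZU(1)] TT])
    then show ?thesis
      using nn_swap(2)[OF horizon_nonneg qm[OF ZU]] by (subst nn_integral_add) (simp_all add: nn_swap(1)[OF horizon_nonneg qm[OF ZU]])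
  qed
  have split: "(\<integral>\<^sup>+\<omega>. ennreal (?q Z U t \<omega>) \<partial>MM) = (\<integral>\<^sup>+\<omega>. ennreal (Z t \<omega> \<bullet> (wXX G k t *v Z t \<omega>)) \<partial>MM) + (\<integral>\<^sup>+\<omega>. ennreal (U t \<omega> \<bullet> (wDD G k t *v U t \<omega>)) \<partial>MM)"
    if ZU: "sq_process MM TT Z" "sq_process MM TT U" and t: "t \<in> {0..TT}" for Z U t
  proof -
    have "(\<lambda>\<omega>. Z t \<omega> \<bullet> (wXX G k t *v Z t \<omega>)) \<in> borel_measurable MM" "(\<lambda>\<omega>. U t \<omega> \<bullet> (wDD G k t *v U t \<omega>)) \<in> borel_measurable MM"
      by (rule joint_section[OF jq(1)[OF ZU(1)] t], rule joint_section[OF jq(2)[OF ZU(2)] t])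
    then show ?thesis using psdX[OF t] psdD[OF t] by (simp add: ennreal_plus nn_integral_add)
  qed
  have "?N Z' U' \<le> ?N Z U"
    unfolding N[OF Z(1) U(1)] N[OF Z(2) U(2)]
  proof (rule add_mono)
    show "(\<integral>\<^sup>+\<omega>. ennreal (Z' TT \<omega> \<bullet> (wXX G k TT *v Z' TT \<omega>)) \<partial>MM) \<le> (\<integral>\<^sup>+\<omega>. ennreal (Z TT \<omega> \<bullet> (wXX G k TT *v Z TT \<omega>)) \<partial>MM)"
      by (rule quadratic_proj_le[OF pZ[OF TT] psdX[OF TT]])
    show "(\<integral>\<^sup>+t\<in>{0..TT}. (\<integral>\<^sup>+\<omega>. ennreal (?q Z' U' t \<omega>) \<partial>MM) \<partial>lborel) \<le> (\<integral>\<^sup>+t\<in>{0..TT}. (\<integral>\<^sup>+\<omega>. ennreal (?q Z U t \<omega>) \<partial>MM) \<partial>lborel)"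
    proof (rule nn_integral_mono_AE)
      show "AE t in lborel. (\<integral>\<^sup>+\<omega>. ennreal (?q Z' U' t \<omega>) \<partial>MM) * indicator {0..TT} t \<le> (\<integral>\<^sup>+\<omega>. ennreal (?q Z U t \<omega>) \<partial>MM) * indicator {0..TT} t"
        using pU
      proof eventually_elim
        case (elim t)
        show ?case
        proof (cases "t \<in> {0..TT}")
          case True
          have "(\<integral>\<^sup>+\<omega>. ennreal (?q Z' U' t \<omega>) \<partial>MM) \<le> (\<integral>\<^sup>+\<omega>. ennreal (?q Z U t \<omega>) \<partial>MM)"
            unfolding split[OF Z(1) U(1) True] split[OF Z(2) U(2) True]
            by (intro add_mono quadratic_proj_le[OF pZ[OF True] psdX[OF True]] quadratic_proj_le[OF elim[THEN mp, OF True] psdD[OF True]])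
          then show ?thesis using True by simp
        qed simp
      qed
    qed
  qed
  moreover have "?L Z' = ?L Z"
  proof -
    note i = inner_proj_eq[OF pZ wX_span]
    have e: "expectation (\<lambda>\<omega>. 2 * (wX G k t \<omega> \<bullet> Z' t \<omega>) + w0 G k t) = expectation (\<lambda>\<omega>. 2 * (wX G k t \<omega> \<bullet> Z t \<omega>) + w0 G k t)"
      if t: "t \<in> {0..TT}" for t
      using i(1)[OF t t, of k] i(2)[OF t t, of k] i(3)[OF t t, of k] by simp
    have "expectation (\<lambda>\<omega>. LINT t:{0..TT}|lborel. 2 * (wX G k t \<omega> \<bullet> Z' t \<omega>) + w0 G k t) = expectation (\<lambda>\<omega>. LINT t:{0..TT}|lborel. 2 * (wX G k t \<omega> \<bullet> Z t \<omega>) + w0 G k t)"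
      unfolding linear_cost_Fubini(2)[OF horizon_nonneg wX_sq Z(1) w0_int] linear_cost_Fubini(2)[OF horizon_nonneg wX_sq Z(2) w0_int]
    proof (intro Bochner_Integration.integral_cong refl)
      fix t :: real
      show "indicator {0..TT} t * expectation (\<lambda>\<omega>. 2 * (wX G k t \<omega> \<bullet> Z' t \<omega>) + w0 G k t) = indicator {0..TT} t * expectation (\<lambda>\<omega>. 2 * (wX G k t \<omega> \<bullet> Z t \<omega>) + w0 G k t)"
        using e[of t] by (cases "t \<in> {0..TT}") simp_all
    qed
    then show ?thesis
      using i(1)[OF TT TT, of k] i(2)[OF TT TT, of k] i(3)[OF TT TT, of k]
        linear_cost_Fubini(1)[OF horizon_nonneg wX_sq Z(1) w0_int, of k] linear_cost_Fubini(1)[OF horizon_nonneg wX_sq Z(2) w0_int, of k] by simp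
  qed
  ultimately show ?thesis
    unfolding cost_def Let_def by (simp add: add_right_mono less_eq_ennreal.rep_eq)
qed

lemma signal_proj:
  assumes Z: "sq_process MM TT Z" "sq_process MM TT Z'" and t: "t \<in> {0..TT}"
    and p: "AE s in lborel. s \<in> {0..TT} \<longrightarrow> is_projv MM gens (Z s) (Z' s)"
  shows "is_projv MM gens (signal G Z k t) (signal G Z' k t)"
proof -
  have "is_projv MM gens (\<lambda>\<omega>. LINT s:{0..t}|lborel. sens G k s *v Z s \<omega>) (\<lambda>\<omega>. LINT s:{0..t}|lborel. sens G k s *v Z' s \<omega>)"
  proof (rule time_integral_proj[OF horizon_nonneg gens_L2 sens_X_sq[OF Z(1)] sens_X_sq[OF Z(2)] _ t])
    show "AE s in lborel. s \<in> {0..TT} \<longrightarrow> is_projv MM gens (\<lambda>\<omega>. sens G k s *v Z s \<omega>) (\<lambda>\<omega>. sens G k s *v Z' s \<omega>)"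
      using p by eventually_elim (use is_projv_matvec[OF gens_L2] in blast)
  qed
  from is_projv_add[OF gens_L2 this is_projv_matvec[OF gens_L2 is_projv_self[OF noise_span[OF t]]]]
  show ?thesis unfolding signal_def[abs_def] .
qed

text \<open>Only the state estimate and the density part are chosen for the new signal, as
  projections of the old ones. Innovation and noise filter are linear images of these and of the
  signal, so they are projected automatically, and \<open>stoch_integral_proj\<close> carries over
  each defining integral, including the feedback of the filter into its own state estimate.\<close>

lemma plays_linear_proj:
  assumes pl: "plays_linear G F k L (signal G Z k) R1 Xh1 U"
    and Z: "sq_process MM TT Z" "sq_process MM TT Z'" and pZ: "\<And>t. t \<in> {0..TT} \<Longrightarrow> is_projv MM gens (Z t) (Z' t)"
    and pU: "AE t in lborel. t \<in> {0..TT} \<longrightarrow> is_projv MM gens (U t) (U' t)"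
  shows "\<exists>R2 Xh2. plays_linear G F k L (signal G Z' k) R2 Xh2 U'"
proof -
  let ?I = "innovation G k (signal G Z k) Xh1"
  have Xs: "sq_process MM TT Xh1" and sm: "smoothing_density G F k ?I R1"
    and Xi: "AE t in lborel. t \<in> {0..TT} \<longrightarrow> has_stoch_integral MM (noise_filter k ?I R1 t) (X_ker F t) 0 t (\<lambda>\<omega>. Xh1 t \<omega> - X_mean F t)"
    and act: "AE t in lborel. t \<in> {0..TT} \<longrightarrow> has_stoch_integral MM (noise_filter k ?I R1 t) (D_ker L t) 0 t (\<lambda>\<omega>. U t \<omega> - D_mean L t)"
    using pl unfolding plays_linear_def frozen_filter_def lin_action_def Let_def by simp_all
  from process_projection_ex[OF horizon_nonneg Xs] obtain Xh2 where
    Xh2: "sq_process MM TT Xh2 \<and> (\<forall>t\<in>{0..TT}. orthv MM {} (Xh1 t) \<longrightarrow> is_projv MM gens (Xh1 t) (Xh2 t))" ..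
  note Xs2 = conjunct1[OF Xh2] and pX = AE_projv[OF horizon_nonneg Xs conjunct2[OF Xh2]]
  have R1s: "sq_process MM t (R1 t)" if "t \<in> {0..TT}" for t using sm that by (simp add: smoothing_density_def)
  \<comment> \<open>\<open>smoothing_density\<close> demands measurability of \<open>R t\<close> for
    each \<open>t\<close> separately, so the choices at different \<open>t\<close> may be
    unrelated.\<close>
  have ex: "\<forall>t\<in>{0..TT}. \<exists>R2. sq_process MM t R2 \<and> (\<forall>u\<in>{0..t}. orthv MM {} (R1 t u) \<longrightarrow> is_projv MM gens (R1 t u) (R2 u))"
  proof
    fix t assume t: "t \<in> {0..TT}"
    then have "0 \<le> t" by simp
    from process_projection_ex[OF this R1s[OF t]]
    show "\<exists>R2. sq_process MM t R2 \<and> (\<forall>u\<in>{0..t}. orthv MM {} (R1 t u) \<longrightarrow> is_projv MM gens (R1 t u) (R2 u))" .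
  qed
  from bchoice[OF ex] obtain R2 where
    R2: "\<forall>t\<in>{0..TT}. sq_process MM t (R2 t) \<and> (\<forall>u\<in>{0..t}. orthv MM {} (R1 t u) \<longrightarrow> is_projv MM gens (R1 t u) (R2 t u))" ..
  have R2s: "sq_process MM t (R2 t)" if "t \<in> {0..TT}" for t by (rule conjunct1[OF R2[THEN bspec, OF that]])
  have pR: "AE u in lborel. u \<in> {0..t} \<longrightarrow> is_projv MM gens (R1 t u) (R2 t u)" if t: "t \<in> {0..TT}" for t
  proof (rule AE_projv[OF _ R1s[OF t] conjunct2[OF R2[THEN bspec, OF t]]])
    show "0 \<le> t" using t by simp
  qed
  let ?J = "innovation G k (signal G Z' k) Xh2"
  have pZ': "AE s in lborel. s \<in> {0..TT} \<longrightarrow> is_projv MM gens (Z s) (Z' s)"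
    by (rule AE_I2, rule impI, rule pZ)
  have pI: "is_projv MM gens (?I u) (?J u)" if u: "u \<in> {0..TT}" for u
  proof -
    have "is_projv MM gens (\<lambda>\<omega>. LINT s:{0..u}|lborel. sens G k s *v Xh1 s \<omega>) (\<lambda>\<omega>. LINT s:{0..u}|lborel. sens G k s *v Xh2 s \<omega>)"
    proof (rule time_integral_proj[OF horizon_nonneg gens_L2 sens_X_sq[OF Xs] sens_X_sq[OF Xs2] _ u])
      show "AE s in lborel. s \<in> {0..TT} \<longrightarrow> is_projv MM gens (\<lambda>\<omega>. sens G k s *v Xh1 s \<omega>) (\<lambda>\<omega>. sens G k s *v Xh2 s \<omega>)"
        using pX by eventually_elim (use is_projv_matvec[OF gens_L2] in blast)
    qed
    from is_projv_diff[OF gens_L2 signal_proj[OF Z u pZ'] this] show ?thesis unfolding innovation_def[abs_def] .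
  qed
  have pN: "is_projv MM gens (noise_filter k ?I R1 t u) (noise_filter k ?J R2 t u)" if t: "t \<in> {0..TT}" and u: "u \<in> {0..t}" for t u
  proof -
    have t0: "0 \<le> t" and uT: "u \<in> {0..TT}" using t u by auto
    from is_projv_add[OF gens_L2 is_projv_matvec[OF gens_L2 pI[OF uT]] time_integral_proj[OF t0 gens_L2 R1s[OF t] R2s[OF t] pR[OF t] u]]
    show ?thesis unfolding noise_filter_def[abs_def] .
  qed
  have pc: "is_projv MM gens (\<lambda>\<omega>. V \<omega> - c) (\<lambda>\<omega>. V' \<omega> - c)" if "is_projv MM gens V V'" for V V' :: "'w \<Rightarrow> real^'d" and c
    by (rule is_projv_diff[OF gens_L2 that is_projv_self[OF span_const]])
  have "smoothing_density G F k ?J R2"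
    unfolding smoothing_density_def
  proof (intro ballI conjI)
    fix t assume t: "t \<in> {0..TT}"
    show "sq_process MM t (R2 t)" by (rule R2s[OF t])
    have "AE u in lborel. u \<in> {0..t} \<longrightarrow> has_stoch_integral MM ?I (\<lambda>s. transpose (err_ker F k s u) ** transpose (sens G k s)) u t (R1 t u)"
      using sm t by (simp add: smoothing_density_def)
    then show "AE u in lborel. u \<in> {0..t} \<longrightarrow> has_stoch_integral MM ?J (\<lambda>s. transpose (err_ker F k s u) ** transpose (sens G k s)) u t (R2 t u)"
      using pR[OF t]
    proof eventually_elim
      case (elim u)
      show ?case
      proof (rule impI)
        assume u: "u \<in> {0..t}"
        show "has_stoch_integral MM ?J (\<lambda>s. transpose (err_ker F k s u) ** transpose (sens G k s)) u t (R2 t u)"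
        proof (rule stoch_integral_proj[OF elim(1)[THEN mp, OF u] gens_L2 _ elim(2)[THEN mp, OF u]])
          show "is_projv MM gens (?I r) (?J r)" if "r \<in> {u..t}" for r by (rule pI) (use that u t in auto)
        qed
      qed
    qed
  qed
  moreover have "AE t in lborel. t \<in> {0..TT} \<longrightarrow> has_stoch_integral MM (noise_filter k ?J R2 t) (X_ker F t) 0 t (\<lambda>\<omega>. Xh2 t \<omega> - X_mean F t)"
    using Xi pX
  proof eventually_elim
    case (elim t)
    show ?case by (rule impI) (rule stoch_integral_proj[OF elim(1)[THEN mp] gens_L2 pN pc[OF elim(2)[THEN mp]]])
  qed
  moreover have "AE t in lborel. t \<in> {0..TT} \<longrightarrow> has_stoch_integral MM (noise_filter k ?J R2 t) (D_ker L t) 0 t (\<lambda>\<omega>. U' t \<omega> - D_mean L t)"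
    using act pU
  proof eventually_elim
    case (elim t)
    show ?case by (rule impI) (rule stoch_integral_proj[OF elim(1)[THEN mp] gens_L2 pN pc[OF elim(2)[THEN mp]]])
  qed
  ultimately show ?thesis
    unfolding plays_linear_def frozen_filter_def lin_action_def Let_def using Xs2 by blast
qed

end

section \<open>Unilateral deviations\<close>


locale lq_deviation = lq_candidate G F S X D Xhat R
  for G :: "('w, 'd::finite, 'n::finite) lq_game" and F S X D Xhat R +
  fixes i :: 'n and \<phi> :: "real \<Rightarrow> (real \<Rightarrow> real^'d) \<Rightarrow> real^'d" and X' D'
  assumes strat: "strategy_map (horizon G) \<phi>" and dev: "deviation_play G F S i X' D'"
    and play: "AE \<omega> in Pr G. \<forall>t\<in>{0..horizon G}. D' i t \<omega> = \<phi> t (\<lambda>s. signal G X' i s \<omega>)"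
    and info: "\<And>t. t \<in> {0..horizon G} \<Longrightarrow> contained_mod_null (Pr G) (history (Pr G) (signal G X' i) t)
             (history (Pr G) (innovation G i (signal G X i) (Xhat i)) t)"
begin

lemma
  shows X'_sq: "sq_process MM TT X'" and D'_sq: "\<And>k. sq_process MM TT (D' k)"
    and X'_state: "state_equation G X' D'"
    and X'_plays: "\<And>k. k \<noteq> i \<Longrightarrow> \<exists>R Xhat. plays_linear G F k (S k) (signal G X' k) R Xhat (D' k)"
  using dev unfolding deviation_play_def by simp_all

text \<open>A strategy map is measurable on continuous paths, so \<open>action_meas\<close> has to
  know that almost every signal path is one.\<close>

lemma signal_path_continuous:
  "AE \<omega> in MM. continuous_on {0..TT} (\<lambda>s. signal G X' k s \<omega>)"
proof -
  have s: "sq_process MM TT (\<lambda>s \<omega>. sens G k s *v X' s \<omega>)" by (rule sens_X_sq[OF X'_sq])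
  have TT: "TT \<in> {0..TT}" using T0 by simp
  have 1: "AE \<omega> in MM. set_integrable lborel {0..TT} (\<lambda>s. sens G k s *v X' s \<omega>)"
    by (rule path_integrable[OF horizon_nonneg sq_process_jmeas[OF s] _ TT]) (use s in \<open>simp add: sq_process_def\<close>)
  have "AE \<omega> in MM. \<forall>q. continuous_on {0..TT} (\<lambda>t. noise G t \<omega> $ q)"
    using W_scalar by (simp add: AE_all_countable scalar_brownian_def)
  then show ?thesis using 1
  proof eventually_elim
    case (elim \<omega>)
    have "continuous_on {0..TT} (\<lambda>t. \<chi> a. noise G t \<omega> $ (Some k, a))"
      by (intro continuous_on_vec_lambda elim(1)[rule_format])
    moreover have "(\<chi> a. noise G t \<omega> $ (Some k, a)) = obs_block k *v noise G t \<omega>" for t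
      by (simp add: vec_eq_iff block_nth)
    ultimately have "continuous_on {0..TT} (\<lambda>t. obs_block k *v noise G t \<omega>)" by simp
    from continuous_on_add[OF LINT_continuous[OF elim(2)] this] show ?case
      unfolding signal_def .
  qed
qed

text \<open>An event of \<open>D' i t\<close> is almost surely an event of the deviated signal
  history, hence by \<open>contained_mod_null\<close> one of the innovation path of the candidate,
  which lies in \<open>FY i t\<close>. The deviated information is thereby placed in the filtration
  whose conditional expectations are the filters.\<close>

lemma action_meas:
  assumes t: "t \<in> {0..TT}"
  shows "D' i t \<in> borel_measurable (FY i t)"
proof (rule measurableI)
  let ?Y = "signal G X' i"
  fix B :: "(real^'d) set" assume B: "B \<in> sets borel"
  have Dm: "D' i t \<in> borel_measurable MM" by (rule joint_section[OF sq_process_jmeas[OF D'_sq] t])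
  have tt: "t \<in> {0..t}" using t by simp
  have "(\<lambda>(s, y). \<phi> s y) \<in> borel_measurable (restrict_space borel {0..t} \<Otimes>\<^sub>M path_history TT t)"
    using strat t by (simp add: strategy_map_def)
  from joint_section[OF this tt] have "\<phi> t \<in> borel_measurable (path_history TT t)" .
  from measurable_sets[OF this B]
  have C: "\<phi> t -` B \<inter> {y. continuous_on {0..TT} y} \<in> sets (path_history TT t)"
    by (simp add: path_history_def)
  \<comment> \<open>An event in \<open>path_history\<close> is the preimage of a set
    \<open>A\<close> of restricted paths, and the same \<open>A\<close> defines the corresponding
    event in the history of the signal.\<close>
  have ps: "sets (path_history TT t) = {(\<lambda>y. restrict y {0..t}) -` A \<inter> {y :: real \<Rightarrow> real^'d. continuous_on {0..TT} y} | A. A \<in> sets (PiM {0..t} (\<lambda>_. borel))}"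
    unfolding path_history_def by (rule sets_vimage_algebra2) (auto simp: space_PiM)
  from C[unfolded ps] obtain A where
    A: "\<phi> t -` B \<inter> {y. continuous_on {0..TT} y} = (\<lambda>y. restrict y {0..t}) -` A \<inter> {y. continuous_on {0..TT} y}"
      "A \<in> sets (PiM {0..t} (\<lambda>_. borel))"
    by (elim CollectE exE conjE)
  define E where "E = (\<lambda>\<omega>. \<lambda>s\<in>{0..t}. ?Y s \<omega>) -` A \<inter> space MM"
  have E: "E \<in> sets (history MM ?Y t)" unfolding E_def history_def by (rule in_vimage_algebra[OF A(2)])
  obtain C' where C': "C' \<in> sets (history MM (II i) t)" "AE \<omega> in MM. \<omega> \<in> E \<longleftrightarrow> \<omega> \<in> C'"
    using info[OF t] E unfolding contained_mod_null_def by blast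
  have C'F: "C' \<in> sets (FY i t)" using C'(1) II_FY_meas[OF t] by blast
  have "AE \<omega> in MM. \<omega> \<in> D' i t -` B \<inter> space MM \<longleftrightarrow> \<omega> \<in> C'"
    using play signal_path_continuous[of i] C'(2) AE_space
  proof eventually_elim
    case (elim \<omega>)
    have "D' i t \<omega> = \<phi> t (\<lambda>s. ?Y s \<omega>)" using elim(1) t by blast
    then have "D' i t \<omega> \<in> B \<longleftrightarrow> (\<lambda>s. ?Y s \<omega>) \<in> \<phi> t -` B \<inter> {y. continuous_on {0..TT} y}" using elim(2) by simp
    also have "\<dots> \<longleftrightarrow> restrict (\<lambda>s. ?Y s \<omega>) {0..t} \<in> A" unfolding A(1) using elim(2) by simp
    also have "\<dots> \<longleftrightarrow> \<omega> \<in> E" using elim(4) by (simp add: E_def)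
    finally show ?case using elim(3,4) by simp
  qed
  then show "D' i t -` B \<inter> space (FY i t) \<in> sets (FY i t)"
    using completed_set_cong[OF Y_subalgebra[OF t] measurable_sets[OF Dm B] C'F[unfolded FY_def]]
    by (simp add: FY_def)
qed simp

lemma action_span:
  assumes t: "t \<in> {0..TT}" and L: "orthv MM {} (D' i t)"
  shows "orthv MM (orth MM (indicators (FY i t))) (D' i t)"
proof
  fix a
  show "(\<lambda>\<omega>. D' i t \<omega> $ a) \<in> orth MM (orth MM (indicators (FY i t)))"
    by (rule meas_in_span[OF FY_subalgebra[OF t] orth_L2[OF L[rule_format]] borel_measurable_vec_nth[OF action_meas[OF t]]])
qed

lemma action_adapted:
  assumes t: "t \<in> {0..TT}" and L: "orthv MM {} (D' i t)"
  shows "\<forall>a q. \<forall>u\<in>{t..TT}. expectation (\<lambda>\<omega>. D' i t \<omega> $ a * inc q t u \<omega>) = 0"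
proof (intro allI ballI)
  fix a q u assume u: "u \<in> {t..TT}"
  show "expectation (\<lambda>\<omega>. D' i t \<omega> $ a * inc q t u \<omega>) = 0"
    by (rule orthD[OF action_span[OF t L, rule_format] inc_orth_FY[OF t u]])
qed

lemma state_drift_sq:
  assumes "sq_process MM TT Z" "\<And>k. sq_process MM TT (U k)"
  shows "sq_process MM TT (\<lambda>s \<omega>. drift G s *v Z s \<omega> + (\<Sum>j\<in>UNIV. U j s \<omega>))"
  by (intro sq_process_add sq_process_sum sq_process_matvec horizon_nonneg drift_tb assms)

text \<open>\<open>sq_process\<close> yields a finite second moment at almost every time; the state
  equation upgrades this to every time, including the terminal one.\<close>

lemma X'_L2: assumes t: "t \<in> {0..TT}" shows "orthv MM {} (X' t)"
proof -
  let ?V = "\<lambda>\<omega>. LINT s:{0..t}|lborel. drift G s *v X' s \<omega> + (\<Sum>j\<in>UNIV. D' j s \<omega>)"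
  have E: "({} :: ('w \<Rightarrow> real) set) \<subseteq> L2 MM" by simp
  have n: "orthv MM {} (noise G u)" if "u \<in> {0..TT}" for u using B_L2[OF that] by (simp add: orth_empty)
  have h: "has_stoch_integral MM (\<lambda>s \<omega>. block None *v noise G s \<omega>) (vol G) 0 t (\<lambda>\<omega>. X' t \<omega> - init G - ?V \<omega>)"
    using X'_state t by (simp add: state_equation_def)
  have 1: "orthv MM {} (\<lambda>\<omega>. X' t \<omega> - init G - ?V \<omega>)"
  proof (rule stoch_integral_orth[OF h _ E])
    show "orthv MM {} (\<lambda>\<omega>. block None *v noise G u \<omega>)" if "u \<in> {0..t}" for u
      by (rule orthv_matvec[OF E n]) (use that t in simp)
  qed (use t in simp)
  have sq: "sq_process MM TT (\<lambda>s \<omega>. drift G s *v X' s \<omega> + (\<Sum>j\<in>UNIV. D' j s \<omega>))"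
    by (rule state_drift_sq[OF X'_sq D'_sq])
  have 2: "orthv MM {} ?V"
  proof (rule time_integral_orth[OF horizon_nonneg E sq _ t])
    show "AE s in lborel. s \<in> {0..t} \<longrightarrow> orthv MM {} (\<lambda>\<omega>. drift G s *v X' s \<omega> + (\<Sum>j\<in>UNIV. D' j s \<omega>))"
      using sq_process_AE_L2[OF horizon_nonneg sq] by eventually_elim (use t in simp)
  qed
  have 3: "orthv MM {} (\<lambda>_. init G)" by (simp add: orth_empty L2_one)
  show ?thesis using orthv_add[OF E orthv_add[OF E 1 2] 3] by simp
qed

text \<open>The assumptions on \<open>U\<close>, \<open>K\<close> and \<open>m\<close> are what
  \<open>exists_process_projection_kernel\<close> yields for the action of player \<open>i\<close>
  with \<open>\<tau> t = t\<close>.\<close>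

lemma projected_play_cost_le:
  assumes nash: "linear_nash G F S X D R Xhat"
    and Us: "sq_process MM TT U"
    and Km: "(\<lambda>(t, u). K t u) \<in> borel_measurable (restrict_space borel {0..TT} \<Otimes>\<^sub>M borel)"
    and mm: "time_measurable TT m"
    and Kfin: "\<And>t. t \<in> {0..TT} \<Longrightarrow> (\<integral>\<^sup>+u\<in>{0..t}. ennreal ((norm (K t u :: ('d, 'n) noise_mat))\<^sup>2) \<partial>lborel) < \<infinity>"
    and Kint: "\<And>t. t \<in> {0..TT} \<Longrightarrow> orthv MM {} (D' i t) \<Longrightarrow> has_stoch_integral MM noisev (K t) 0 t (\<lambda>\<omega>. U t \<omega> - m t)"
    and pU0: "\<And>t. t \<in> {0..TT} \<Longrightarrow> orthv MM {} (D' i t) \<Longrightarrow>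
      (\<forall>a q. \<forall>u\<in>{t..TT}. expectation (\<lambda>\<omega>. D' i t \<omega> $ a * inc q t u \<omega>) = 0) \<Longrightarrow> is_projv MM gens (D' i t) (U t)"
  shows "cost G i X (D i) \<le> cost G i X' (D' i)"
proof -
  from process_projection_ex[OF horizon_nonneg X'_sq] obtain Z where
    Z: "sq_process MM TT Z \<and> (\<forall>t\<in>{0..TT}. orthv MM {} (X' t) \<longrightarrow> is_projv MM gens (X' t) (Z t))" ..
  have Zs: "sq_process MM TT Z" by (rule conjunct1[OF Z])
  have pZ: "is_projv MM gens (X' t) (Z t)" if t: "t \<in> {0..TT}" for t
    by (rule conjunct2[OF Z, THEN bspec, OF t, THEN mp, OF X'_L2[OF t]])
  have pZ': "AE t in lborel. t \<in> {0..TT} \<longrightarrow> is_projv MM gens (X' t) (Z t)"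
    by (rule AE_projv[OF horizon_nonneg X'_sq conjunct2[OF Z]])
  have pU: "is_projv MM gens (D' i t) (U t)" if t: "t \<in> {0..TT}" and L: "orthv MM {} (D' i t)" for t
    by (rule pU0[OF t L action_adapted[OF t L]])
  have nv: "noisev = noise G" by (simp add: fun_eq_iff noisev_def)
  have ex: "\<forall>k. \<exists>V. sq_process MM TT V \<and> (\<forall>t\<in>{0..TT}. orthv MM {} (D' k t) \<longrightarrow> is_projv MM gens (D' k t) (V t))"
    by (rule allI) (rule process_projection_ex[OF horizon_nonneg D'_sq])
  from choice[OF ex] obtain V where
    V: "\<forall>k. sq_process MM TT (V k) \<and> (\<forall>t\<in>{0..TT}. orthv MM {} (D' k t) \<longrightarrow> is_projv MM gens (D' k t) (V k t))" ..
  \<comment> \<open>The deviating player needs the version of the projection that comes with the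
    kernel \<open>K\<close>; for the opponents any jointly measurable version will do.\<close>
  define P where "P k = (if k = i then U else V k)" for k
  have Pi: "P i = U" by (simp add: P_def)
  have Ps: "sq_process MM TT (P k)" for k
  proof (cases "k = i")
    case True then show ?thesis using Us by (simp add: P_def)
  next
    case False then show ?thesis using conjunct1[OF V[THEN spec, of k]] by (simp add: P_def)
  qed
  have pP: "AE t in lborel. t \<in> {0..TT} \<longrightarrow> is_projv MM gens (D' k t) (P k t)" for k
  proof (rule AE_projv[OF horizon_nonneg D'_sq], intro ballI impI)
    fix t assume t: "t \<in> {0..TT}" and L: "orthv MM {} (D' k t)"
    show "is_projv MM gens (D' k t) (P k t)"
    proof (cases "k = i")
      case True
      show ?thesis using pU[OF t L[unfolded True]] unfolding True Pi .
    next
      case False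
      then have PV: "P k = V k" by (simp add: P_def)
      show ?thesis unfolding PV by (rule conjunct2[OF V[THEN spec, of k], THEN bspec, OF t, THEN mp, OF L])
    qed
  qed
  \<comment> \<open>The sum over the players in the drift needs one null set of times for all of
    them.\<close>
  have pall: "AE t in lborel. \<forall>k. t \<in> {0..TT} \<longrightarrow> is_projv MM gens (D' k t) (P k t)"
    using pP by (simp only: AE_all_countable) simp
  have se: "state_equation G Z P"
    unfolding state_equation_def
  proof
    fix t assume t: "t \<in> {0..TT}"
    let ?v = "\<lambda>Z P \<omega>. LINT s:{0..t}|lborel. drift G s *v Z s \<omega> + (\<Sum>j\<in>UNIV. P j s \<omega>)"
    have h: "has_stoch_integral MM (\<lambda>s \<omega>. block None *v noise G s \<omega>) (vol G) 0 t (\<lambda>\<omega>. X' t \<omega> - init G - ?v X' D' \<omega>)"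
      using X'_state t by (simp add: state_equation_def)
    have pv: "is_projv MM gens (?v X' D') (?v Z P)"
    proof (rule time_integral_proj[OF horizon_nonneg gens_L2 state_drift_sq[OF X'_sq D'_sq] state_drift_sq[OF Zs Ps] _ t])
      show "AE s in lborel. s \<in> {0..TT} \<longrightarrow> is_projv MM gens (\<lambda>\<omega>. drift G s *v X' s \<omega> + (\<Sum>j\<in>UNIV. D' j s \<omega>)) (\<lambda>\<omega>. drift G s *v Z s \<omega> + (\<Sum>j\<in>UNIV. P j s \<omega>))"
        using pall
      proof eventually_elim
        case (elim s)
        show ?case
        proof (rule impI)
          assume s: "s \<in> {0..TT}"
          have "is_projv MM gens (\<lambda>\<omega>. \<Sum>j\<in>UNIV. D' j s \<omega>) (\<lambda>\<omega>. \<Sum>j\<in>UNIV. P j s \<omega>)"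
            by (rule is_projv_sum[OF gens_L2]) (rule elim[THEN spec, THEN mp, OF s])
          from is_projv_add[OF gens_L2 is_projv_matvec[OF gens_L2 pZ[OF s]] this]
          show "is_projv MM gens (\<lambda>\<omega>. drift G s *v X' s \<omega> + (\<Sum>j\<in>UNIV. D' j s \<omega>)) (\<lambda>\<omega>. drift G s *v Z s \<omega> + (\<Sum>j\<in>UNIV. P j s \<omega>))" .
        qed
      qed
    qed
    show "has_stoch_integral MM (\<lambda>s \<omega>. block None *v noise G s \<omega>) (vol G) 0 t (\<lambda>\<omega>. Z t \<omega> - init G - ?v Z P \<omega>)"
    proof (rule stoch_integral_proj[OF h gens_L2])
      show "is_projv MM gens (\<lambda>\<omega>. block None *v noise G u \<omega>) (\<lambda>\<omega>. block None *v noise G u \<omega>)" if "u \<in> {0..t}" for u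
        by (rule is_projv_matvec[OF gens_L2 is_projv_self[OF noise_span]]) (use that t in simp)
      show "is_projv MM gens (\<lambda>\<omega>. X' t \<omega> - init G - ?v X' D' \<omega>) (\<lambda>\<omega>. Z t \<omega> - init G - ?v Z P \<omega>)"
        by (rule is_projv_diff[OF gens_L2 is_projv_diff[OF gens_L2 pZ[OF t] is_projv_self[OF span_const]] pv])
    qed
  qed
  have pl: "\<exists>R Xhat. plays_linear G F k (S k) (signal G Z k) R Xhat (P k)" if ki: "k \<noteq> i" for k
  proof -
    obtain R1 Xh1 where "plays_linear G F k (S k) (signal G X' k) R1 Xh1 (D' k)" using X'_plays[OF ki] by blast
    from plays_linear_proj[OF this X'_sq Zs pZ pP[of k]] show ?thesis .
  qed
  have dp: "deviation_play G F S i Z P"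
    unfolding deviation_play_def using Zs Ps se pl by blast
  have ls: "lin_strategy TT \<lparr>D_mean = m, D_ker = K\<rparr>"
  proof -
    have "kernel_measurable TT K"
    proof -
      have m1: "(\<lambda>x. (fst x, snd x)) \<in> measurable (restrict_space borel ({0..TT} \<times> {0..TT})) (restrict_space borel {0..TT} \<Otimes>\<^sub>M borel)"
      proof (rule measurable_Pair)
        show "fst \<in> measurable (restrict_space borel ({0..TT} \<times> {0..TT})) (restrict_space borel {0..TT})"
          by (rule measurable_restrict_space2)
            (auto simp: space_restrict_space intro!: measurable_restrict_space1 borel_measurable_continuous_onI continuous_intros)
        show "snd \<in> measurable (restrict_space borel ({0..TT} \<times> {0..TT})) borel"
          by (intro measurable_restrict_space1 borel_measurable_continuous_onI continuous_intros)
      qed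
      from measurable_compose[OF m1 Km] show ?thesis by (simp add: kernel_measurable_def case_prod_beta')
    qed
    then show ?thesis using mm Kfin by (simp add: lin_strategy_def)
  qed
  \<comment> \<open>\<open>lin_action\<close> is a statement for almost every \<open>t\<close>; this
    leaves out the times at which \<open>D' i t\<close> is not square integrable.\<close>
  have la: "lin_action G \<lparr>D_mean = m, D_ker = K\<rparr> (WW i) (P i)"
    unfolding lin_action_def Pi lin_strategy.simps
    using sq_process_AE_L2[OF horizon_nonneg D'_sq[of i]]
  proof eventually_elim
    case (elim t)
    show ?case
    proof (rule impI)
      assume t: "t \<in> {0..TT}"
      note L = elim[THEN mp, OF t]
      have "orthv MM (orth MM (indicators (FY i t))) (U t)"
      proof
        fix a
        show "(\<lambda>\<omega>. U t \<omega> $ a) \<in> orth MM (orth MM (indicators (FY i t)))"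
          by (rule proj_keeps_measurability[OF gens_L2 FY_subalgebra[OF t] cond_exp_gens[OF t]
              action_span[OF t L, THEN spec] pU[OF t L, THEN spec]])
      qed
      from linear_of_measurable[OF t Kint[OF t L, unfolded nv] this]
      show "has_stoch_integral MM (WW i t) (K t) 0 t (\<lambda>\<omega>. U t \<omega> - m t)" .
    qed
  qed
  have "cost G i X (D i) \<le> cost G i Z (P i)"
    using nash ls dp la unfolding linear_nash_def by blast
  also have "\<dots> \<le> cost G i X' (D' i)"
    by (rule cost_proj_le[OF X'_sq Zs D'_sq Ps pZ pP])
  finally show ?thesis .
qed

lemma cost_le:
  assumes nash: "linear_nash G F S X D R Xhat"
  shows "cost G i X (D i) \<le> cost G i X' (D' i)"
proof -
  have ad: "AE t in lborel. t \<in> {0..TT} \<longrightarrow> (\<forall>a q. \<forall>u\<in>{t..TT}. expectation (\<lambda>\<omega>. D' i t \<omega> $ a * inc q t u \<omega>) = 0)"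
    using sq_process_AE_L2[OF horizon_nonneg D'_sq[of i]]
  proof eventually_elim
    case (elim t)
    show ?case by (rule impI) (rule action_adapted[OF _ elim[THEN mp]])
  qed
  \<comment> \<open>At time \<open>t\<close> the projection has horizon \<open>t\<close>, so that
    the kernel of the action loads on no later noise.\<close>
  have idm: "(\<lambda>t. t) \<in> borel_measurable (restrict_space borel {0..TT})"
    by (rule measurable_restrict_space1) simp
  show ?thesis
  proof (rule exists_process_projection_kernel[OF horizon_nonneg D'_sq[of i] idm _ ad])
    show "t \<in> {0..TT}" if "t \<in> {0..TT}" for t by (rule that)
  next
    fix U K m
    assume Us: "sq_process MM TT U"
    and Km: "(\<lambda>(t, u). K t u) \<in> borel_measurable (restrict_space borel {0..TT} \<Otimes>\<^sub>M borel)"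
    and mm: "time_measurable TT m"
    and Kfin: "\<And>t. t \<in> {0..TT} \<Longrightarrow> (\<integral>\<^sup>+u\<in>{0..t}. ennreal ((norm (K t u :: ('d, 'n) noise_mat))\<^sup>2) \<partial>lborel) < \<infinity>"
    and Kint: "\<And>t. t \<in> {0..TT} \<Longrightarrow> orthv MM {} (D' i t) \<Longrightarrow> has_stoch_integral MM noisev (K t) 0 t (\<lambda>\<omega>. U t \<omega> - m t)"
    and pU0: "\<And>t. t \<in> {0..TT} \<Longrightarrow> orthv MM {} (D' i t) \<Longrightarrow>
      (\<forall>a q. \<forall>u\<in>{t..TT}. expectation (\<lambda>\<omega>. D' i t \<omega> $ a * inc q t u \<omega>) = 0) \<Longrightarrow> is_projv MM gens (D' i t) (U t)"
    then show ?thesis by (rule projected_play_cost_le[OF nash])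
  qed
qed

end

theorem mainTheorem6:
  fixes G :: "('w, 'd::finite, 'n::finite) lq_game"
    and F :: "('d, 'n) filter_coeffs"
    and S :: "'n \<Rightarrow> ('d, 'n) lin_strategy"
    and X :: "real \<Rightarrow> 'w \<Rightarrow> real^'d"
    and D Xhat :: "'n \<Rightarrow> real \<Rightarrow> 'w \<Rightarrow> real^'d"
    and R :: "'n \<Rightarrow> real \<Rightarrow> real \<Rightarrow> 'w \<Rightarrow> ('d, 'n) noise_vec"
  assumes "lq_game G"
    and "candidate G F S X D R Xhat"
    and "linear_nash G F S X D R Xhat"
  shows "unrestricted_nash G F S X D Xhat"
  unfolding unrestricted_nash_def
proof (intro allI impI)
  fix i \<phi> X' D'
  assume a: "strategy_map (horizon G) \<phi> \<and> deviation_play G F S i X' D' \<and>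
        (AE \<omega> in Pr G. \<forall>t\<in>{0..horizon G}. D' i t \<omega> = \<phi> t (\<lambda>s. signal G X' i s \<omega>)) \<and>
        (\<forall>t\<in>{0..horizon G}.
           contained_mod_null (Pr G) (history (Pr G) (signal G X' i) t)
             (history (Pr G) (innovation G i (signal G X i) (Xhat i)) t))"
  interpret lq_deviation G F S X D Xhat R i \<phi> X' D'
    using assms(1,2) a by unfold_locales auto
  show "cost G i X (D i) \<le> cost G i X' (D' i)" by (rule cost_le[OF assms(3)])
qed

end
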